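(* Let $z:\mathbb{R}\times S^1\to D$ be a smooth solution of \[ \partial_\tau\Big(\frac{z_\tau}{(1-|z|^2)^2}\Big)-e^{-2\tau}\partial_\theta\Big(\frac{z_\theta}{(1-|z|^2)^2}\Big)=\frac{2z}{(1-|z|^2)^3}\big[|z_\tau|^2-e^{-2\tau}|z_\theta|^2\big]. \] Let $\theta_0\in S^1$ and assume there are $T$ and $0<\gamma<1$ such that $\rho(\tau,\theta_0)/\tau\le 1-\gamma$ for all $\tau\ge T$, and that there is a sequence $\tau_k\to\infty$ with $\rho(\tau_k,\theta_0)/\tau_k\ge\gamma$. Then there are $\eta>0$ and an isometry $\phi$ from $(D,g_D)$ to $(\mathbb{R}^2,g_R)$ such that, setting $(Q,P)=\phi\circ z$ and $I_\eta=(\theta_0-\eta,\theta_0+\eta)$, the following holds: there exist $\alpha>0$, $\tau_0$, functions $v,\phi_0,q,r\in C^\infty(I_\eta,\mathbb{R})$ with $0<\alpha\le v\le 1-\alpha<1$ on $I_\eta$, and for every non-negative integer $k$ polynomials $\Xi_{i,k}$ ($i=1,\dots,4$) in $\tau$, such that for all $\tau\ge\tau_0$, with $p=v\tau+\phi_0$, \[ \|P_\tau-v\|_{C^k(I_\eta)}\le\Xi_{1,k}e^{-\alpha\tau},\quad \|P-p\|_{C^k(I_\eta)}\le\Xi_{2,k}e^{-\alpha\tau}, \] \[ \|e^{2p}Q_\tau-r\|_{C^k(I_\eta)}\le\Xi_{3,k}e^{-\alpha\tau},\quad \Big\|e^{2p}(Q-q)+\frac{r}{2v}\Big\|_{C^k(I_\eta)}\le\Xi_{4,k}e^{-\alpha\tau}.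 \]
   Context: $D$ is the open unit disc in $\mathbb{C}$ with hyperbolic metric $g_D=4(dx^2+dy^2)/(1-x^2-y^2)^2$; $(\mathbb{R}^2,g_R)$ has coordinates $(Q,P)$ and metric $g_R=dP^2+e^{2P}dQ^2$ (also hyperbolic space). $S^1=\mathbb{R}/2\pi\mathbb{Z}$. $\rho=\ln\frac{1+|z|}{1-|z|}$ is the hyperbolic distance from $0$ to $z$. $\|\cdot\|_{C^k(I_\eta)}$ is the sum of sup norms over $I_\eta$ of $\theta$-derivatives of order $0,\dots,k$ of the function at time $\tau$. (The conclusion is the paper's "conclusions of Theorem 1 with $S^1$ replaced by $I_\eta$", Theorem 1 being the statement that for solutions of the $(P,Q)$ Gowdy equations satisfying suitable initial bounds such expansions hold.) *)

theory Defs
  imports "HOL-Analysis.Analysis" "HOL-Computational_Algebra.Polynomial"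
begin

primrec dirD :: "'a::real_normed_vector list \<Rightarrow> ('a \<Rightarrow> 'b::real_normed_vector) \<Rightarrow> 'a \<Rightarrow> 'b" where
  "dirD [] f = f"
| "dirD (v # vs) f = (\<lambda>x. vector_derivative (\<lambda>t. dirD vs f (x + t *\<^sub>R v)) (at 0))"

definition Cinf_on :: "'a::real_normed_vector set \<Rightarrow> ('a \<Rightarrow> 'b::real_normed_vector) \<Rightarrow> bool" where
  "Cinf_on S f \<longleftrightarrow>
     (\<forall>vs. continuous_on S (dirD vs f) \<and>
        (\<forall>x\<in>S. \<forall>v. ((\<lambda>t. dirD vs f (x + t *\<^sub>R v)) has_vector_derivative dirD (v # vs) f x) (at 0)))"

definition gD :: "complex \<Rightarrow> complex \<Rightarrow> real" where
  "gD x v = 4 * (cmod v)^2 / (1 - (cmod x)^2)^2"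

(* metric g_R = dP^2 + e^{2P} dQ^2 on R^2 with coordinates (Q,P), at y applied to w *)
definition gR :: "real \<times> real \<Rightarrow> real \<times> real \<Rightarrow> real" where
  "gR y w = (snd w)^2 + exp (2 * snd y) * (fst w)^2"

definition hyp_isometry :: "(complex \<Rightarrow> real \<times> real) \<Rightarrow> bool" where
  "hyp_isometry \<phi> \<longleftrightarrow>
     bij_betw \<phi> (ball 0 1) UNIV \<and> Cinf_on (ball 0 1) \<phi> \<and>
     Cinf_on UNIV (inv_into (ball 0 1) \<phi>) \<and>
     (\<forall>x\<in>ball 0 1. \<forall>v. gR (\<phi> x) (dirD [v] \<phi> x) = gD x v)"

definition ptau :: "(real \<Rightarrow> real \<Rightarrow> 'a::real_normed_vector) \<Rightarrow> real \<Rightarrow> real \<Rightarrow> 'a" where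
  "ptau f = (\<lambda>\<tau> \<theta>. vector_derivative (\<lambda>s. f s \<theta>) (at \<tau>))"

definition ptheta :: "(real \<Rightarrow> real \<Rightarrow> 'a::real_normed_vector) \<Rightarrow> real \<Rightarrow> real \<Rightarrow> 'a" where
  "ptheta f = (\<lambda>\<tau> \<theta>. vector_derivative (\<lambda>s. f \<tau> s) (at \<theta>))"

(* hyperbolic distance from 0 to z in D *)
definition hrho :: "complex \<Rightarrow> real" where
  "hrho z = ln ((1 + cmod z) / (1 - cmod z))"

definition gowdy_eq :: "(real \<Rightarrow> real \<Rightarrow> complex) \<Rightarrow> bool" where
  "gowdy_eq z \<longleftrightarrow> (\<forall>\<tau> \<theta>.
     ptau (\<lambda>t s. ptau z t s / complex_of_real ((1 - (cmod (z t s))^2)^2)) \<tau> \<theta>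
     - complex_of_real (exp (-2*\<tau>)) *
       ptheta (\<lambda>t s. ptheta z t s / complex_of_real ((1 - (cmod (z t s))^2)^2)) \<tau> \<theta>
     = 2 * z \<tau> \<theta> / complex_of_real ((1 - (cmod (z \<tau> \<theta>))^2)^3) *
       complex_of_real ((cmod (ptau z \<tau> \<theta>))^2 - exp (-2*\<tau>) * (cmod (ptheta z \<tau> \<theta>))^2))"

(* C^k(I) norm at time tau: sum over j=0..k of sup over I of |d^j/dtheta^j F(tau,.)|
   (taken in the extended reals, so that it may be infinite) *)
definition Ck_norm :: "nat \<Rightarrow> real set \<Rightarrow> (real \<Rightarrow> real \<Rightarrow> real) \<Rightarrow> real \<Rightarrow> ereal" where
  "Ck_norm k I F \<tau> = (\<Sum>j\<le>k. (SUP \<theta>\<in>I. ereal \<bar>(deriv ^^ j) (F \<tau>) \<theta>\<bar>))"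

end

theory Submission
  imports Defs
begin

text \<open>Let \<open>a \<sigma>\<close> and \<open>b \<sigma>\<close>, for \<open>\<sigma> = 1\<close> and \<open>\<sigma> = -1\<close>, be the components in the orthonormal frame
  \<open>dP\<close>, \<open>exp P dQ\<close> of the derivative of the solution along the two families of characteristics
  \<open>\<theta> + \<sigma> exp (-\<tau>) = const\<close>. The Gowdy equation becomes an ordinary differential equation for each pair
  along the characteristics of the other family, which forces the supremum of
  \<open>A \<sigma> = (a \<sigma>)\<^sup>2 + (b \<sigma>)\<^sup>2\<close> over the light cone \<open>\<bar>\<theta> - \<theta>\<^sub>0\<bar> \<le> exp (-\<tau>)\<close> to decrease, to a limit \<open>v\<^sup>2\<close> say.
  Following characteristics backwards from a point where A is nearly maximal shows that A tends to
  \<open>v\<^sup>2\<close> uniformly on the cone and that the two derivatives become equal there. The growth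
  conditions on \<open>\<rho>\<close> then give \<open>\<gamma> \<le> v \<le> 1 - \<gamma>\<close>.

  In the limit \<open>b\<close> satisfies \<open>b' = - a b\<close>, so either \<open>(a, b)\<close> tends to \<open>(v, 0)\<close>, or P tends to
  \<open>-\<infinity>\<close> linearly. The second alternative cannot hold both for \<open>z\<close> and for \<open>- z\<close>; this decides the
  isometry. In the first case the data at some late time are uniformly close to \<open>(v, 0)\<close> on a whole
  interval about \<open>\<theta>\<^sub>0\<close> and its domain of dependence. As \<open>0 < v < 1\<close>, a continuity argument along the
  characteristics yields exponential decay of b there, then by induction bounds for all \<open>\<theta>\<close> derivatives,
  and the expansions follow by integrating in \<open>\<tau>\<close>.\<close>

subsection \<open>Smooth functions\<close>

text \<open>The growth hypotheses constrain only the distance to the origin at one angle, whereas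
  the expansions need control of all derivatives on an interval, and nothing is small to start with.
  Two facts bridge this. A does not depend on the frame, and the frame connection acts on (a, b) as
  a rotation, so it drops out of the equation of A; for the covariant \<theta>-derivative it drops
  out up to a curvature term, so \<theta>-derivatives of a and b are O(exp \<tau>) on the cone. As
  the cone has width of order exp (-\<tau>), this is a Lipschitz bound at the scale of the cone, and
  it carries near-maximality from the points reached by characteristics to all points. The range 0 <
  v < 1 is the contraction condition of \<open>b \<sigma>' + b \<sigma> / 2 = (1/2 - a \<sigma>) b
  (-\<sigma>)\<close> near a = v. The isometry is one of two half-plane charts, with distinguished
  boundary points 1 and -1: P is the Busemann function of such a point, and it cannot tend to
  -\<infinity> at both, since \<open>disc_P z + disc_P (- z) \<ge> 0\<close>.\<close>

text \<open>Iterated derivatives have to lie in F only up to equality on S, because outside S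
  \<open>dirD\<close> may be an arbitrary default; as S is open, the values on S decide the
  derivatives at its points. Every closure property below then amounts to exhibiting a class that is
  stable under directional derivatives.\<close>

lemma Cinf_on_coinduct:
  fixes f :: "'a::real_normed_vector \<Rightarrow> 'b::real_normed_vector"
  assumes S: "open S" and f: "f \<in> F"
    and cont: "\<And>g. g \<in> F \<Longrightarrow> continuous_on S g"
    and der: "\<And>g v. g \<in> F \<Longrightarrow>
      \<exists>h\<in>F. \<forall>x\<in>S. ((\<lambda>t. g (x + t *\<^sub>R v)) has_vector_derivative h x) (at 0)"
  shows "Cinf_on S f"
proof -
  have near: "\<forall>\<^sub>F t in at 0. x + t *\<^sub>R v \<in> S" if "x \<in> S" for x v
  proof -
    have "((\<lambda>t. x + t *\<^sub>R v) \<longlongrightarrow> x + 0 *\<^sub>R v) (at 0)" by (intro tendsto_intros)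
    then show ?thesis using S that by (auto simp: tendsto_def)
  qed
  have step: "((\<lambda>t. g' (x + t *\<^sub>R v)) has_vector_derivative h x) (at 0)"
    if g: "\<forall>x\<in>S. g' x = g x" and h: "((\<lambda>t. g (x + t *\<^sub>R v)) has_vector_derivative h x) (at 0)" and x: "x \<in> S"
    for g g' h x v
    using h unfolding has_vector_derivative_def
    by (rule has_derivative_transform_eventually)
      (use near[OF x, of v] g x in \<open>auto elim: eventually_mono\<close>)
  have *: "\<exists>g\<in>F. \<forall>x\<in>S. dirD vs f x = g x" for vs
  proof (induction vs)
    case Nil
    then show ?case using f by auto
  next
    case (Cons v vs)
    then obtain g where g: "g \<in> F" "\<forall>x\<in>S. dirD vs f x = g x" by blast
    obtain h where h: "h \<in> F" "\<forall>x\<in>S. ((\<lambda>t. g (x + t *\<^sub>R v)) has_vector_derivative h x) (at 0)"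
      using der[OF g(1)] by blast
    then have "\<forall>x\<in>S. dirD (v # vs) f x = h x"
      using step[OF g(2)] by (auto intro: vector_derivative_at)
    with h show ?case by blast
  qed
  show ?thesis unfolding Cinf_on_def
  proof (intro allI conjI ballI)
    fix vs
    obtain g where g: "g \<in> F" "\<forall>x\<in>S. dirD vs f x = g x" using * by blast
    show "continuous_on S (dirD vs f)" using cont[OF g(1)] g(2) continuous_on_cong[of S S] by metis
    fix x v assume x: "x \<in> S"
    obtain h where h: "h \<in> F" "\<forall>x\<in>S. ((\<lambda>t. g (x + t *\<^sub>R v)) has_vector_derivative h x) (at 0)"
      using der[OF g(1)] by blast
    have "((\<lambda>t. dirD vs f (x + t *\<^sub>R v)) has_vector_derivative h x) (at 0)"
      using step[OF g(2)] h x by blast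
    then show "((\<lambda>t. dirD vs f (x + t *\<^sub>R v)) has_vector_derivative dirD (v # vs) f x) (at 0)"
      by (simp add: vector_derivative_at)
  qed
qed

lemma Cinf_on_continuous: "Cinf_on S f \<Longrightarrow> continuous_on S f"
  unfolding Cinf_on_def by (metis dirD.simps(1))

lemma Cinf_on_has_dirD:
  "Cinf_on S f \<Longrightarrow> x \<in> S \<Longrightarrow> ((\<lambda>t. f (x + t *\<^sub>R v)) has_vector_derivative dirD [v] f x) (at 0)"
  unfolding Cinf_on_def by (metis dirD.simps(1))

lemma dirD_append: "dirD (vs @ ws) f = dirD vs (dirD ws f)"
  by (induction vs) auto

lemma Cinf_on_dirD: "Cinf_on S f \<Longrightarrow> Cinf_on S (dirD ws f)"
  unfolding Cinf_on_def by (metis append_Cons dirD_append)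

lemma Cinf_on_subset: "Cinf_on S f \<Longrightarrow> T \<subseteq> S \<Longrightarrow> Cinf_on T f"
  unfolding Cinf_on_def by (meson continuous_on_subset subsetD)

lemma Cinf_on_cong:
  assumes "open S" "Cinf_on S f" "\<And>x. x \<in> S \<Longrightarrow> f x = g x"
  shows "Cinf_on S g"
proof (rule Cinf_on_coinduct[OF assms(1), where F = "{h. \<exists>k. Cinf_on S k \<and> (\<forall>x\<in>S. k x = h x)}"])
  show "g \<in> {h. \<exists>k. Cinf_on S k \<and> (\<forall>x\<in>S. k x = h x)}" using assms by auto
next
  fix h assume "h \<in> {h. \<exists>k. Cinf_on S k \<and> (\<forall>x\<in>S. k x = h x)}"
  then obtain k where k: "Cinf_on S k" "\<forall>x\<in>S. k x = h x" by blast
  show "continuous_on S h" using Cinf_on_continuous[OF k(1)] k(2) continuous_on_cong[of S S] by metis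
  fix v
  have "\<forall>x\<in>S. ((\<lambda>t. h (x + t *\<^sub>R v)) has_vector_derivative dirD [v] k x) (at 0)"
  proof
    fix x assume x: "x \<in> S"
    have "((\<lambda>t. x + t *\<^sub>R v) \<longlongrightarrow> x + 0 *\<^sub>R v) (at 0)" by (intro tendsto_intros)
    then have "\<forall>\<^sub>F t in at 0. x + t *\<^sub>R v \<in> S" using assms(1) x by (auto simp: tendsto_def)
    then show "((\<lambda>t. h (x + t *\<^sub>R v)) has_vector_derivative dirD [v] k x) (at 0)"
      using Cinf_on_has_dirD[OF k(1) x, of v] k(2) x unfolding has_vector_derivative_def
      by (elim has_derivative_transform_eventually) (auto elim: eventually_mono)
  qed
  then show "\<exists>h'\<in>{h. \<exists>k. Cinf_on S k \<and> (\<forall>x\<in>S. k x = h x)}.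
      \<forall>x\<in>S. ((\<lambda>t. h (x + t *\<^sub>R v)) has_vector_derivative h' x) (at 0)"
    using Cinf_on_dirD[OF k(1), of "[v]"] by blast
qed

lemma Cinf_on_const: "open S \<Longrightarrow> Cinf_on S (\<lambda>x. c)"
  by (rule Cinf_on_coinduct[where F = "range (\<lambda>c x. c)"])
    (auto intro!: exI[of _ 0] derivative_eq_intros)

lemma Cinf_on_bounded_linear_compose:
  assumes S: "open S" and L: "bounded_linear L" and f: "Cinf_on S f"
  shows "Cinf_on S (\<lambda>x. L (f x))"
proof (rule Cinf_on_coinduct[OF S, where F = "(\<lambda>f x. L (f x)) ` {f. Cinf_on S f}"])
  show "(\<lambda>x. L (f x)) \<in> (\<lambda>f x. L (f x)) ` {f. Cinf_on S f}" using f by auto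
next
  fix g assume "g \<in> (\<lambda>f x. L (f x)) ` {f. Cinf_on S f}"
  then obtain k where k: "Cinf_on S k" "g = (\<lambda>x. L (k x))" by auto
  show "continuous_on S g"
    unfolding k using Cinf_on_continuous[OF k(1)] L bounded_linear.continuous_on by blast
  fix v
  have "\<forall>x\<in>S. ((\<lambda>t. g (x + t *\<^sub>R v)) has_vector_derivative L (dirD [v] k x)) (at 0)"
    unfolding k(2) using Cinf_on_has_dirD[OF k(1)] bounded_linear.has_vector_derivative[OF L] by blast
  then show "\<exists>h\<in>(\<lambda>f x. L (f x)) ` {f. Cinf_on S f}.
      \<forall>x\<in>S. ((\<lambda>t. g (x + t *\<^sub>R v)) has_vector_derivative h x) (at 0)"
    using Cinf_on_dirD[OF k(1), of "[v]"] by (auto intro!: bexI[of _ "\<lambda>x. L (dirD [v] k x)"])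
qed

lemma Cinf_on_ident: "open S \<Longrightarrow> Cinf_on S (\<lambda>x. x)"
proof (rule Cinf_on_coinduct[where F = "insert (\<lambda>x. x) (range (\<lambda>c x. c))"])
  fix g :: "'a \<Rightarrow> 'a" and v :: 'a
  assume "g \<in> insert (\<lambda>x. x) (range (\<lambda>c x. c))"
  then consider "g = (\<lambda>x. x)" | c where "g = (\<lambda>x. c)" by auto
  then show "\<exists>h\<in>insert (\<lambda>x. x) (range (\<lambda>c x. c)).
      \<forall>x\<in>S. ((\<lambda>t. g (x + t *\<^sub>R v)) has_vector_derivative h x) (at 0)"
  proof cases
    case 1
    then show ?thesis by (auto intro!: bexI[of _ "\<lambda>x. v"] derivative_eq_intros)
  next
    case 2
    then show ?thesis by (auto intro!: bexI[of _ "\<lambda>x. 0"] derivative_eq_intros)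
  qed
qed (auto intro: continuous_intros)

lemma Cinf_on_bounded_linear: "open S \<Longrightarrow> bounded_linear L \<Longrightarrow> Cinf_on S L"
  using Cinf_on_bounded_linear_compose[OF _ _ Cinf_on_ident] by blast

lemma Cinf_on_Pair:
  assumes S: "open S" and f: "Cinf_on S f" and g: "Cinf_on S g"
  shows "Cinf_on S (\<lambda>x. (f x, g x))"
proof (rule Cinf_on_coinduct[OF S, where F = "{h. \<exists>f g. Cinf_on S f \<and> Cinf_on S g \<and> h = (\<lambda>x. (f x, g x))}"])
  fix h :: "'a \<Rightarrow> 'b \<times> 'c" and v
  assume "h \<in> {h. \<exists>f g. Cinf_on S f \<and> Cinf_on S g \<and> h = (\<lambda>x. (f x, g x))}"
  then obtain f g where fg: "Cinf_on S f" "Cinf_on S g" "h = (\<lambda>x. (f x, g x))" by blast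
  have "\<forall>x\<in>S. ((\<lambda>t. h (x + t *\<^sub>R v)) has_vector_derivative (dirD [v] f x, dirD [v] g x)) (at 0)"
    unfolding fg(3) using Cinf_on_has_dirD[OF fg(1)] Cinf_on_has_dirD[OF fg(2)]
    by (auto intro: has_vector_derivative_Pair)
  moreover have "Cinf_on S (dirD [v] f)" "Cinf_on S (dirD [v] g)"
    using fg by (auto intro: Cinf_on_dirD simp del: dirD.simps)
  ultimately show "\<exists>h'\<in>{h. \<exists>f g. Cinf_on S f \<and> Cinf_on S g \<and> h = (\<lambda>x. (f x, g x))}.
      \<forall>x\<in>S. ((\<lambda>t. h (x + t *\<^sub>R v)) has_vector_derivative h' x) (at 0)"
    by (intro bexI[of _ "\<lambda>x. (dirD [v] f x, dirD [v] g x)"]) blast+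
qed (use f g in \<open>auto intro!: continuous_on_Pair intro: Cinf_on_continuous\<close>)

text \<open>The derivative of each of these expressions is again such an expression, so
  coinduction handles all the closure properties at once.\<close>

inductive smooth_expr :: "'a::real_normed_vector set \<Rightarrow> ('a \<Rightarrow> real) \<Rightarrow> bool" for S where
  base: "Cinf_on S f \<Longrightarrow> smooth_expr S f"
| add: "smooth_expr S f \<Longrightarrow> smooth_expr S g \<Longrightarrow> smooth_expr S (\<lambda>x. f x + g x)"
| mult: "smooth_expr S f \<Longrightarrow> smooth_expr S g \<Longrightarrow> smooth_expr S (\<lambda>x. f x * g x)"
| exp: "smooth_expr S f \<Longrightarrow> smooth_expr S (\<lambda>x. exp (f x))"
| inverse: "smooth_expr S f \<Longrightarrow> (\<And>x. x \<in> S \<Longrightarrow> f x \<noteq> 0) \<Longrightarrow> smooth_expr S (\<lambda>x. inverse (f x))"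
| ln: "smooth_expr S f \<Longrightarrow> (\<And>x. x \<in> S \<Longrightarrow> f x > 0) \<Longrightarrow> smooth_expr S (\<lambda>x. ln (f x))"

lemma smooth_expr_der:
  assumes S: "open S" and f: "smooth_expr S f"
  shows "continuous_on S f \<and>
    (\<exists>h. smooth_expr S h \<and> (\<forall>x\<in>S. ((\<lambda>t. f (x + t *\<^sub>R v)) has_vector_derivative h x) (at 0)))"
  using f
proof induction
  case (base f)
  then show ?case using Cinf_on_continuous[OF base] Cinf_on_has_dirD[OF base]
    smooth_expr.base[OF Cinf_on_dirD[OF base, of "[v]"]] by blast
next
  case (add f g)
  then obtain f' g' where "smooth_expr S f'" "smooth_expr S g'"
    "\<forall>x\<in>S. ((\<lambda>t. f (x + t *\<^sub>R v)) has_vector_derivative f' x) (at 0)"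
    "\<forall>x\<in>S. ((\<lambda>t. g (x + t *\<^sub>R v)) has_vector_derivative g' x) (at 0)" by blast
  with add show ?case
    by (intro conjI exI[of _ "\<lambda>x. f' x + g' x"])
      (auto intro!: continuous_intros smooth_expr.add derivative_eq_intros)
next
  case (mult f g)
  then obtain f' g' where "smooth_expr S f'" "smooth_expr S g'"
    "\<forall>x\<in>S. ((\<lambda>t. f (x + t *\<^sub>R v)) has_vector_derivative f' x) (at 0)"
    "\<forall>x\<in>S. ((\<lambda>t. g (x + t *\<^sub>R v)) has_vector_derivative g' x) (at 0)" by blast
  with mult show ?case
    by (intro conjI exI[of _ "\<lambda>x. f x * g' x + f' x * g x"])
      (auto intro!: continuous_intros smooth_expr.add smooth_expr.mult
        simp flip: has_real_derivative_iff_has_vector_derivative intro: derivative_eq_intros)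
next
  case (exp f)
  then obtain f' where "smooth_expr S f'"
    "\<forall>x\<in>S. ((\<lambda>t. f (x + t *\<^sub>R v)) has_vector_derivative f' x) (at 0)" by blast
  with exp show ?case
    by (intro conjI exI[of _ "\<lambda>x. exp (f x) * f' x"])
      (auto intro!: continuous_intros smooth_expr.exp smooth_expr.mult
        simp flip: has_real_derivative_iff_has_vector_derivative intro: derivative_eq_intros)
next
  case (inverse f)
  then obtain f' where f': "smooth_expr S f'"
    "\<forall>x\<in>S. ((\<lambda>t. f (x + t *\<^sub>R v)) has_vector_derivative f' x) (at 0)" by blast
  \<comment> \<open>The factor -1 in the derivative of 1/f must itself be an expression; constants
    enter through \<open>base\<close>.\<close>
  have "Cinf_on S (\<lambda>x. -1 :: real)" using S by (rule Cinf_on_const)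
  with inverse f' show ?case
    by (intro conjI exI[of _ "\<lambda>x. (- 1) * (inverse (f x) * (f' x * inverse (f x)))"]
        smooth_expr.mult smooth_expr.inverse smooth_expr.base[of _ "\<lambda>x. -1"])
      (auto intro!: continuous_intros derivative_eq_intros
        simp flip: has_real_derivative_iff_has_vector_derivative)
next
  case (ln f)
  then obtain f' where f': "smooth_expr S f'"
    "\<forall>x\<in>S. ((\<lambda>t. f (x + t *\<^sub>R v)) has_vector_derivative f' x) (at 0)" by blast
  have "\<And>x. x \<in> S \<Longrightarrow> f x \<noteq> 0" using ln(2) by force
  with ln f' show ?case
    by (intro conjI exI[of _ "\<lambda>x. inverse (f x) * f' x"])
      (auto intro!: continuous_intros smooth_expr.inverse smooth_expr.mult derivative_eq_intros
        simp: divide_inverse simp flip: has_real_derivative_iff_has_vector_derivative)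
qed

lemma smooth_expr_imp_Cinf_on: "open S \<Longrightarrow> smooth_expr S f \<Longrightarrow> Cinf_on S f"
  by (rule Cinf_on_coinduct[where F = "Collect (smooth_expr S)"])
    (use smooth_expr_der in \<open>fastforce+\<close>)

lemma Cinf_on_arith:
  fixes f g :: "'a::real_normed_vector \<Rightarrow> real"
  assumes "open S" "Cinf_on S f"
  shows Cinf_on_add: "Cinf_on S g \<Longrightarrow> Cinf_on S (\<lambda>x. f x + g x)"
    and Cinf_on_mult: "Cinf_on S g \<Longrightarrow> Cinf_on S (\<lambda>x. f x * g x)"
    and Cinf_on_exp: "Cinf_on S (\<lambda>x. exp (f x))"
    and Cinf_on_inverse: "(\<And>x. x \<in> S \<Longrightarrow> f x \<noteq> 0) \<Longrightarrow> Cinf_on S (\<lambda>x. inverse (f x))"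
    and Cinf_on_ln: "(\<And>x. x \<in> S \<Longrightarrow> f x > 0) \<Longrightarrow> Cinf_on S (\<lambda>x. ln (f x))"
  using assms by (auto intro!: smooth_expr_imp_Cinf_on intro: smooth_expr.intros)

lemma Cinf_on_minus:
  fixes f :: "'a::real_normed_vector \<Rightarrow> real"
  assumes "open S" "Cinf_on S f" shows "Cinf_on S (\<lambda>x. - f x)"
  using Cinf_on_mult[OF assms(1) Cinf_on_const[OF assms(1), of "-1"] assms(2)] by simp

lemma Cinf_on_diff:
  fixes f g :: "'a::real_normed_vector \<Rightarrow> real"
  assumes "open S" "Cinf_on S f" "Cinf_on S g" shows "Cinf_on S (\<lambda>x. f x - g x)"
  using Cinf_on_add[OF assms(1,2) Cinf_on_minus[OF assms(1,3)]] by simp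

lemma Cinf_on_divide:
  fixes f g :: "'a::real_normed_vector \<Rightarrow> real"
  assumes "open S" "Cinf_on S f" "Cinf_on S g" "\<And>x. x \<in> S \<Longrightarrow> g x \<noteq> 0"
  shows "Cinf_on S (\<lambda>x. f x / g x)"
  using Cinf_on_mult[OF assms(1,2) Cinf_on_inverse[OF assms(1,3,4)]] by (simp add: divide_inverse)

lemma Cinf_on_power:
  fixes f :: "'a::real_normed_vector \<Rightarrow> real"
  assumes "open S" "Cinf_on S f" shows "Cinf_on S (\<lambda>x. f x ^ n)"
  by (induction n) (auto intro: Cinf_on_mult Cinf_on_const assms)

lemmas Cinf_on_intros = Cinf_on_const Cinf_on_add Cinf_on_mult Cinf_on_exp Cinf_on_inverse Cinf_on_ln
  Cinf_on_minus Cinf_on_diff Cinf_on_divide Cinf_on_power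

section \<open>Smooth functions of time and angle on a strip\<close>

text \<open>Time runs over all reals and only the angle is localised: the solution is global in
  \<tau>, while the limit functions exist on an interval of angles. The curried form fits
  \<open>ptau\<close> and \<open>ptheta\<close>.\<close>

definition smooth_strip :: "real set \<Rightarrow> (real \<Rightarrow> real \<Rightarrow> real) \<Rightarrow> bool" where
  "smooth_strip I F \<longleftrightarrow> Cinf_on (UNIV \<times> I) (\<lambda>x. F (fst x) (snd x))"

lemma smooth_strip_arith:
  assumes "open I" "smooth_strip I F"
  shows smooth_strip_add: "smooth_strip I G \<Longrightarrow> smooth_strip I (\<lambda>\<tau> \<theta>. F \<tau> \<theta> + G \<tau> \<theta>)"
    and smooth_strip_diff: "smooth_strip I G \<Longrightarrow> smooth_strip I (\<lambda>\<tau> \<theta>. F \<tau> \<theta> - G \<tau> \<theta>)"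
    and smooth_strip_mult: "smooth_strip I G \<Longrightarrow> smooth_strip I (\<lambda>\<tau> \<theta>. F \<tau> \<theta> * G \<tau> \<theta>)"
    and smooth_strip_minus: "smooth_strip I (\<lambda>\<tau> \<theta>. - F \<tau> \<theta>)"
    and smooth_strip_exp: "smooth_strip I (\<lambda>\<tau> \<theta>. exp (F \<tau> \<theta>))"
    and smooth_strip_power: "smooth_strip I (\<lambda>\<tau> \<theta>. F \<tau> \<theta> ^ n)"
    and smooth_strip_divide: "smooth_strip I G \<Longrightarrow> (\<And>\<tau> \<theta>. \<theta> \<in> I \<Longrightarrow> G \<tau> \<theta> \<noteq> 0)
      \<Longrightarrow> smooth_strip I (\<lambda>\<tau> \<theta>. F \<tau> \<theta> / G \<tau> \<theta>)"
    and smooth_strip_ln: "(\<And>\<tau> \<theta>. \<theta> \<in> I \<Longrightarrow> F \<tau> \<theta> > 0) \<Longrightarrow> smooth_strip I (\<lambda>\<tau> \<theta>. ln (F \<tau> \<theta>))"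
  using assms unfolding smooth_strip_def by (auto intro!: Cinf_on_intros open_Times)

lemma smooth_strip_const: "open I \<Longrightarrow> smooth_strip I (\<lambda>\<tau> \<theta>. c)"
  unfolding smooth_strip_def by (intro Cinf_on_const open_Times open_UNIV)

lemma smooth_strip_time: "open I \<Longrightarrow> smooth_strip I (\<lambda>\<tau> \<theta>. \<tau>)"
  unfolding smooth_strip_def by (intro Cinf_on_bounded_linear open_Times open_UNIV bounded_linear_fst)

lemmas smooth_strip_intros = smooth_strip_const smooth_strip_time smooth_strip_arith

lemma smooth_strip_subset: "smooth_strip I F \<Longrightarrow> J \<subseteq> I \<Longrightarrow> smooth_strip J F"
  unfolding smooth_strip_def by (rule Cinf_on_subset) auto

lemma smooth_strip_continuous:
  "smooth_strip I F \<Longrightarrow> continuous_on (UNIV \<times> I) (\<lambda>x. F (fst x) (snd x))"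
  unfolding smooth_strip_def by (rule Cinf_on_continuous)

text \<open>\<open>dirD\<close> differentiates at t = 0 along x + t v, while \<open>ptau\<close> and
  \<open>ptheta\<close> differentiate at the point itself; this matches the two conventions.\<close>

lemma has_vector_derivative_at_shift:
  fixes g :: "real \<Rightarrow> 'a::real_normed_vector"
  shows "((\<lambda>t. g (c + t)) has_vector_derivative d) (at 0) \<longleftrightarrow> (g has_vector_derivative d) (at c)"
proof
  assume "((\<lambda>t. g (c + t)) has_vector_derivative d) (at 0)"
  then have "((\<lambda>t. g (c + t)) \<circ> (\<lambda>t. t - c) has_vector_derivative 1 *\<^sub>R d) (at c)"
    by (intro vector_diff_chain_at) (auto intro!: derivative_eq_intros)
  then show "(g has_vector_derivative d) (at c)" by (simp add: o_def)
next
  assume "(g has_vector_derivative d) (at c)"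
  then have "(g \<circ> (\<lambda>t. c + t) has_vector_derivative 1 *\<^sub>R d) (at 0)"
    by (intro vector_diff_chain_at) (auto intro!: derivative_eq_intros)
  then show "((\<lambda>t. g (c + t)) has_vector_derivative d) (at 0)" by (simp add: o_def)
qed

lemma dirD_tau: "dirD [(1, 0)] (\<lambda>x. F (fst x) (snd x)) x = ptau F (fst x) (snd x)"
  and dirD_theta: "dirD [(0, 1)] (\<lambda>x. F (fst x) (snd x)) x = ptheta F (fst x) (snd x)"
  for F :: "real \<Rightarrow> real \<Rightarrow> 'a::real_normed_vector" and x :: "real \<times> real"
  using has_vector_derivative_at_shift[of "\<lambda>s. F s (snd x)" "fst x"]
    has_vector_derivative_at_shift[of "\<lambda>s. F (fst x) s" "snd x"]
  by (simp_all add: ptau_def ptheta_def vector_derivative_def)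

lemma Cinf_on_has_partials:
  fixes F :: "real \<Rightarrow> real \<Rightarrow> 'a::real_normed_vector"
  assumes "Cinf_on S (\<lambda>x. F (fst x) (snd x))" "(\<tau>, \<theta>) \<in> S"
  shows "((\<lambda>s. F s \<theta>) has_vector_derivative ptau F \<tau> \<theta>) (at \<tau>)"
    and "((\<lambda>s. F \<tau> s) has_vector_derivative ptheta F \<tau> \<theta>) (at \<theta>)"
  using Cinf_on_has_dirD[OF assms, of "(1, 0)"] Cinf_on_has_dirD[OF assms, of "(0, 1)"]
    has_vector_derivative_at_shift[of "\<lambda>s. F s \<theta>" \<tau>] has_vector_derivative_at_shift[of "\<lambda>s. F \<tau> s" \<theta>]
  unfolding dirD_tau dirD_theta by simp_all

lemma Cinf_on_ptau:
  "Cinf_on S (\<lambda>x. F (fst x) (snd x)) \<Longrightarrow> Cinf_on S (\<lambda>x. ptau F (fst x) (snd x))"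
  using Cinf_on_dirD[of S "\<lambda>x. F (fst x) (snd x)" "[(1, 0)]"] unfolding dirD_tau[abs_def] .

lemma Cinf_on_ptheta:
  "Cinf_on S (\<lambda>x. F (fst x) (snd x)) \<Longrightarrow> Cinf_on S (\<lambda>x. ptheta F (fst x) (snd x))"
  using Cinf_on_dirD[of S "\<lambda>x. F (fst x) (snd x)" "[(0, 1)]"] unfolding dirD_theta[abs_def] .

lemma smooth_strip_ptau: "smooth_strip I F \<Longrightarrow> smooth_strip I (ptau F)"
  and smooth_strip_ptheta: "smooth_strip I F \<Longrightarrow> smooth_strip I (ptheta F)"
  unfolding smooth_strip_def by (fact Cinf_on_ptau Cinf_on_ptheta)+

lemma smooth_strip_ptheta_iter: "smooth_strip I F \<Longrightarrow> smooth_strip I ((ptheta ^^ k) F)"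
  by (induction k) (auto intro: smooth_strip_ptheta)

lemma has_ptau:
  assumes "smooth_strip I F" "\<theta> \<in> I"
  shows "((\<lambda>s. F s \<theta>) has_real_derivative ptau F \<tau> \<theta>) (at \<tau>)"
  using Cinf_on_has_partials(1)[of "UNIV \<times> I" F] assms
  unfolding smooth_strip_def has_real_derivative_iff_has_vector_derivative by blast

lemma has_ptheta:
  assumes "smooth_strip I F" "\<theta> \<in> I"
  shows "((\<lambda>s. F \<tau> s) has_real_derivative ptheta F \<tau> \<theta>) (at \<theta>)"
  using Cinf_on_has_partials(2)[of "UNIV \<times> I" F] assms
  unfolding smooth_strip_def has_real_derivative_iff_has_vector_derivative by blast

lemma ptauI: "((\<lambda>s. F s \<theta>) has_real_derivative d) (at \<tau>) \<Longrightarrow> ptau F \<tau> \<theta> = d"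
  and pthetaI: "((\<lambda>s. F \<tau> s) has_real_derivative d) (at \<theta>) \<Longrightarrow> ptheta F \<tau> \<theta> = d"
  unfolding ptau_def ptheta_def has_real_derivative_iff_has_vector_derivative
  by (rule vector_derivative_at; assumption)+

lemma smooth_strip_cont_section:
  assumes "smooth_strip I F"
  shows "continuous_on I (F \<tau>)" and "\<theta> \<in> I \<Longrightarrow> continuous_on UNIV (\<lambda>s. F s \<theta>)"
  by (intro continuous_at_imp_continuous_on ballI DERIV_isCont, erule has_ptheta[OF assms])
    (intro continuous_at_imp_continuous_on ballI DERIV_isCont, erule has_ptau[OF assms])

text \<open>Smoothness is expressed by directional derivatives along straight lines, so the chain
  rule along a curve needs an argument: the increment in \<tau> at the fixed angle w s is written
  with the mean value theorem, and joint continuity of \<open>ptau F\<close> lets the intermediate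
  point tend to \<tau>. The remaining increment is one-dimensional.\<close>

lemma smooth_strip_path:
  assumes I: "open I" and F: "smooth_strip I F" and w: "(w has_real_derivative d) (at \<tau>)" and "w \<tau> \<in> I"
  shows "((\<lambda>s. F s (w s)) has_real_derivative ptau F \<tau> (w \<tau>) + d * ptheta F \<tau> (w \<tau>)) (at \<tau>)"
proof -
  have contw: "(w \<longlongrightarrow> w \<tau>) (at \<tau>)" using DERIV_isCont[OF w] by (simp add: isCont_def)
  have near: "\<forall>\<^sub>F s in at \<tau>. w s \<in> I" using contw I assms(4) by (auto simp: tendsto_def)
  \<comment> \<open>A mean value point between s and \<tau> for the angle w s. The choice is
    meaningful for s \<noteq> \<tau> with w s in I, which covers all s \<noteq> \<tau> near
    \<tau>.\<close>
  define \<xi> where "\<xi> s = (SOME x. min s \<tau> \<le> x \<and> x \<le> max s \<tau> \<and>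
      F s (w s) - F \<tau> (w s) = (s - \<tau>) * ptau F x (w s))" for s
  have \<xi>: "min s \<tau> \<le> \<xi> s \<and> \<xi> s \<le> max s \<tau> \<and> F s (w s) - F \<tau> (w s) = (s - \<tau>) * ptau F (\<xi> s) (w s)"
    if s: "s \<noteq> \<tau>" "w s \<in> I" for s
  proof -
    have "\<exists>x. min s \<tau> \<le> x \<and> x \<le> max s \<tau> \<and> F s (w s) - F \<tau> (w s) = (s - \<tau>) * ptau F x (w s)"
    proof (cases "s < \<tau>")
      case True
      obtain x where x: "x > s" "x < \<tau>" "F \<tau> (w s) - F s (w s) = (\<tau> - s) * ptau F x (w s)"
        using MVT2[OF True, of "\<lambda>r. F r (w s)" "\<lambda>r. ptau F r (w s)"] has_ptau[OF F s(2)] by blast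
      have "F s (w s) - F \<tau> (w s) = (s - \<tau>) * ptau F x (w s)" using x(3) by (simp add: algebra_simps)
      then show ?thesis using x True by (intro exI[of _ x]) auto
    next
      case False
      then have "\<tau> < s" using s by simp
      then obtain x where "x > \<tau>" "x < s" "F s (w s) - F \<tau> (w s) = (s - \<tau>) * ptau F x (w s)"
        using MVT2[of \<tau> s "\<lambda>r. F r (w s)" "\<lambda>r. ptau F r (w s)"] has_ptau[OF F s(2)] by blast
      then show ?thesis by (intro exI[of _ x]) auto
    qed
    then show ?thesis unfolding \<xi>_def by (rule someI_ex)
  qed
  have lim\<xi>: "(\<xi> \<longlongrightarrow> \<tau>) (at \<tau>)"
  proof (rule tendsto_sandwich)
    have ne: "\<forall>\<^sub>F s in at \<tau>. s \<noteq> \<tau>" by (simp add: eventually_at_filter)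
    show "\<forall>\<^sub>F s in at \<tau>. min s \<tau> \<le> \<xi> s" using near ne by eventually_elim (use \<xi> in blast)
    show "\<forall>\<^sub>F s in at \<tau>. \<xi> s \<le> max s \<tau>" using near ne by eventually_elim (use \<xi> in blast)
    have "((\<lambda>s. min s \<tau>) \<longlongrightarrow> min \<tau> \<tau>) (at \<tau>)" "((\<lambda>s. max s \<tau>) \<longlongrightarrow> max \<tau> \<tau>) (at \<tau>)"
      by (intro tendsto_intros)+
    then show "((\<lambda>s. min s \<tau>) \<longlongrightarrow> \<tau>) (at \<tau>)" "((\<lambda>s. max s \<tau>) \<longlongrightarrow> \<tau>) (at \<tau>)" by auto
  qed
  have "isCont (\<lambda>x. ptau F (fst x) (snd x)) (\<tau>, w \<tau>)"
    using smooth_strip_continuous[OF smooth_strip_ptau[OF F]] I assms(4)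
    by (simp add: continuous_on_eq_continuous_at open_Times)
  from isCont_tendsto_compose[OF this tendsto_Pair[OF lim\<xi> contw]]
  have 1: "((\<lambda>s. ptau F (\<xi> s) (w s)) \<longlongrightarrow> ptau F \<tau> (w \<tau>)) (at \<tau>)" by simp
  have 1: "((\<lambda>s. (F s (w s) - F \<tau> (w s)) / (s - \<tau>)) \<longlongrightarrow> ptau F \<tau> (w \<tau>)) (at \<tau>)"
    by (rule Lim_transform_eventually[OF 1])
      (use near \<xi> in \<open>auto simp: eventually_at_filter elim!: eventually_mono\<close>)
  have "((\<lambda>s. F \<tau> (w s)) has_real_derivative ptheta F \<tau> (w \<tau>) * d) (at \<tau>)"
    by (rule DERIV_chain2[OF has_ptheta[OF F assms(4)] w])
  then have 2: "((\<lambda>s. (F \<tau> (w s) - F \<tau> (w \<tau>)) / (s - \<tau>)) \<longlongrightarrow> d * ptheta F \<tau> (w \<tau>)) (at \<tau>)"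
    by (simp add: has_field_derivative_iff mult.commute)
  show ?thesis
    using tendsto_add[OF 1 2] by (simp add: has_field_derivative_iff flip: add_divide_distrib)
qed

text \<open>F t - F b is the time integral of \<open>ptau F\<close>. Differentiating under the
  integral sign expresses \<open>ptheta F t - ptheta F b\<close> as the integral of
  \<open>ptheta (ptau F)\<close>, whose derivative at \<tau> is the integrand. The lower limit b =
  \<tau> - 1 makes \<tau> an interior point.\<close>

lemma ptau_ptheta_commute:
  assumes I: "open I" and F: "smooth_strip I F" and \<theta>: "\<theta> \<in> I"
  shows "ptau (ptheta F) \<tau> \<theta> = ptheta (ptau F) \<tau> \<theta>"
proof -
  obtain e where e: "e > 0" "ball \<theta> e \<subseteq> I" using I \<theta> open_contains_ball by blast
  define G where "G = ptau F"
  have G: "smooth_strip I G" and H: "smooth_strip I (ptheta G)"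
    unfolding G_def using F smooth_strip_ptau smooth_strip_ptheta by blast+
  define b where "b = \<tau> - 1"
  have FTC: "((\<lambda>s. G s x) has_integral F t x - F b x) {b..t}" if "t \<ge> b" "x \<in> I" for t x
  proof (rule fundamental_theorem_of_calculus[OF that(1)])
    fix s
    show "((\<lambda>t. F t x) has_vector_derivative G s x) (at s within {b..t})"
      using has_ptau[OF F that(2), of s] unfolding G_def has_real_derivative_iff_has_vector_derivative
      by (rule has_vector_derivative_at_within)
  qed
  have lb: "((\<lambda>x. integral (cbox b t) (\<lambda>s. G s x)) has_vector_derivative
      integral (cbox b t) (\<lambda>s. ptheta G s \<theta>)) (at \<theta> within ball \<theta> e)" if "t \<ge> b" for t
  proof (rule leibniz_rule_vector_derivative)
    fix x s assume "x \<in> ball \<theta> e"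
    then have "x \<in> I" using e by blast
    then show "((\<lambda>x. G s x) has_vector_derivative ptheta G s x) (at x within ball \<theta> e)"
      using has_ptheta[OF G, of x s] unfolding has_real_derivative_iff_has_vector_derivative
      by (blast intro: has_vector_derivative_at_within)
  next
    fix x assume "x \<in> ball \<theta> e"
    then have "x \<in> I" using e by blast
    then show "(\<lambda>s. G s x) integrable_on cbox b t"
      using FTC[OF that, of x] by (auto simp: integrable_on_def)
  next
    have "continuous_on (ball \<theta> e \<times> cbox b t) (\<lambda>p. (\<lambda>x. ptheta G (fst x) (snd x)) (snd p, fst p))"
      by (rule continuous_on_compose2[OF smooth_strip_continuous[OF H]])
        (intro continuous_on_Pair continuous_on_fst continuous_on_snd continuous_on_id, use e in force)
    then show "continuous_on (ball \<theta> e \<times> cbox b t) (\<lambda>(x, s). ptheta G s x)"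
      by (simp add: case_prod_beta)
  qed (use e in auto)
  have eq: "integral {b..t} (\<lambda>s. ptheta G s \<theta>) = ptheta F t \<theta> - ptheta F b \<theta>" if "t \<ge> b" for t
  proof -
    have "((\<lambda>x. integral (cbox b t) (\<lambda>s. G s x)) has_vector_derivative
      integral (cbox b t) (\<lambda>s. ptheta G s \<theta>)) (at \<theta>)"
      using lb[OF that] e(1) by (simp add: at_within_open[of \<theta> "ball \<theta> e"])
    then have "((\<lambda>x. F t x - F b x) has_vector_derivative
      integral (cbox b t) (\<lambda>s. ptheta G s \<theta>)) (at \<theta>)"
      by (rule has_vector_derivative_transform_within_open[of _ _ _ "ball \<theta> e"])
        (use e(1) integral_unique[OF FTC[OF that subsetD[OF e(2)]]] in auto)
    moreover have "((\<lambda>x. F t x - F b x) has_vector_derivative ptheta F t \<theta> - ptheta F b \<theta>) (at \<theta>)"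
      using has_ptheta[OF F \<theta>] unfolding has_real_derivative_iff_has_vector_derivative
      by (intro derivative_intros) auto
    ultimately show ?thesis using vector_derivative_unique_at[of "\<lambda>x. F t x - F b x"] by simp
  qed
  have "((\<lambda>t. integral {b..t} (\<lambda>s. ptheta G s \<theta>)) has_real_derivative ptheta G \<tau> \<theta>) (at \<tau> within {b..\<tau>+1})"
    by (rule integral_has_real_derivative[OF continuous_on_subset[OF smooth_strip_cont_section(2)[OF H \<theta>]]])
      (simp_all add: b_def)
  then have "((\<lambda>t. integral {b..t} (\<lambda>s. ptheta G s \<theta>)) has_real_derivative ptheta G \<tau> \<theta>) (at \<tau>)"
    by (subst (asm) at_within_interior) (simp_all add: b_def)
  then have "((\<lambda>t. ptheta F t \<theta> - ptheta F b \<theta>) has_real_derivative ptheta G \<tau> \<theta>) (at \<tau>)"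
  proof (rule has_field_derivative_transform_within_open)
    show "\<tau> \<in> {b<..}" by (simp add: b_def)
    show "integral {b..t} (\<lambda>s. ptheta G s \<theta>) = ptheta F t \<theta> - ptheta F b \<theta>" if "t \<in> {b<..}" for t
      using eq[of t] that by simp
  qed simp
  then have "((\<lambda>t. ptheta F t \<theta> - ptheta F b \<theta> + ptheta F b \<theta>) has_real_derivative ptheta G \<tau> \<theta> + 0) (at \<tau>)"
    by (intro DERIV_add DERIV_const)
  then show ?thesis unfolding G_def by (intro ptauI) simp
qed

lemma ptheta_cong:
  assumes "open I" "\<And>\<theta>. \<theta> \<in> I \<Longrightarrow> F \<tau> \<theta> = G \<tau> \<theta>" "\<theta> \<in> I"
  shows "ptheta F \<tau> \<theta> = ptheta G \<tau> \<theta>"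
proof -
  have "(F \<tau> has_vector_derivative d) (at \<theta>) \<longleftrightarrow> (G \<tau> has_vector_derivative d) (at \<theta>)" for d
    using has_vector_derivative_transform_within_open[of "F \<tau>" d \<theta> I "G \<tau>"]
      has_vector_derivative_transform_within_open[of "G \<tau>" d \<theta> I "F \<tau>"] assms by metis
  then show ?thesis unfolding ptheta_def vector_derivative_def by simp
qed

lemma ptheta_iter_cong:
  assumes I: "open I" and "\<And>\<theta>. \<theta> \<in> I \<Longrightarrow> F \<tau> \<theta> = G \<tau> \<theta>" "\<theta> \<in> I"
  shows "(ptheta ^^ k) F \<tau> \<theta> = (ptheta ^^ k) G \<tau> \<theta>"
  using assms(3)
proof (induction k arbitrary: \<theta>)
  case (Suc k)
  then show ?case using ptheta_cong[OF I, of "(ptheta ^^ k) F" \<tau> "(ptheta ^^ k) G"] by simp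
qed (use assms in simp)

lemma ptau_ptheta_iter_commute:
  assumes I: "open I" and F: "smooth_strip I F" and \<theta>: "\<theta> \<in> I"
  shows "ptau ((ptheta ^^ k) F) \<tau> \<theta> = (ptheta ^^ k) (ptau F) \<tau> \<theta>"
  using \<theta>
proof (induction k arbitrary: \<theta>)
  case (Suc k)
  have "ptau ((ptheta ^^ Suc k) F) \<tau> \<theta> = ptheta (ptau ((ptheta ^^ k) F)) \<tau> \<theta>"
    using ptau_ptheta_commute[OF I smooth_strip_ptheta_iter[OF F] Suc.prems] by simp
  also have "\<dots> = ptheta ((ptheta ^^ k) (ptau F)) \<tau> \<theta>"
    by (rule ptheta_cong[OF I]) (use Suc in auto)
  finally show ?case by simp
qed auto

lemma ptheta_arith:
  assumes "smooth_strip I F" "smooth_strip I G" "\<theta> \<in> I"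
  shows ptheta_add: "ptheta (\<lambda>\<tau> \<theta>. F \<tau> \<theta> + G \<tau> \<theta>) \<tau> \<theta> = ptheta F \<tau> \<theta> + ptheta G \<tau> \<theta>"
    and ptheta_diff: "ptheta (\<lambda>\<tau> \<theta>. F \<tau> \<theta> - G \<tau> \<theta>) \<tau> \<theta> = ptheta F \<tau> \<theta> - ptheta G \<tau> \<theta>"
proof -
  note F = has_ptheta[OF assms(1,3)] and G = has_ptheta[OF assms(2,3)]
  show "ptheta (\<lambda>\<tau> \<theta>. F \<tau> \<theta> + G \<tau> \<theta>) \<tau> \<theta> = ptheta F \<tau> \<theta> + ptheta G \<tau> \<theta>"
    by (rule pthetaI[OF DERIV_add[OF F G]])
  show "ptheta (\<lambda>\<tau> \<theta>. F \<tau> \<theta> - G \<tau> \<theta>) \<tau> \<theta> = ptheta F \<tau> \<theta> - ptheta G \<tau> \<theta>"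
    by (rule pthetaI[OF DERIV_diff[OF F G]])
qed

lemma ptheta_cmult:
  assumes "smooth_strip I F" "\<theta> \<in> I"
  shows "ptheta (\<lambda>\<tau> \<theta>. c \<tau> * F \<tau> \<theta>) \<tau> \<theta> = c \<tau> * ptheta F \<tau> \<theta>"
  by (rule pthetaI, rule DERIV_cmult, rule has_ptheta[OF assms])

lemma ptheta_iter_add:
  assumes I: "open I" and F: "smooth_strip I F" "smooth_strip I G" and "\<theta> \<in> I"
  shows "(ptheta ^^ k) (\<lambda>\<tau> \<theta>. F \<tau> \<theta> + G \<tau> \<theta>) \<tau> \<theta> = (ptheta ^^ k) F \<tau> \<theta> + (ptheta ^^ k) G \<tau> \<theta>"
  using assms(4)
proof (induction k arbitrary: \<theta>)
  case (Suc k)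
  have "(ptheta ^^ Suc k) (\<lambda>\<tau> \<theta>. F \<tau> \<theta> + G \<tau> \<theta>) \<tau> \<theta>
      = ptheta (\<lambda>\<tau> \<theta>. (ptheta ^^ k) F \<tau> \<theta> + (ptheta ^^ k) G \<tau> \<theta>) \<tau> \<theta>"
    unfolding funpow.simps o_def by (rule ptheta_cong[OF I]) (use Suc in auto)
  then show ?case
    using ptheta_add[OF smooth_strip_ptheta_iter[OF F(1)] smooth_strip_ptheta_iter[OF F(2)] Suc.prems] by simp
qed auto

lemma ptheta_iter_cmult:
  assumes I: "open I" and F: "smooth_strip I F" and "\<theta> \<in> I"
  shows "(ptheta ^^ k) (\<lambda>\<tau> \<theta>. c \<tau> * F \<tau> \<theta>) \<tau> \<theta> = c \<tau> * (ptheta ^^ k) F \<tau> \<theta>"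
  using assms(3)
proof (induction k arbitrary: \<theta>)
  case (Suc k)
  have "(ptheta ^^ Suc k) (\<lambda>\<tau> \<theta>. c \<tau> * F \<tau> \<theta>) \<tau> \<theta> = ptheta (\<lambda>\<tau> \<theta>. c \<tau> * (ptheta ^^ k) F \<tau> \<theta>) \<tau> \<theta>"
    unfolding funpow.simps o_def by (rule ptheta_cong[OF I]) (use Suc in auto)
  then show ?case
    using ptheta_cmult[OF smooth_strip_ptheta_iter[OF F] Suc.prems] by simp
qed auto

lemma ptheta_iter_minus:
  assumes "open I" "smooth_strip I F" "\<theta> \<in> I"
  shows "(ptheta ^^ k) (\<lambda>\<tau> \<theta>. - F \<tau> \<theta>) \<tau> \<theta> = - (ptheta ^^ k) F \<tau> \<theta>"
  using ptheta_iter_cmult[OF assms, of k "\<lambda>_. -1"] by simp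

lemma ptheta_iter_diff:
  assumes "open I" "smooth_strip I F" "smooth_strip I G" "\<theta> \<in> I"
  shows "(ptheta ^^ k) (\<lambda>\<tau> \<theta>. F \<tau> \<theta> - G \<tau> \<theta>) \<tau> \<theta> = (ptheta ^^ k) F \<tau> \<theta> - (ptheta ^^ k) G \<tau> \<theta>"
  using ptheta_iter_add[OF assms(1,2) smooth_strip_minus[OF assms(1,3)] assms(4), of k]
    ptheta_iter_minus[OF assms(1,3,4)] by simp

lemma ptheta_iter_mult:
  assumes I: "open I" and F: "smooth_strip I F" "smooth_strip I G" and "\<theta> \<in> I"
  shows "(ptheta ^^ k) (\<lambda>\<tau> \<theta>. F \<tau> \<theta> * G \<tau> \<theta>) \<tau> \<theta> =
    (\<Sum>i=0..k. of_nat (k choose i) * (ptheta ^^ i) F \<tau> \<theta> * (ptheta ^^ (k - i)) G \<tau> \<theta>)"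
  using assms(4)
proof (induction k arbitrary: \<theta>)
  case (Suc k)
  have "(ptheta ^^ Suc k) (\<lambda>\<tau> \<theta>. F \<tau> \<theta> * G \<tau> \<theta>) \<tau> \<theta> =
      ptheta (\<lambda>\<tau> \<theta>. \<Sum>i=0..k. of_nat (k choose i) * (ptheta ^^ i) F \<tau> \<theta> * (ptheta ^^ (k - i)) G \<tau> \<theta>) \<tau> \<theta>"
    unfolding funpow.simps o_def by (rule ptheta_cong[OF I]) (use Suc in auto)
  also have "\<dots> = (\<Sum>i=0..k. of_nat (k choose i) *
      ((ptheta ^^ Suc i) F \<tau> \<theta> * (ptheta ^^ (k - i)) G \<tau> \<theta> + (ptheta ^^ i) F \<tau> \<theta> * (ptheta ^^ (Suc k - i)) G \<tau> \<theta>))"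
  proof (rule pthetaI, rule DERIV_sum)
    fix i assume i: "i \<in> {0..k}"
    have "((\<lambda>s. (ptheta ^^ i) F \<tau> s) has_real_derivative (ptheta ^^ Suc i) F \<tau> \<theta>) (at \<theta>)"
      using has_ptheta[OF smooth_strip_ptheta_iter[OF F(1), of i] Suc.prems, of \<tau>] by simp
    moreover have "((\<lambda>s. (ptheta ^^ (k - i)) G \<tau> s) has_real_derivative (ptheta ^^ (Suc k - i)) G \<tau> \<theta>) (at \<theta>)"
      using has_ptheta[OF smooth_strip_ptheta_iter[OF F(2), of "k - i"] Suc.prems, of \<tau>] i by (simp add: Suc_diff_le)
    ultimately show "((\<lambda>s. of_nat (k choose i) * (ptheta ^^ i) F \<tau> s * (ptheta ^^ (k - i)) G \<tau> s)
      has_real_derivative of_nat (k choose i) *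
      ((ptheta ^^ Suc i) F \<tau> \<theta> * (ptheta ^^ (k - i)) G \<tau> \<theta> + (ptheta ^^ i) F \<tau> \<theta> * (ptheta ^^ (Suc k - i)) G \<tau> \<theta>)) (at \<theta>)"
      by (auto intro!: derivative_eq_intros simp: algebra_simps)
  qed
  also have "\<dots> = (\<Sum>i=0..Suc k. of_nat (Suc k choose i) * (ptheta ^^ i) F \<tau> \<theta> * (ptheta ^^ (Suc k - i)) G \<tau> \<theta>)"
  proof -
    let ?f = "\<lambda>i. (ptheta ^^ i) F \<tau> \<theta>" and ?g = "\<lambda>i. (ptheta ^^ i) G \<tau> \<theta>"
    have "(\<Sum>i=0..Suc k. of_nat (Suc k choose i) * ?f i * ?g (Suc k - i)) =
      ?f 0 * ?g (Suc k) + (\<Sum>i=0..k. of_nat (Suc k choose Suc i) * ?f (Suc i) * ?g (k - i))"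
      by (subst sum.atLeast0_atMost_Suc_shift) (simp add: o_def)
    also have "(\<Sum>i=0..k. of_nat (Suc k choose Suc i) * ?f (Suc i) * ?g (k - i)) =
      (\<Sum>i=0..k. of_nat (k choose i) * ?f (Suc i) * ?g (k - i)) +
      (\<Sum>i=0..k. of_nat (k choose Suc i) * ?f (Suc i) * ?g (k - i))"
      by (simp add: sum.distrib[symmetric] algebra_simps)
    also have "?f 0 * ?g (Suc k) + (\<dots>) = (\<Sum>i=0..k. of_nat (k choose i) * ?f (Suc i) * ?g (k - i)) +
      (\<Sum>i=0..Suc k. of_nat (k choose i) * ?f i * ?g (Suc k - i))"
      by (subst sum.atLeast0_atMost_Suc_shift) (simp add: o_def)
    also have "(\<Sum>i=0..Suc k. of_nat (k choose i) * ?f i * ?g (Suc k - i)) =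
       (\<Sum>i=0..k. of_nat (k choose i) * ?f i * ?g (Suc k - i))" by simp
    finally show ?thesis by (simp add: sum.distrib[symmetric] algebra_simps)
  qed
  finally show ?case .
qed auto

text \<open>Connects the \<theta>-derivatives used throughout with the \<open>deriv\<close> in
  \<open>Ck_norm\<close>. It holds for every F, since \<open>deriv\<close> and
  \<open>vector_derivative\<close> agree even where no derivative exists.\<close>

lemma ptheta_iter_eq_deriv: "(ptheta ^^ k) F \<tau> = (deriv ^^ k) (F \<tau>)"
proof (induction k)
  case (Suc k)
  have "(ptheta ^^ Suc k) F \<tau> = (\<lambda>\<theta>. vector_derivative ((ptheta ^^ k) F \<tau>) (at \<theta>))"
    by (simp add: ptheta_def)
  then show ?case using Suc by (simp add: fun_eq_iff field_derivative_eq_vector_derivative)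
qed simp

subsection \<open>Characteristics\<close>

text \<open>The curve s \<mapsto> \<open>\<theta> + \<sigma> * (exp (-\<tau>) - exp (-s))\<close> is
  the characteristic through (\<tau>, \<theta>). The relational form lets derivatives of products
  and powers be computed with the rules for one variable; \<open>Dchar\<close> is the same
  derivative as an operator that can be iterated.\<close>

definition char_deriv :: "real \<Rightarrow> (real \<Rightarrow> real \<Rightarrow> real) \<Rightarrow> real \<Rightarrow> real \<Rightarrow> real \<Rightarrow> bool" where
  "char_deriv \<sigma> F \<tau> \<theta> d \<longleftrightarrow>
    ((\<lambda>s. F s (\<theta> + \<sigma> * (exp (-\<tau>) - exp (-s)))) has_real_derivative d) (at \<tau>)"

definition Dchar :: "real \<Rightarrow> (real \<Rightarrow> real \<Rightarrow> real) \<Rightarrow> real \<Rightarrow> real \<Rightarrow> real" where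
  "Dchar \<sigma> F \<tau> \<theta> = ptau F \<tau> \<theta> + \<sigma> * exp (-\<tau>) * ptheta F \<tau> \<theta>"

lemma smooth_strip_Dchar: "open I \<Longrightarrow> smooth_strip I F \<Longrightarrow> smooth_strip I (Dchar \<sigma> F)"
  unfolding Dchar_def[abs_def]
  by (intro smooth_strip_intros smooth_strip_ptau smooth_strip_ptheta) auto

lemma char_deriv_Dchar:
  assumes "smooth_strip UNIV F"
  shows "char_deriv \<sigma> F \<tau> \<theta> (Dchar \<sigma> F \<tau> \<theta>)"
proof -
  have "((\<lambda>s. \<theta> + \<sigma> * (exp (-\<tau>) - exp (-s))) has_real_derivative \<sigma> * exp (-\<tau>)) (at \<tau>)"
    by (auto intro!: derivative_eq_intros)
  from smooth_strip_path[OF open_UNIV assms this] show ?thesis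
    by (simp add: char_deriv_def Dchar_def)
qed

lemma char_deriv_path:
  assumes "char_deriv \<sigma> F s (\<theta> + \<sigma> * (exp (-\<tau>) - exp (-s))) d"
  shows "((\<lambda>s. F s (\<theta> + \<sigma> * (exp (-\<tau>) - exp (-s)))) has_real_derivative d) (at s)"
proof -
  have "\<theta> + \<sigma> * (exp (-\<tau>) - exp (-s)) + \<sigma> * (exp (-s) - exp (-r)) = \<theta> + \<sigma> * (exp (-\<tau>) - exp (-r))" for r
    by (simp add: algebra_simps)
  with assms show ?thesis unfolding char_deriv_def by simp
qed

text \<open>Going back from \<tau> to s moves the angle by at most exp (-s) - exp (-\<tau>), which
  is exactly the growth of the radius. For \<eta> > 0 the region is the domain of dependence of an
  initial interval, for \<eta> = 0 a light cone.\<close>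

lemma char_path_bound:
  fixes \<theta> \<theta>\<^sub>0 \<eta> \<sigma> s \<tau> :: real
  assumes "\<bar>\<theta> - \<theta>\<^sub>0\<bar> \<le> \<eta> + exp (-\<tau>)" "s \<le> \<tau>" "\<bar>\<sigma>\<bar> \<le> 1"
  shows "\<bar>\<theta> + \<sigma> * (exp (-\<tau>) - exp (-s)) - \<theta>\<^sub>0\<bar> \<le> \<eta> + exp (-s)"
proof -
  define d where "d = \<sigma> * (exp (-\<tau>) - exp (-s))"
  have "\<bar>d\<bar> \<le> 1 * (exp (-s) - exp (-\<tau>))"
    unfolding d_def abs_mult by (rule mult_mono) (use assms in auto)
  moreover have "\<bar>\<theta> + d - \<theta>\<^sub>0\<bar> \<le> \<bar>\<theta> - \<theta>\<^sub>0\<bar> + \<bar>d\<bar>"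
    using abs_triangle_ineq[of "\<theta> - \<theta>\<^sub>0" d] by (simp add: algebra_simps)
  ultimately show ?thesis using assms(1) unfolding d_def[symmetric] by simp
qed

text \<open>In the proof, S is the largest ratio of the functions to their bounds; running backwards
  along the characteristic through the point where it is attained shows that it is at most 1.\<close>

lemma char_comparison:
  fixes X :: "'i \<Rightarrow> real \<Rightarrow> real \<Rightarrow> real" and B B' :: "'i \<Rightarrow> real \<Rightarrow> real" and sg :: "'i \<Rightarrow> real"
  assumes N: "finite N" and sg: "\<And>i. i \<in> N \<Longrightarrow> \<bar>sg i\<bar> \<le> 1"
    and cont: "\<And>i. i \<in> N \<Longrightarrow> continuous_on UNIV (\<lambda>p. X i (fst p) (snd p))"
    and Bpos: "\<And>i \<tau>. i \<in> N \<Longrightarrow> T \<le> \<tau> \<Longrightarrow> \<tau> \<le> T2 \<Longrightarrow> B i \<tau> > 0"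
    and Bder: "\<And>i \<tau>. i \<in> N \<Longrightarrow> T \<le> \<tau> \<Longrightarrow> \<tau> \<le> T2 \<Longrightarrow> (B i has_real_derivative B' i \<tau>) (at \<tau>)"
    and init: "\<And>i \<theta>. i \<in> N \<Longrightarrow> \<bar>\<theta> - \<theta>\<^sub>0\<bar> \<le> \<eta> + exp (-T) \<Longrightarrow> X i T \<theta> \<le> B i T"
    and step: "\<And>i \<tau> \<theta> S. i \<in> N \<Longrightarrow> T < \<tau> \<Longrightarrow> \<tau> < T2 \<Longrightarrow> \<bar>\<theta> - \<theta>\<^sub>0\<bar> \<le> \<eta> + exp (-\<tau>) \<Longrightarrow> S \<ge> 1 \<Longrightarrow>
       (\<And>j. j \<in> N \<Longrightarrow> X j \<tau> \<theta> \<le> S * B j \<tau>) \<Longrightarrow>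
       \<exists>d. char_deriv (sg i) (X i) \<tau> \<theta> d \<and> d + \<mu> * X i \<tau> \<theta> \<le> S * (B' i \<tau> + \<mu> * B i \<tau>)"
    and i: "i \<in> N" and \<tau>: "T \<le> \<tau>" "\<tau> \<le> T2" and \<theta>: "\<bar>\<theta> - \<theta>\<^sub>0\<bar> \<le> \<eta> + exp (-\<tau>)"
  shows "X i \<tau> \<theta> \<le> B i \<tau>"
proof -
  define R where "R = {p::real \<times> real. T \<le> fst p \<and> fst p \<le> T2 \<and> \<bar>snd p - \<theta>\<^sub>0\<bar> \<le> \<eta> + exp (- fst p)}"
  define r where "r j p = X j (fst p) (snd p) / B j (fst p)" for j p
  have "closed R" unfolding R_def
    by (intro closed_Collect_conj closed_Collect_le continuous_intros)
  moreover have "R \<subseteq> cbox (T, \<theta>\<^sub>0 - \<eta> - exp (-T)) (T2, \<theta>\<^sub>0 + \<eta> + exp (-T))"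
  proof
    fix p assume p: "p \<in> R"
    then have "exp (- fst p) \<le> exp (-T)" by (simp add: R_def)
    then have "\<bar>snd p - \<theta>\<^sub>0\<bar> \<le> \<eta> + exp (-T)" using p unfolding R_def by (metis (mono_tags, lifting) add_left_mono mem_Collect_eq order_trans)
    with p show "p \<in> cbox (T, \<theta>\<^sub>0 - \<eta> - exp (-T)) (T2, \<theta>\<^sub>0 + \<eta> + exp (-T))"
      by (cases p) (auto simp: R_def abs_le_iff)
  qed
  ultimately have R: "compact R"
    by (meson bounded_cbox bounded_subset compact_eq_bounded_closed)
  have ne: "R \<noteq> {}" 
  proof -
    have "(\<tau>, \<theta>) \<in> R" using \<tau> \<theta> by (simp add: R_def)
    then show ?thesis by blast
  qed
  have contr: "continuous_on R (r j)" if "j \<in> N" for j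
  proof -
    have "isCont (B j) t" if "T \<le> t" "t \<le> T2" for t using Bder[OF \<open>j \<in> N\<close> that] DERIV_isCont by blast
    then have "continuous_on {T..T2} (B j)" by (intro continuous_at_imp_continuous_on) auto
    then have "continuous_on R (\<lambda>p. B j (fst p))"
      by (rule continuous_on_compose2) (auto simp: R_def intro!: continuous_intros)
    moreover have "continuous_on R (\<lambda>p. X j (fst p) (snd p))"
      using cont[OF that] continuous_on_subset by blast
    moreover have "\<forall>p\<in>R. B j (fst p) \<noteq> 0" using Bpos[OF that] by (force simp: R_def)
    ultimately have "continuous_on R (\<lambda>p. X j (fst p) (snd p) / B j (fst p))"
      by (auto intro!: continuous_on_divide)
    then show ?thesis unfolding r_def .
  qed
  have "\<forall>j\<in>N. \<exists>p\<in>R. \<forall>q\<in>R. r j q \<le> r j p"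
    using continuous_attains_sup[OF R ne contr] by blast
  then obtain pm where pm: "\<And>j. j \<in> N \<Longrightarrow> pm j \<in> R" "\<And>j q. j \<in> N \<Longrightarrow> q \<in> R \<Longrightarrow> r j q \<le> r j (pm j)"
    by metis
  define S where "S = Max ((\<lambda>j. r j (pm j)) ` N)"
  have "S \<in> (\<lambda>j. r j (pm j)) ` N" unfolding S_def using N i by (intro Max_in) auto
  then obtain k where k: "k \<in> N" "S = r k (pm k)" by blast
  have rS: "r j q \<le> S" if "j \<in> N" "q \<in> R" for j q
  proof -
    have "r j (pm j) \<le> S" unfolding S_def using N that by (intro Max_ge) auto
    then show ?thesis using pm(2)[OF that] by linarith
  qed
  have XS: "X j t x \<le> S * B j t" if "j \<in> N" "T \<le> t" "t \<le> T2" "\<bar>x - \<theta>\<^sub>0\<bar> \<le> \<eta> + exp (-t)" for j t x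
    using rS[OF that(1), of "(t, x)"] Bpos[OF that(1-3)] that by (simp add: R_def r_def divide_le_eq)
  have "S \<le> 1"
  proof (rule ccontr)
    assume "\<not> S \<le> 1"
    then have S: "S > 1" by simp
    obtain t x where tx: "pm k = (t, x)" by fastforce
    have t: "T \<le> t" "t \<le> T2" and x: "\<bar>x - \<theta>\<^sub>0\<bar> \<le> \<eta> + exp (-t)"
      using pm(1)[OF k(1)] by (auto simp: R_def tx)
    have eq: "X k t x = S * B k t" using k(2) Bpos[OF k(1) t] by (simp add: r_def tx)
    have "t \<noteq> T"
    proof
      assume "t = T"
      then have "S * B k t \<le> 1 * B k t" using init[OF k(1), of x] x eq by simp
      then show False using S Bpos[OF k(1) t] by simp
    qed
    then have tT: "T < t" using t by simp
    define w where "w s = x + sg k * (exp (-t) - exp (-s))" for s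
    have w: "\<bar>w s - \<theta>\<^sub>0\<bar> \<le> \<eta> + exp (-s)" if "s \<le> t" for s
      unfolding w_def by (rule char_path_bound[OF x that sg[OF k(1)]])
    \<comment> \<open>exp (\<mu> s) is an integrating factor: the damping term stays on the left of
      \<open>step\<close>, and only the coupling to the other functions has to be estimated. S > 1
      makes \<phi> positive at T, attainment of the maximum makes it vanish at t, yet
      \<open>step\<close> makes it nondecreasing.\<close>
    define \<phi> where "\<phi> s = exp (\<mu> * s) * (S * B k s - X k s (w s))" for s
    have "\<phi> T \<le> \<phi> t"
    proof (rule DERIV_nonneg_imp_increasing_open[of T t \<phi>])
      show "T \<le> t" by fact
      fix s assume s: "T < s" "s < t"
      have s2: "T \<le> s" "s \<le> T2" using s t by auto
      have ws: "\<bar>w s - \<theta>\<^sub>0\<bar> \<le> \<eta> + exp (- s)" using w s by simp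
      have "s < T2" "S \<ge> 1" using s t S by auto
      from step[OF k(1) s(1) this(1) ws this(2) XS[OF _ s2 ws]] obtain d
        where d: "char_deriv (sg k) (X k) s (w s) d" "d + \<mu> * X k s (w s) \<le> S * (B' k s + \<mu> * B k s)"
        by blast
      have "((\<lambda>s. X k s (w s)) has_real_derivative d) (at s)"
        using char_deriv_path d(1) unfolding w_def by blast
      then have "(\<phi> has_real_derivative exp (\<mu> * s) * (\<mu> * (S * B k s - X k s (w s)) + (S * B' k s - d))) (at s)"
        unfolding \<phi>_def using Bder[OF k(1) s2]
        by (auto intro!: derivative_eq_intros simp: algebra_simps)
      moreover have "exp (\<mu> * s) * (\<mu> * (S * B k s - X k s (w s)) + (S * B' k s - d)) \<ge> 0"
        using d(2) by (intro mult_nonneg_nonneg) (auto simp: algebra_simps)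
      ultimately show "\<exists>y. (\<phi> has_real_derivative y) (at s) \<and> y \<ge> 0" by blast
    next
      have "isCont (B k) s" if "T \<le> s" "s \<le> T2" for s using Bder[OF k(1) that] DERIV_isCont by blast
      then have "continuous_on {T..t} (B k)" using t by (intro continuous_at_imp_continuous_on) auto
      moreover have "continuous_on {T..t} (\<lambda>s. X k s (w s))"
      proof -
        have "continuous_on {T..t} (\<lambda>s. (s, w s))" unfolding w_def by (intro continuous_intros)
        from continuous_on_compose2[OF cont[OF k(1)] this] show ?thesis by simp
      qed
      ultimately show "continuous_on {T..t} \<phi>" unfolding \<phi>_def by (intro continuous_intros)
    qed
    moreover have "\<phi> t = 0" using eq by (simp add: \<phi>_def w_def)
    moreover have "\<phi> T > 0"
    proof -
      have B: "B k T > 0" using Bpos[OF k(1)] t by auto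
      have "X k T (w T) \<le> B k T" using init[OF k(1)] w[of T] t by auto
      also have "\<dots> < S * B k T" using S B by simp
      finally show ?thesis by (simp add: \<phi>_def)
    qed
    ultimately show False by simp
  qed
  then have "S * B i \<tau> \<le> 1 * B i \<tau>" using Bpos[OF i \<tau>] by (intro mult_right_mono) auto
  then show ?thesis using XS[OF i \<tau> \<theta>] by simp
qed

text \<open>The coefficient in \<open>Dchar\<close> depends on \<tau> only, so differentiating the
  system in \<theta> does not change its principal part.\<close>

lemma Dchar_ptheta_iter:
  assumes "open I" "smooth_strip I F" "\<theta> \<in> I"
  shows "Dchar \<sigma> ((ptheta ^^ k) F) \<tau> \<theta> = (ptheta ^^ k) (Dchar \<sigma> F) \<tau> \<theta>"
proof -
  have "(ptheta ^^ k) (Dchar \<sigma> F) \<tau> \<theta> =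
      (ptheta ^^ k) (ptau F) \<tau> \<theta> + (ptheta ^^ k) (\<lambda>\<tau> \<theta>. \<sigma> * exp (-\<tau>) * ptheta F \<tau> \<theta>) \<tau> \<theta>"
    unfolding Dchar_def[abs_def]
    by (rule ptheta_iter_add[OF assms(1) _ _ assms(3)])
      (intro smooth_strip_intros smooth_strip_ptau smooth_strip_ptheta assms)+
  also have "(ptheta ^^ k) (\<lambda>\<tau> \<theta>. \<sigma> * exp (-\<tau>) * ptheta F \<tau> \<theta>) \<tau> \<theta> = \<sigma> * exp (-\<tau>) * (ptheta ^^ k) (ptheta F) \<tau> \<theta>"
    by (rule ptheta_iter_cmult[OF assms(1) smooth_strip_ptheta[OF assms(2)] assms(3)])
  finally show ?thesis
    by (simp add: Dchar_def[of \<sigma> "(ptheta ^^ k) F"] ptau_ptheta_iter_commute[OF assms] funpow_swap1)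
qed

lemma char_deriv_cmult: "char_deriv \<sigma> F \<tau> \<theta> d \<Longrightarrow> char_deriv \<sigma> (\<lambda>\<tau> \<theta>. c * F \<tau> \<theta>) \<tau> \<theta> (c * d)"
  unfolding char_deriv_def by (rule DERIV_cmult)

lemma char_deriv_diff_const: "char_deriv \<sigma> F \<tau> \<theta> d \<Longrightarrow> char_deriv \<sigma> (\<lambda>\<tau> \<theta>. F \<tau> \<theta> - c) \<tau> \<theta> d"
  unfolding char_deriv_def by (auto intro!: derivative_eq_intros)

text \<open>Serves the Leibniz sums, whose two factors have different growth e1 and e2. The
  constants are made nonnegative first, so that they can be multiplied and added.\<close>

lemma sum_mult_bound:
  fixes A B :: "nat \<Rightarrow> 'x \<Rightarrow> real" and c :: "nat \<Rightarrow> real"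
  assumes "finite K" and e: "\<And>x. x \<in> X \<Longrightarrow> e1 x \<ge> 0" "\<And>x. x \<in> X \<Longrightarrow> e2 x \<ge> 0"
    and A: "\<And>i. i \<in> K \<Longrightarrow> \<exists>C. \<forall>x\<in>X. \<bar>A i x\<bar> \<le> C * e1 x"
    and B: "\<And>i. i \<in> K \<Longrightarrow> \<exists>C. \<forall>x\<in>X. \<bar>B i x\<bar> \<le> C * e2 x"
  shows "\<exists>C\<ge>0. \<forall>x\<in>X. \<bar>\<Sum>i\<in>K. c i * A i x * B i x\<bar> \<le> C * (e1 x * e2 x)"
proof -
  have "\<exists>C\<ge>0. \<forall>x\<in>X. \<bar>c i * A i x * B i x\<bar> \<le> C * (e1 x * e2 x)" if i: "i \<in> K" for i
  proof -
    obtain C1 C2 where C: "\<forall>x\<in>X. \<bar>A i x\<bar> \<le> C1 * e1 x" "\<forall>x\<in>X. \<bar>B i x\<bar> \<le> C2 * e2 x"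
      using A[OF i] B[OF i] by blast
    have "\<bar>c i * A i x * B i x\<bar> \<le> (\<bar>c i\<bar> * \<bar>C1\<bar> * \<bar>C2\<bar>) * (e1 x * e2 x)" if x: "x \<in> X" for x
    proof -
      have "\<bar>A i x\<bar> \<le> \<bar>C1\<bar> * e1 x"
        using C(1) x e(1)[OF x] by (meson abs_ge_self mult_right_mono order_trans)
      moreover have "\<bar>B i x\<bar> \<le> \<bar>C2\<bar> * e2 x"
        using C(2) x e(2)[OF x] by (meson abs_ge_self mult_right_mono order_trans)
      ultimately have "\<bar>A i x\<bar> * \<bar>B i x\<bar> \<le> (\<bar>C1\<bar> * e1 x) * (\<bar>C2\<bar> * e2 x)"
        using e[OF x] by (intro mult_mono) auto
      then have "\<bar>c i\<bar> * (\<bar>A i x\<bar> * \<bar>B i x\<bar>) \<le> \<bar>c i\<bar> * ((\<bar>C1\<bar> * e1 x) * (\<bar>C2\<bar> * e2 x))"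
        by (rule mult_left_mono) simp
      then show ?thesis by (simp add: abs_mult mult_ac)
    qed
    then show ?thesis by (intro exI[of _ "\<bar>c i\<bar> * \<bar>C1\<bar> * \<bar>C2\<bar>"]) auto
  qed
  then obtain D where D: "\<And>i. i \<in> K \<Longrightarrow> D i \<ge> 0"
    "\<And>i x. i \<in> K \<Longrightarrow> x \<in> X \<Longrightarrow> \<bar>c i * A i x * B i x\<bar> \<le> D i * (e1 x * e2 x)" by metis
  show ?thesis
  proof (intro exI conjI ballI)
    show "0 \<le> sum D K" using D by (intro sum_nonneg) auto
    fix x assume "x \<in> X"
    then have "\<bar>\<Sum>i\<in>K. c i * A i x * B i x\<bar> \<le> (\<Sum>i\<in>K. D i * (e1 x * e2 x))"
      using D(2) by (intro order_trans[OF sum_abs] sum_mono) auto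
    then show "\<bar>\<Sum>i\<in>K. c i * A i x * B i x\<bar> \<le> sum D K * (e1 x * e2 x)" by (simp add: sum_distrib_right)
  qed
qed

subsection \<open>The system in the orthonormal frame\<close>

text \<open>With \<open>c \<sigma> = a \<sigma> + i b \<sigma>\<close> both equations read
  \<open>Dchar (-\<sigma>) (c \<sigma>) = - i b (-\<sigma>) c \<sigma> - (c \<sigma> - c
  (-\<sigma>)) / 2\<close>. The first term is the connection of the frame, a rotation; the second
  comes from the \<tau>-dependence of the characteristic speed.\<close>

locale gowdy_frame =
  fixes a b :: "real \<Rightarrow> real \<Rightarrow> real \<Rightarrow> real"
  assumes smooth_a: "\<And>\<sigma>. smooth_strip UNIV (a \<sigma>)" and smooth_b: "\<And>\<sigma>. smooth_strip UNIV (b \<sigma>)"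
    and a_eq: "\<And>\<sigma> \<tau> \<theta>. \<sigma> \<in> {1, -1} \<Longrightarrow>
      Dchar (- \<sigma>) (a \<sigma>) \<tau> \<theta> = b \<sigma> \<tau> \<theta> * b (- \<sigma>) \<tau> \<theta> - (a \<sigma> \<tau> \<theta> - a (- \<sigma>) \<tau> \<theta>) / 2"
    and b_eq: "\<And>\<sigma> \<tau> \<theta>. \<sigma> \<in> {1, -1} \<Longrightarrow>
      Dchar (- \<sigma>) (b \<sigma>) \<tau> \<theta> = - a \<sigma> \<tau> \<theta> * b (- \<sigma>) \<tau> \<theta> - (b \<sigma> \<tau> \<theta> - b (- \<sigma>) \<tau> \<theta>) / 2"
begin

lemma continuous_ab:
  "continuous_on UNIV (\<lambda>p. a \<sigma> (fst p) (snd p))" "continuous_on UNIV (\<lambda>p. b \<sigma> (fst p) (snd p))"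
  using smooth_strip_continuous[OF smooth_a] smooth_strip_continuous[OF smooth_b] by simp_all

end

section \<open>Data close to (v, 0) on an interval\<close>

text \<open>\<delta> is the width of the tube for a about \<open>v\<^sub>0\<close>, g the decay rate
  of b and \<epsilon> its initial size. The margins g + \<delta> keep the coupling in the equation
  of b below 1/2 throughout the tube. \<open>\<epsilon>\<^sup>2 < \<delta> * g\<close> bounds the
  time integral of the square of the bound for b by \<delta>/2.
  \<open>\<epsilon> \<le> g / 8\<close> absorbs the cross terms of the differentiated
  equations.\<close>

locale gowdy_small = gowdy_frame +
  fixes T \<eta> \<theta>\<^sub>0 v\<^sub>0 \<delta> g \<epsilon> :: real
  assumes pos: "\<delta> > 0" "g > 0" "\<epsilon> > 0" "\<eta> > 0"
    and v0: "g + \<delta> \<le> v\<^sub>0" "v\<^sub>0 \<le> 1 - g - \<delta>"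
    and eps: "\<epsilon>\<^sup>2 < \<delta> * g" "\<epsilon> \<le> g / 8"
    and init_a: "\<And>\<sigma> \<theta>. \<sigma> \<in> {1, -1} \<Longrightarrow> \<bar>\<theta> - \<theta>\<^sub>0\<bar> \<le> \<eta> + exp (-T) \<Longrightarrow> \<bar>a \<sigma> T \<theta> - v\<^sub>0\<bar> \<le> \<delta> / 2"
    and init_b: "\<And>\<sigma> \<theta>. \<sigma> \<in> {1, -1} \<Longrightarrow> \<bar>\<theta> - \<theta>\<^sub>0\<bar> \<le> \<eta> + exp (-T) \<Longrightarrow> \<bar>b \<sigma> T \<theta>\<bar> \<le> \<epsilon>"
begin

text \<open>In the form \<open>b \<sigma>' + b \<sigma> / 2 = (1/2 - a \<sigma>) b
  (-\<sigma>)\<close> the equation of b is contracting when |1/2 - a| < 1/2, that is for 0 < a < 1;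
  g becomes the rate of decay.\<close>

lemma half_minus_v:
  assumes "\<bar>x - v\<^sub>0\<bar> \<le> \<delta>"
  shows "\<bar>1/2 - x\<bar> \<le> 1/2 - g"
  using assms v0 by linarith

text \<open>The barrier B = \<open>\<epsilon> * exp (- g * (\<tau> - T))\<close> satisfies B' + B/2
  = (1/2 - g) B, which dominates the coupling. The bound on a is asked on the open time interval
  only, so that the lemma can feed a continuity argument ending at T2.\<close>

lemma b_bound_until:
  assumes a: "\<And>\<sigma> \<tau> \<theta>. \<sigma> \<in> {1, -1} \<Longrightarrow> T < \<tau> \<Longrightarrow> \<tau> < T2 \<Longrightarrow> \<bar>\<theta> - \<theta>\<^sub>0\<bar> \<le> \<eta> + exp (-\<tau>) \<Longrightarrow> \<bar>a \<sigma> \<tau> \<theta> - v\<^sub>0\<bar> \<le> \<delta>"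
    and \<sigma>: "\<sigma> \<in> {1, -1}" and \<tau>: "T \<le> \<tau>" "\<tau> \<le> T2" and \<theta>: "\<bar>\<theta> - \<theta>\<^sub>0\<bar> \<le> \<eta> + exp (-\<tau>)"
  shows "\<bar>b \<sigma> \<tau> \<theta>\<bar> \<le> \<epsilon> * exp (- g * (\<tau> - T))"
proof -
  \<comment> \<open>The second component is a sign: comparing s b from above for both signs bounds
    the absolute value.\<close>
  define N :: "(real \<times> real) set" where "N = {1, -1} \<times> {1, -1}"
  have "snd i * b (fst i) \<tau> \<theta> \<le> \<epsilon> * exp (- g * (\<tau> - T))" if i: "i \<in> N" for i
  proof (rule char_comparison[where X = "\<lambda>i \<tau> \<theta>. snd i * b (fst i) \<tau> \<theta>" and N = N and sg = "\<lambda>i. - fst i" and \<mu> = "1/2"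
        and T = T and \<eta> = \<eta> and \<theta>\<^sub>0 = \<theta>\<^sub>0 and ?T2.0 = T2 and B = "\<lambda>i \<tau>. \<epsilon> * exp (- g * (\<tau> - T))" and B' = "\<lambda>i \<tau>. - g * (\<epsilon> * exp (- g * (\<tau> - T)))"])
    fix j and t x S :: real
    assume j: "j \<in> N" and t: "T < t" "t < T2" and x: "\<bar>x - \<theta>\<^sub>0\<bar> \<le> \<eta> + exp (-t)" and S: "S \<ge> 1"
      and le: "\<And>j. j \<in> N \<Longrightarrow> snd j * b (fst j) t x \<le> S * (\<epsilon> * exp (- g * (t - T)))"
    obtain \<sigma>' s where js: "j = (\<sigma>', s)" "\<sigma>' \<in> {1, -1}" "s \<in> {1, -1}" using j unfolding N_def by auto
    let ?B = "\<epsilon> * exp (- g * (t - T))"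
    let ?d = "s * Dchar (- \<sigma>') (b \<sigma>') t x"
    have "\<bar>b (- \<sigma>') t x\<bar> \<le> S * ?B"
      using le[of "(-\<sigma>', 1)"] le[of "(-\<sigma>', -1)"] js by (auto simp: N_def abs_le_iff)
    moreover have "\<bar>1/2 - a \<sigma>' t x\<bar> \<le> 1/2 - g" by (intro half_minus_v a js t x)
    ultimately have "\<bar>(1/2 - a \<sigma>' t x) * b (- \<sigma>') t x\<bar> \<le> (1/2 - g) * (S * ?B)"
      unfolding abs_mult by (intro mult_mono) auto
    moreover have "?d + 1/2 * (s * b \<sigma>' t x) = s * ((1/2 - a \<sigma>' t x) * b (- \<sigma>') t x)"
      unfolding b_eq[OF js(2)] by (simp add: field_simps)
    ultimately have "?d + 1/2 * (s * b \<sigma>' t x) \<le> (1/2 - g) * (S * ?B)"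
      using js(3) by (auto simp: abs_le_iff)
    also have "\<dots> = S * (- g * ?B + 1/2 * ?B)" by (simp add: algebra_simps)
    finally have "?d + 1/2 * (s * b \<sigma>' t x) \<le> S * (- g * ?B + 1/2 * ?B)" .
    moreover have "char_deriv (- \<sigma>') (\<lambda>\<tau> \<theta>. s * b \<sigma>' \<tau> \<theta>) t x ?d"
      by (intro char_deriv_cmult char_deriv_Dchar smooth_b)
    ultimately show "\<exists>d. char_deriv (- fst j) (\<lambda>\<tau> \<theta>. snd j * b (fst j) \<tau> \<theta>) t x d \<and>
        d + 1/2 * (snd j * b (fst j) t x) \<le> S * (- g * ?B + 1/2 * ?B)"
      unfolding js(1) fst_conv snd_conv by blast
  next
    fix j x assume "j \<in> N" "\<bar>x - \<theta>\<^sub>0\<bar> \<le> \<eta> + exp (-T)"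
    then show "snd j * b (fst j) T x \<le> \<epsilon> * exp (- g * (T - T))"
      using init_b[of 1 x] init_b[of "-1" x] by (auto simp: N_def)
  next
    fix j :: "real \<times> real" and t :: real
    show "continuous_on UNIV (\<lambda>p. snd j * b (fst j) (fst p) (snd p))"
      by (intro continuous_on_mult continuous_on_const continuous_ab)
    show "((\<lambda>\<tau>. \<epsilon> * exp (- g * (\<tau> - T))) has_real_derivative - g * (\<epsilon> * exp (- g * (t - T)))) (at t)"
      by (auto intro!: derivative_eq_intros)
  qed (use i \<tau> \<theta> pos in \<open>auto simp: N_def\<close>)
  from this[of "(\<sigma>, 1)"] this[of "(\<sigma>, -1)"] show ?thesis using \<sigma> by (auto simp: N_def abs_le_iff)
qed

text \<open>Improves \<le> \<delta> to < \<delta>, which is the step of the continuity argument. The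
  barrier starts at \<delta>/2 and grows by the integral of the bound for the product of the two b,
  at most \<open>\<epsilon>\<^sup>2 / (2 * g)\<close> and hence less than \<delta>/2.\<close>

lemma a_bound_until:
  assumes a: "\<And>\<sigma> \<tau> \<theta>. \<sigma> \<in> {1, -1} \<Longrightarrow> T < \<tau> \<Longrightarrow> \<tau> < T2 \<Longrightarrow> \<bar>\<theta> - \<theta>\<^sub>0\<bar> \<le> \<eta> + exp (-\<tau>) \<Longrightarrow> \<bar>a \<sigma> \<tau> \<theta> - v\<^sub>0\<bar> \<le> \<delta>"
    and \<sigma>: "\<sigma> \<in> {1, -1}" and \<tau>: "T \<le> \<tau>" "\<tau> \<le> T2" and \<theta>: "\<bar>\<theta> - \<theta>\<^sub>0\<bar> \<le> \<eta> + exp (-\<tau>)"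
  shows "\<bar>a \<sigma> \<tau> \<theta> - v\<^sub>0\<bar> < \<delta>"
proof -
  define N :: "(real \<times> real) set" where "N = {1, -1} \<times> {1, -1}"
  define B where "B t = \<delta> / 2 + \<epsilon>\<^sup>2 / (2 * g) * (1 - exp (- 2 * g * (t - T)))" for t
  define B' where "B' t = \<epsilon>\<^sup>2 * exp (- 2 * g * (t - T))" for t
  have Bpos: "B t > 0" if "T \<le> t" for t
  proof -
    have "exp (- 2 * g * (t - T)) \<le> 1" using that pos by (simp add: mult_nonneg_nonneg)
    then have "\<epsilon>\<^sup>2 / (2 * g) * (1 - exp (- 2 * g * (t - T))) \<ge> 0" using pos by (intro mult_nonneg_nonneg) auto
    then show ?thesis using pos by (simp add: B_def)
  qed
  have "snd i * (a (fst i) \<tau> \<theta> - v\<^sub>0) \<le> B \<tau>" if i: "i \<in> N" for i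
  proof (rule char_comparison[where X = "\<lambda>i \<tau> \<theta>. snd i * (a (fst i) \<tau> \<theta> - v\<^sub>0)" and N = N and sg = "\<lambda>i. - fst i" and \<mu> = "1/2"
        and T = T and \<eta> = \<eta> and \<theta>\<^sub>0 = \<theta>\<^sub>0 and ?T2.0 = T2 and B = "\<lambda>i. B" and B' = "\<lambda>i. B'"])
    fix j and t x S :: real
    assume j: "j \<in> N" and t: "T < t" "t < T2" and x: "\<bar>x - \<theta>\<^sub>0\<bar> \<le> \<eta> + exp (-t)" and S: "S \<ge> 1"
      and le: "\<And>j. j \<in> N \<Longrightarrow> snd j * (a (fst j) t x - v\<^sub>0) \<le> S * B t"
    obtain \<sigma>' s where js: "j = (\<sigma>', s)" "\<sigma>' \<in> {1, -1}" "s \<in> {1, -1}" using j unfolding N_def by auto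
    let ?d = "s * Dchar (- \<sigma>') (a \<sigma>') t x"
    have "\<bar>b \<sigma>' t x\<bar> \<le> \<epsilon> * exp (- g * (t - T))" "\<bar>b (- \<sigma>') t x\<bar> \<le> \<epsilon> * exp (- g * (t - T))"
      using b_bound_until[OF a] js t x by auto
    then have "\<bar>b \<sigma>' t x * b (- \<sigma>') t x\<bar> \<le> (\<epsilon> * exp (- g * (t - T))) * (\<epsilon> * exp (- g * (t - T)))"
      unfolding abs_mult using pos by (intro mult_mono) auto
    also have "\<dots> = B' t" unfolding B'_def power2_eq_square by (simp add: field_simps flip: exp_add)
    also have "\<dots> \<le> S * B' t" using S mult_right_mono[OF S, of "B' t"] by (simp add: B'_def)
    finally have bb: "\<bar>b \<sigma>' t x * b (- \<sigma>') t x\<bar> \<le> S * B' t" .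
    have "\<bar>a (- \<sigma>') t x - v\<^sub>0\<bar> \<le> S * B t"
      using le[of "(-\<sigma>', 1)"] le[of "(-\<sigma>', -1)"] js by (auto simp: N_def abs_le_iff)
    moreover have "?d + 1/2 * (s * (a \<sigma>' t x - v\<^sub>0)) = s * (b \<sigma>' t x * b (- \<sigma>') t x + (a (- \<sigma>') t x - v\<^sub>0) / 2)"
      unfolding a_eq[OF js(2)] by (simp add: field_simps)
    moreover have "s * (p + q / 2) \<le> m + n / 2" if "\<bar>p\<bar> \<le> m" "\<bar>q\<bar> \<le> n" for p q m n
      using js(3) that by auto
    ultimately have "?d + 1/2 * (s * (a \<sigma>' t x - v\<^sub>0)) \<le> S * B' t + S * B t / 2"
      using bb by metis
    then have "?d + 1/2 * (s * (a \<sigma>' t x - v\<^sub>0)) \<le> S * (B' t + 1/2 * B t)" by (simp add: algebra_simps)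
    moreover have "char_deriv (- \<sigma>') (\<lambda>\<tau> \<theta>. s * (a \<sigma>' \<tau> \<theta> - v\<^sub>0)) t x ?d"
      by (intro char_deriv_cmult char_deriv_diff_const char_deriv_Dchar smooth_a)
    ultimately show "\<exists>d. char_deriv (- fst j) (\<lambda>\<tau> \<theta>. snd j * (a (fst j) \<tau> \<theta> - v\<^sub>0)) t x d \<and>
        d + 1/2 * (snd j * (a (fst j) t x - v\<^sub>0)) \<le> S * (B' t + 1/2 * B t)"
      unfolding js(1) fst_conv snd_conv by blast
  next
    fix j x assume "j \<in> N" "\<bar>x - \<theta>\<^sub>0\<bar> \<le> \<eta> + exp (-T)"
    then obtain \<sigma>' s where js: "j = (\<sigma>', s)" "s \<in> {1, -1}" "\<bar>a \<sigma>' T x - v\<^sub>0\<bar> \<le> \<delta> / 2"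
      using init_a by (auto simp: N_def)
    have "s * p \<le> m" if "\<bar>p\<bar> \<le> m" for p m :: real using js(2) that by auto
    from this[OF js(3)] show "snd j * (a (fst j) T x - v\<^sub>0) \<le> B T" by (simp add: js(1) B_def)
  next
    fix t :: real
    show "(B has_real_derivative B' t) (at t)" unfolding B_def B'_def using pos
      by (auto intro!: derivative_eq_intros simp: field_simps)
    show "continuous_on UNIV (\<lambda>p. snd j * (a (fst j) (fst p) (snd p) - v\<^sub>0))" for j :: "real \<times> real"
      by (intro continuous_on_mult continuous_on_diff continuous_on_const continuous_ab)
  qed (use i \<tau> \<theta> Bpos in \<open>auto simp: N_def\<close>)
  from this[of "(\<sigma>, 1)"] this[of "(\<sigma>, -1)"] have "\<bar>a \<sigma> \<tau> \<theta> - v\<^sub>0\<bar> \<le> B \<tau>"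
    using \<sigma> by (auto simp: N_def abs_le_iff)
  also have "B \<tau> < \<delta>"
  proof -
    have "\<epsilon>\<^sup>2 / (2 * g) * (1 - exp (- 2 * g * (\<tau> - T))) \<le> \<epsilon>\<^sup>2 / (2 * g) * 1"
      using pos by (intro mult_left_mono) auto
    also have "\<dots> < \<delta> / 2" using eps(1) pos by (simp add: field_simps)
    finally show ?thesis by (simp add: B_def)
  qed
  finally show ?thesis .
qed

text \<open>The set where one of the two a leaves the open tube, cut off at time \<tau>, is compact
  and so has an earliest point p. Before p the weak bound holds, and \<open>a_bound_until\<close>
  yields the strict bound at p, a contradiction.\<close>

lemma a_bound:
  assumes \<sigma>: "\<sigma> \<in> {1, -1}" and \<tau>: "T \<le> \<tau>" and \<theta>: "\<bar>\<theta> - \<theta>\<^sub>0\<bar> \<le> \<eta> + exp (-\<tau>)"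
  shows "\<bar>a \<sigma> \<tau> \<theta> - v\<^sub>0\<bar> < \<delta>"
proof (rule ccontr)
  assume bad: "\<not> \<bar>a \<sigma> \<tau> \<theta> - v\<^sub>0\<bar> < \<delta>"
  define K where "K s = {p::real \<times> real. T \<le> fst p \<and> fst p \<le> \<tau> \<and> \<bar>snd p - \<theta>\<^sub>0\<bar> \<le> \<eta> + exp (- fst p) \<and> \<delta> \<le> \<bar>a s (fst p) (snd p) - v\<^sub>0\<bar>}" for s
  have "closed (K s)" for s unfolding K_def
    by (intro closed_Collect_conj closed_Collect_le continuous_intros continuous_ab)
  moreover have "K s \<subseteq> cbox (T, \<theta>\<^sub>0 - \<eta> - exp (-T)) (\<tau>, \<theta>\<^sub>0 + \<eta> + exp (-T))" for s
  proof
    fix p assume p: "p \<in> K s"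
    then have e: "exp (- fst p) \<le> exp (-T)" by (simp add: K_def)
    have "\<bar>snd p - \<theta>\<^sub>0\<bar> \<le> \<eta> + exp (- fst p)" using p by (simp add: K_def)
    then have "\<bar>snd p - \<theta>\<^sub>0\<bar> \<le> \<eta> + exp (-T)" using add_left_mono[OF e] by (rule order_trans)
    with p show "p \<in> cbox (T, \<theta>\<^sub>0 - \<eta> - exp (-T)) (\<tau>, \<theta>\<^sub>0 + \<eta> + exp (-T))"
      by (cases p) (auto simp: K_def abs_le_iff)
  qed
  ultimately have "compact (K s)" for s
    by (meson bounded_cbox bounded_subset compact_eq_bounded_closed)
  then have comp: "compact (K 1 \<union> K (-1))" by blast
  have "(\<tau>, \<theta>) \<in> K 1 \<union> K (-1)" using \<sigma> \<tau> \<theta> bad by (auto simp: K_def)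
  then have ne: "K 1 \<union> K (-1) \<noteq> {}" by blast
  obtain p where p: "p \<in> K 1 \<union> K (-1)" "\<And>q. q \<in> K 1 \<union> K (-1) \<Longrightarrow> fst p \<le> fst q"
    using continuous_attains_inf[OF comp ne, of fst] continuous_on_fst[OF continuous_on_id] by blast
  obtain s where s: "s \<in> {1, -1}" "p \<in> K s" using p(1) by blast
  have "\<bar>a s (fst p) (snd p) - v\<^sub>0\<bar> < \<delta>"
  proof (rule a_bound_until[of "fst p"])
    fix s' t x assume *: "s' \<in> {1, - 1::real}" "T < t" "t < fst p" "\<bar>x - \<theta>\<^sub>0\<bar> \<le> \<eta> + exp (-t)"
    show "\<bar>a s' t x - v\<^sub>0\<bar> \<le> \<delta>"
    proof (rule ccontr)
      assume "\<not> ?thesis"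
      then have "(t, x) \<in> K s'" using * s(2) by (auto simp: K_def)
      then have "fst p \<le> t" using p(2)[of "(t, x)"] *(1) by auto
      then show False using * by simp
    qed
  qed (use s in \<open>auto simp: K_def\<close>)
  then show False using s(2) by (auto simp: K_def)
qed

lemma b_bound:
  assumes "\<sigma> \<in> {1, -1}" "T \<le> \<tau>" "\<bar>\<theta> - \<theta>\<^sub>0\<bar> \<le> \<eta> + exp (-\<tau>)"
  shows "\<bar>b \<sigma> \<tau> \<theta>\<bar> \<le> \<epsilon> * exp (- g * (\<tau> - T))"
  by (rule b_bound_until[of \<tau>, OF _ assms(1,2) order_refl assms(3)])
    (rule less_imp_le, rule a_bound, auto)

lemma leibniz_sum_split:
  fixes A B :: "nat \<Rightarrow> real"
  assumes "k > 0"
  shows "(\<Sum>i=0..k. of_nat (k choose i) * A i * B (k - i)) =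
    A 0 * B k + A k * B 0 + (\<Sum>i\<in>{1..<k}. of_nat (k choose i) * A i * B (k - i))"
proof -
  have "{0..k} = insert 0 (insert k {1..<k})" using assms by auto
  then show ?thesis using assms by simp
qed

definition Rgn :: "(real \<times> real) set" where
  "Rgn = {x. T \<le> fst x \<and> \<bar>snd x - \<theta>\<^sub>0\<bar> \<le> \<eta> + exp (- fst x)}"

text \<open>The k-th derivatives solve the linearised system with sources made of lower derivatives.
  The rate drops from g to g/2, but only once for all k: the difference pays for b times the k-th
  derivative of a, and for the sources.\<close>

lemma higher_deriv_bound:
  "\<exists>C. \<forall>\<sigma>\<in>{1,-1}. \<forall>x\<in>Rgn. \<bar>(ptheta ^^ k) (a \<sigma>) (fst x) (snd x)\<bar> \<le> C \<and>
     \<bar>(ptheta ^^ k) (b \<sigma>) (fst x) (snd x)\<bar> \<le> C * exp (- (g / 2) * (fst x - T))"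
proof (induction k rule: less_induct)
  case (less k)
  define E where "E t = exp (- (g / 2) * (t - T))" for t
  have E: "0 < E t" "t \<ge> T \<Longrightarrow> E t \<le> 1" for t using pos by (auto simp: E_def)
  have bE: "\<bar>b \<sigma> t x\<bar> \<le> \<epsilon> * E t" if "\<sigma> \<in> {1, -1}" "T \<le> t" "\<bar>x - \<theta>\<^sub>0\<bar> \<le> \<eta> + exp (-t)" for \<sigma> t x
  proof -
    have "g * (t - T) \<ge> (g / 2) * (t - T)" using pos that by (intro mult_right_mono) auto
    then have "exp (- g * (t - T)) \<le> E t" unfolding E_def by simp
    then have "\<epsilon> * exp (- g * (t - T)) \<le> \<epsilon> * E t" using pos by (intro mult_left_mono) auto
    then show ?thesis using b_bound[OF that] by linarith
  qed
  show ?case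
  proof (cases "k = 0")
    case True
    have "\<bar>a \<sigma> (fst x) (snd x)\<bar> \<le> \<bar>v\<^sub>0\<bar> + \<delta> + \<epsilon>"
      "\<bar>b \<sigma> (fst x) (snd x)\<bar> \<le> (\<bar>v\<^sub>0\<bar> + \<delta> + \<epsilon>) * E (fst x)" if "\<sigma> \<in> {1, -1}" "x \<in> Rgn" for \<sigma> x
    proof -
      have x: "T \<le> fst x" "\<bar>snd x - \<theta>\<^sub>0\<bar> \<le> \<eta> + exp (- fst x)" using that by (auto simp: Rgn_def)
      show "\<bar>a \<sigma> (fst x) (snd x)\<bar> \<le> \<bar>v\<^sub>0\<bar> + \<delta> + \<epsilon>" using a_bound[OF that(1) x] pos by linarith
      have "\<epsilon> * E (fst x) \<le> (\<bar>v\<^sub>0\<bar> + \<delta> + \<epsilon>) * E (fst x)"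
        using pos E by (intro mult_right_mono) (auto intro: less_imp_le)
      then show "\<bar>b \<sigma> (fst x) (snd x)\<bar> \<le> (\<bar>v\<^sub>0\<bar> + \<delta> + \<epsilon>) * E (fst x)"
        using bE[OF that(1) x] by linarith
    qed
    then show ?thesis unfolding E_def[symmetric] True by (intro exI[of _ "\<bar>v\<^sub>0\<bar> + \<delta> + \<epsilon>"]) auto
  next
    case False
    then have k: "k > 0" by simp
    define y z where "y i \<sigma> = (ptheta ^^ i) (a \<sigma>)" and "z i \<sigma> = (ptheta ^^ i) (b \<sigma>)" for i \<sigma>
    have smy: "smooth_strip UNIV (y i \<sigma>)" and smz: "smooth_strip UNIV (z i \<sigma>)" for i \<sigma>
      unfolding y_def z_def by (intro smooth_strip_ptheta_iter smooth_a smooth_b)+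
    \<comment> \<open>The middle terms of the Leibniz sums. All factors have order below k, so by
      induction R1 is O(\<open>E * E\<close>) and R2 is O(E).\<close>
    define R1 where "R1 \<sigma> t x = (\<Sum>i\<in>{1..<k}. of_nat (k choose i) * z i \<sigma> t x * z (k - i) (- \<sigma>) t x)" for \<sigma> t x
    define R2 where "R2 \<sigma> t x = (\<Sum>i\<in>{1..<k}. of_nat (k choose i) * y i \<sigma> t x * z (k - i) (- \<sigma>) t x)" for \<sigma> t x
    have Dy: "Dchar (- \<sigma>) (y k \<sigma>) t x =
        b \<sigma> t x * z k (- \<sigma>) t x + z k \<sigma> t x * b (- \<sigma>) t x + R1 \<sigma> t x - (y k \<sigma> t x - y k (- \<sigma>) t x) / 2"
      if "\<sigma> \<in> {1, -1}" for \<sigma> t x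
    proof -
      have "Dchar (- \<sigma>) (y k \<sigma>) t x = (ptheta ^^ k) (Dchar (- \<sigma>) (a \<sigma>)) t x"
        unfolding y_def by (rule Dchar_ptheta_iter[OF open_UNIV smooth_a UNIV_I])
      also have "Dchar (- \<sigma>) (a \<sigma>) = (\<lambda>t x. b \<sigma> t x * b (- \<sigma>) t x - 1/2 * (a \<sigma> t x - a (- \<sigma>) t x))"
        by (intro ext) (simp add: a_eq[OF that])
      also have "(ptheta ^^ k) \<dots> t x = (ptheta ^^ k) (\<lambda>t x. b \<sigma> t x * b (- \<sigma>) t x) t x - 1/2 * (y k \<sigma> t x - y k (- \<sigma>) t x)"
        unfolding y_def
        by (subst ptheta_iter_diff[OF open_UNIV] ptheta_iter_cmult[OF open_UNIV, of _ _ _ "\<lambda>_. 1/2"],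
            (intro smooth_strip_intros open_UNIV smooth_a smooth_b UNIV_I)+)+ simp
      also have "(ptheta ^^ k) (\<lambda>t x. b \<sigma> t x * b (- \<sigma>) t x) t x = b \<sigma> t x * z k (- \<sigma>) t x + z k \<sigma> t x * b (- \<sigma>) t x + R1 \<sigma> t x"
        using leibniz_sum_split[OF k, of "\<lambda>i. (ptheta ^^ i) (b \<sigma>) t x" "\<lambda>i. (ptheta ^^ i) (b (- \<sigma>)) t x"]
        unfolding ptheta_iter_mult[OF open_UNIV smooth_b smooth_b UNIV_I] R1_def z_def by simp
      finally show ?thesis by simp
    qed
    have Dz: "Dchar (- \<sigma>) (z k \<sigma>) t x =
        - (a \<sigma> t x * z k (- \<sigma>) t x + y k \<sigma> t x * b (- \<sigma>) t x + R2 \<sigma> t x) - (z k \<sigma> t x - z k (- \<sigma>) t x) / 2"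
      if "\<sigma> \<in> {1, -1}" for \<sigma> t x
    proof -
      have "Dchar (- \<sigma>) (z k \<sigma>) t x = (ptheta ^^ k) (Dchar (- \<sigma>) (b \<sigma>)) t x"
        unfolding z_def by (rule Dchar_ptheta_iter[OF open_UNIV smooth_b UNIV_I])
      also have "Dchar (- \<sigma>) (b \<sigma>) = (\<lambda>t x. (-1) * (a \<sigma> t x * b (- \<sigma>) t x) - 1/2 * (b \<sigma> t x - b (- \<sigma>) t x))"
        by (intro ext) (simp add: b_eq[OF that])
      also have "(ptheta ^^ k) \<dots> t x = (-1) * (ptheta ^^ k) (\<lambda>t x. a \<sigma> t x * b (- \<sigma>) t x) t x - 1/2 * (z k \<sigma> t x - z k (- \<sigma>) t x)"
        unfolding z_def
        by (subst ptheta_iter_diff[OF open_UNIV] ptheta_iter_cmult[OF open_UNIV, of _ _ _ "\<lambda>_. 1/2"]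
              ptheta_iter_cmult[OF open_UNIV, of _ _ _ "\<lambda>_. -1"],
            (intro smooth_strip_intros open_UNIV smooth_a smooth_b UNIV_I)+)+ simp
      also have "(ptheta ^^ k) (\<lambda>t x. a \<sigma> t x * b (- \<sigma>) t x) t x = a \<sigma> t x * z k (- \<sigma>) t x + y k \<sigma> t x * b (- \<sigma>) t x + R2 \<sigma> t x"
        using leibniz_sum_split[OF k, of "\<lambda>i. (ptheta ^^ i) (a \<sigma>) t x" "\<lambda>i. (ptheta ^^ i) (b (- \<sigma>)) t x"]
        unfolding ptheta_iter_mult[OF open_UNIV smooth_a smooth_b UNIV_I] R2_def z_def y_def by simp
      finally show ?thesis by simp
    qed
    have IHz: "\<exists>C. \<forall>x\<in>Rgn. \<bar>z i \<sigma> (fst x) (snd x)\<bar> \<le> C * E (fst x)"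
      and IHy: "\<exists>C. \<forall>x\<in>Rgn. \<bar>y i \<sigma> (fst x) (snd x)\<bar> \<le> C * 1" if "i < k" "\<sigma> \<in> {1, -1}" for i \<sigma>
      using less[OF that(1)] that(2) unfolding y_def z_def E_def by fastforce+
    have "\<exists>C\<ge>0. \<forall>x\<in>Rgn. \<bar>R1 \<sigma> (fst x) (snd x)\<bar> \<le> C * (E (fst x) * E (fst x))" if "\<sigma> \<in> {1, -1}" for \<sigma>
      unfolding R1_def by (rule sum_mult_bound) (use that E(1) in \<open>auto intro!: IHz less_imp_le\<close>)
    moreover have "\<exists>C\<ge>0. \<forall>x\<in>Rgn. \<bar>R2 \<sigma> (fst x) (snd x)\<bar> \<le> C * (1 * E (fst x))" if "\<sigma> \<in> {1, -1}" for \<sigma>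
      unfolding R2_def by (rule sum_mult_bound) (use that E(1) in \<open>auto intro!: IHz IHy[unfolded mult_1_right] less_imp_le\<close>)
    ultimately have "\<forall>\<sigma>\<in>{1, -1}. \<exists>C\<ge>0. \<forall>x\<in>Rgn. \<bar>R1 \<sigma> (fst x) (snd x)\<bar> \<le> C * (E (fst x) * E (fst x))"
      "\<forall>\<sigma>\<in>{1, -1}. \<exists>C\<ge>0. \<forall>x\<in>Rgn. \<bar>R2 \<sigma> (fst x) (snd x)\<bar> \<le> C * (1 * E (fst x))" by blast+
    then obtain c1 c2 where c: "\<And>\<sigma>. \<sigma> \<in> {1, -1} \<Longrightarrow> c1 \<sigma> \<ge> 0" "\<And>\<sigma>. \<sigma> \<in> {1, -1} \<Longrightarrow> c2 \<sigma> \<ge> 0"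
      "\<And>\<sigma> x. \<sigma> \<in> {1, -1} \<Longrightarrow> x \<in> Rgn \<Longrightarrow> \<bar>R1 \<sigma> (fst x) (snd x)\<bar> \<le> c1 \<sigma> * (E (fst x) * E (fst x))"
      "\<And>\<sigma> x. \<sigma> \<in> {1, -1} \<Longrightarrow> x \<in> Rgn \<Longrightarrow> \<bar>R2 \<sigma> (fst x) (snd x)\<bar> \<le> c2 \<sigma> * (1 * E (fst x))" by metis
    define C where "C = c1 1 + c1 (-1) + c2 1 + c2 (-1)"
    have C: "C \<ge> 0" "c1 \<sigma> \<le> C" "c2 \<sigma> \<le> C" if "\<sigma> \<in> {1, -1}" for \<sigma>
      using that c(1)[of 1] c(1)[of "-1"] c(2)[of 1] c(2)[of "-1"] by (auto simp: C_def)
    have R1: "\<bar>R1 \<sigma> t x\<bar> \<le> C * (E t * E t)" and R2: "\<bar>R2 \<sigma> t x\<bar> \<le> C * E t"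
      if "\<sigma> \<in> {1, -1}" "T \<le> t" "\<bar>x - \<theta>\<^sub>0\<bar> \<le> \<eta> + exp (-t)" for \<sigma> t x
    proof -
      have "c1 \<sigma> * (E t * E t) \<le> C * (E t * E t)" "c2 \<sigma> * E t \<le> C * E t"
        using C[OF that(1)] E(1)[of t] by (auto intro!: mult_right_mono)
      then show "\<bar>R1 \<sigma> t x\<bar> \<le> C * (E t * E t)" "\<bar>R2 \<sigma> t x\<bar> \<le> C * E t"
        using c(3)[OF that(1), of "(t, x)"] c(4)[OF that(1), of "(t, x)"] that by (auto simp: Rgn_def)
    qed
    have "\<exists>M. \<forall>x\<in>{\<theta>\<^sub>0 - \<eta> - exp (-T)..\<theta>\<^sub>0 + \<eta> + exp (-T)}. \<bar>f T x\<bar> \<le> M"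
      if "smooth_strip UNIV f" for f
      using compact_imp_bounded[OF compact_continuous_image[OF continuous_on_subset[OF smooth_strip_cont_section(1)[OF that, of T] subset_UNIV]
        compact_Icc[of "\<theta>\<^sub>0 - \<eta> - exp (-T)" "\<theta>\<^sub>0 + \<eta> + exp (-T)"]]]
      unfolding bounded_iff by auto
    then obtain M where M: "\<And>f x. smooth_strip UNIV f \<Longrightarrow> x \<in> {\<theta>\<^sub>0 - \<eta> - exp (-T)..\<theta>\<^sub>0 + \<eta> + exp (-T)} \<Longrightarrow> \<bar>f T x\<bar> \<le> M f"
      by metis
    \<comment> \<open>The first term limits the sources to a quarter of g K, the 1 keeps K positive,
      and the last sum dominates the initial values.\<close>
    define K where "K = 4 * C / g + 1 + (\<bar>M (y k 1)\<bar> + \<bar>M (y k (-1))\<bar> + \<bar>M (z k 1)\<bar> + \<bar>M (z k (-1))\<bar>)"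
    have "4 * C / g \<ge> 0" using C(1)[of 1] pos by simp
    then have K: "K > 0" "4 * C / g \<le> K" unfolding K_def by linarith+
    then have CK: "4 * C \<le> g * K" using pos by (simp add: field_simps)
    define N :: "(real \<times> real \<times> bool) set" where "N = {1, -1} \<times> {1, -1} \<times> UNIV"
    define X where "X = (\<lambda>(\<sigma>, s, w) t x. s * (if w then y k \<sigma> t x else z k \<sigma> t x))"
    \<comment> \<open>The barrier for the derivatives of a rises from K towards 2 K. Its derivative
      \<open>g * K * (E t * E t)\<close> is what absorbs R1 and the products of b with k-th
      derivatives of b.\<close>
    define B where "B = (\<lambda>(\<sigma>::real, s::real, w) t. if w then K * (2 - E t * E t) else K * E t)"
    define B' where "B' = (\<lambda>(\<sigma>::real, s::real, w) t. if w then g * K * (E t * E t) else - (g / 2) * K * E t)"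
    have main: "X i t x \<le> B i t" if i: "i \<in> N" and t: "T \<le> t" and x: "\<bar>x - \<theta>\<^sub>0\<bar> \<le> \<eta> + exp (-t)" for i t x
    proof (rule char_comparison[where X = X and N = N and sg = "\<lambda>i. - fst i" and \<mu> = "1/2"
        and T = T and \<eta> = \<eta> and \<theta>\<^sub>0 = \<theta>\<^sub>0 and ?T2.0 = t and B = B and B' = B'])
      fix j and t x S :: real
      assume j: "j \<in> N" and t: "T < t" and x: "\<bar>x - \<theta>\<^sub>0\<bar> \<le> \<eta> + exp (-t)" and S: "S \<ge> 1"
        and le: "\<And>j. j \<in> N \<Longrightarrow> X j t x \<le> S * B j t"
      obtain \<sigma> s w where js: "j = (\<sigma>, s, w)" "\<sigma> \<in> {1, -1}" "s \<in> {1, -1}" using j unfolding N_def by auto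
      have yS: "\<bar>y k \<sigma> t x\<bar> \<le> S * (K * (2 - E t * E t))" and zS: "\<bar>z k \<sigma> t x\<bar> \<le> S * (K * E t)" if "\<sigma> \<in> {1, -1}" for \<sigma>
        using le[of "(\<sigma>, 1, True)"] le[of "(\<sigma>, -1, True)"] le[of "(\<sigma>, 1, False)"] le[of "(\<sigma>, -1, False)"] that
        by (auto simp: N_def X_def B_def abs_le_iff)
      have m\<sigma>: "- \<sigma> \<in> {1, -1}" using js by auto
      have sle: "s * p \<le> m" if "\<bar>p\<bar> \<le> m" for p m :: real using js(3) that by auto
      note b = bE[OF _ less_imp_le[OF t] x]
      have Et: "0 < E t" "E t \<le> 1" using E t by auto
      have "1 * (g * K) \<le> S * (g * K)" using S pos K by (intro mult_right_mono) auto
      then have CS: "4 * C \<le> S * (g * K)" using CK by linarith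
      show "\<exists>d. char_deriv (- fst j) (X j) t x d \<and> d + 1/2 * X j t x \<le> S * (B' j t + 1/2 * B j t)"
      proof (cases w)
        case True
        let ?d = "s * Dchar (- \<sigma>) (y k \<sigma>) t x"
        have "\<bar>b \<sigma> t x * z k (- \<sigma>) t x\<bar> \<le> (\<epsilon> * E t) * (S * (K * E t))"
          unfolding abs_mult using b[OF js(2)] zS[OF m\<sigma>] by (intro mult_mono) auto
        moreover have "\<bar>z k \<sigma> t x * b (- \<sigma>) t x\<bar> \<le> (S * (K * E t)) * (\<epsilon> * E t)"
          unfolding abs_mult using b[OF m\<sigma>] zS[OF js(2)] by (intro mult_mono) auto
        moreover note R1[OF js(2) less_imp_le[OF t] x] yS[OF m\<sigma>]
        moreover have "\<bar>p + q + r + u / 2\<bar> \<le> P + Q + R + U / 2"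
          if "\<bar>p\<bar> \<le> P" "\<bar>q\<bar> \<le> Q" "\<bar>r\<bar> \<le> R" "\<bar>u\<bar> \<le> U" for p q r u P Q R U :: real
          using that by linarith
        ultimately have "\<bar>b \<sigma> t x * z k (- \<sigma>) t x + z k \<sigma> t x * b (- \<sigma>) t x + R1 \<sigma> t x + y k (- \<sigma>) t x / 2\<bar>
          \<le> (\<epsilon> * E t) * (S * (K * E t)) + (S * (K * E t)) * (\<epsilon> * E t) + C * (E t * E t) + S * (K * (2 - E t * E t)) / 2"
          by blast
        then have "\<bar>b \<sigma> t x * z k (- \<sigma>) t x + z k \<sigma> t x * b (- \<sigma>) t x + R1 \<sigma> t x + y k (- \<sigma>) t x / 2\<bar>
          \<le> (2 * \<epsilon> * S * K + C) * (E t * E t) + S * (K * (2 - E t * E t)) / 2"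
          by (simp add: algebra_simps)
        also have "(2 * \<epsilon> * S * K + C) * (E t * E t) \<le> (S * (g * K)) * (E t * E t)"
        proof (rule mult_right_mono)
          have "\<epsilon> * (S * K) \<le> g / 8 * (S * K)" using eps(2) S K by (intro mult_right_mono) auto
          moreover note CS
          moreover have "0 \<le> S * (g * K)" using S pos K by simp
          ultimately show "2 * \<epsilon> * S * K + C \<le> S * (g * K)" by (simp add: algebra_simps)
        qed (use Et in simp)
        finally have *: "\<bar>b \<sigma> t x * z k (- \<sigma>) t x + z k \<sigma> t x * b (- \<sigma>) t x + R1 \<sigma> t x + y k (- \<sigma>) t x / 2\<bar>
          \<le> S * (g * K * (E t * E t) + 1/2 * (K * (2 - E t * E t)))" by (simp add: field_simps)
        have "?d + 1/2 * (s * y k \<sigma> t x) = s * (b \<sigma> t x * z k (- \<sigma>) t x + z k \<sigma> t x * b (- \<sigma>) t x + R1 \<sigma> t x + y k (- \<sigma>) t x / 2)"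
          unfolding Dy[OF js(2)] by (simp add: field_simps)
        with sle[OF *] have "?d + 1/2 * X j t x \<le> S * (B' j t + 1/2 * B j t)"
          by (simp add: js(1) True X_def B_def B'_def)
        moreover have "char_deriv (- fst j) (X j) t x ?d"
          unfolding js(1) X_def by (simp add: True char_deriv_cmult char_deriv_Dchar smy)
        ultimately show ?thesis by blast
      next
        case False
        let ?d = "s * Dchar (- \<sigma>) (z k \<sigma>) t x"
        have Y: "\<bar>y k \<sigma> t x\<bar> \<le> S * (2 * K)"
        proof -
          have "K * (2 - E t * E t) \<le> K * 2" by (rule mult_left_mono) (use K Et in auto)
          then have "S * (K * (2 - E t * E t)) \<le> S * (K * 2)" by (rule mult_left_mono) (use S in simp)
          then show ?thesis using yS[OF js(2)] by (simp add: mult.commute)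
        qed
        have "\<bar>1/2 - a \<sigma> t x\<bar> \<le> 1/2 - g"
          by (intro half_minus_v less_imp_le a_bound js(2) less_imp_le[OF t] x)
        then have "\<bar>(1/2 - a \<sigma> t x) * z k (- \<sigma>) t x\<bar> \<le> (1/2 - g) * (S * (K * E t))"
          unfolding abs_mult using zS[OF m\<sigma>] by (intro mult_mono) auto
        moreover have "\<bar>y k \<sigma> t x * b (- \<sigma>) t x\<bar> \<le> (S * (2 * K)) * (\<epsilon> * E t)"
          unfolding abs_mult using b[OF m\<sigma>] Y S K by (intro mult_mono) auto
        moreover note R2[OF js(2) less_imp_le[OF t] x]
        ultimately have "\<bar>(1/2 - a \<sigma> t x) * z k (- \<sigma>) t x - y k \<sigma> t x * b (- \<sigma>) t x - R2 \<sigma> t x\<bar>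
          \<le> (1/2 - g) * (S * (K * E t)) + (S * (2 * K)) * (\<epsilon> * E t) + C * E t"
          by linarith
        also have "\<dots> = ((1/2 - g) * (S * K) + 2 * \<epsilon> * S * K + C) * E t" by (simp add: algebra_simps)
        \<comment> \<open>The term with \<epsilon> and the source C take at most g S K / 4 each,
          together exactly the difference between the rates g and g/2.\<close>
        also have "\<dots> \<le> ((1/2 - g / 2) * (S * K)) * E t"
        proof (rule mult_right_mono)
          have "\<epsilon> * (S * K) \<le> g / 8 * (S * K)" using eps(2) S K by (intro mult_right_mono) auto
          moreover note CS
          ultimately show "(1/2 - g) * (S * K) + 2 * \<epsilon> * S * K + C \<le> (1/2 - g / 2) * (S * K)"
            by (simp add: algebra_simps)
        qed (use Et in simp)
        finally have *: "\<bar>(1/2 - a \<sigma> t x) * z k (- \<sigma>) t x - y k \<sigma> t x * b (- \<sigma>) t x - R2 \<sigma> t x\<bar>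
          \<le> S * (- (g / 2) * K * E t + 1/2 * (K * E t))" by (simp add: algebra_simps)
        have "?d + 1/2 * (s * z k \<sigma> t x) = s * ((1/2 - a \<sigma> t x) * z k (- \<sigma>) t x - y k \<sigma> t x * b (- \<sigma>) t x - R2 \<sigma> t x)"
          unfolding Dz[OF js(2)] by (simp add: field_simps)
        with sle[OF *] have "?d + 1/2 * X j t x \<le> S * (B' j t + 1/2 * B j t)"
          by (simp add: js(1) False X_def B_def B'_def)
        moreover have "char_deriv (- fst j) (X j) t x ?d"
          unfolding js(1) X_def by (simp add: False char_deriv_cmult char_deriv_Dchar smz)
        ultimately show ?thesis by blast
      qed
    next
      fix j assume "j \<in> N"
      then show "continuous_on UNIV (\<lambda>p. X j (fst p) (snd p))"
        using smooth_strip_continuous[OF smy[of k "fst j"]] smooth_strip_continuous[OF smz[of k "fst j"]]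
        by (cases "snd (snd j)") (auto simp: X_def case_prod_beta intro!: continuous_on_mult_left)
    next
      fix j and t :: real assume j: "j \<in> N" and t: "T \<le> t"
      have "E t * E t \<le> 1 * 1" using E(1)[of t] E(2)[OF t] by (intro mult_mono) auto
      then have "E t * E t < 2" by simp
      then show "0 < B j t" using K E(1)[of t] by (cases j) (auto simp: B_def)
      show "(B j has_real_derivative B' j t) (at t)"
        by (cases j) (auto simp: B_def B'_def E_def intro!: derivative_eq_intros)
    next
      fix j x assume "j \<in> N" and x: "\<bar>x - \<theta>\<^sub>0\<bar> \<le> \<eta> + exp (-T)"
      then obtain \<sigma> s w where js: "j = (\<sigma>, s, w)" "\<sigma> \<in> {1, -1}" "s \<in> {1, -1}" unfolding N_def by auto
      have "x \<in> {\<theta>\<^sub>0 - \<eta> - exp (-T)..\<theta>\<^sub>0 + \<eta> + exp (-T)}" using x by (auto simp: abs_le_iff)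
      then have "\<bar>y k \<sigma> T x\<bar> \<le> M (y k \<sigma>)" "\<bar>z k \<sigma> T x\<bar> \<le> M (z k \<sigma>)" using M smy smz by blast+
      moreover have "M (y k \<sigma>) \<le> K" "M (z k \<sigma>) \<le> K" using js(2) \<open>4 * C / g \<ge> 0\<close> by (auto simp: K_def)
      moreover have "s * p \<le> m" if "\<bar>p\<bar> \<le> m" for p m :: real using js(3) that by auto
      ultimately have "s * y k \<sigma> T x \<le> K" "s * z k \<sigma> T x \<le> K" by (meson order_trans)+
      then show "X j T x \<le> B j T" by (simp add: js(1) X_def B_def E_def)
    qed (use i t x in \<open>auto simp: N_def\<close>)
    show ?thesis unfolding E_def[symmetric]
    proof (intro exI[of _ "2 * K"] ballI)
      fix \<sigma> :: real and x assume \<sigma>: "\<sigma> \<in> {1, -1}" and x: "x \<in> Rgn"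
      then have x: "T \<le> fst x" "\<bar>snd x - \<theta>\<^sub>0\<bar> \<le> \<eta> + exp (- fst x)" by (auto simp: Rgn_def)
      have "\<bar>y k \<sigma> (fst x) (snd x)\<bar> \<le> K * (2 - E (fst x) * E (fst x))" "\<bar>z k \<sigma> (fst x) (snd x)\<bar> \<le> K * E (fst x)"
        using main[OF _ x, of "(\<sigma>, 1, True)"] main[OF _ x, of "(\<sigma>, -1, True)"]
          main[OF _ x, of "(\<sigma>, 1, False)"] main[OF _ x, of "(\<sigma>, -1, False)"] \<sigma>
        by (auto simp: N_def X_def B_def abs_le_iff)
      moreover have "K * (2 - E (fst x) * E (fst x)) \<le> K * 2" "K * E (fst x) \<le> 2 * K * E (fst x)"
        using K E(1)[of "fst x"] by (auto intro!: mult_left_mono mult_right_mono)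
      ultimately show "\<bar>(ptheta ^^ k) (a \<sigma>) (fst x) (snd x)\<bar> \<le> 2 * K \<and>
          \<bar>(ptheta ^^ k) (b \<sigma>) (fst x) (snd x)\<bar> \<le> 2 * K * E (fst x)"
        unfolding y_def z_def by linarith
    qed
  qed
qed

end

subsection \<open>Functions of exponential order with all spatial derivatives\<close>

lemma smooth_strip_cong:
  assumes "open I" "smooth_strip I F" "\<And>\<tau> \<theta>. \<theta> \<in> I \<Longrightarrow> F \<tau> \<theta> = G \<tau> \<theta>"
  shows "smooth_strip I G"
  using Cinf_on_cong[of "UNIV \<times> I" "\<lambda>x. F (fst x) (snd x)" "\<lambda>x. G (fst x) (snd x)"] assms
  unfolding smooth_strip_def by (auto simp: open_Times)

text \<open>One rate \<beta> serves all orders of derivatives; only the constant depends on the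
  order. Polynomial growth is traded for an arbitrarily small increase of \<beta>, so sums,
  products, \<theta>-derivatives, exponentials and time integrals can all be treated by adding
  rates.\<close>

definition exp_order :: "real set \<Rightarrow> real \<Rightarrow> real \<Rightarrow> (real \<Rightarrow> real \<Rightarrow> real) \<Rightarrow> bool" where
  "exp_order I T \<beta> F \<longleftrightarrow> smooth_strip I F \<and>
    (\<forall>k. \<exists>C. \<forall>x\<in>{T..} \<times> I. \<bar>(ptheta ^^ k) F (fst x) (snd x)\<bar> \<le> C * exp (\<beta> * fst x))"

lemma exp_orderD: "exp_order I T \<beta> F \<Longrightarrow> \<exists>C. \<forall>x\<in>{T..} \<times> I. \<bar>(ptheta ^^ k) F (fst x) (snd x)\<bar> \<le> C * exp (\<beta> * fst x)"
  and exp_order_smooth: "exp_order I T \<beta> F \<Longrightarrow> smooth_strip I F"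
  unfolding exp_order_def by auto

lemma exp_orderD0:
  assumes "exp_order I T \<beta> F"
  obtains C where "C \<ge> 0" "\<And>\<tau> \<theta>. \<tau> \<ge> T \<Longrightarrow> \<theta> \<in> I \<Longrightarrow> \<bar>F \<tau> \<theta>\<bar> \<le> C * exp (\<beta> * \<tau>)"
proof -
  obtain C where C: "\<forall>x\<in>{T..} \<times> I. \<bar>F (fst x) (snd x)\<bar> \<le> C * exp (\<beta> * fst x)"
    using exp_orderD[OF assms, of 0] by auto
  have "\<bar>F \<tau> \<theta>\<bar> \<le> \<bar>C\<bar> * exp (\<beta> * \<tau>)" if "\<tau> \<ge> T" "\<theta> \<in> I" for \<tau> \<theta>
  proof -
    have "\<bar>F \<tau> \<theta>\<bar> \<le> C * exp (\<beta> * \<tau>)" using C that by auto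
    also have "\<dots> \<le> \<bar>C\<bar> * exp (\<beta> * \<tau>)" by (intro mult_right_mono) auto
    finally show ?thesis .
  qed
  then show thesis by (intro that[of "\<bar>C\<bar>"]) auto
qed

lemma exp_order_mono:
  assumes "exp_order I T \<beta> F" "\<beta> \<le> \<beta>'" "T \<ge> 0"
  shows "exp_order I T \<beta>' F"
  unfolding exp_order_def
proof (intro conjI allI)
  fix k
  obtain C where C: "\<forall>x\<in>{T..} \<times> I. \<bar>(ptheta ^^ k) F (fst x) (snd x)\<bar> \<le> C * exp (\<beta> * fst x)"
    using exp_orderD[OF assms(1)] by blast
  have "\<bar>(ptheta ^^ k) F (fst x) (snd x)\<bar> \<le> \<bar>C\<bar> * exp (\<beta>' * fst x)" if x: "x \<in> {T..} \<times> I" for x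
  proof -
    have "\<bar>(ptheta ^^ k) F (fst x) (snd x)\<bar> \<le> C * exp (\<beta> * fst x)" using C x by blast
    also have "\<dots> \<le> \<bar>C\<bar> * exp (\<beta>' * fst x)"
      using assms x by (intro mult_mono) (auto intro!: mult_right_mono)
    finally show ?thesis .
  qed
  then show "\<exists>C. \<forall>x\<in>{T..} \<times> I. \<bar>(ptheta ^^ k) F (fst x) (snd x)\<bar> \<le> C * exp (\<beta>' * fst x)" by blast
qed (use assms exp_order_smooth in blast)

lemma exp_order_cong:
  assumes I: "open I" and F: "exp_order I T \<beta> F" and eq: "\<And>\<tau> \<theta>. \<theta> \<in> I \<Longrightarrow> F \<tau> \<theta> = G \<tau> \<theta>"
  shows "exp_order I T \<beta> G"
  unfolding exp_order_def
proof (intro conjI allI)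
  show "smooth_strip I G" by (rule smooth_strip_cong[OF I exp_order_smooth[OF F] eq])
  fix k
  have *: "(ptheta ^^ k) G (fst x) (snd x) = (ptheta ^^ k) F (fst x) (snd x)" if "x \<in> {T..} \<times> I" for x
    by (rule ptheta_iter_cong[OF I]) (use that eq in auto)
  show "\<exists>C. \<forall>x\<in>{T..} \<times> I. \<bar>(ptheta ^^ k) G (fst x) (snd x)\<bar> \<le> C * exp (\<beta> * fst x)"
    using exp_orderD[OF F, of k] * by auto
qed

lemma exp_order_ptheta: "exp_order I T \<beta> F \<Longrightarrow> exp_order I T \<beta> (ptheta F)"
  unfolding exp_order_def
  by (metis smooth_strip_ptheta funpow_Suc_right o_apply)

lemma exp_order_add:
  assumes I: "open I" and F: "exp_order I T \<beta> F" "exp_order I T \<beta> G"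
  shows "exp_order I T \<beta> (\<lambda>\<tau> \<theta>. F \<tau> \<theta> + G \<tau> \<theta>)"
  unfolding exp_order_def
proof (intro conjI allI)
  note sm = F[THEN exp_order_smooth]
  show "smooth_strip I (\<lambda>\<tau> \<theta>. F \<tau> \<theta> + G \<tau> \<theta>)" by (intro smooth_strip_intros I sm)
  fix k
  obtain C1 where C1: "\<forall>x\<in>{T..} \<times> I. \<bar>(ptheta ^^ k) F (fst x) (snd x)\<bar> \<le> C1 * exp (\<beta> * fst x)"
    using exp_orderD[OF F(1)] by blast
  obtain C2 where C2: "\<forall>x\<in>{T..} \<times> I. \<bar>(ptheta ^^ k) G (fst x) (snd x)\<bar> \<le> C2 * exp (\<beta> * fst x)"
    using exp_orderD[OF F(2)] by blast
  have "\<bar>(ptheta ^^ k) (\<lambda>\<tau> \<theta>. F \<tau> \<theta> + G \<tau> \<theta>) (fst x) (snd x)\<bar> \<le> (C1 + C2) * exp (\<beta> * fst x)"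
    if x: "x \<in> {T..} \<times> I" for x
  proof -
    have "(ptheta ^^ k) (\<lambda>\<tau> \<theta>. F \<tau> \<theta> + G \<tau> \<theta>) (fst x) (snd x) =
        (ptheta ^^ k) F (fst x) (snd x) + (ptheta ^^ k) G (fst x) (snd x)"
      by (rule ptheta_iter_add[OF I sm]) (use x in auto)
    moreover have "\<bar>(ptheta ^^ k) F (fst x) (snd x)\<bar> \<le> C1 * exp (\<beta> * fst x)"
      "\<bar>(ptheta ^^ k) G (fst x) (snd x)\<bar> \<le> C2 * exp (\<beta> * fst x)" using C1 C2 x by blast+
    ultimately show ?thesis by (simp add: algebra_simps)
  qed
  then show "\<exists>C. \<forall>x\<in>{T..} \<times> I. \<bar>(ptheta ^^ k) (\<lambda>\<tau> \<theta>. F \<tau> \<theta> + G \<tau> \<theta>) (fst x) (snd x)\<bar> \<le> C * exp (\<beta> * fst x)"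
    by blast
qed

lemma exp_order_mult:
  assumes I: "open I" and F: "exp_order I T \<beta>1 F" and G: "exp_order I T \<beta>2 G"
  shows "exp_order I T (\<beta>1 + \<beta>2) (\<lambda>\<tau> \<theta>. F \<tau> \<theta> * G \<tau> \<theta>)"
  unfolding exp_order_def
proof (intro conjI allI)
  note sm = F[THEN exp_order_smooth] G[THEN exp_order_smooth]
  show "smooth_strip I (\<lambda>\<tau> \<theta>. F \<tau> \<theta> * G \<tau> \<theta>)" by (intro smooth_strip_intros I sm)
  fix k
  have "\<exists>C\<ge>0. \<forall>x\<in>{T..} \<times> I. \<bar>\<Sum>i\<in>{0..k}. of_nat (k choose i) * (ptheta ^^ i) F (fst x) (snd x) * (ptheta ^^ (k - i)) G (fst x) (snd x)\<bar>
      \<le> C * (exp (\<beta>1 * fst x) * exp (\<beta>2 * fst x))"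
    by (rule sum_mult_bound) (simp_all only: finite_atLeastAtMost exp_ge_zero exp_orderD[OF F] exp_orderD[OF G])
  then obtain C where C: "\<forall>x\<in>{T..} \<times> I. \<bar>\<Sum>i\<in>{0..k}. of_nat (k choose i) * (ptheta ^^ i) F (fst x) (snd x) * (ptheta ^^ (k - i)) G (fst x) (snd x)\<bar>
      \<le> C * (exp (\<beta>1 * fst x) * exp (\<beta>2 * fst x))" by blast
  have "\<bar>(ptheta ^^ k) (\<lambda>\<tau> \<theta>. F \<tau> \<theta> * G \<tau> \<theta>) (fst x) (snd x)\<bar> \<le> C * exp ((\<beta>1 + \<beta>2) * fst x)"
    if x: "x \<in> {T..} \<times> I" for x
  proof -
    have "snd x \<in> I" using x by auto
    then show ?thesis using C x unfolding ptheta_iter_mult[OF I sm \<open>snd x \<in> I\<close>] distrib_right exp_add by blast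
  qed
  then show "\<exists>C. \<forall>x\<in>{T..} \<times> I. \<bar>(ptheta ^^ k) (\<lambda>\<tau> \<theta>. F \<tau> \<theta> * G \<tau> \<theta>) (fst x) (snd x)\<bar> \<le> C * exp ((\<beta>1 + \<beta>2) * fst x)"
    by blast
qed

lemma exp_order_time:
  assumes I: "open I" and sm: "smooth_strip I (\<lambda>\<tau> \<theta>. c \<tau>)" and c: "\<And>\<tau>. \<tau> \<ge> T \<Longrightarrow> \<bar>c \<tau>\<bar> \<le> C * exp (\<beta> * \<tau>)"
  shows "exp_order I T \<beta> (\<lambda>\<tau> \<theta>. c \<tau>)"
  unfolding exp_order_def
proof (intro conjI allI sm)
  fix k
  have z: "(ptheta ^^ Suc k) (\<lambda>\<tau> \<theta>. c \<tau>) = (\<lambda>\<tau> \<theta>. 0)" for k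
    by (induction k) (auto simp: ptheta_def fun_eq_iff)
  show "\<exists>C. \<forall>x\<in>{T..} \<times> I. \<bar>(ptheta ^^ k) (\<lambda>\<tau> \<theta>. c \<tau>) (fst x) (snd x)\<bar> \<le> C * exp (\<beta> * fst x)"
  proof (cases k)
    case 0
    then show ?thesis using c by (intro exI[of _ C]) auto
  next
    case (Suc n)
    show ?thesis unfolding Suc z by (intro exI[of _ 0]) auto
  qed
qed

lemma exp_order_const: "open I \<Longrightarrow> exp_order I T 0 (\<lambda>\<tau> \<theta>. c)"
  by (rule exp_order_time[where C = "\<bar>c\<bar>"]) (auto intro: smooth_strip_const)

lemma exp_order_exp_time: "open I \<Longrightarrow> exp_order I T c (\<lambda>\<tau> \<theta>. exp (c * \<tau>))"
  by (rule exp_order_time[where C = 1]) (auto intro!: smooth_strip_intros)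

lemma exp_order_cmult:
  assumes "open I" "exp_order I T \<beta> F"
  shows "exp_order I T \<beta> (\<lambda>\<tau> \<theta>. c * F \<tau> \<theta>)"
  using exp_order_mult[OF assms(1) exp_order_const[OF assms(1)] assms(2), of c] by simp

lemma exp_order_diff:
  assumes I: "open I" and F: "exp_order I T \<beta> F" "exp_order I T \<beta> G"
  shows "exp_order I T \<beta> (\<lambda>\<tau> \<theta>. F \<tau> \<theta> - G \<tau> \<theta>)"
  using exp_order_add[OF I F(1) exp_order_cmult[OF I F(2), of "-1"]] by simp

text \<open>Comparison with the primitive \<open>C / \<beta> * exp (\<beta> * t)\<close>. Negative
  \<beta> serves convergence to a limit, positive \<beta> growth from initial data.\<close>

lemma exp_decay_increment:
  assumes I: "open I" and F: "smooth_strip I F" and "\<beta> \<noteq> 0"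
    and C: "\<forall>x\<in>{T..} \<times> I. \<bar>(ptheta ^^ k) (ptau F) (fst x) (snd x)\<bar> \<le> C * exp (\<beta> * fst x)"
    and "T \<le> s" "s \<le> t" "\<theta> \<in> I"
  shows "\<bar>(ptheta ^^ k) F t \<theta> - (ptheta ^^ k) F s \<theta>\<bar> \<le> C / \<beta> * (exp (\<beta> * t) - exp (\<beta> * s))"
proof (cases "s = t")
  case False
  let ?f = "\<lambda>s. (ptheta ^^ k) F s \<theta>"
  have d: "(?f has_real_derivative (ptheta ^^ k) (ptau F) u \<theta>) (at u)" for u
    using has_ptau[OF smooth_strip_ptheta_iter[OF F] assms(7)] ptau_ptheta_iter_commute[OF I F assms(7)] by metis
  have "norm (?f t - ?f s) \<le> C / \<beta> * exp (\<beta> * t) - C / \<beta> * exp (\<beta> * s)"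
  proof (rule differentiable_bound_general)
    show "s < t" using False assms by simp
    show "continuous_on {s..t} ?f" using d by (intro continuous_at_imp_continuous_on ballI DERIV_isCont)
    show "continuous_on {s..t} (\<lambda>u. C / \<beta> * exp (\<beta> * u))" by (intro continuous_intros)
    fix u assume u: "s < u" "u < t"
    show "(?f has_vector_derivative (ptheta ^^ k) (ptau F) u \<theta>) (at u)"
      using d has_real_derivative_iff_has_vector_derivative by blast
    show "((\<lambda>u. C / \<beta> * exp (\<beta> * u)) has_vector_derivative C * exp (\<beta> * u)) (at u)"
      unfolding has_real_derivative_iff_has_vector_derivative[symmetric]
      using assms(3) by (auto intro!: derivative_eq_intros)
    show "norm ((ptheta ^^ k) (ptau F) u \<theta>) \<le> C * exp (\<beta> * u)"
      using C[rule_format, of "(u, \<theta>)"] u assms by simp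
  qed
  then show ?thesis by (simp add: algebra_simps)
qed simp

text \<open>The class for the coinduction consists of all multiples c L k, since a direction
  contributes only a scalar factor: itself on the line, its second component in the plane.\<close>

lemma derivative_tower:
  fixes L :: "nat \<Rightarrow> real \<Rightarrow> real"
  assumes I: "open I" and d: "\<And>k x. x \<in> I \<Longrightarrow> (L k has_real_derivative L (Suc k) x) (at x)"
  shows Cinf_on_derivative_tower: "Cinf_on I (L 0)"
    and smooth_strip_derivative_tower: "smooth_strip I (\<lambda>\<tau>. L 0)"
    and ptheta_derivative_tower: "\<theta> \<in> I \<Longrightarrow> (ptheta ^^ k) (\<lambda>\<tau>. L 0) \<tau> \<theta> = L k \<theta>"
proof -
  have cont: "continuous_on I (L k)" for k
    using d by (intro continuous_at_imp_continuous_on ballI DERIV_isCont) auto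
  have der: "((\<lambda>t. c * L k (y + t * w)) has_vector_derivative c * w * L (Suc k) y) (at 0)"
    if "y \<in> I" for c k y w
  proof -
    have 1: "((\<lambda>t. y + t * w) has_real_derivative w) (at 0)" by (auto intro!: derivative_eq_intros)
    have "(L k has_real_derivative L (Suc k) y) (at (y + 0 * w))" using d[OF that] by simp
    from DERIV_cmult[OF DERIV_chain2[OF this 1], of c] show ?thesis
      unfolding has_real_derivative_iff_has_vector_derivative by (simp add: mult_ac)
  qed
  show "Cinf_on I (L 0)"
  proof (rule Cinf_on_coinduct[OF I, where F = "{f. \<exists>c k. f = (\<lambda>x. c * L k x)}"])
    have "L 0 = (\<lambda>x. 1 * L 0 x)" by simp
    then show "L 0 \<in> {f. \<exists>c k. f = (\<lambda>x. c * L k x)}" by blast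
    fix f v assume "f \<in> {f. \<exists>c k. f = (\<lambda>x. c * L k x)}"
    then obtain c k where f: "f = (\<lambda>x. c * L k x)" by blast
    show "continuous_on I f" unfolding f by (intro continuous_intros cont)
    show "\<exists>h\<in>{f. \<exists>c k. f = (\<lambda>x. c * L k x)}. \<forall>x\<in>I. ((\<lambda>t. f (x + t *\<^sub>R v)) has_vector_derivative h x) (at 0)"
      using der unfolding f by (intro bexI[of _ "\<lambda>x. c * v * L (Suc k) x"]) auto
  qed
  show "smooth_strip I (\<lambda>\<tau>. L 0)" unfolding smooth_strip_def
  proof (rule Cinf_on_coinduct[where F = "{f. \<exists>c k. f = (\<lambda>x. c * L k (snd x))}"])
    show "open (UNIV \<times> I)" by (intro open_Times I open_UNIV)
    have "(\<lambda>x. L 0 (snd x)) = (\<lambda>x. 1 * L 0 (snd x))" by simp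
    then show "(\<lambda>x. L 0 (snd x)) \<in> {f. \<exists>c k. f = (\<lambda>x. c * L k (snd x))}" by blast
    fix f :: "real \<times> real \<Rightarrow> real" and v assume "f \<in> {f. \<exists>c k. f = (\<lambda>x. c * L k (snd x))}"
    then obtain c k where f: "f = (\<lambda>x. c * L k (snd x))" by blast
    show "continuous_on (UNIV \<times> I) f" unfolding f
      by (intro continuous_on_mult_left continuous_on_compose2[OF cont] continuous_on_snd continuous_on_id) auto
    show "\<exists>h\<in>{f. \<exists>c k. f = (\<lambda>x. c * L k (snd x))}.
        \<forall>x\<in>UNIV \<times> I. ((\<lambda>t. f (x + t *\<^sub>R v)) has_vector_derivative h x) (at 0)"
      using der unfolding f by (intro bexI[of _ "\<lambda>x. c * snd v * L (Suc k) (snd x)"]) auto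
  qed
  show "\<theta> \<in> I \<Longrightarrow> (ptheta ^^ k) (\<lambda>\<tau>. L 0) \<tau> \<theta> = L k \<theta>"
  proof (induction k arbitrary: \<theta>)
    case (Suc k)
    have "ptheta ((ptheta ^^ k) (\<lambda>\<tau>. L 0)) \<tau> \<theta> = ptheta (\<lambda>\<tau>. L k) \<tau> \<theta>"
      by (rule ptheta_cong[OF I]) (use Suc in auto)
    also have "\<dots> = L (Suc k) \<theta>" using d[OF Suc.prems] by (intro pthetaI)
    finally show ?case by simp
  qed simp
qed

text \<open>All \<theta>-derivatives converge uniformly on I because their time derivatives are
  integrable, so the limit can be differentiated term by term; this is where convexity of I enters.
  The remainder is the tail of the integral and decays at the same rate.\<close>

lemma exp_order_limit:
  assumes I: "open I" "convex I" and F: "smooth_strip I F" and D: "exp_order I T (-\<beta>) (ptau F)" and \<beta>: "\<beta> > 0"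
  obtains L where "Cinf_on I L" "smooth_strip I (\<lambda>\<tau>. L)" "exp_order I T (-\<beta>) (\<lambda>\<tau> \<theta>. F \<tau> \<theta> - L \<theta>)"
proof -
  have "\<forall>k. \<exists>C. \<forall>x\<in>{T..} \<times> I. \<bar>(ptheta ^^ k) (ptau F) (fst x) (snd x)\<bar> \<le> C * exp (- \<beta> * fst x)"
    using exp_orderD[OF D] by blast
  then obtain C0 where C0: "\<And>k x. x \<in> {T..} \<times> I \<Longrightarrow> \<bar>(ptheta ^^ k) (ptau F) (fst x) (snd x)\<bar> \<le> C0 k * exp (- \<beta> * fst x)"
    by metis
  define C where "C k = \<bar>C0 k\<bar> / \<beta>" for k
  have C: "C k \<ge> 0" for k using \<beta> by (simp add: C_def)
  define f where "f k t \<theta> = (ptheta ^^ k) F t \<theta>" for k t \<theta>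
  have inc: "\<bar>f k t \<theta> - f k s \<theta>\<bar> \<le> C k * exp (- \<beta> * s)" if "T \<le> s" "s \<le> t" "\<theta> \<in> I" for k s t \<theta>
  proof -
    have "\<forall>x\<in>{T..} \<times> I. \<bar>(ptheta ^^ k) (ptau F) (fst x) (snd x)\<bar> \<le> \<bar>C0 k\<bar> * exp (- \<beta> * fst x)"
      using C0 by (meson abs_ge_self exp_ge_zero mult_right_mono order_trans)
    from exp_decay_increment[OF I(1) F _ this that] \<beta>
    have "\<bar>f k t \<theta> - f k s \<theta>\<bar> \<le> C k * (exp (- \<beta> * s) - exp (- \<beta> * t))"
      by (simp add: f_def C_def algebra_simps diff_divide_distrib)
    also have "\<dots> \<le> C k * exp (- \<beta> * s)" using C by (intro mult_left_mono) auto
    finally show ?thesis .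
  qed
  have to0: "(\<lambda>n. K * exp (- \<beta> * real n)) \<longlonglongrightarrow> 0" for K
  proof -
    have "(\<lambda>n. exp (- \<beta>) ^ n) \<longlonglongrightarrow> 0" using \<beta> by (intro LIMSEQ_power_zero) auto
    then have "(\<lambda>n. exp (- \<beta> * real n)) \<longlonglongrightarrow> 0" by (simp add: exp_of_nat_mult[symmetric] mult.commute)
    then show ?thesis by (rule tendsto_mult_right_zero)
  qed
  \<comment> \<open>Integer times are enough for the limit, as \<open>inc\<close> controls the
    increments between all real times.\<close>
  define L where "L k \<theta> = lim (\<lambda>n. f k (real n) \<theta>)" for k \<theta>
  have L: "(\<lambda>n. f k (real n) \<theta>) \<longlonglongrightarrow> L k \<theta>" if "\<theta> \<in> I" for k \<theta>
  proof -
    have "Cauchy (\<lambda>n. f k (real n) \<theta>)"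
    proof (rule CauchyI)
      fix e :: real assume "e > 0"
      then have "\<forall>\<^sub>F n in sequentially. \<bar>C k * exp (- \<beta> * real n)\<bar> < e / 2"
        using tendstoD[OF to0[of "C k"], of "e / 2"] by (simp add: dist_real_def)
      moreover have "\<forall>\<^sub>F n in sequentially. T \<le> real n" using real_arch_simple[of T]
        by (meson eventually_sequentially of_nat_mono order_trans)
      ultimately have "\<forall>\<^sub>F n in sequentially. T \<le> real n \<and> \<bar>C k * exp (- \<beta> * real n)\<bar> < e / 2"
        by eventually_elim auto
      then obtain N where N: "T \<le> real N" "\<bar>C k * exp (- \<beta> * real N)\<bar> < e / 2"
        unfolding eventually_sequentially by blast
      have "norm (f k (real m) \<theta> - f k (real n) \<theta>) < e" if "m \<ge> N" "n \<ge> N" for m n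
        using inc[OF N(1) _ \<open>\<theta> \<in> I\<close>, of "real m" k] inc[OF N(1) _ \<open>\<theta> \<in> I\<close>, of "real n" k] that N(2) by simp
      then show "\<exists>M. \<forall>m\<ge>M. \<forall>n\<ge>M. norm (f k (real m) \<theta> - f k (real n) \<theta>) < e" by blast
    qed
    then show ?thesis unfolding L_def by (simp add: Cauchy_convergent convergent_LIMSEQ_iff[symmetric])
  qed
  have bd: "\<bar>f k t \<theta> - L k \<theta>\<bar> \<le> C k * exp (- \<beta> * t)" if t: "T \<le> t" and \<theta>: "\<theta> \<in> I" for k t \<theta>
  proof (rule tendsto_upperbound)
    show "(\<lambda>n. \<bar>f k t \<theta> - f k (real n) \<theta>\<bar>) \<longlonglongrightarrow> \<bar>f k t \<theta> - L k \<theta>\<bar>"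
      by (intro tendsto_intros L \<theta>)
    have "\<forall>\<^sub>F n in sequentially. t \<le> real n" using real_arch_simple[of t]
      by (meson eventually_sequentially of_nat_mono order_trans)
    then show "\<forall>\<^sub>F n in sequentially. \<bar>f k t \<theta> - f k (real n) \<theta>\<bar> \<le> C k * exp (- \<beta> * t)"
      by eventually_elim (subst abs_minus_commute, erule inc[OF t _ \<theta>])
  qed simp
  have der: "(L k has_real_derivative L (Suc k) x) (at x)" if x: "x \<in> I" for k x
  proof -
    have "\<exists>g. \<forall>x\<in>I. (\<lambda>n. f k (real n) x) \<longlonglongrightarrow> g x \<and> (g has_derivative (\<lambda>h. L (Suc k) x * h)) (at x within I)"
    proof (rule has_derivative_sequence[OF I(2)])
      fix n and x assume "x \<in> I"
      show "(f k (real n) has_derivative (\<lambda>h. f (Suc k) (real n) x * h)) (at x within I)"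
        using has_ptheta[OF smooth_strip_ptheta_iter[OF F, of k] \<open>x \<in> I\<close>, of "real n"]
        by (auto simp: f_def[abs_def] has_field_derivative_def intro: has_derivative_at_withinI)
    next
      fix e :: real assume "e > 0"
      then have "\<forall>\<^sub>F n in sequentially. \<bar>C (Suc k) * exp (- \<beta> * real n)\<bar> < e"
        using tendstoD[OF to0[of "C (Suc k)"], of e] by (simp add: dist_real_def)
      moreover have "\<forall>\<^sub>F n in sequentially. T \<le> real n" using real_arch_simple[of T]
        by (meson eventually_sequentially of_nat_mono order_trans)
      ultimately show "\<forall>\<^sub>F n in sequentially. \<forall>x\<in>I. \<forall>h. norm (f (Suc k) (real n) x * h - L (Suc k) x * h) \<le> e * norm h"
      proof eventually_elim
        case (elim n)
        show ?case
        proof (intro ballI allI)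
          fix x h assume "x \<in> I"
          have "\<bar>f (Suc k) (real n) x - L (Suc k) x\<bar> \<le> e" using bd[OF elim(2) \<open>x \<in> I\<close>, of "Suc k"] elim(1) by linarith
          then have "\<bar>f (Suc k) (real n) x - L (Suc k) x\<bar> * \<bar>h\<bar> \<le> e * \<bar>h\<bar>" by (rule mult_right_mono) simp
          then show "norm (f (Suc k) (real n) x * h - L (Suc k) x * h) \<le> e * norm h"
            by (simp add: abs_mult left_diff_distrib[symmetric])
        qed
      qed
    next
      show "x \<in> I" "(\<lambda>n. f k (real n) x) \<longlonglongrightarrow> L k x" using x L by auto
    qed
    then obtain g where g: "\<And>x. x \<in> I \<Longrightarrow> (\<lambda>n. f k (real n) x) \<longlonglongrightarrow> g x"
      "\<And>x. x \<in> I \<Longrightarrow> (g has_derivative (\<lambda>h. L (Suc k) x * h)) (at x within I)" by blast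
    have "g y = L k y" if "y \<in> I" for y by (rule LIMSEQ_unique[OF g(1)[OF that] L[OF that]])
    moreover have "(g has_real_derivative L (Suc k) x) (at x)"
      using g(2)[OF x] unfolding at_within_open[OF x I(1)] has_field_derivative_def .
    ultimately show ?thesis
      using has_field_derivative_transform_within_open[of g _ x I "L k"] x I(1) by blast
  qed
  have tow: "Cinf_on I (L 0)" "smooth_strip I (\<lambda>\<tau>. L 0)"
    "\<And>\<theta> k \<tau>. \<theta> \<in> I \<Longrightarrow> (ptheta ^^ k) (\<lambda>\<tau>. L 0) \<tau> \<theta> = L k \<theta>"
    using derivative_tower[of I L] I(1) der by blast+
  show thesis
  proof
    show "Cinf_on I (L 0)" by (rule tow(1))
    show sm: "smooth_strip I (\<lambda>\<tau>. L 0)" by (rule tow(2))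
    show "exp_order I T (- \<beta>) (\<lambda>\<tau> \<theta>. F \<tau> \<theta> - L 0 \<theta>)"
      unfolding exp_order_def
    proof (intro conjI allI)
      show "smooth_strip I (\<lambda>\<tau> \<theta>. F \<tau> \<theta> - L 0 \<theta>)" by (intro smooth_strip_diff I F sm)
      fix k
      have "\<bar>(ptheta ^^ k) (\<lambda>\<tau> \<theta>. F \<tau> \<theta> - L 0 \<theta>) (fst x) (snd x)\<bar> \<le> C k * exp (- \<beta> * fst x)" if x: "x \<in> {T..} \<times> I" for x
      proof -
        have \<theta>: "snd x \<in> I" and t: "T \<le> fst x" using x by auto
        show ?thesis unfolding ptheta_iter_diff[OF I(1) F sm \<theta>] tow(3)[OF \<theta>]
          using bd[OF t \<theta>, of k] by (simp add: f_def)
      qed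
      then show "\<exists>C. \<forall>x\<in>{T..} \<times> I. \<bar>(ptheta ^^ k) (\<lambda>\<tau> \<theta>. F \<tau> \<theta> - L 0 \<theta>) (fst x) (snd x)\<bar> \<le> C * exp (- \<beta> * fst x)"
        by blast
    qed
  qed
qed

text \<open>Smoothness beyond the closure of the bounded interval makes the data at time T bounded
  on I. With arbitrarily small \<beta> this converts bounded time derivatives into subexponential
  growth.\<close>

lemma exp_order_growth:
  assumes I: "open I" "I \<subseteq> {lo..hi}" and F: "smooth_strip UNIV F" and D: "exp_order I T \<beta> (ptau F)" and \<beta>: "\<beta> > 0"
  shows "exp_order I T \<beta> F"
  unfolding exp_order_def
proof (intro conjI allI)
  show FI: "smooth_strip I F" using smooth_strip_subset[OF F] by blast
  fix k
  obtain C where C: "\<forall>x\<in>{T..} \<times> I. \<bar>(ptheta ^^ k) (ptau F) (fst x) (snd x)\<bar> \<le> C * exp (\<beta> * fst x)"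
    using exp_orderD[OF D] by blast
  obtain M where M: "\<And>x. x \<in> {lo..hi} \<Longrightarrow> \<bar>(ptheta ^^ k) F T x\<bar> \<le> M"
    using compact_imp_bounded[OF compact_continuous_image[OF continuous_on_subset[OF
        smooth_strip_cont_section(1)[OF smooth_strip_ptheta_iter[OF F, of k], of T] subset_UNIV]
        compact_Icc[of lo hi]]]
    unfolding bounded_iff by (auto simp del: atLeastAtMost_iff)
  have "\<bar>(ptheta ^^ k) F (fst x) (snd x)\<bar> \<le> (\<bar>M\<bar> * exp (- \<beta> * T) + \<bar>C\<bar> / \<beta>) * exp (\<beta> * fst x)"
    if x: "x \<in> {T..} \<times> I" for x
  proof -
    have \<theta>: "snd x \<in> I" and t: "T \<le> fst x" using x by auto
    have "\<forall>x\<in>{T..} \<times> I. \<bar>(ptheta ^^ k) (ptau F) (fst x) (snd x)\<bar> \<le> \<bar>C\<bar> * exp (\<beta> * fst x)"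
      using C by (meson abs_ge_self exp_ge_zero mult_right_mono order_trans)
    from exp_decay_increment[OF I(1) FI _ this order_refl t \<theta>] \<beta>
    have "\<bar>(ptheta ^^ k) F (fst x) (snd x) - (ptheta ^^ k) F T (snd x)\<bar> \<le> \<bar>C\<bar> / \<beta> * (exp (\<beta> * fst x) - exp (\<beta> * T))"
      by simp
    also have "\<dots> \<le> \<bar>C\<bar> / \<beta> * exp (\<beta> * fst x)" using \<beta> by (intro mult_left_mono) auto
    finally have 1: "\<bar>(ptheta ^^ k) F (fst x) (snd x) - (ptheta ^^ k) F T (snd x)\<bar> \<le> \<bar>C\<bar> / \<beta> * exp (\<beta> * fst x)" .
    have "\<bar>(ptheta ^^ k) F T (snd x)\<bar> \<le> \<bar>M\<bar> * 1" using M[of "snd x"] \<theta> I(2) by force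
    also have "\<dots> \<le> \<bar>M\<bar> * (exp (- \<beta> * T) * exp (\<beta> * fst x))"
      using t \<beta> by (intro mult_left_mono) (auto simp flip: exp_add)
    finally show ?thesis using 1 by (simp add: algebra_simps)
  qed
  then show "\<exists>C. \<forall>x\<in>{T..} \<times> I. \<bar>(ptheta ^^ k) F (fst x) (snd x)\<bar> \<le> C * exp (\<beta> * fst x)" by blast
qed

text \<open>For G = exp F the identity \<open>ptheta G = ptheta F * G\<close> charges each
  \<theta>-derivative with one factor of subexponential growth, paid for by halving \<delta> in the
  induction on k. An upper bound for F suffices, as negative F only makes G smaller.\<close>

lemma exp_order_exp:
  assumes I: "open I" and F: "smooth_strip I F" and up: "\<And>\<tau> \<theta>. T \<le> \<tau> \<Longrightarrow> \<theta> \<in> I \<Longrightarrow> F \<tau> \<theta> \<le> \<beta> * \<tau> + c"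
    and D: "\<And>\<delta>. \<delta> > 0 \<Longrightarrow> exp_order I T \<delta> (ptheta F)" and T: "T \<ge> 0" and \<delta>: "\<delta> > 0"
  shows "exp_order I T (\<beta> + \<delta>) (\<lambda>\<tau> \<theta>. exp (F \<tau> \<theta>))"
proof -
  define G where "G \<tau> \<theta> = exp (F \<tau> \<theta>)" for \<tau> \<theta>
  have G: "smooth_strip I G" unfolding G_def by (intro smooth_strip_exp I F)
  have DG: "ptheta G \<tau> \<theta> = ptheta F \<tau> \<theta> * G \<tau> \<theta>" if "\<theta> \<in> I" for \<tau> \<theta>
    unfolding G_def using DERIV_chain2[OF DERIV_exp has_ptheta[OF F that]] by (intro pthetaI) (simp add: mult.commute)
  have "\<exists>C. \<forall>x\<in>{T..} \<times> I. \<bar>(ptheta ^^ k) G (fst x) (snd x)\<bar> \<le> C * exp ((\<beta> + \<delta>) * fst x)" if "\<delta> > 0" for k \<delta>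
    using that
  proof (induction k arbitrary: \<delta> rule: less_induct)
    case (less k)
    show ?case
    proof (cases k)
      case 0
      have "\<bar>G (fst x) (snd x)\<bar> \<le> exp c * exp ((\<beta> + \<delta>) * fst x)" if x: "x \<in> {T..} \<times> I" for x
      proof -
        have x: "T \<le> fst x" "snd x \<in> I" using x by auto
        have "0 \<le> \<delta> * fst x" using x T less.prems by simp
        then have "F (fst x) (snd x) \<le> c + (\<beta> + \<delta>) * fst x" using up[OF x] by (simp add: algebra_simps)
        then show ?thesis by (simp add: G_def flip: exp_add)
      qed
      then show ?thesis unfolding 0 funpow_0 by blast
    next
      case (Suc m)
      have "\<exists>C\<ge>0. \<forall>x\<in>{T..} \<times> I. \<bar>\<Sum>i\<in>{0..m}. of_nat (m choose i) * (ptheta ^^ i) (ptheta F) (fst x) (snd x) * (ptheta ^^ (m - i)) G (fst x) (snd x)\<bar>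
          \<le> C * (exp (\<delta> / 2 * fst x) * exp ((\<beta> + \<delta> / 2) * fst x))"
      proof (rule sum_mult_bound)
        fix i assume "i \<in> {0..m}"
        show "\<exists>C. \<forall>x\<in>{T..} \<times> I. \<bar>(ptheta ^^ i) (ptheta F) (fst x) (snd x)\<bar> \<le> C * exp (\<delta> / 2 * fst x)"
          using less.prems by (intro exp_orderD[OF D]) simp
        show "\<exists>C. \<forall>x\<in>{T..} \<times> I. \<bar>(ptheta ^^ (m - i)) G (fst x) (snd x)\<bar> \<le> C * exp ((\<beta> + \<delta> / 2) * fst x)"
          using less.prems Suc by (intro less.IH) auto
      qed simp_all
      then obtain C where C: "\<And>x. x\<in>{T..} \<times> I \<Longrightarrow> \<bar>\<Sum>i\<in>{0..m}. of_nat (m choose i) * (ptheta ^^ i) (ptheta F) (fst x) (snd x) * (ptheta ^^ (m - i)) G (fst x) (snd x)\<bar>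
          \<le> C * (exp (\<delta> / 2 * fst x) * exp ((\<beta> + \<delta> / 2) * fst x))" by blast
      have "\<bar>(ptheta ^^ k) G (fst x) (snd x)\<bar> \<le> C * exp ((\<beta> + \<delta>) * fst x)" if x: "x \<in> {T..} \<times> I" for x
      proof -
        have \<theta>: "snd x \<in> I" using x by auto
        have "(ptheta ^^ k) G (fst x) (snd x) = (ptheta ^^ m) (ptheta G) (fst x) (snd x)"
          unfolding Suc by (simp add: funpow_swap1)
        also have "\<dots> = (ptheta ^^ m) (\<lambda>\<tau> \<theta>. ptheta F \<tau> \<theta> * G \<tau> \<theta>) (fst x) (snd x)"
          by (rule ptheta_iter_cong[OF I _ \<theta>]) (rule DG)
        finally have "\<bar>(ptheta ^^ k) G (fst x) (snd x)\<bar> \<le> C * (exp (\<delta> / 2 * fst x) * exp ((\<beta> + \<delta> / 2) * fst x))"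
          using C[OF x] unfolding ptheta_iter_mult[OF I smooth_strip_ptheta[OF F] G \<theta>] by simp
        also have "exp (\<delta> / 2 * fst x) * exp ((\<beta> + \<delta> / 2) * fst x) = exp ((\<beta> + \<delta>) * fst x)"
          by (simp add: algebra_simps flip: exp_add)
        finally show ?thesis .
      qed
      then show ?thesis by blast
    qed
  qed
  then show ?thesis unfolding exp_order_def using G \<delta> unfolding G_def by blast
qed

lemma Ck_norm_exp_order:
  assumes "exp_order I T \<beta> F"
  shows "\<exists>C. \<forall>\<tau>\<ge>T. Ck_norm k I F \<tau> \<le> ereal (C * exp (\<beta> * \<tau>))"
proof -
  obtain C where C: "\<And>j x. x \<in> {T..} \<times> I \<Longrightarrow> \<bar>(ptheta ^^ j) F (fst x) (snd x)\<bar> \<le> C j * exp (\<beta> * fst x)"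
    using exp_orderD[OF assms] by metis
  have "Ck_norm k I F \<tau> \<le> ereal ((\<Sum>j\<le>k. C j) * exp (\<beta> * \<tau>))" if "\<tau> \<ge> T" for \<tau>
  proof -
    have "Ck_norm k I F \<tau> \<le> (\<Sum>j\<le>k. ereal (C j * exp (\<beta> * \<tau>)))"
      unfolding Ck_norm_def
    proof (intro sum_mono SUP_least)
      fix j \<theta> assume "\<theta> \<in> I"
      then show "ereal \<bar>(deriv ^^ j) (F \<tau>) \<theta>\<bar> \<le> ereal (C j * exp (\<beta> * \<tau>))"
        using C[of "(\<tau>, \<theta>)" j] that by (simp add: ptheta_iter_eq_deriv)
    qed
    then show ?thesis by (simp add: sum_distrib_right)
  qed
  then show ?thesis by blast
qed

lemma exp_order_tendsto_0:
  assumes "exp_order I T (-\<beta>) F" "\<beta> > 0" "\<theta> \<in> I"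
  shows "((\<lambda>\<tau>. F \<tau> \<theta>) \<longlongrightarrow> 0) at_top"
proof -
  obtain C where C: "C \<ge> 0" "\<And>\<tau> \<theta>. \<tau> \<ge> T \<Longrightarrow> \<theta> \<in> I \<Longrightarrow> \<bar>F \<tau> \<theta>\<bar> \<le> C * exp (- \<beta> * \<tau>)"
    using exp_orderD0[OF assms(1)] by blast
  have "filterlim (\<lambda>\<tau>. - \<beta> * \<tau>) at_bot at_top"
    using assms(2) by (intro filterlim_tendsto_neg_mult_at_bot[OF tendsto_const _ filterlim_ident]) auto
  then have "((\<lambda>\<tau>. C * exp (- \<beta> * \<tau>)) \<longlongrightarrow> C * 0) at_top"
    by (intro tendsto_intros filterlim_compose[OF exp_at_bot])
  then have "((\<lambda>\<tau>. C * exp (- \<beta> * \<tau>)) \<longlongrightarrow> 0) at_top" by simp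
  then show ?thesis
    by (rule Lim_null_comparison[rotated])
      (use C(2) assms(3) in \<open>auto intro: eventually_mono[OF eventually_ge_at_top[of T]]\<close>)
qed

section \<open>The second-order equations for P and Q\<close>

text \<open>The first-order term arises from differentiating exp (-\<tau>); it equals half the
  difference of the two characteristic derivatives, for \<sigma> = 1 or -1, and is the origin of the
  terms \<open>(a \<sigma> - a (-\<sigma>)) / 2\<close> in the frame system.\<close>

lemma Dchar_Dchar:
  assumes "smooth_strip UNIV F"
  shows "Dchar (-\<sigma>) (Dchar \<sigma> F) \<tau> \<theta> =
    ptau (ptau F) \<tau> \<theta> - \<sigma>\<^sup>2 * exp (-2 * \<tau>) * ptheta (ptheta F) \<tau> \<theta> - \<sigma> * exp (-\<tau>) * ptheta F \<tau> \<theta>"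
proof -
  have d: "((\<lambda>s. \<sigma> * exp (-s)) has_real_derivative - (\<sigma> * exp (-\<tau>))) (at \<tau>)" by (auto intro!: derivative_eq_intros)
  have "ptau (Dchar \<sigma> F) \<tau> \<theta> = ptau (ptau F) \<tau> \<theta> + (\<sigma> * exp (-\<tau>) * ptau (ptheta F) \<tau> \<theta> - \<sigma> * exp (-\<tau>) * ptheta F \<tau> \<theta>)"
    using DERIV_add[OF has_ptau[OF smooth_strip_ptau[OF assms] UNIV_I, of \<theta> \<tau>] DERIV_mult[OF d has_ptau[OF smooth_strip_ptheta[OF assms] UNIV_I, of \<theta> \<tau>]]]
    unfolding Dchar_def[abs_def] by (intro ptauI) (simp add: algebra_simps)
  moreover have "ptheta (Dchar \<sigma> F) \<tau> \<theta> = ptheta (ptau F) \<tau> \<theta> + \<sigma> * exp (-\<tau>) * ptheta (ptheta F) \<tau> \<theta>"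
    using DERIV_add[OF has_ptheta[OF smooth_strip_ptau[OF assms] UNIV_I, of \<tau> \<theta>] DERIV_cmult[OF has_ptheta[OF smooth_strip_ptheta[OF assms] UNIV_I, of \<tau> \<theta>], of "\<sigma> * exp (-\<tau>)"]]
    unfolding Dchar_def[abs_def] by (intro pthetaI) simp
  moreover have e: "exp (-2 * \<tau>) = exp (-\<tau>) * exp (-\<tau>)" by (simp flip: exp_add)
  ultimately show ?thesis
    unfolding Dchar_def[of "-\<sigma>"] e using ptau_ptheta_commute[OF open_UNIV assms UNIV_I, of \<tau> \<theta>]
    by (simp add: algebra_simps power2_eq_square)
qed

locale gowdy_PQ = gowdy_frame a b for a b +
  fixes P Q :: "real \<Rightarrow> real \<Rightarrow> real"
  assumes smooth_P: "smooth_strip UNIV P" and smooth_Q: "smooth_strip UNIV Q"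
    and a_P: "\<And>\<sigma> \<tau> \<theta>. \<sigma> \<in> {1, -1} \<Longrightarrow> a \<sigma> \<tau> \<theta> = Dchar \<sigma> P \<tau> \<theta>"
    and b_Q: "\<And>\<sigma> \<tau> \<theta>. \<sigma> \<in> {1, -1} \<Longrightarrow> b \<sigma> \<tau> \<theta> = exp (P \<tau> \<theta>) * Dchar \<sigma> Q \<tau> \<theta>"
begin

text \<open>Together with \<open>ptau P\<close> these separate time from space derivatives: the
  first letters stand for the half-sums and half-differences of the characteristic quantities a and
  b.\<close>

definition "gp \<tau> \<theta> = exp (-\<tau>) * ptheta P \<tau> \<theta>"
definition "hq \<tau> \<theta> = exp (P \<tau> \<theta>) * ptau Q \<tau> \<theta>"
definition "kq \<tau> \<theta> = exp (P \<tau> \<theta>) * (exp (-\<tau>) * ptheta Q \<tau> \<theta>)"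

lemma a_split: "a 1 \<tau> \<theta> = ptau P \<tau> \<theta> + gp \<tau> \<theta>" "a (-1) \<tau> \<theta> = ptau P \<tau> \<theta> - gp \<tau> \<theta>"
  and b_split: "b 1 \<tau> \<theta> = hq \<tau> \<theta> + kq \<tau> \<theta>" "b (-1) \<tau> \<theta> = hq \<tau> \<theta> - kq \<tau> \<theta>"
  by (auto simp: a_P b_Q Dchar_def gp_def hq_def kq_def algebra_simps)

lemma smooth_hk: "smooth_strip UNIV hq" "smooth_strip UNIV kq"
  unfolding hq_def[abs_def] kq_def[abs_def]
  by (intro smooth_strip_intros smooth_strip_ptau smooth_strip_ptheta smooth_P smooth_Q open_UNIV)+

text \<open>The product of the two b is \<open>hq\<^sup>2 - kq\<^sup>2\<close>, the usual source in
  the wave equation of P. Keeping it as a product of decaying factors is convenient for the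
  rates.\<close>

lemma ptau_ptau_P:
  "ptau (ptau P) \<tau> \<theta> = exp (-2 * \<tau>) * ptheta (ptheta P) \<tau> \<theta> + b 1 \<tau> \<theta> * b (-1) \<tau> \<theta>"
proof -
  have "a 1 = Dchar 1 P" by (intro ext) (simp add: a_P)
  then have "Dchar (-1) (a 1) \<tau> \<theta> = Dchar (-1) (Dchar 1 P) \<tau> \<theta>" by simp
  moreover have "Dchar (-1) (a 1) \<tau> \<theta> = b 1 \<tau> \<theta> * b (-1) \<tau> \<theta> - gp \<tau> \<theta>"
    using a_eq[of 1 \<tau> \<theta>] by (simp add: a_split)
  ultimately show ?thesis using Dchar_Dchar[OF smooth_P, of 1 \<tau> \<theta>] unfolding gp_def by simp
qed

text \<open>\<open>exp (2 * P) * ptau Q\<close>, the momentum conjugate to Q. Its conservation law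
  \<open>ptau Rq = exp (-2 * \<tau>) * ptheta (exp (2 * P) * ptheta Q)\<close> is what
  \<open>ptau_Rq\<close> says in frame components; r arises from it.\<close>

definition "Rq \<tau> \<theta> = exp (P \<tau> \<theta>) * hq \<tau> \<theta>"

lemma smooth_Rq: "smooth_strip UNIV Rq"
  unfolding Rq_def[abs_def] by (intro smooth_strip_intros smooth_hk smooth_P open_UNIV)

lemma ptau_Rq: "ptau Rq \<tau> \<theta> = exp (P \<tau> \<theta>) * (exp (-\<tau>) * ptheta kq \<tau> \<theta> + gp \<tau> \<theta> * kq \<tau> \<theta>)"
proof -
  have b1: "b 1 = (\<lambda>\<tau> \<theta>. exp (P \<tau> \<theta>) * Dchar 1 Q \<tau> \<theta>)" by (intro ext) (simp add: b_Q)
  have smD: "smooth_strip UNIV (Dchar 1 Q)" by (intro smooth_strip_Dchar smooth_Q open_UNIV)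
  have "char_deriv (-1) (b 1) \<tau> \<theta> (exp (P \<tau> \<theta>) * (Dchar (-1) P \<tau> \<theta> * Dchar 1 Q \<tau> \<theta> + Dchar (-1) (Dchar 1 Q) \<tau> \<theta>))"
    using char_deriv_Dchar[OF smooth_P, of "-1" \<tau> \<theta>] char_deriv_Dchar[OF smD, of "-1" \<tau> \<theta>]
    unfolding b1 char_deriv_def by (auto intro!: derivative_eq_intros simp: algebra_simps)
  then have "exp (P \<tau> \<theta>) * (Dchar (-1) P \<tau> \<theta> * Dchar 1 Q \<tau> \<theta> + Dchar (-1) (Dchar 1 Q) \<tau> \<theta>) = Dchar (-1) (b 1) \<tau> \<theta>"
    using char_deriv_Dchar[OF smooth_b, of "-1" 1 \<tau> \<theta>] DERIV_unique unfolding char_deriv_def by blast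
  also have "\<dots> = - a 1 \<tau> \<theta> * b (-1) \<tau> \<theta> - kq \<tau> \<theta>" using b_eq[of 1 \<tau> \<theta>] by (simp add: b_split)
  finally have "exp (P \<tau> \<theta>) * (ptau (ptau Q) \<tau> \<theta> - exp (-2 * \<tau>) * ptheta (ptheta Q) \<tau> \<theta>)
      = - a 1 \<tau> \<theta> * b (-1) \<tau> \<theta> - a (-1) \<tau> \<theta> * b 1 \<tau> \<theta>"
    using Dchar_Dchar[OF smooth_Q, of 1 \<tau> \<theta>] by (simp add: kq_def a_P b_Q algebra_simps)
  also have "\<dots> = 2 * (gp \<tau> \<theta> * kq \<tau> \<theta> - ptau P \<tau> \<theta> * hq \<tau> \<theta>)" by (simp add: a_split b_split algebra_simps)
  finally have wave: "exp (P \<tau> \<theta>) * ptau (ptau Q) \<tau> \<theta> =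
      exp (P \<tau> \<theta>) * exp (-2 * \<tau>) * ptheta (ptheta Q) \<tau> \<theta> + 2 * (gp \<tau> \<theta> * kq \<tau> \<theta> - ptau P \<tau> \<theta> * hq \<tau> \<theta>)"
    by (simp add: algebra_simps)
  have "ptau Rq \<tau> \<theta> = exp (P \<tau> \<theta>) * (2 * (ptau P \<tau> \<theta> * hq \<tau> \<theta>) + exp (P \<tau> \<theta>) * ptau (ptau Q) \<tau> \<theta>)"
    unfolding Rq_def[abs_def] hq_def[abs_def]
    using has_ptau[OF smooth_P UNIV_I, of \<theta> \<tau>] has_ptau[OF smooth_strip_ptau[OF smooth_Q] UNIV_I, of \<theta> \<tau>]
    by (intro ptauI) (auto intro!: derivative_eq_intros simp: algebra_simps)
  moreover have "ptheta kq \<tau> \<theta> = exp (P \<tau> \<theta>) * exp (-\<tau>) * (ptheta P \<tau> \<theta> * ptheta Q \<tau> \<theta> + ptheta (ptheta Q) \<tau> \<theta>)"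
    unfolding kq_def[abs_def]
    using has_ptheta[OF smooth_P UNIV_I, of \<tau> \<theta>] has_ptheta[OF smooth_strip_ptheta[OF smooth_Q] UNIV_I, of \<tau> \<theta>]
    by (intro pthetaI) (auto intro!: derivative_eq_intros simp: algebra_simps)
  moreover have e: "exp (-2 * \<tau>) = exp (-\<tau>) * exp (-\<tau>)" by (simp flip: exp_add)
  ultimately show ?thesis unfolding wave e
    by (simp add: gp_def kq_def algebra_simps)
qed

end

section \<open>Asymptotic expansions on the interval\<close>

text \<open>\<open>\<delta> \<le> g / 32\<close> is used for the last expansion, where replacing the
  function v by uniform rates costs 4 \<delta>.\<close>

locale gowdy_small_PQ = gowdy_small a b T \<eta> \<theta>\<^sub>0 v\<^sub>0 \<delta> g \<epsilon> + gowdy_PQ a b P Q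
  for a b T \<eta> \<theta>\<^sub>0 v\<^sub>0 \<delta> g \<epsilon> P Q +
  assumes T0: "T \<ge> 0" and \<delta>g: "\<delta> \<le> g / 32"
begin

definition "I = {\<theta>\<^sub>0 - \<eta> <..< \<theta>\<^sub>0 + \<eta>}"

lemma I: "open I" "convex I" "I \<subseteq> {\<theta>\<^sub>0 - \<eta>..\<theta>\<^sub>0 + \<eta>}"
  unfolding I_def by auto

lemma I_Rgn: "x \<in> {T..} \<times> I \<Longrightarrow> x \<in> Rgn"
proof -
  assume "x \<in> {T..} \<times> I"
  then have "T \<le> fst x" "\<bar>snd x - \<theta>\<^sub>0\<bar> \<le> \<eta>" by (auto simp: I_def)
  moreover have "0 \<le> exp (- fst x)" by simp
  ultimately show ?thesis unfolding Rgn_def by (simp del: exp_ge_zero)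
qed

lemma smooth_strip_I: "smooth_strip UNIV F \<Longrightarrow> smooth_strip I F"
  by (erule smooth_strip_subset) simp

lemma order_a:
  assumes \<sigma>: "\<sigma> \<in> {1, -1}"
  shows "exp_order I T 0 (a \<sigma>)"
  unfolding exp_order_def
proof (intro conjI allI smooth_strip_I smooth_a)
  fix k
  obtain C where "\<And>x. x\<in>Rgn \<Longrightarrow> \<bar>(ptheta ^^ k) (a \<sigma>) (fst x) (snd x)\<bar> \<le> C"
    using higher_deriv_bound[of k] \<sigma> by blast
  then show "\<exists>C. \<forall>x\<in>{T..} \<times> I. \<bar>(ptheta ^^ k) (a \<sigma>) (fst x) (snd x)\<bar> \<le> C * exp (0 * fst x)"
    using I_Rgn by (intro exI[of _ C]) simp
qed

lemma order_b:
  assumes \<sigma>: "\<sigma> \<in> {1, -1}"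
  shows "exp_order I T (- (g / 2)) (b \<sigma>)"
  unfolding exp_order_def
proof (intro conjI allI smooth_strip_I smooth_b)
  fix k
  obtain C where C: "\<And>x. x\<in>Rgn \<Longrightarrow> \<bar>(ptheta ^^ k) (b \<sigma>) (fst x) (snd x)\<bar> \<le> C * exp (- (g / 2) * (fst x - T))"
    using higher_deriv_bound[of k] \<sigma> by blast
  have "exp (- (g / 2) * (t - T)) = exp (g / 2 * T) * exp (- (g / 2) * t)" for t
    by (simp add: field_simps flip: exp_add)
  then show "\<exists>C. \<forall>x\<in>{T..} \<times> I. \<bar>(ptheta ^^ k) (b \<sigma>) (fst x) (snd x)\<bar> \<le> C * exp (- (g / 2) * fst x)"
    using C[OF I_Rgn] by (intro exI[of _ "C * exp (g / 2 * T)"]) (simp add: mult.assoc)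
qed

lemma g_half: "g < 1/2" using v0 pos by linarith

lemma order_f: "exp_order I T 0 (ptau P)"
  by (rule exp_order_cong[OF I(1) exp_order_cmult[OF I(1) exp_order_add[OF I(1) order_a[of 1] order_a[of "-1"]], of "1/2"]])
    (auto simp: a_split)

lemma order_k: "exp_order I T (- (g / 2)) kq"
  by (rule exp_order_cong[OF I(1) exp_order_cmult[OF I(1) exp_order_diff[OF I(1) order_b[of 1] order_b[of "-1"]], of "1/2"]])
    (auto simp: b_split)

text \<open>The time derivative is the \<theta>-derivative of \<open>ptau P\<close> and hence
  bounded; the linear growth that results is recorded as an arbitrarily small exponential
  rate.\<close>

lemma order_P\<theta>:
  assumes "\<mu> > 0"
  shows "exp_order I T \<mu> (ptheta P)"
proof (rule exp_order_growth[OF I(1) I(3) smooth_strip_ptheta[OF smooth_P] _ assms])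
  have "exp_order I T 0 (ptau (ptheta P))"
    by (rule exp_order_cong[OF I(1) exp_order_ptheta[OF order_f]])
      (simp add: ptau_ptheta_commute[OF open_UNIV smooth_P])
  then show "exp_order I T \<mu> (ptau (ptheta P))" by (rule exp_order_mono) (use assms T0 in auto)
qed

lemma order_gp:
  assumes "\<mu> > 0"
  shows "exp_order I T (-1 + \<mu>) gp"
  using exp_order_mult[OF I(1) exp_order_exp_time[OF I(1), of T "-1"] order_P\<theta>[OF assms]]
  by (simp add: gp_def[abs_def])

lemma f_bound:
  assumes "T \<le> \<tau>" "\<theta> \<in> I"
  shows "\<bar>ptau P \<tau> \<theta> - v\<^sub>0\<bar> \<le> \<delta>"
proof -
  have "(\<tau>, \<theta>) \<in> Rgn" using assms by (intro I_Rgn) auto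
  then show ?thesis using a_bound[of 1 \<tau> \<theta>] a_bound[of "-1" \<tau> \<theta>] by (auto simp: Rgn_def a_split)
qed

lemma P_bound: "\<exists>c. \<forall>\<tau>\<ge>T. \<forall>\<theta>\<in>I. \<bar>P \<tau> \<theta> - v\<^sub>0 * \<tau>\<bar> \<le> \<delta> * \<tau> + c"
proof -
  obtain M where M: "\<And>x. x \<in> {\<theta>\<^sub>0 - \<eta>..\<theta>\<^sub>0 + \<eta>} \<Longrightarrow> \<bar>P T x\<bar> \<le> M"
    using compact_imp_bounded[OF compact_continuous_image[OF continuous_on_subset[OF
        smooth_strip_cont_section(1)[OF smooth_P, of T] subset_UNIV]
        compact_Icc[of "\<theta>\<^sub>0 - \<eta>" "\<theta>\<^sub>0 + \<eta>"]]]
    unfolding bounded_iff by (auto simp del: atLeastAtMost_iff)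
  have "\<bar>P \<tau> \<theta> - v\<^sub>0 * \<tau>\<bar> \<le> \<delta> * \<tau> + (M + \<bar>v\<^sub>0 * T\<bar>)" if \<tau>: "T \<le> \<tau>" and \<theta>: "\<theta> \<in> I" for \<tau> \<theta>
  proof -
    have d: "((\<lambda>s. P s \<theta> - v\<^sub>0 * s) has_real_derivative ptau P s \<theta> - v\<^sub>0) (at s)" for s
      by (rule DERIV_diff[OF has_ptau[OF smooth_P UNIV_I]]) (auto intro!: derivative_eq_intros)
    have "norm ((P \<tau> \<theta> - v\<^sub>0 * \<tau>) - (P T \<theta> - v\<^sub>0 * T)) \<le> \<delta> * norm (\<tau> - T)"
      by (rule field_differentiable_bound[of "{T..\<tau>}" "\<lambda>s. P s \<theta> - v\<^sub>0 * s" "\<lambda>s. ptau P s \<theta> - v\<^sub>0"])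
        (use \<tau> f_bound[OF _ \<theta>] d in \<open>auto intro: has_field_derivative_at_within\<close>)
    moreover have "\<bar>P T \<theta>\<bar> \<le> M" using M \<theta> I(3) by blast
    moreover have "0 \<le> \<delta> * T" using pos T0 by simp
    ultimately show ?thesis using \<tau> by (simp add: algebra_simps)
  qed
  then show ?thesis by blast
qed

lemma order_expP:
  assumes "\<mu> > 0"
  shows "exp_order I T (v\<^sub>0 + \<delta> + \<mu>) (\<lambda>\<tau> \<theta>. exp (P \<tau> \<theta>))"
proof -
  obtain c where "\<forall>\<tau>\<ge>T. \<forall>\<theta>\<in>I. \<bar>P \<tau> \<theta> - v\<^sub>0 * \<tau>\<bar> \<le> \<delta> * \<tau> + c" using P_bound by blast
  then have c: "P \<tau> \<theta> \<le> (v\<^sub>0 + \<delta>) * \<tau> + c" if "\<tau> \<ge> T" "\<theta> \<in> I" for \<tau> \<theta>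
    using that by (fastforce simp: abs_le_iff algebra_simps)
  show ?thesis by (rule exp_order_exp[OF I(1) smooth_strip_I[OF smooth_P] c order_P\<theta> T0 assms])
qed

text \<open>This is where v < 1 counts: exp P grows at rate at most
  \<open>v\<^sub>0 + \<delta> \<le> 1 - g\<close> up to small losses, so the factor exp (-\<tau>)
  leaves decay of rate g, and the decay g/2 of \<open>kq\<close> covers the losses g/8.\<close>

lemma order_ptau_Rq: "exp_order I T (- g) (ptau Rq)"
proof -
  have \<mu>: "g / 8 > 0" using pos by simp
  note eP = order_expP[OF \<mu>]
  have 1: "exp_order I T (v\<^sub>0 + \<delta> + g / 8 + (- 1 + - (g / 2))) (\<lambda>\<tau> \<theta>. exp (P \<tau> \<theta>) * (exp (-1 * \<tau>) * ptheta kq \<tau> \<theta>))"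
    by (rule exp_order_mult[OF I(1) eP exp_order_mult[OF I(1) exp_order_exp_time[OF I(1)] exp_order_ptheta[OF order_k]]])
  have 2: "exp_order I T (v\<^sub>0 + \<delta> + g / 8 + ((- 1 + g / 8) + - (g / 2))) (\<lambda>\<tau> \<theta>. exp (P \<tau> \<theta>) * (gp \<tau> \<theta> * kq \<tau> \<theta>))"
    by (rule exp_order_mult[OF I(1) eP exp_order_mult[OF I(1) order_gp[OF \<mu>] order_k]])
  have "exp_order I T (- g) (\<lambda>\<tau> \<theta>. exp (P \<tau> \<theta>) * (exp (-1 * \<tau>) * ptheta kq \<tau> \<theta>) + exp (P \<tau> \<theta>) * (gp \<tau> \<theta> * kq \<tau> \<theta>))"
    by (rule exp_order_add[OF I(1) exp_order_mono[OF 1 _ T0] exp_order_mono[OF 2 _ T0]]) (use v0 pos in linarith)+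
  then show ?thesis by (rule exp_order_cong[OF I(1)]) (simp add: ptau_Rq algebra_simps)
qed

text \<open>v, \<open>\<phi>\<^sub>0\<close> and r are the limits of \<open>ptau P\<close>, of P
  minus v \<tau>, and of \<open>exp (2 * p) * ptau Q\<close>, each obtained by integrating a
  decaying time derivative. For q the leading correction of Q has to be split off before
  integrating.\<close>

lemma asymptotic_expansion:
  "\<exists>v \<phi>\<^sub>0 q r. Cinf_on I v \<and> Cinf_on I \<phi>\<^sub>0 \<and> Cinf_on I q \<and> Cinf_on I r \<and>
    (\<forall>\<theta>\<in>I. g \<le> v \<theta> \<and> v \<theta> \<le> 1 - g) \<and>
    exp_order I T (- (g / 8)) (\<lambda>t \<theta>. ptau P t \<theta> - v \<theta>) \<and>
    exp_order I T (- (g / 8)) (\<lambda>t \<theta>. P t \<theta> - (v \<theta> * t + \<phi>\<^sub>0 \<theta>)) \<and>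
    exp_order I T (- (g / 8)) (\<lambda>t \<theta>. exp (2 * (v \<theta> * t + \<phi>\<^sub>0 \<theta>)) * ptau Q t \<theta> - r \<theta>) \<and>
    exp_order I T (- (g / 8)) (\<lambda>t \<theta>. exp (2 * (v \<theta> * t + \<phi>\<^sub>0 \<theta>)) * (Q t \<theta> - q \<theta>) + r \<theta> / (2 * v \<theta>))"
proof -
  define \<mu> where "\<mu> = g / 8"
  have \<mu>: "\<mu> > 0" using pos by (simp add: \<mu>_def)
  have smf: "smooth_strip I (ptau P)" by (intro smooth_strip_I smooth_strip_ptau smooth_P)
  have "exp_order I T (- g) (ptau (ptau P))"
  proof -
    \<comment> \<open>The subexponential growth of the spatial derivatives is generously estimated
      by rate 1; -1 is still below -g.\<close>
    have 1: "exp_order I T (-2 + 1) (\<lambda>\<tau> \<theta>. exp (-2 * \<tau>) * ptheta (ptheta P) \<tau> \<theta>)"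
      by (rule exp_order_mult[OF I(1) exp_order_exp_time[OF I(1)] exp_order_ptheta[OF order_P\<theta>]]) simp
    have 2: "exp_order I T (- (g / 2) + - (g / 2)) (\<lambda>\<tau> \<theta>. b 1 \<tau> \<theta> * b (-1) \<tau> \<theta>)"
      by (rule exp_order_mult[OF I(1) order_b order_b]) auto
    show ?thesis
      by (rule exp_order_cong[OF I(1) exp_order_add[OF I(1) exp_order_mono[OF 1 _ T0] exp_order_mono[OF 2 _ T0]]])
        (use g_half in \<open>auto simp: ptau_ptau_P\<close>)
  qed
  from exp_order_limit[OF I(1,2) smf this pos(2)] obtain v where v: "Cinf_on I v" "smooth_strip I (\<lambda>\<tau>. v)"
    "exp_order I T (- g) (\<lambda>\<tau> \<theta>. ptau P \<tau> \<theta> - v \<theta>)" by blast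
  \<comment> \<open>The limit v inherits the tube of \<open>ptau P\<close>; in particular v > 0,
    which makes r / (2 v) smooth.\<close>
  have vb: "\<bar>v \<theta> - v\<^sub>0\<bar> \<le> \<delta>" if "\<theta> \<in> I" for \<theta>
  proof (rule tendsto_upperbound)
    have "((\<lambda>\<tau>. \<bar>v \<theta> - v\<^sub>0\<bar> - \<bar>ptau P \<tau> \<theta> - v \<theta>\<bar>) \<longlongrightarrow> \<bar>v \<theta> - v\<^sub>0\<bar> - \<bar>0\<bar>) at_top"
      by (intro tendsto_diff tendsto_const tendsto_rabs exp_order_tendsto_0[OF v(3) pos(2) that])
    then show "((\<lambda>\<tau>. \<bar>v \<theta> - v\<^sub>0\<bar> - \<bar>ptau P \<tau> \<theta> - v \<theta>\<bar>) \<longlongrightarrow> \<bar>v \<theta> - v\<^sub>0\<bar>) at_top" by simp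
    show "\<forall>\<^sub>F \<tau> in at_top. \<bar>v \<theta> - v\<^sub>0\<bar> - \<bar>ptau P \<tau> \<theta> - v \<theta>\<bar> \<le> \<delta>"
      using eventually_ge_at_top[of T]
    proof eventually_elim
      case (elim \<tau>)
      then show ?case using f_bound[OF elim that] by linarith
    qed
  qed simp
  have vpos: "v \<theta> > 0" if "\<theta> \<in> I" for \<theta> using vb[OF that] v0 pos by linarith
  have smP: "smooth_strip I (\<lambda>\<tau> \<theta>. P \<tau> \<theta> - v \<theta> * \<tau>)"
    by (intro smooth_strip_intros v(2) smooth_strip_I[OF smooth_P] I(1))
  have "exp_order I T (- g) (ptau (\<lambda>\<tau> \<theta>. P \<tau> \<theta> - v \<theta> * \<tau>))"
  proof (rule exp_order_cong[OF I(1) v(3)])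
    fix \<tau> \<theta>
    show "ptau P \<tau> \<theta> - v \<theta> = ptau (\<lambda>\<tau> \<theta>. P \<tau> \<theta> - v \<theta> * \<tau>) \<tau> \<theta>"
      by (rule ptauI[symmetric], rule DERIV_diff[OF has_ptau[OF smooth_P UNIV_I]]) (auto intro!: derivative_eq_intros)
  qed
  from exp_order_limit[OF I(1,2) smP this pos(2)] obtain \<phi> where \<phi>: "Cinf_on I \<phi>" "smooth_strip I (\<lambda>\<tau>. \<phi>)"
    "exp_order I T (- g) (\<lambda>\<tau> \<theta>. P \<tau> \<theta> - v \<theta> * \<tau> - \<phi> \<theta>)" by blast
  define p where "p \<tau> \<theta> = v \<theta> * \<tau> + \<phi> \<theta>" for \<tau> \<theta>
  define W where "W \<tau> \<theta> = P \<tau> \<theta> - p \<tau> \<theta>" for \<tau> \<theta>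
  have smp: "smooth_strip I p" unfolding p_def[abs_def]
    by (intro smooth_strip_intros v(2) \<phi>(2) I(1))
  have W: "exp_order I T (- g) W"
    by (rule exp_order_cong[OF I(1) \<phi>(3)]) (simp add: W_def p_def)
  have smW: "smooth_strip I W" using W exp_order_smooth by blast
  have dp: "((\<lambda>s. p s \<theta>) has_real_derivative v \<theta>) (at \<tau>)" for \<tau> \<theta>
    unfolding p_def by (auto intro!: derivative_eq_intros)
  obtain C where C: "C \<ge> 0" "\<And>\<tau> \<theta>. \<tau> \<ge> T \<Longrightarrow> \<theta> \<in> I \<Longrightarrow> \<bar>W \<tau> \<theta>\<bar> \<le> C * exp (- g * \<tau>)"
    using exp_orderD0[OF W] by blast
  have WC: "\<bar>W \<tau> \<theta>\<bar> \<le> C" if "\<tau> \<ge> T" "\<theta> \<in> I" for \<tau> \<theta>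
  proof -
    have "exp (- g * \<tau>) \<le> 1" using pos T0 that by simp
    then have "C * exp (- g * \<tau>) \<le> C * 1" by (rule mult_left_mono) (rule C(1))
    then show ?thesis using C(2)[OF that] by simp
  qed
  have eW: "exp_order I T (0 + \<mu>) (\<lambda>\<tau> \<theta>. exp (-2 * W \<tau> \<theta>))"
  proof (rule exp_order_exp[OF I(1) _ _ _ T0 \<mu>])
    show "smooth_strip I (\<lambda>\<tau> \<theta>. -2 * W \<tau> \<theta>)" by (intro smooth_strip_intros smW I(1))
    show "-2 * W \<tau> \<theta> \<le> 0 * \<tau> + 2 * C" if "T \<le> \<tau>" "\<theta> \<in> I" for \<tau> \<theta> using WC[OF that] by linarith
    show "exp_order I T d (ptheta (\<lambda>\<tau> \<theta>. -2 * W \<tau> \<theta>))" if "d > 0" for d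
      by (rule exp_order_mono[OF exp_order_ptheta[OF exp_order_cmult[OF I(1) W]] _ T0]) (use that pos in simp)
  qed
  have Rq: "exp_order I T \<mu> Rq"
    by (rule exp_order_growth[OF I(1) I(3) smooth_Rq exp_order_mono[OF order_ptau_Rq _ T0] \<mu>]) (use \<mu> pos in simp)
  \<comment> \<open>R differs from \<open>Rq\<close> by the factor \<open>exp (-2 * W)\<close>, and
    W decays, so replacing P by p in the exponent costs only small rates.\<close>
  define R where "R \<tau> \<theta> = exp (2 * p \<tau> \<theta>) * ptau Q \<tau> \<theta>" for \<tau> \<theta>
  have R_eq: "R \<tau> \<theta> = exp (-2 * W \<tau> \<theta>) * Rq \<tau> \<theta>" for \<tau> \<theta>
  proof -
    have "exp (-2 * W \<tau> \<theta>) * (exp (P \<tau> \<theta>) * exp (P \<tau> \<theta>)) = exp (2 * p \<tau> \<theta>)"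
      unfolding W_def by (simp add: algebra_simps flip: exp_add)
    then show ?thesis by (simp add: R_def Rq_def hq_def flip: mult.assoc)
  qed
  have smR: "smooth_strip I R" unfolding R_def[abs_def]
    by (intro smooth_strip_intros smp I(1) smooth_strip_I[OF smooth_strip_ptau[OF smooth_Q]])
  have R: "exp_order I T (2 * \<mu>) R"
    using exp_order_mult[OF I(1) eW Rq] by (simp add: R_eq[abs_def])
  have "exp_order I T (- (g / 2)) (ptau R)"
  proof -
    have 1: "exp_order I T (0 + \<mu> + - g) (\<lambda>\<tau> \<theta>. exp (-2 * W \<tau> \<theta>) * ptau Rq \<tau> \<theta>)"
      by (rule exp_order_mult[OF I(1) eW order_ptau_Rq])
    have 2: "exp_order I T (0 + \<mu> + (- g + \<mu>)) (\<lambda>\<tau> \<theta>. exp (-2 * W \<tau> \<theta>) * ((ptau P \<tau> \<theta> - v \<theta>) * Rq \<tau> \<theta>))"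
      by (rule exp_order_mult[OF I(1) eW exp_order_mult[OF I(1) v(3) Rq]])
    have 3: "exp_order I T (- (g / 2)) (\<lambda>\<tau> \<theta>. exp (-2 * W \<tau> \<theta>) * ptau Rq \<tau> \<theta> +
        (-2) * (exp (-2 * W \<tau> \<theta>) * ((ptau P \<tau> \<theta> - v \<theta>) * Rq \<tau> \<theta>)))"
      by (rule exp_order_add[OF I(1) exp_order_mono[OF 1 _ T0] exp_order_cmult[OF I(1) exp_order_mono[OF 2 _ T0]]])
        (use pos in \<open>auto simp: \<mu>_def\<close>)
    show ?thesis
    proof (rule exp_order_cong[OF I(1) 3])
      fix \<tau> \<theta>
      have dW: "((\<lambda>s. W s \<theta>) has_real_derivative ptau P \<tau> \<theta> - v \<theta>) (at \<tau>)"
        unfolding W_def by (rule DERIV_diff[OF has_ptau[OF smooth_P UNIV_I] dp])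
      show "exp (-2 * W \<tau> \<theta>) * ptau Rq \<tau> \<theta> + (-2) * (exp (-2 * W \<tau> \<theta>) * ((ptau P \<tau> \<theta> - v \<theta>) * Rq \<tau> \<theta>)) = ptau R \<tau> \<theta>"
        unfolding R_eq[abs_def]
        by (rule ptauI[symmetric])
          (use dW has_ptau[OF smooth_Rq UNIV_I, of \<theta> \<tau>] in \<open>auto intro!: derivative_eq_intros simp: algebra_simps\<close>)
    qed
  qed
  from exp_order_limit[OF I(1,2) smR this] pos obtain r where r: "Cinf_on I r" "smooth_strip I (\<lambda>\<tau>. r)"
    "exp_order I T (- (g / 2)) (\<lambda>\<tau> \<theta>. R \<tau> \<theta> - r \<theta>)" by auto
  obtain c where c: "\<And>\<tau> \<theta>. T \<le> \<tau> \<Longrightarrow> \<theta> \<in> I \<Longrightarrow> \<bar>P \<tau> \<theta> - v\<^sub>0 * \<tau>\<bar> \<le> \<delta> * \<tau> + c" using P_bound by blast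
  have p_bd: "\<bar>p \<tau> \<theta> - v\<^sub>0 * \<tau>\<bar> \<le> \<delta> * \<tau> + (c + C)" if "T \<le> \<tau>" "\<theta> \<in> I" for \<tau> \<theta>
    using c[OF that] WC[OF that] unfolding W_def by linarith
  have order_p\<theta>: "exp_order I T d (ptheta p)" if "d > 0" for d
  proof (rule exp_order_cong[OF I(1) exp_order_diff[OF I(1) order_P\<theta>[OF that] exp_order_mono[OF exp_order_ptheta[OF W] _ T0]]])
    show "- g \<le> d" using that pos by simp
    fix \<tau> \<theta> assume "\<theta> \<in> I"
    have "p = (\<lambda>\<tau> \<theta>. P \<tau> \<theta> - W \<tau> \<theta>)" by (simp add: W_def fun_eq_iff)
    then show "ptheta P \<tau> \<theta> - ptheta W \<tau> \<theta> = ptheta p \<tau> \<theta>"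
      using ptheta_diff[OF smooth_strip_I[OF smooth_P] smW \<open>\<theta> \<in> I\<close>, of \<tau>] by simp
  qed
  have cm\<theta>: "exp_order I T d (ptheta (\<lambda>\<tau> \<theta>. s * p \<tau> \<theta>))" if "d > 0" for d s
    by (rule exp_order_cong[OF I(1) exp_order_cmult[OF I(1) order_p\<theta>[OF that], of s]])
      (simp add: ptheta_cmult[OF smp, of _ "\<lambda>_. s"])
  have em: "exp_order I T (-2 * (v\<^sub>0 - \<delta>) + \<mu>) (\<lambda>\<tau> \<theta>. exp (-2 * p \<tau> \<theta>))"
  proof (rule exp_order_exp[OF I(1) _ _ cm\<theta> T0 \<mu>])
    show "smooth_strip I (\<lambda>\<tau> \<theta>. -2 * p \<tau> \<theta>)" by (intro smooth_strip_intros smp I(1))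
    show "-2 * p \<tau> \<theta> \<le> -2 * (v\<^sub>0 - \<delta>) * \<tau> + 2 * (c + C)" if "T \<le> \<tau>" "\<theta> \<in> I" for \<tau> \<theta>
      using p_bd[OF that] unfolding abs_le_iff by (simp add: algebra_simps)
  qed
  have ep: "exp_order I T (2 * (v\<^sub>0 + \<delta>) + \<mu>) (\<lambda>\<tau> \<theta>. exp (2 * p \<tau> \<theta>))"
  proof (rule exp_order_exp[OF I(1) _ _ cm\<theta> T0 \<mu>])
    show "smooth_strip I (\<lambda>\<tau> \<theta>. 2 * p \<tau> \<theta>)" by (intro smooth_strip_intros smp I(1))
    show "2 * p \<tau> \<theta> \<le> 2 * (v\<^sub>0 + \<delta>) * \<tau> + 2 * (c + C)" if "T \<le> \<tau>" "\<theta> \<in> I" for \<tau> \<theta>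
      using p_bd[OF that] unfolding abs_le_iff by (simp add: algebra_simps)
  qed
  \<comment> \<open>Q with its leading correction removed. Integrating \<open>ptau Q\<close>, which
    is about r exp (-2 p), would bound Q - q only by a multiple of exp (-2 p) up to losses. V has
    derivative \<open>exp (-2 * p) * (R - r)\<close>, so V - q gains the decay of R - r and stays
    small after multiplication by exp (2 p).\<close>
  define V where "V \<tau> \<theta> = Q \<tau> \<theta> + exp (-2 * p \<tau> \<theta>) * (r \<theta> / (2 * v \<theta>))" for \<tau> \<theta>
  \<comment> \<open>exp (-2 p) decays at rate \<open>2 * (v\<^sub>0 - \<delta>)\<close> up to the
    loss \<mu>, and R - r at rate g/2.\<close>
  define \<beta> where "\<beta> = 2 * (v\<^sub>0 - \<delta>) - \<mu> + g / 2"
  have \<beta>: "\<beta> > 0" using v0 pos by (simp add: \<beta>_def \<mu>_def)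
  have smV: "smooth_strip I V" unfolding V_def[abs_def]
    by (intro smooth_strip_intros smp I(1) smooth_strip_I[OF smooth_Q] r(2) v(2)) (use vpos in force)
  have "exp_order I T (- \<beta>) (ptau V)"
  proof (rule exp_order_cong[OF I(1)])
    show "exp_order I T (- \<beta>) (\<lambda>\<tau> \<theta>. exp (-2 * p \<tau> \<theta>) * (R \<tau> \<theta> - r \<theta>))"
      using exp_order_mult[OF I(1) em r(3)] by (simp add: \<beta>_def algebra_simps)
    fix \<tau> \<theta> assume "\<theta> \<in> I"
    then have "v \<theta> \<noteq> 0" using vpos by force
    then have "((\<lambda>s. V s \<theta>) has_real_derivative ptau Q \<tau> \<theta> - exp (-2 * p \<tau> \<theta>) * r \<theta>) (at \<tau>)"
      unfolding V_def using has_ptau[OF smooth_Q UNIV_I, of \<theta> \<tau>] dp[of \<theta> \<tau>]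
      by (auto intro!: derivative_eq_intros simp: field_simps)
    moreover have "ptau Q \<tau> \<theta> = exp (-2 * p \<tau> \<theta>) * R \<tau> \<theta>"
      unfolding R_def by (simp flip: mult.assoc exp_add)
    ultimately show "exp (-2 * p \<tau> \<theta>) * (R \<tau> \<theta> - r \<theta>) = ptau V \<tau> \<theta>"
      by (intro ptauI[symmetric]) (simp add: algebra_simps)
  qed
  from exp_order_limit[OF I(1,2) smV this \<beta>] obtain q where q: "Cinf_on I q" "smooth_strip I (\<lambda>\<tau>. q)"
    "exp_order I T (- \<beta>) (\<lambda>\<tau> \<theta>. V \<tau> \<theta> - q \<theta>)" by blast
  have U: "exp_order I T (- (g / 8)) (\<lambda>\<tau> \<theta>. exp (2 * p \<tau> \<theta>) * (Q \<tau> \<theta> - q \<theta>) + r \<theta> / (2 * v \<theta>))"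
  proof (rule exp_order_cong[OF I(1) exp_order_mono[OF exp_order_mult[OF I(1) ep q(3)] _ T0]])
    \<comment> \<open>The uniform rates of exp (2 p) and exp (-2 p) fail to cancel by 4 \<delta>;
      with both losses the sum is 4 \<delta> - g/4.\<close>
    show "2 * (v\<^sub>0 + \<delta>) + \<mu> + - \<beta> \<le> - (g / 8)" using \<delta>g pos by (simp add: \<beta>_def \<mu>_def)
    fix \<tau> \<theta>
    have "exp (2 * p \<tau> \<theta>) * (exp (-2 * p \<tau> \<theta>) * x) = x" for x by (simp flip: mult.assoc exp_add)
    then show "exp (2 * p \<tau> \<theta>) * (V \<tau> \<theta> - q \<theta>) = exp (2 * p \<tau> \<theta>) * (Q \<tau> \<theta> - q \<theta>) + r \<theta> / (2 * v \<theta>)"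
      unfolding V_def by (simp add: ring_distribs)
  qed
  show ?thesis
  proof (intro exI conjI)
    show "Cinf_on I v" "Cinf_on I \<phi>" "Cinf_on I q" "Cinf_on I r" by fact+
    show "\<forall>\<theta>\<in>I. g \<le> v \<theta> \<and> v \<theta> \<le> 1 - g" using vb v0 by (fastforce simp: abs_le_iff)
    show "exp_order I T (- (g / 8)) (\<lambda>t \<theta>. ptau P t \<theta> - v \<theta>)" by (rule exp_order_mono[OF v(3) _ T0]) (use pos in simp)
    show "exp_order I T (- (g / 8)) (\<lambda>t \<theta>. P t \<theta> - (v \<theta> * t + \<phi> \<theta>))"
      by (rule exp_order_mono[OF W[unfolded W_def[abs_def] p_def] _ T0]) (use pos in simp)
    show "exp_order I T (- (g / 8)) (\<lambda>t \<theta>. exp (2 * (v \<theta> * t + \<phi> \<theta>)) * ptau Q t \<theta> - r \<theta>)"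
      by (rule exp_order_mono[OF r(3)[unfolded R_def p_def] _ T0]) (use pos in simp)
    show "exp_order I T (- (g / 8)) (\<lambda>t \<theta>. exp (2 * (v \<theta> * t + \<phi> \<theta>)) * (Q t \<theta> - q \<theta>) + r \<theta> / (2 * v \<theta>))"
      using U unfolding p_def .
  qed
qed

end

subsection \<open>The light cone of a point\<close>

text \<open>At the last point with f \<ge> c before a violation, f equals c and has positive
  derivative, so f exceeds c just afterwards. The sign of the derivative matters only at the level c
  itself.\<close>

lemma barrier:
  fixes f f' :: "real \<Rightarrow> real"
  assumes d: "\<And>x. p \<le> x \<Longrightarrow> x \<le> q \<Longrightarrow> (f has_real_derivative f' x) (at x)"
    and up: "\<And>x. p \<le> x \<Longrightarrow> x \<le> q \<Longrightarrow> f x = c \<Longrightarrow> f' x > 0"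
    and "f p \<ge> c" "p \<le> y" "y \<le> q"
  shows "f y \<ge> c"
proof (rule ccontr)
  assume "\<not> f y \<ge> c"
  then have y: "f y < c" by simp
  define A where "A = {x\<in>{p..y}. c \<le> f x}"
  have "isCont f x" if "x \<in> {p..y}" for x using d[of x] that assms(5) DERIV_isCont by auto
  then have cont: "continuous_on {p..y} f" by (intro continuous_at_imp_continuous_on) blast
  have "A = {p..y} \<inter> f -` {c..}" by (auto simp: A_def)
  then have "closed A" using continuous_closed_preimage[OF cont closed_atLeastAtMost closed_atLeast] by simp
  moreover have "bounded A" unfolding A_def by (rule bounded_subset[of "{p..y}"]) auto
  moreover have "p \<in> A" using assms by (simp add: A_def)
  ultimately have "\<exists>x0\<in>A. \<forall>x\<in>A. x \<le> x0"
    using compact_attains_sup[of A] by (auto simp: compact_eq_bounded_closed)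
  then obtain x0 where x0: "x0 \<in> A" "\<And>x. x \<in> A \<Longrightarrow> x \<le> x0" by blast
  have x0y: "p \<le> x0" "x0 < y" using x0(1) y by (auto simp: A_def less_le)
  have less: "f x < c" if "x0 < x" "x \<le> y" for x
    using x0(2)[of x] that x0y by (force simp: A_def)
  have "f x0 \<le> c"
  proof (rule ccontr)
    assume "\<not> f x0 \<le> c"
    then have "\<exists>x\<ge>x0. x \<le> y \<and> f x = c"
      using IVT2'[of f y c x0] y x0y continuous_on_subset[OF cont, of "{x0..y}"] by auto
    then obtain x where "x0 \<le> x" "x \<le> y" "f x = c" by blast
    then show False using less[of x] \<open>\<not> f x0 \<le> c\<close> by (cases "x = x0") auto
  qed
  then have eq: "f x0 = c" using x0(1) by (simp add: A_def)
  obtain e where e: "e > 0" "\<And>h. 0 < h \<Longrightarrow> h < e \<Longrightarrow> f x0 < f (x0 + h)"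
    using DERIV_pos_inc_right[OF d up[OF _ _ eq]] x0y assms(5) by force
  define h where "h = min (e / 2) (y - x0)"
  have "0 < h" "h < e" "x0 + h \<le> y" using e(1) x0y by (auto simp: h_def)
  then show False using e(2)[of h] less[of "x0 + h"] eq by simp
qed

locale gowdy_cone = gowdy_frame +
  fixes \<theta>\<^sub>0 :: real
begin

text \<open>The slice at time \<tau> of the past light cone whose tip is at infinite time over
  \<open>\<theta>\<^sub>0\<close>.\<close>

definition "pcone \<tau> = {\<theta>. \<bar>\<theta> - \<theta>\<^sub>0\<bar> \<le> exp (-\<tau>)}"

lemma pcone_iff: "\<theta> \<in> pcone \<tau> \<longleftrightarrow> \<bar>\<theta> - \<theta>\<^sub>0\<bar> \<le> 0 + exp (-\<tau>)"
  by (simp add: pcone_def)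

lemma pcone_center: "\<theta>\<^sub>0 \<in> pcone \<tau>"
  by (simp add: pcone_def)

lemma pcone_path:
  assumes "\<theta> \<in> pcone \<tau>" "s \<le> \<tau>" "\<sigma> \<in> {1, -1}"
  shows "\<theta> + \<sigma> * (exp (-\<tau>) - exp (-s)) \<in> pcone s"
  unfolding pcone_iff by (rule char_path_bound) (use assms in \<open>auto simp: pcone_iff\<close>)

text \<open>A is the squared length of a characteristic derivative and independent of the frame.
  When a and b come from P and Q, \<open>Kq\<close> is four times the squared length of exp
  (-\<tau>) times the \<theta>-derivative.\<close>

definition "A \<sigma> \<tau> \<theta> = (a \<sigma> \<tau> \<theta>)\<^sup>2 + (b \<sigma> \<tau> \<theta>)\<^sup>2"
definition "Kq \<tau> \<theta> = (a 1 \<tau> \<theta> - a (-1) \<tau> \<theta>)\<^sup>2 + (b 1 \<tau> \<theta> - b (-1) \<tau> \<theta>)\<^sup>2"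

lemma A_nonneg: "A \<sigma> \<tau> \<theta> \<ge> 0" and Kq_nonneg: "Kq \<tau> \<theta> \<ge> 0"
  by (simp_all add: A_def Kq_def)

lemma smooth_A: "smooth_strip UNIV (A \<sigma>)" and smooth_Kq: "smooth_strip UNIV Kq"
  unfolding A_def[abs_def] Kq_def[abs_def]
  by (intro smooth_strip_add smooth_strip_power smooth_strip_diff smooth_a smooth_b open_UNIV)+

lemma Kq_eq: "\<sigma> \<in> {1, -1} \<Longrightarrow> Kq \<tau> \<theta> = (a \<sigma> \<tau> \<theta> - a (-\<sigma>) \<tau> \<theta>)\<^sup>2 + (b \<sigma> \<tau> \<theta> - b (-\<sigma>) \<tau> \<theta>)\<^sup>2"
  by (auto simp: Kq_def power2_commute)

text \<open>The rotation drops out of the length. What remains is - x.(x - y) = - |x|^2 / 2 + |y|^2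
  / 2 - |x - y|^2 / 2 for the vectors x, y of the two families; the last term is the one that later
  forces them together.\<close>

lemma char_A:
  assumes "\<sigma> \<in> {1, -1}"
  shows "char_deriv (-\<sigma>) (A \<sigma>) \<tau> \<theta> (- A \<sigma> \<tau> \<theta> / 2 + A (-\<sigma>) \<tau> \<theta> / 2 - Kq \<tau> \<theta> / 2)"
proof -
  have "char_deriv (-\<sigma>) (A \<sigma>) \<tau> \<theta> (2 * a \<sigma> \<tau> \<theta> * Dchar (-\<sigma>) (a \<sigma>) \<tau> \<theta> + 2 * b \<sigma> \<tau> \<theta> * Dchar (-\<sigma>) (b \<sigma>) \<tau> \<theta>)"
    using char_deriv_Dchar[OF smooth_a, of "-\<sigma>" \<sigma> \<tau> \<theta>] char_deriv_Dchar[OF smooth_b, of "-\<sigma>" \<sigma> \<tau> \<theta>]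
    unfolding char_deriv_def A_def by (auto intro!: derivative_eq_intros)
  also have "2 * a \<sigma> \<tau> \<theta> * Dchar (-\<sigma>) (a \<sigma>) \<tau> \<theta> + 2 * b \<sigma> \<tau> \<theta> * Dchar (-\<sigma>) (b \<sigma>) \<tau> \<theta> =
      - A \<sigma> \<tau> \<theta> / 2 + A (-\<sigma>) \<tau> \<theta> / 2 - Kq \<tau> \<theta> / 2"
    unfolding a_eq[OF assms] b_eq[OF assms] Kq_eq[OF assms] A_def
    by (simp add: field_simps power2_eq_square)
  finally show ?thesis .
qed

text \<open>Along its characteristic A relaxes towards the value for the other family, so constants
  are barriers.\<close>

lemma A_mono:
  assumes m: "m > 0" and init: "\<And>\<sigma> \<theta>. \<sigma> \<in> {1, -1} \<Longrightarrow> \<theta> \<in> pcone T \<Longrightarrow> A \<sigma> T \<theta> \<le> m"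
    and "\<sigma> \<in> {1, -1}" "T \<le> \<tau>" "\<theta> \<in> pcone \<tau>"
  shows "A \<sigma> \<tau> \<theta> \<le> m"
proof (rule char_comparison[where X = A and N = "{1, -1}" and sg = "\<lambda>i. - i" and \<mu> = "1/2"
      and T = T and \<eta> = 0 and \<theta>\<^sub>0 = \<theta>\<^sub>0 and ?T2.0 = \<tau> and B = "\<lambda>_ _. m" and B' = "\<lambda>_ _. 0"])
  fix s t x S :: real
  assume *: "s \<in> {1, -1}" "S \<ge> 1" "\<And>j. j \<in> {1, -1} \<Longrightarrow> A j t x \<le> S * m"
  have "A (-s) t x \<le> S * m" using *(1) *(3)[of "-s"] by auto
  then have "(- A s t x / 2 + A (-s) t x / 2 - Kq t x / 2) + 1/2 * A s t x \<le> S * (0 + 1/2 * m)"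
    using Kq_nonneg[of t x] by (simp add: field_simps)
  then show "\<exists>d. char_deriv (- s) (A s) t x d \<and> d + 1/2 * A s t x \<le> S * (0 + 1/2 * m)"
    using char_A[OF *(1)] by blast
next
  show "continuous_on UNIV (\<lambda>p. A s (fst p) (snd p))" for s
    using smooth_strip_continuous[OF smooth_A] by simp
qed (use assms in \<open>auto simp: pcone_iff\<close>)

lemma pcone_bounded:
  assumes "smooth_strip UNIV F"
  shows "\<exists>M. \<forall>x\<in>pcone T. \<bar>F T x\<bar> \<le> M"
proof -
  have "pcone T = {\<theta>\<^sub>0 - exp (-T)..\<theta>\<^sub>0 + exp (-T)}" by (auto simp: pcone_def)
  then show ?thesis
    using compact_imp_bounded[OF compact_continuous_image[OF continuous_on_subset[OF
        smooth_strip_cont_section(1)[OF assms, of T] subset_UNIV]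
        compact_Icc[of "\<theta>\<^sub>0 - exp (-T)" "\<theta>\<^sub>0 + exp (-T)"]]]
    unfolding bounded_iff by (auto simp del: atLeastAtMost_iff)
qed

text \<open>The covariant derivative of the frame components in the direction of theta: the
  connection term is what removes the quadratic terms that are not under control.\<close>

definition "\<omega> \<tau> \<theta> = exp \<tau> * (b 1 \<tau> \<theta> - b (-1) \<tau> \<theta>) / 2"
definition "\<kappa> \<tau> \<theta> = exp \<tau> * (a (-1) \<tau> \<theta> * b 1 \<tau> \<theta> - a 1 \<tau> \<theta> * b (-1) \<tau> \<theta>) / 2"
definition "Y \<sigma> \<tau> \<theta> = ptheta (a \<sigma>) \<tau> \<theta> - \<omega> \<tau> \<theta> * b \<sigma> \<tau> \<theta>"
definition "Z \<sigma> \<tau> \<theta> = ptheta (b \<sigma>) \<tau> \<theta> + \<omega> \<tau> \<theta> * a \<sigma> \<tau> \<theta>"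

text \<open>\<open>\<omega>\<close> is the connection in the direction \<theta> and
  \<open>b (-\<sigma>)\<close> the connection along the characteristic; the difference of their
  cross derivatives is the curvature \<open>\<kappa>\<close>, the same for both families. As the
  target has constant curvature, \<open>\<kappa>\<close> is quadratic in a and b and contains no
  further derivatives.\<close>

lemma char_\<omega>:
  assumes "\<sigma> \<in> {1, -1}"
  shows "char_deriv (-\<sigma>) \<omega> \<tau> \<theta> (\<kappa> \<tau> \<theta> + ptheta (b (-\<sigma>)) \<tau> \<theta>)"
proof -
  have 1: "Dchar (-\<sigma>) (b (-\<sigma>)) \<tau> \<theta> = Dchar \<sigma> (b (-\<sigma>)) \<tau> \<theta> - 2 * \<sigma> * exp (-\<tau>) * ptheta (b (-\<sigma>)) \<tau> \<theta>"
    by (simp add: Dchar_def)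
  have 2: "Dchar \<sigma> (b (-\<sigma>)) \<tau> \<theta> = - a (-\<sigma>) \<tau> \<theta> * b \<sigma> \<tau> \<theta> - (b (-\<sigma>) \<tau> \<theta> - b \<sigma> \<tau> \<theta>) / 2"
    using b_eq[of "-\<sigma>" \<tau> \<theta>] assms by auto
  have "char_deriv (-\<sigma>) \<omega> \<tau> \<theta> (exp \<tau> * (b 1 \<tau> \<theta> - b (-1) \<tau> \<theta>) / 2 + exp \<tau> * (Dchar (-\<sigma>) (b 1) \<tau> \<theta> - Dchar (-\<sigma>) (b (-1)) \<tau> \<theta>) / 2)"
    using char_deriv_Dchar[OF smooth_b, of "-\<sigma>" 1 \<tau> \<theta>] char_deriv_Dchar[OF smooth_b, of "-\<sigma>" "-1" \<tau> \<theta>]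
    unfolding char_deriv_def \<omega>_def by (auto intro!: derivative_eq_intros simp: field_simps)
  also have "exp \<tau> * (b 1 \<tau> \<theta> - b (-1) \<tau> \<theta>) / 2 + exp \<tau> * (Dchar (-\<sigma>) (b 1) \<tau> \<theta> - Dchar (-\<sigma>) (b (-1)) \<tau> \<theta>) / 2
      = \<kappa> \<tau> \<theta> + ptheta (b (-\<sigma>)) \<tau> \<theta>"
  proof -
    have e: "exp \<tau> * (exp (-\<tau>) * u) = u" for u by (simp flip: mult.assoc exp_add)
    have s: "Dchar (-\<sigma>) (b 1) \<tau> \<theta> - Dchar (-\<sigma>) (b (-1)) \<tau> \<theta> = \<sigma> * (Dchar (-\<sigma>) (b \<sigma>) \<tau> \<theta> - Dchar (-\<sigma>) (b (-\<sigma>)) \<tau> \<theta>)"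
      using assms by auto
    have "exp \<tau> * (b 1 \<tau> \<theta> - b (-1) \<tau> \<theta> + (Dchar (-\<sigma>) (b 1) \<tau> \<theta> - Dchar (-\<sigma>) (b (-1)) \<tau> \<theta>)) =
        exp \<tau> * (a (-1) \<tau> \<theta> * b 1 \<tau> \<theta> - a 1 \<tau> \<theta> * b (-1) \<tau> \<theta>) + 2 * (exp \<tau> * (exp (-\<tau>) * ptheta (b (-\<sigma>)) \<tau> \<theta>))"
      unfolding s 1 2 b_eq[OF assms] using assms by (auto simp: field_simps)
    then show ?thesis unfolding e \<kappa>_def by (simp add: field_simps)
  qed
  finally show ?thesis .
qed

lemma Dchar_ptheta:
  assumes "smooth_strip UNIV F" shows "Dchar \<sigma> (ptheta F) \<tau> \<theta> = ptheta (Dchar \<sigma> F) \<tau> \<theta>"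
  using Dchar_ptheta_iter[OF open_UNIV assms UNIV_I, of \<sigma> 1] by simp

text \<open>With \<open>char_Z\<close> this is the frame system for Y + i Z, plus the curvature term
  \<open>i \<kappa> (a \<sigma> + i b \<sigma>)\<close> from commuting the two covariant
  derivatives. All products of b with \<theta>-derivatives are hidden in the rotation.\<close>

lemma char_Y:
  assumes "\<sigma> \<in> {1, -1}"
  shows "char_deriv (-\<sigma>) (Y \<sigma>) \<tau> \<theta> (b (-\<sigma>) \<tau> \<theta> * Z \<sigma> \<tau> \<theta> - (Y \<sigma> \<tau> \<theta> - Y (-\<sigma>) \<tau> \<theta>) / 2 - \<kappa> \<tau> \<theta> * b \<sigma> \<tau> \<theta>)"
proof -
  have "Dchar (-\<sigma>) (a \<sigma>) = (\<lambda>\<tau> \<theta>. b \<sigma> \<tau> \<theta> * b (-\<sigma>) \<tau> \<theta> - (a \<sigma> \<tau> \<theta> - a (-\<sigma>) \<tau> \<theta>) / 2)"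
    by (intro ext a_eq assms)
  then have D: "Dchar (-\<sigma>) (ptheta (a \<sigma>)) \<tau> \<theta> = b \<sigma> \<tau> \<theta> * ptheta (b (-\<sigma>)) \<tau> \<theta> + ptheta (b \<sigma>) \<tau> \<theta> * b (-\<sigma>) \<tau> \<theta>
      - (ptheta (a \<sigma>) \<tau> \<theta> - ptheta (a (-\<sigma>)) \<tau> \<theta>) / 2"
    unfolding Dchar_ptheta[OF smooth_a]
    using has_ptheta[OF smooth_b UNIV_I, of \<sigma> \<tau> \<theta>] has_ptheta[OF smooth_b UNIV_I, of "-\<sigma>" \<tau> \<theta>]
      has_ptheta[OF smooth_a UNIV_I, of \<sigma> \<tau> \<theta>] has_ptheta[OF smooth_a UNIV_I, of "-\<sigma>" \<tau> \<theta>]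
    by (intro pthetaI) (auto intro!: derivative_eq_intros)
  have "char_deriv (-\<sigma>) (Y \<sigma>) \<tau> \<theta> (Dchar (-\<sigma>) (ptheta (a \<sigma>)) \<tau> \<theta>
      - ((\<kappa> \<tau> \<theta> + ptheta (b (-\<sigma>)) \<tau> \<theta>) * b \<sigma> \<tau> \<theta> + \<omega> \<tau> \<theta> * Dchar (-\<sigma>) (b \<sigma>) \<tau> \<theta>))"
    using char_deriv_Dchar[OF smooth_strip_ptheta[OF smooth_a], of "-\<sigma>" \<sigma> \<tau> \<theta>] char_\<omega>[OF assms, of \<tau> \<theta>]
      char_deriv_Dchar[OF smooth_b, of "-\<sigma>" \<sigma> \<tau> \<theta>]
    unfolding char_deriv_def Y_def by (auto intro!: derivative_eq_intros)
  also have "Dchar (-\<sigma>) (ptheta (a \<sigma>)) \<tau> \<theta>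
      - ((\<kappa> \<tau> \<theta> + ptheta (b (-\<sigma>)) \<tau> \<theta>) * b \<sigma> \<tau> \<theta> + \<omega> \<tau> \<theta> * Dchar (-\<sigma>) (b \<sigma>) \<tau> \<theta>) =
      b (-\<sigma>) \<tau> \<theta> * Z \<sigma> \<tau> \<theta> - (Y \<sigma> \<tau> \<theta> - Y (-\<sigma>) \<tau> \<theta>) / 2 - \<kappa> \<tau> \<theta> * b \<sigma> \<tau> \<theta>"
    unfolding D b_eq[OF assms] Y_def Z_def by (simp add: field_simps)
  finally show ?thesis .
qed

lemma char_Z:
  assumes "\<sigma> \<in> {1, -1}"
  shows "char_deriv (-\<sigma>) (Z \<sigma>) \<tau> \<theta> (- b (-\<sigma>) \<tau> \<theta> * Y \<sigma> \<tau> \<theta> - (Z \<sigma> \<tau> \<theta> - Z (-\<sigma>) \<tau> \<theta>) / 2 + \<kappa> \<tau> \<theta> * a \<sigma> \<tau> \<theta>)"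
proof -
  have "Dchar (-\<sigma>) (b \<sigma>) = (\<lambda>\<tau> \<theta>. - a \<sigma> \<tau> \<theta> * b (-\<sigma>) \<tau> \<theta> - (b \<sigma> \<tau> \<theta> - b (-\<sigma>) \<tau> \<theta>) / 2)"
    by (intro ext b_eq assms)
  then have D: "Dchar (-\<sigma>) (ptheta (b \<sigma>)) \<tau> \<theta> = - a \<sigma> \<tau> \<theta> * ptheta (b (-\<sigma>)) \<tau> \<theta> - ptheta (a \<sigma>) \<tau> \<theta> * b (-\<sigma>) \<tau> \<theta>
      - (ptheta (b \<sigma>) \<tau> \<theta> - ptheta (b (-\<sigma>)) \<tau> \<theta>) / 2"
    unfolding Dchar_ptheta[OF smooth_b]
    using has_ptheta[OF smooth_b UNIV_I, of \<sigma> \<tau> \<theta>] has_ptheta[OF smooth_b UNIV_I, of "-\<sigma>" \<tau> \<theta>]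
      has_ptheta[OF smooth_a UNIV_I, of \<sigma> \<tau> \<theta>]
    by (intro pthetaI) (auto intro!: derivative_eq_intros)
  have "char_deriv (-\<sigma>) (Z \<sigma>) \<tau> \<theta> (Dchar (-\<sigma>) (ptheta (b \<sigma>)) \<tau> \<theta>
      + ((\<kappa> \<tau> \<theta> + ptheta (b (-\<sigma>)) \<tau> \<theta>) * a \<sigma> \<tau> \<theta> + \<omega> \<tau> \<theta> * Dchar (-\<sigma>) (a \<sigma>) \<tau> \<theta>))"
    using char_deriv_Dchar[OF smooth_strip_ptheta[OF smooth_b], of "-\<sigma>" \<sigma> \<tau> \<theta>] char_\<omega>[OF assms, of \<tau> \<theta>]
      char_deriv_Dchar[OF smooth_a, of "-\<sigma>" \<sigma> \<tau> \<theta>]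
    unfolding char_deriv_def Z_def by (auto intro!: derivative_eq_intros)
  also have "Dchar (-\<sigma>) (ptheta (b \<sigma>)) \<tau> \<theta>
      + ((\<kappa> \<tau> \<theta> + ptheta (b (-\<sigma>)) \<tau> \<theta>) * a \<sigma> \<tau> \<theta> + \<omega> \<tau> \<theta> * Dchar (-\<sigma>) (a \<sigma>) \<tau> \<theta>) =
      - b (-\<sigma>) \<tau> \<theta> * Y \<sigma> \<tau> \<theta> - (Z \<sigma> \<tau> \<theta> - Z (-\<sigma>) \<tau> \<theta>) / 2 + \<kappa> \<tau> \<theta> * a \<sigma> \<tau> \<theta>"
    unfolding D a_eq[OF assms] Y_def Z_def by (simp add: field_simps)
  finally show ?thesis .
qed

lemma smooth_YZ: "smooth_strip UNIV (Y \<sigma>)" "smooth_strip UNIV (Z \<sigma>)"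
proof -
  have "smooth_strip UNIV \<omega>" unfolding \<omega>_def[abs_def]
    by (intro smooth_strip_divide smooth_strip_mult smooth_strip_exp smooth_strip_time smooth_strip_diff smooth_strip_const smooth_b open_UNIV) simp
  then show "smooth_strip UNIV (Y \<sigma>)" "smooth_strip UNIV (Z \<sigma>)" unfolding Y_def[abs_def] Z_def[abs_def]
    by (intro smooth_strip_diff smooth_strip_add smooth_strip_mult smooth_strip_ptheta smooth_a smooth_b open_UNIV; assumption)+
qed

text \<open>The rotation cancels in the squared length; the weight exp (-\<tau>) adds damping and
  removes the factor exp \<tau> from \<open>\<kappa>\<close>. After the curvature term has taken its
  share, damping of rate 3/2 faces a coupling 1/2 to the other family and a source
  \<open>m ^ 3\<close>, so any constant B \<ge> \<open>m ^ 3\<close> above the initial values is a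
  barrier.\<close>

lemma YZ_bound:
  assumes m: "m \<ge> 1" and Am: "\<And>\<sigma> \<tau> \<theta>. \<sigma> \<in> {1, -1} \<Longrightarrow> 0 \<le> \<tau> \<Longrightarrow> \<theta> \<in> pcone \<tau> \<Longrightarrow> A \<sigma> \<tau> \<theta> \<le> m"
  shows "\<exists>B\<ge>1. \<forall>\<sigma>\<in>{1,-1}. \<forall>\<tau>\<ge>0. \<forall>\<theta>\<in>pcone \<tau>. (exp (-\<tau>) * Y \<sigma> \<tau> \<theta>)\<^sup>2 + (exp (-\<tau>) * Z \<sigma> \<tau> \<theta>)\<^sup>2 \<le> B"
proof -
  define X where "X \<sigma> \<tau> \<theta> = (exp (-\<tau>) * Y \<sigma> \<tau> \<theta>)\<^sup>2 + (exp (-\<tau>) * Z \<sigma> \<tau> \<theta>)\<^sup>2" for \<sigma> \<tau> \<theta>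
  have smX: "smooth_strip UNIV (X \<sigma>)" for \<sigma> unfolding X_def[abs_def]
    by (intro smooth_strip_add smooth_strip_power smooth_strip_mult smooth_strip_exp smooth_strip_minus smooth_strip_time smooth_YZ open_UNIV)
  obtain M1 where M1: "\<forall>x\<in>pcone 0. \<bar>X 1 0 x\<bar> \<le> M1" using pcone_bounded[OF smX] by blast
  obtain M2 where M2: "\<forall>x\<in>pcone 0. \<bar>X (-1) 0 x\<bar> \<le> M2" using pcone_bounded[OF smX] by blast
  define B where "B = m ^ 3 + \<bar>M1\<bar> + \<bar>M2\<bar>"
  have m3: "m ^ 3 \<ge> 1" using m by (rule one_le_power)
  have B: "B \<ge> 1" "B \<ge> m ^ 3" using m3 by (auto simp: B_def)
  have "X \<sigma> \<tau> \<theta> \<le> B" if \<sigma>: "\<sigma> \<in> {1, -1}" and \<tau>: "0 \<le> \<tau>" and \<theta>: "\<theta> \<in> pcone \<tau>" for \<sigma> \<tau> \<theta>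
  proof (rule char_comparison[where X = X and N = "{1, -1}" and sg = "\<lambda>i. - i" and \<mu> = "3/2"
        and T = 0 and \<eta> = 0 and \<theta>\<^sub>0 = \<theta>\<^sub>0 and ?T2.0 = \<tau> and B = "\<lambda>_ _. B" and B' = "\<lambda>_ _. 0"])
    fix s t x S :: real
    assume s: "s \<in> {1, -1}" and t: "0 < t" and x: "\<bar>x - \<theta>\<^sub>0\<bar> \<le> 0 + exp (-t)" and S: "S \<ge> 1"
      and le: "\<And>j. j \<in> {1, -1} \<Longrightarrow> X j t x \<le> S * B"
    have ms: "- s \<in> {1, -1}" using s by auto
    have xc: "x \<in> pcone t" using x by (simp add: pcone_iff)
    define e where "e = exp (-t)"
    define y z ym zm where "y = e * Y s t x" and "z = e * Z s t x" and "ym = e * Y (-s) t x" and "zm = e * Z (-s) t x"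
    define k where "k = (a (-1) t x * b 1 t x - a 1 t x * b (-1) t x) / 2"
    have ek: "e * \<kappa> t x = k" unfolding e_def \<kappa>_def k_def by (simp add: exp_minus)
    let ?d = "2 * y * (- y + e * (b (-s) t x * Z s t x - (Y s t x - Y (-s) t x) / 2 - \<kappa> t x * b s t x))
      + 2 * z * (- z + e * (- b (-s) t x * Y s t x - (Z s t x - Z (-s) t x) / 2 + \<kappa> t x * a s t x))"
    have cd: "char_deriv (-s) (X s) t x ?d"
      using char_Y[OF s, of t x] char_Z[OF s, of t x]
      unfolding char_deriv_def X_def y_def z_def e_def
      by (auto intro!: derivative_eq_intros simp: field_simps power2_eq_square)
    have "?d = 2 * y * (- y + (b (-s) t x * z - (y - ym) / 2 - k * b s t x))
      + 2 * z * (- z + (- b (-s) t x * y - (z - zm) / 2 + k * a s t x))"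
      unfolding ek[symmetric] y_def z_def ym_def zm_def by (simp add: algebra_simps)
    also have "\<dots> = - 3 * (y\<^sup>2 + z\<^sup>2) + (y * ym + z * zm) + 2 * (k * (z * a s t x - y * b s t x))"
      by (simp add: field_simps power2_eq_square)
    finally have d: "?d = - 3 * (y\<^sup>2 + z\<^sup>2) + (y * ym + z * zm) + 2 * (k * (z * a s t x - y * b s t x))" .
    have X: "X s t x = y\<^sup>2 + z\<^sup>2" "X (-s) t x = ym\<^sup>2 + zm\<^sup>2" by (simp_all add: X_def y_def z_def ym_def zm_def e_def)
    have 1: "y * ym + z * zm \<le> (y\<^sup>2 + z\<^sup>2) / 2 + (ym\<^sup>2 + zm\<^sup>2) / 2"
      using sum_squares_bound[of y ym] sum_squares_bound[of z zm] by (simp add: field_simps)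
    have A1: "A 1 t x \<le> m" "A (-1) t x \<le> m" "A s t x \<le> m" using Am s t xc by auto
    have k: "k\<^sup>2 \<le> m\<^sup>2"
    proof -
      have "2 * k \<le> ((a (-1) t x)\<^sup>2 + (b 1 t x)\<^sup>2) / 2 + ((a 1 t x)\<^sup>2 + (b (-1) t x)\<^sup>2) / 2"
        using sum_squares_bound[of "a (-1) t x" "b 1 t x"] sum_squares_bound[of "- a 1 t x" "b (-1) t x"]
        by (simp add: k_def field_simps)
      moreover have "- 2 * k \<le> ((a (-1) t x)\<^sup>2 + (b 1 t x)\<^sup>2) / 2 + ((a 1 t x)\<^sup>2 + (b (-1) t x)\<^sup>2) / 2"
        using sum_squares_bound[of "- a (-1) t x" "b 1 t x"] sum_squares_bound[of "a 1 t x" "b (-1) t x"]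
        by (simp add: k_def field_simps)
      moreover have "\<bar>k\<bar> \<le> m"
        if "2 * k \<le> (p + q) / 2 + (r + u) / 2" "- 2 * k \<le> (p + q) / 2 + (r + u) / 2" "r + q \<le> m" "p + u \<le> m" for p q r u
        using that m by (simp add: abs_le_iff field_simps)
      ultimately have "\<bar>k\<bar> \<le> m" using A1(1,2) unfolding A_def by blast
      then show ?thesis using m by (simp add: abs_le_square_iff[symmetric])
    qed
    have "(z * a s t x - y * b s t x)\<^sup>2 \<le> (y\<^sup>2 + z\<^sup>2) * A s t x"
    proof -
      have "(y\<^sup>2 + z\<^sup>2) * A s t x - (z * a s t x - y * b s t x)\<^sup>2 = (y * a s t x + z * b s t x)\<^sup>2"
        by (simp add: A_def power2_eq_square algebra_simps)
      then show ?thesis by (metis diff_ge_0_iff_ge zero_le_power2)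
    qed
    also have "\<dots> \<le> (y\<^sup>2 + z\<^sup>2) * m" using A1 by (intro mult_left_mono) auto
    finally have q: "(z * a s t x - y * b s t x)\<^sup>2 / m \<le> y\<^sup>2 + z\<^sup>2" using m by (simp add: divide_le_eq)
    have "2 * (k * w) \<le> k\<^sup>2 * m + w\<^sup>2 / m" for w
    proof -
      have "k\<^sup>2 * m + w\<^sup>2 / m - 2 * (k * w) = (k * m - w)\<^sup>2 / m" using m by (simp add: field_simps power2_eq_square)
      moreover have "(k * m - w)\<^sup>2 / m \<ge> 0" using m by simp
      ultimately show ?thesis by linarith
    qed
    from this[of "z * a s t x - y * b s t x"] q
    have "2 * (k * (z * a s t x - y * b s t x)) \<le> k\<^sup>2 * m + (y\<^sup>2 + z\<^sup>2)" by linarith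
    also have "k\<^sup>2 * m \<le> m\<^sup>2 * m" using k m by (intro mult_right_mono) auto
    finally have 2: "2 * (k * (z * a s t x - y * b s t x)) \<le> m ^ 3 + (y\<^sup>2 + z\<^sup>2)"
      by (simp add: power3_eq_cube power2_eq_square)
    have "1 * B \<le> S * B" using B S by (intro mult_right_mono) auto
    then have "m ^ 3 \<le> S * B" using B by linarith
    then have "?d + 3/2 * X s t x \<le> S * (0 + 3/2 * B)"
      using le[OF ms] 1 2 unfolding d X by (simp add: field_simps)
    with cd show "\<exists>d. char_deriv (- s) (X s) t x d \<and> d + 3/2 * X s t x \<le> S * (0 + 3/2 * B)" by blast
  next
    fix s x assume "s \<in> {1, -1::real}" "\<bar>x - \<theta>\<^sub>0\<bar> \<le> 0 + exp (- 0)"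
    then have "\<bar>X s 0 x\<bar> \<le> \<bar>M1\<bar> + \<bar>M2\<bar>" using M1 M2 by (force simp: pcone_iff)
    then show "X s 0 x \<le> B" using m3 by (simp add: B_def)
  next
    show "continuous_on UNIV (\<lambda>p. X s (fst p) (snd p))" for s
      using smooth_strip_continuous[OF smX] by simp
  qed (use that B in \<open>auto simp: pcone_iff\<close>)
  then show ?thesis using B(1) unfolding X_def by blast
qed

end

lemma Dchar_eqI: "smooth_strip UNIV F \<Longrightarrow> char_deriv s F \<tau> \<theta> d \<Longrightarrow> Dchar s F \<tau> \<theta> = d"
  using char_deriv_Dchar[of F s \<tau> \<theta>] DERIV_unique unfolding char_deriv_def by blast

lemma abs_le_of_power2_le:
  fixes u m :: real
  assumes "u\<^sup>2 \<le> m" "1 \<le> m"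
  shows "\<bar>u\<bar> \<le> m"
proof -
  have "m * 1 \<le> m * m" by (rule mult_left_mono) (use assms(2) in auto)
  then have "m \<le> m\<^sup>2" by (simp only: power2_eq_square mult_1_right)
  with assms(1) have "u\<^sup>2 \<le> m\<^sup>2" by (rule order_trans)
  then show ?thesis using assms(2) by (simp add: abs_le_square_iff[symmetric])
qed

context gowdy_cone
begin

text \<open>The system gives the derivative of \<open>a \<sigma>\<close> only along the family
  -\<sigma>. Along its own family the derivative differs by 2 exp (-\<tau>) times a
  \<theta>-derivative, up to sign, and this is bounded by \<open>YZ_bound\<close>.\<close>

lemma cone_bounds:
  obtains m \<Lambda> where "m \<ge> 1" "\<Lambda> \<ge> 1"
    "\<And>\<sigma> \<tau> \<theta>. \<sigma> \<in> {1, -1} \<Longrightarrow> 0 \<le> \<tau> \<Longrightarrow> \<theta> \<in> pcone \<tau> \<Longrightarrow> A \<sigma> \<tau> \<theta> \<le> m"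
    "\<And>\<sigma> \<tau> \<theta>. \<sigma> \<in> {1, -1} \<Longrightarrow> 0 \<le> \<tau> \<Longrightarrow> \<theta> \<in> pcone \<tau> \<Longrightarrow> \<bar>a \<sigma> \<tau> \<theta>\<bar> \<le> m \<and> \<bar>b \<sigma> \<tau> \<theta>\<bar> \<le> m"
    "\<And>s \<sigma> \<tau> \<theta>. s \<in> {1, -1} \<Longrightarrow> \<sigma> \<in> {1, -1} \<Longrightarrow> 0 \<le> \<tau> \<Longrightarrow> \<theta> \<in> pcone \<tau> \<Longrightarrow>
       \<bar>Dchar s (A \<sigma>) \<tau> \<theta>\<bar> \<le> \<Lambda> \<and> \<bar>Dchar s Kq \<tau> \<theta>\<bar> \<le> \<Lambda> \<and>
       \<bar>ptheta (A \<sigma>) \<tau> \<theta>\<bar> \<le> \<Lambda> * exp \<tau> \<and> \<bar>ptheta Kq \<tau> \<theta>\<bar> \<le> \<Lambda> * exp \<tau>"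
proof -
  obtain M1 where M1: "\<forall>x\<in>pcone 0. \<bar>A 1 0 x\<bar> \<le> M1" using pcone_bounded[OF smooth_A] by blast
  obtain M2 where M2: "\<forall>x\<in>pcone 0. \<bar>A (-1) 0 x\<bar> \<le> M2" using pcone_bounded[OF smooth_A] by blast
  define m where "m = 1 + \<bar>M1\<bar> + \<bar>M2\<bar>"
  have m: "m \<ge> 1" by (simp add: m_def)
  have Am: "A \<sigma> \<tau> \<theta> \<le> m" if that: "\<sigma> \<in> {1, -1}" "0 \<le> \<tau>" "\<theta> \<in> pcone \<tau>" for \<sigma> \<tau> \<theta>
  proof (rule A_mono[OF _ _ that])
    show "A s 0 x \<le> m" if "s \<in> {1, -1}" "x \<in> pcone 0" for s x
      using M1 M2 that by (force simp: m_def)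
  qed (use m in simp)
  have ab: "\<bar>a \<sigma> \<tau> \<theta>\<bar> \<le> m" "\<bar>b \<sigma> \<tau> \<theta>\<bar> \<le> m" if "\<sigma> \<in> {1, -1}" "0 \<le> \<tau>" "\<theta> \<in> pcone \<tau>" for \<sigma> \<tau> \<theta>
    using Am[OF that] unfolding A_def
    by (auto intro!: abs_le_of_power2_le[OF _ m] intro: order_trans[rotated])
  obtain B where B: "B \<ge> 1" "\<And>\<sigma> \<tau> \<theta>. \<sigma> \<in> {1,-1} \<Longrightarrow> \<tau> \<ge> 0 \<Longrightarrow> \<theta> \<in> pcone \<tau> \<Longrightarrow> (exp (-\<tau>) * Y \<sigma> \<tau> \<theta>)\<^sup>2 + (exp (-\<tau>) * Z \<sigma> \<tau> \<theta>)\<^sup>2 \<le> B"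
    using YZ_bound[OF m Am] by blast
  define L0 where "L0 = B + m * m"
  define L1 where "L1 = m * m + m + 2 * L0"
  have L: "0 \<le> L0" "L0 \<le> L1" "1 \<le> L1" using B(1) m mult_mono[of 1 m 1 m] by (auto simp: L0_def L1_def)
  have pth: "\<bar>exp (-\<tau>) * ptheta (a \<sigma>) \<tau> \<theta>\<bar> \<le> L0" "\<bar>exp (-\<tau>) * ptheta (b \<sigma>) \<tau> \<theta>\<bar> \<le> L0"
    if *: "\<sigma> \<in> {1, -1}" "0 \<le> \<tau>" "\<theta> \<in> pcone \<tau>" for \<sigma> \<tau> \<theta>
  proof -
    have sq: "(exp (-\<tau>) * Y \<sigma> \<tau> \<theta>)\<^sup>2 \<le> B" "(exp (-\<tau>) * Z \<sigma> \<tau> \<theta>)\<^sup>2 \<le> B"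
      using B(2)[OF *] zero_le_power2[of "exp (-\<tau>) * Y \<sigma> \<tau> \<theta>"] zero_le_power2[of "exp (-\<tau>) * Z \<sigma> \<tau> \<theta>"] by linarith+
    note YZ = abs_le_of_power2_le[OF sq(1) B(1)] abs_le_of_power2_le[OF sq(2) B(1)]
    have om: "exp (-\<tau>) * \<omega> \<tau> \<theta> = (b 1 \<tau> \<theta> - b (-1) \<tau> \<theta>) / 2" by (simp add: \<omega>_def exp_minus)
    have "\<bar>exp (-\<tau>) * \<omega> \<tau> \<theta>\<bar> \<le> m" unfolding om using ab(2)[of 1] ab(2)[of "-1"] * by fastforce
    then have o: "\<bar>(exp (-\<tau>) * \<omega> \<tau> \<theta>) * b \<sigma> \<tau> \<theta>\<bar> \<le> m * m" "\<bar>(exp (-\<tau>) * \<omega> \<tau> \<theta>) * a \<sigma> \<tau> \<theta>\<bar> \<le> m * m"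
      unfolding abs_mult[of "exp (-\<tau>) * \<omega> \<tau> \<theta>"] using ab[OF *] m by (auto intro!: mult_mono)
    have "exp (-\<tau>) * ptheta (a \<sigma>) \<tau> \<theta> = exp (-\<tau>) * Y \<sigma> \<tau> \<theta> + (exp (-\<tau>) * \<omega> \<tau> \<theta>) * b \<sigma> \<tau> \<theta>"
      "exp (-\<tau>) * ptheta (b \<sigma>) \<tau> \<theta> = exp (-\<tau>) * Z \<sigma> \<tau> \<theta> - (exp (-\<tau>) * \<omega> \<tau> \<theta>) * a \<sigma> \<tau> \<theta>"
      by (simp_all add: Y_def Z_def algebra_simps)
    then show "\<bar>exp (-\<tau>) * ptheta (a \<sigma>) \<tau> \<theta>\<bar> \<le> L0" "\<bar>exp (-\<tau>) * ptheta (b \<sigma>) \<tau> \<theta>\<bar> \<le> L0"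
      using YZ o unfolding L0_def by linarith+
  qed
  have pth': "\<bar>ptheta (a \<sigma>) \<tau> \<theta>\<bar> \<le> L0 * exp \<tau>" "\<bar>ptheta (b \<sigma>) \<tau> \<theta>\<bar> \<le> L0 * exp \<tau>"
    if *: "\<sigma> \<in> {1, -1}" "0 \<le> \<tau>" "\<theta> \<in> pcone \<tau>" for \<sigma> \<tau> \<theta>
    using pth[OF *] by (simp_all add: abs_mult exp_minus field_simps)
  have D: "\<bar>Dchar s (a \<sigma>) \<tau> \<theta>\<bar> \<le> L1" "\<bar>Dchar s (b \<sigma>) \<tau> \<theta>\<bar> \<le> L1"
    if s: "s \<in> {1, -1}" and *: "\<sigma> \<in> {1, -1}" "0 \<le> \<tau>" "\<theta> \<in> pcone \<tau>" for s \<sigma> \<tau> \<theta>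
  proof -
    have **: "- \<sigma> \<in> {1, -1}" using * by auto
    have p: "\<bar>b \<sigma> \<tau> \<theta> * b (-\<sigma>) \<tau> \<theta>\<bar> \<le> m * m" "\<bar>a \<sigma> \<tau> \<theta> * b (-\<sigma>) \<tau> \<theta>\<bar> \<le> m * m"
      unfolding abs_mult using ab[OF *] ab[OF ** *(2,3)] m by (auto intro!: mult_mono)
    have d: "\<bar>Dchar (-\<sigma>) (a \<sigma>) \<tau> \<theta>\<bar> \<le> m * m + m" "\<bar>Dchar (-\<sigma>) (b \<sigma>) \<tau> \<theta>\<bar> \<le> m * m + m"
    proof -
      have d3: "\<bar>u - (x - y) / 2\<bar> \<le> c + e" if "\<bar>u\<bar> \<le> c" "\<bar>x\<bar> \<le> e" "\<bar>y\<bar> \<le> e" for u x y c e :: real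
        using that by (auto simp: abs_le_iff field_simps)
      show "\<bar>Dchar (-\<sigma>) (a \<sigma>) \<tau> \<theta>\<bar> \<le> m * m + m"
        unfolding a_eq[OF *(1)] by (rule d3[OF p(1) ab(1)[OF *] ab(1)[OF ** *(2,3)]])
      show "\<bar>Dchar (-\<sigma>) (b \<sigma>) \<tau> \<theta>\<bar> \<le> m * m + m"
        unfolding b_eq[OF *(1)] by (rule d3[OF _ ab(2)[OF *] ab(2)[OF ** *(2,3)]]) (use p(2) in simp)
    qed
    have e: "Dchar s F \<tau> \<theta> = Dchar (-\<sigma>) F \<tau> \<theta> + (s + \<sigma>) * (exp (-\<tau>) * ptheta F \<tau> \<theta>)" for F
      by (simp add: Dchar_def algebra_simps)
    have "\<bar>(s + \<sigma>) * u\<bar> \<le> 2 * L0" if "\<bar>u\<bar> \<le> L0" for u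
      unfolding abs_mult using that s * L by (intro mult_mono) auto
    from this[OF pth(1)[OF *]] this[OF pth(2)[OF *]]
    show "\<bar>Dchar s (a \<sigma>) \<tau> \<theta>\<bar> \<le> L1" "\<bar>Dchar s (b \<sigma>) \<tau> \<theta>\<bar> \<le> L1"
      unfolding e[of "a \<sigma>"] e[of "b \<sigma>"] L1_def using d by linarith+
  qed
  define \<Lambda> where "\<Lambda> = 16 * m * L1"
  have prod: "\<bar>2 * u * w\<bar> \<le> 2 * (c * e)" if "\<bar>u\<bar> \<le> c" "\<bar>w\<bar> \<le> e" for u w c e :: real
  proof -
    have "\<bar>u\<bar> * \<bar>w\<bar> \<le> c * e" using that by (intro mult_mono) auto
    then show ?thesis by (simp add: abs_mult)
  qed
  have mL: "1 * 1 \<le> m * L1" using m L by (intro mult_mono) auto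
  show thesis
  proof (rule that[OF m _ Am])
    show "\<Lambda> \<ge> 1" using mL by (simp add: \<Lambda>_def)
    show "\<bar>a \<sigma> \<tau> \<theta>\<bar> \<le> m \<and> \<bar>b \<sigma> \<tau> \<theta>\<bar> \<le> m" if "\<sigma> \<in> {1, -1}" "0 \<le> \<tau>" "\<theta> \<in> pcone \<tau>" for \<sigma> \<tau> \<theta>
      using ab[OF that] by blast
    fix s \<sigma> \<tau> \<theta> assume s: "s \<in> {1, -1::real}" and *: "\<sigma> \<in> {1, -1::real}" "0 \<le> \<tau>" "\<theta> \<in> pcone \<tau>"
    have dA: "Dchar s (A \<sigma>) \<tau> \<theta> = 2 * a \<sigma> \<tau> \<theta> * Dchar s (a \<sigma>) \<tau> \<theta> + 2 * b \<sigma> \<tau> \<theta> * Dchar s (b \<sigma>) \<tau> \<theta>"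
      using char_deriv_Dchar[OF smooth_a, of s \<sigma> \<tau> \<theta>] char_deriv_Dchar[OF smooth_b, of s \<sigma> \<tau> \<theta>]
      by (intro Dchar_eqI smooth_A) (auto simp: char_deriv_def A_def intro!: derivative_eq_intros)
    have dK: "Dchar s Kq \<tau> \<theta> = 2 * (a 1 \<tau> \<theta> - a (-1) \<tau> \<theta>) * (Dchar s (a 1) \<tau> \<theta> - Dchar s (a (-1)) \<tau> \<theta>)
        + 2 * (b 1 \<tau> \<theta> - b (-1) \<tau> \<theta>) * (Dchar s (b 1) \<tau> \<theta> - Dchar s (b (-1)) \<tau> \<theta>)"
      using char_deriv_Dchar[OF smooth_a, of s 1 \<tau> \<theta>] char_deriv_Dchar[OF smooth_b, of s 1 \<tau> \<theta>]
        char_deriv_Dchar[OF smooth_a, of s "-1" \<tau> \<theta>] char_deriv_Dchar[OF smooth_b, of s "-1" \<tau> \<theta>]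
      by (intro Dchar_eqI smooth_Kq) (auto simp: char_deriv_def Kq_def algebra_simps intro!: derivative_eq_intros)
    have pA: "ptheta (A \<sigma>) \<tau> \<theta> = 2 * a \<sigma> \<tau> \<theta> * ptheta (a \<sigma>) \<tau> \<theta> + 2 * b \<sigma> \<tau> \<theta> * ptheta (b \<sigma>) \<tau> \<theta>"
      using has_ptheta[OF smooth_a UNIV_I, of \<sigma> \<tau> \<theta>] has_ptheta[OF smooth_b UNIV_I, of \<sigma> \<tau> \<theta>]
      by (intro pthetaI) (auto simp: A_def intro!: derivative_eq_intros)
    have pK: "ptheta Kq \<tau> \<theta> = 2 * (a 1 \<tau> \<theta> - a (-1) \<tau> \<theta>) * (ptheta (a 1) \<tau> \<theta> - ptheta (a (-1)) \<tau> \<theta>)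
        + 2 * (b 1 \<tau> \<theta> - b (-1) \<tau> \<theta>) * (ptheta (b 1) \<tau> \<theta> - ptheta (b (-1)) \<tau> \<theta>)"
      using has_ptheta[OF smooth_a UNIV_I, of 1 \<tau> \<theta>] has_ptheta[OF smooth_b UNIV_I, of 1 \<tau> \<theta>]
        has_ptheta[OF smooth_a UNIV_I, of "-1" \<tau> \<theta>] has_ptheta[OF smooth_b UNIV_I, of "-1" \<tau> \<theta>]
      by (intro pthetaI) (auto simp: Kq_def algebra_simps intro!: derivative_eq_intros)
    have one: "1 \<in> {1, -1::real}" "-1 \<in> {1, -1::real}" by auto
    have d2: "\<bar>u - w\<bar> \<le> 2 * c" if "\<bar>u\<bar> \<le> c" "\<bar>w\<bar> \<le> c" for u w c :: real using that by linarith
    note da = d2[OF ab(1)[OF one(1) *(2,3)] ab(1)[OF one(2) *(2,3)]]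
    note db = d2[OF ab(2)[OF one(1) *(2,3)] ab(2)[OF one(2) *(2,3)]]
    note dDa = d2[OF D(1)[OF s one(1) *(2,3)] D(1)[OF s one(2) *(2,3)]]
    note dDb = d2[OF D(2)[OF s one(1) *(2,3)] D(2)[OF s one(2) *(2,3)]]
    note dpa = d2[OF pth'(1)[OF one(1) *(2,3)] pth'(1)[OF one(2) *(2,3)]]
    note dpb = d2[OF pth'(2)[OF one(1) *(2,3)] pth'(2)[OF one(2) *(2,3)]]
    have mL0: "m * (L0 * exp \<tau>) \<le> m * (L1 * exp \<tau>)" "0 \<le> m * (L1 * exp \<tau>)"
      using m L by (auto intro!: mult_left_mono mult_right_mono)
    have "\<bar>Dchar s (A \<sigma>) \<tau> \<theta>\<bar> \<le> \<Lambda>"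
      unfolding dA \<Lambda>_def using prod[OF ab(1)[OF *] D(1)[OF s *]] prod[OF ab(2)[OF *] D(2)[OF s *]] mL by linarith
    moreover have "\<bar>Dchar s Kq \<tau> \<theta>\<bar> \<le> \<Lambda>"
      unfolding dK \<Lambda>_def using prod[OF da dDa] prod[OF db dDb] by linarith
    moreover have "\<bar>ptheta (A \<sigma>) \<tau> \<theta>\<bar> \<le> 16 * (m * (L1 * exp \<tau>))"
      unfolding pA using prod[OF ab(1)[OF *] pth'(1)[OF *]] prod[OF ab(2)[OF *] pth'(2)[OF *]] mL0 by linarith
    moreover have "\<bar>ptheta Kq \<tau> \<theta>\<bar> \<le> 16 * (m * (L1 * exp \<tau>))"
      unfolding pK using prod[OF da dpa] prod[OF db dpb] mL0 by (simp add: mult_ac)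
    ultimately show "\<bar>Dchar s (A \<sigma>) \<tau> \<theta>\<bar> \<le> \<Lambda> \<and> \<bar>Dchar s Kq \<tau> \<theta>\<bar> \<le> \<Lambda> \<and>
       \<bar>ptheta (A \<sigma>) \<tau> \<theta>\<bar> \<le> \<Lambda> * exp \<tau> \<and> \<bar>ptheta Kq \<tau> \<theta>\<bar> \<le> \<Lambda> * exp \<tau>"
      by (simp add: \<Lambda>_def mult_ac)
  qed
qed

text \<open>M is the infimum of the bounds valid on some slice. By \<open>A_mono\<close> such a
  bound persists later, which gives the upper estimate; a slice lying below M by a fixed amount
  would itself provide a bound smaller than M.\<close>

lemma sup_limit:
  obtains M where "M \<ge> 0"
    "\<And>\<delta>. \<delta> > 0 \<Longrightarrow> \<exists>T\<ge>0. \<forall>\<tau>\<ge>T. \<forall>\<theta>\<in>pcone \<tau>. \<forall>\<sigma>\<in>{1,-1}. A \<sigma> \<tau> \<theta> \<le> M + \<delta>"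
    "\<And>\<delta> \<tau>. \<delta> > 0 \<Longrightarrow> \<tau> \<ge> 0 \<Longrightarrow> \<exists>\<theta>\<in>pcone \<tau>. \<exists>\<sigma>\<in>{1,-1}. A \<sigma> \<tau> \<theta> > M - \<delta>"
proof -
  obtain m where m: "m \<ge> 1" "\<And>\<sigma> \<tau> \<theta>. \<sigma> \<in> {1, -1} \<Longrightarrow> 0 \<le> \<tau> \<Longrightarrow> \<theta> \<in> pcone \<tau> \<Longrightarrow> A \<sigma> \<tau> \<theta> \<le> m"
    using cone_bounds by metis
  define S where "S = {m. m > 0 \<and> (\<exists>T\<ge>0. \<forall>\<sigma>\<in>{1,-1}. \<forall>\<theta>\<in>pcone T. A \<sigma> T \<theta> \<le> m)}"
  have mS: "m \<in> S" using m by (auto simp: S_def intro!: exI[of _ 0])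
  have bdd: "bdd_below S" by (rule bdd_belowI[of _ 0]) (auto simp: S_def)
  show thesis
  proof (rule that[of "Inf S"])
    show "Inf S \<ge> 0" using mS by (intro cInf_greatest) (auto simp: S_def)
    fix \<delta> :: real assume \<delta>: "\<delta> > 0"
    then obtain m' where m': "m' \<in> S" "m' < Inf S + \<delta>" using cInf_lessD[of S "Inf S + \<delta>"] mS by auto
    then obtain T where T: "T \<ge> 0" "\<And>\<sigma> \<theta>. \<sigma>\<in>{1,-1} \<Longrightarrow> \<theta>\<in>pcone T \<Longrightarrow> A \<sigma> T \<theta> \<le> m'" and "m' > 0" by (auto simp: S_def)
    have "A \<sigma> \<tau> \<theta> \<le> Inf S + \<delta>" if "\<tau> \<ge> T" "\<theta> \<in> pcone \<tau>" "\<sigma> \<in> {1, -1}" for \<sigma> \<tau> \<theta>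
      using A_mono[OF \<open>m' > 0\<close> T(2) that(3,1,2)] m'(2) by simp
    then show "\<exists>T\<ge>0. \<forall>\<tau>\<ge>T. \<forall>\<theta>\<in>pcone \<tau>. \<forall>\<sigma>\<in>{1,-1}. A \<sigma> \<tau> \<theta> \<le> Inf S + \<delta>" using T(1) by blast
    fix \<tau> :: real assume \<tau>: "\<tau> \<ge> 0"
    show "\<exists>\<theta>\<in>pcone \<tau>. \<exists>\<sigma>\<in>{1,-1}. A \<sigma> \<tau> \<theta> > Inf S - \<delta>"
    proof (rule ccontr)
      assume "\<not> ?thesis"
      then have *: "A \<sigma> \<tau> \<theta> \<le> Inf S - \<delta>" if "\<sigma> \<in> {1, -1}" "\<theta> \<in> pcone \<tau>" for \<sigma> \<theta> using that by force
      have "0 \<le> Inf S - \<delta>" using *[of 1 \<theta>\<^sub>0] pcone_center A_nonneg[of 1 \<tau> \<theta>\<^sub>0] by simp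
      moreover have "A \<sigma> \<tau> \<theta> \<le> Inf S - \<delta> / 2" if "\<sigma> \<in> {1, -1}" "\<theta> \<in> pcone \<tau>" for \<sigma> \<theta> using *[OF that] \<delta> by linarith
      ultimately have "Inf S - \<delta> / 2 \<in> S" unfolding S_def using \<delta> \<tau> by auto
      then show False using cInf_lower[OF _ bdd] \<delta> by fastforce
    qed
  qed
qed

text \<open>A point where \<open>A \<sigma>\<close> is within \<open>\<epsilon>\<close> of its supremum N forces the whole backward
  characteristic to be nearly extremal, because \<open>exp (s/2) * (N - A \<sigma>)\<close> is nondecreasing along it with
  derivative controlling the other quantities.\<close>

lemma deficit_propagation:
  assumes N: "\<And>\<sigma> \<tau> \<theta>. \<sigma> \<in> {1, -1} \<Longrightarrow> T \<le> \<tau> \<Longrightarrow> \<theta> \<in> pcone \<tau> \<Longrightarrow> A \<sigma> \<tau> \<theta> \<le> N"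
    and L: "L > 0" and \<Lambda>: "\<And>s \<sigma> \<tau> \<theta>. s \<in> {1, -1} \<Longrightarrow> \<sigma> \<in> {1, -1} \<Longrightarrow> T \<le> \<tau> \<Longrightarrow> \<theta> \<in> pcone \<tau> \<Longrightarrow>
       \<bar>Dchar s (A \<sigma>) \<tau> \<theta>\<bar> + \<bar>Dchar s Kq \<tau> \<theta>\<bar> \<le> L"
    and Nl: "\<And>\<tau> \<theta>. T \<le> \<tau> \<Longrightarrow> \<theta> \<in> pcone \<tau> \<Longrightarrow> N + Kq \<tau> \<theta> \<le> 2 * L * l"
    and \<sigma>: "\<sigma> \<in> {1, -1}" and l: "l > 0" and s: "T \<le> s" "s + l \<le> \<tau>" and \<theta>: "\<theta> \<in> pcone \<tau>" and e: "N - A \<sigma> \<tau> \<theta> \<le> e"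
  defines "x \<equiv> \<theta> + (-\<sigma>) * (exp (-\<tau>) - exp (-s))"
  shows "N - A \<sigma> s x \<le> exp ((\<tau> - s) / 2) * e"
    and "((N - A (-\<sigma>) s x) + Kq s x)\<^sup>2 \<le> 8 * L * exp ((\<tau> - s) / 2) * e"
proof -
  define w where "w r = \<theta> + (-\<sigma>) * (exp (-\<tau>) - exp (-r))" for r
  have ms: "- \<sigma> \<in> {1, -1}" using \<sigma> by auto
  have w: "w r \<in> pcone r" if "r \<le> \<tau>" for r unfolding w_def by (rule pcone_path[OF \<theta> that ms])
  define H where "H r = exp (r / 2) * (N - A \<sigma> r (w r))" for r
  define \<psi> where "\<psi> r = (N - A (-\<sigma>) r (w r)) + Kq r (w r)" for r
  have dA: "((\<lambda>r. A \<sigma> r (w r)) has_real_derivative - A \<sigma> r (w r) / 2 + A (-\<sigma>) r (w r) / 2 - Kq r (w r) / 2) (at r)" for r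
    unfolding w_def by (rule char_deriv_path, rule char_A[OF \<sigma>])
  have dH: "(H has_real_derivative exp (r / 2) * \<psi> r / 2) (at r)" for r
    unfolding H_def \<psi>_def using dA[of r] by (auto intro!: derivative_eq_intros simp: field_simps)
  have \<psi>0: "\<psi> r \<ge> 0" if "T \<le> r" "r \<le> \<tau>" for r
    using N[OF ms that(1) w[OF that(2)]] Kq_nonneg[of r "w r"] by (simp add: \<psi>_def)
  have mono: "H p \<le> H q" if "T \<le> p" "p \<le> q" "q \<le> \<tau>" for p q
    using that(2)
  proof (rule DERIV_nonneg_imp_nondecreasing)
    fix r assume "p \<le> r" "r \<le> q"
    then show "\<exists>y. (H has_real_derivative y) (at r) \<and> 0 \<le> y" using dH[of r] \<psi>0[of r] that by auto
  qed
  have Hend: "H \<tau> \<le> exp (\<tau> / 2) * e" using e by (simp add: H_def w_def)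
  have xw: "x = w s" by (simp add: x_def w_def)
  have sp: "exp (\<tau> / 2) = exp (s / 2) * exp ((\<tau> - s) / 2)" by (simp add: field_simps flip: exp_add)
  have st: "s \<le> \<tau>" using s l by simp
  have "H s \<le> exp (s / 2) * (exp ((\<tau> - s) / 2) * e)"
    using order_trans[OF mono[OF s(1) st order_refl] Hend] by (simp add: sp mult.assoc)
  then have "exp (s / 2) * (N - A \<sigma> s x) \<le> exp (s / 2) * (exp ((\<tau> - s) / 2) * e)"
    unfolding H_def xw .
  then show "N - A \<sigma> s x \<le> exp ((\<tau> - s) / 2) * e" by (simp only: mult_le_cancel_left_pos[OF exp_gt_zero])
  define y where "y = \<psi> s"
  have y0: "y \<ge> 0" unfolding y_def using \<psi>0 s(1) st by blast
  have "y \<le> 2 * L * l" using Nl[OF s(1) w[OF st]] A_nonneg[of "-\<sigma>" s "w s"] by (simp add: y_def \<psi>_def)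
  \<comment> \<open>\<psi> has Lipschitz constant L and so stays above y/2 for time h after s. Over
    that time H gains a multiple of h y, that is of \<open>y\<^sup>2 / L\<close>; the bound by 2 L l
    keeps s + h before \<tau>.\<close>
  define h where "h = y / (2 * L)"
  have h: "0 \<le> h" "h \<le> l" using y0 \<open>y \<le> 2 * L * l\<close> L by (auto simp: h_def divide_le_eq mult_ac)
  have "y\<^sup>2 \<le> 8 * L * exp ((\<tau> - s) / 2) * e"
  proof (cases "h = 0")
    case True
    then have "y = 0" using L by (simp add: h_def)
    moreover have "0 \<le> e" using e N[OF \<sigma> _ \<theta>] s st by auto
    ultimately show ?thesis using L by simp
  next
    case False
    then have hp: "h > 0" using h by simp
    have sh: "s + h \<le> \<tau>" using h s by simp
    obtain \<xi> where \<xi>: "s < \<xi>" "\<xi> < s + h" "H (s + h) - H s = (s + h - s) * (exp (\<xi> / 2) * \<psi> \<xi> / 2)"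
      using MVT2[of s "s + h" H "\<lambda>r. exp (r / 2) * \<psi> r / 2"] dH hp by auto
    have "norm (\<psi> \<xi> - \<psi> s) \<le> L * norm (\<xi> - s)"
    proof (rule field_differentiable_bound[of "{s..\<tau>}"])
      fix r assume r: "r \<in> {s..\<tau>}"
      have d1: "((\<lambda>r. A (-\<sigma>) r (w r)) has_real_derivative Dchar (-\<sigma>) (A (-\<sigma>)) r (w r)) (at r)"
        unfolding w_def by (rule char_deriv_path, rule char_deriv_Dchar[OF smooth_A])
      have d2: "((\<lambda>r. Kq r (w r)) has_real_derivative Dchar (-\<sigma>) Kq r (w r)) (at r)"
        unfolding w_def by (rule char_deriv_path, rule char_deriv_Dchar[OF smooth_Kq])
      have "(\<psi> has_real_derivative (0 - Dchar (-\<sigma>) (A (-\<sigma>)) r (w r)) + Dchar (-\<sigma>) Kq r (w r)) (at r)"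
        unfolding \<psi>_def by (intro DERIV_add DERIV_diff DERIV_const d1 d2)
      then show "(\<psi> has_field_derivative (0 - Dchar (-\<sigma>) (A (-\<sigma>)) r (w r)) + Dchar (-\<sigma>) Kq r (w r)) (at r within {s..\<tau>})"
        by (rule has_field_derivative_at_within)
      have "w r \<in> pcone r" "T \<le> r" using r s w by auto
      then show "norm ((0 - Dchar (-\<sigma>) (A (-\<sigma>)) r (w r)) + Dchar (-\<sigma>) Kq r (w r)) \<le> L"
        using \<Lambda>[OF ms ms, of r "w r"] by simp
    qed (use \<xi> sh st in auto)
    then have "\<bar>\<psi> \<xi> - y\<bar> \<le> L * (\<xi> - s)" using \<xi> by (simp add: y_def)
    also have "\<dots> \<le> L * h" using \<xi> L by (intro mult_left_mono) auto
    also have "L * h = y / 2" using L by (simp add: h_def)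
    finally have \<psi>\<xi>: "y / 2 \<le> \<psi> \<xi>" by linarith
    have "exp (s / 2) * (y / 2) \<le> exp (\<xi> / 2) * \<psi> \<xi>" using \<psi>\<xi> \<xi> y0 by (intro mult_mono) auto
    then have "h * (exp (s / 2) * (y / 2)) \<le> h * (exp (\<xi> / 2) * \<psi> \<xi>)" using h by (intro mult_left_mono) auto
    then have "h * (exp (s / 2) * (y / 2) / 2) \<le> H (s + h) - H s" using \<xi>(3) by simp
    also have "H (s + h) - H s \<le> H \<tau>"
    proof -
      have "H (s + h) \<le> H \<tau>" using mono[of "s + h" \<tau>] s h sh by simp
      moreover have "H s \<ge> 0" using N[OF \<sigma> s(1) w[OF st]] by (simp add: H_def)
      ultimately show ?thesis by simp
    qed
    also have "H \<tau> \<le> exp (s / 2) * (exp ((\<tau> - s) / 2) * e)" using Hend sp by simp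
    finally have "exp (s / 2) * (h * y / 4) \<le> exp (s / 2) * (exp ((\<tau> - s) / 2) * e)" by (simp add: mult_ac)
    then have "h * y / 4 \<le> exp ((\<tau> - s) / 2) * e" by (simp only: mult_le_cancel_left_pos[OF exp_gt_zero])
    then show ?thesis using L by (simp add: h_def power2_eq_square field_simps)
  qed
  then show "((N - A (-\<sigma>) s x) + Kq s x)\<^sup>2 \<le> 8 * L * exp ((\<tau> - s) / 2) * e"
    by (simp add: y_def \<psi>_def xw)
qed

text \<open>Every point of the cone at time s is close to one that is reached from a near-maximal point
  at time s + Lw by going backwards first along one family of characteristics and then along the other.\<close>

lemma cone_reach:
  fixes s l Lw \<tau> \<theta> \<theta>s \<sigma> :: real
  assumes \<sigma>: "\<sigma> \<in> {1, -1}" and l: "0 < l" "l \<le> 1" "2 * l \<le> \<tau> - s"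
    and \<theta>: "\<theta> \<in> pcone s" and \<theta>s: "\<theta>s \<in> pcone \<tau>"
  obtains r where "s + l \<le> r" "r + l \<le> \<tau>"
    "\<bar>\<theta> - (\<theta>s + (-\<sigma>) * (exp (-\<tau>) - exp (-r)) + \<sigma> * (exp (-r) - exp (-s)))\<bar> \<le> exp (-s) * (2 * l + 6 * exp (-(\<tau> - s)))"
proof -
  define E u where "E = exp (-s)" and "u = exp (-\<tau>)"
  have Eu: "0 < E" "0 < u" by (auto simp: E_def u_def)
  define y where "y = \<sigma> * (\<theta> - \<theta>s)"
  have "\<bar>\<theta> - \<theta>s\<bar> \<le> E + u" using \<theta> \<theta>s by (auto simp: pcone_def E_def u_def)
  then have yb: "\<bar>y\<bar> \<le> E + u" using \<sigma> by (auto simp: y_def)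
  define lo hi where "lo = 2 * (exp l * u) - u - E" and "hi = 2 * (exp (-l) * E) - E - u"
  have "exp l * u \<le> exp (-l) * E" unfolding E_def u_def using l(3) by (simp flip: exp_add)
  then have lohi: "lo \<le> hi" by (simp add: lo_def hi_def)
  \<comment> \<open>The two legs would end exactly at \<theta> for exp (-r) = (y + u + E) / 2.
    Clamping y to [lo, hi] makes both legs last at least l and is the only source of the
    error.\<close>
  define y' where "y' = max lo (min hi y)"
  have y': "lo \<le> y'" "y' \<le> hi" using lohi by (auto simp: y'_def)
  define q where "q = (y' + u + E) / 2"
  have q: "exp l * u \<le> q" "q \<le> exp (-l) * E" using y' by (auto simp: q_def lo_def hi_def)
  have q0: "q > 0" using q(1) Eu by (meson exp_gt_zero less_le_trans mult_pos_pos)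
  define r where "r = - ln q"
  have er: "exp (-r) = q" using q0 by (simp add: r_def)
  have r1: "r + l \<le> \<tau>"
  proof -
    have "exp (l - \<tau>) \<le> exp (-r)" using q(1) unfolding er u_def by (simp flip: exp_add)
    then show ?thesis by simp
  qed
  have r2: "s + l \<le> r"
  proof -
    have "exp (-r) \<le> exp (- l - s)" using q(2) unfolding er E_def by (simp flip: exp_add)
    then show ?thesis by simp
  qed
  have "\<bar>y - y'\<bar> \<le> 2 * ((1 - exp (-l)) * E) + 2 * (exp l * u)"
  proof -
    have "\<bar>y - max (2 * p - u - E) (min (2 * q' - E - u) y)\<bar> \<le> 2 * E - 2 * q' + 2 * p"
      if "q' \<le> E" "u \<le> p" "p \<le> q'" for p q'
      using that yb Eu by (auto simp: max_def min_def abs_le_iff)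
    moreover have "exp (-l) * E \<le> 1 * E" by (rule mult_right_mono) (use l Eu in auto)
    moreover have "1 * u \<le> exp l * u" by (rule mult_right_mono) (use l Eu in auto)
    ultimately have "\<bar>y - y'\<bar> \<le> 2 * E - 2 * (exp (-l) * E) + 2 * (exp l * u)"
      using \<open>exp l * u \<le> exp (-l) * E\<close> unfolding y'_def lo_def hi_def by simp
    then show ?thesis by (simp add: algebra_simps)
  qed
  also have "(1 - exp (-l)) * E \<le> l * E" using exp_ge_add_one_self[of "-l"] Eu by (intro mult_right_mono) auto
  also have "exp l * u \<le> 3 * u"
  proof (rule mult_right_mono)
    have "exp l \<le> exp 1" using l by simp
    then show "exp l \<le> 3" using exp_le by linarith
  qed (use Eu in simp)
  finally have "\<bar>y - y'\<bar> \<le> 2 * (l * E) + 2 * (3 * u)" by simp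
  moreover have "u = E * exp (-(\<tau> - s))" by (simp add: E_def u_def flip: exp_add)
  ultimately have yy: "\<bar>y - y'\<bar> \<le> E * (2 * l + 6 * exp (-(\<tau> - s)))" by (simp add: algebra_simps)
  have "\<theta> - (\<theta>s + (-\<sigma>) * (u - q) + \<sigma> * (q - E)) = \<sigma> * (y - y')"
    using \<sigma> by (auto simp: y_def q_def field_simps)
  then have "\<bar>\<theta> - (\<theta>s + (-\<sigma>) * (u - q) + \<sigma> * (q - E))\<bar> = \<bar>y - y'\<bar>" using \<sigma> by auto
  then show thesis using that[OF r2 r1] yy unfolding er u_def E_def by simp
qed

text \<open>A nearly maximal point at time s + Lw is followed back along two legs. The first leg
  makes the deficit of the other family small at the corner; the second transports that deficit, and
  at its end x2 both families are nearly maximal and \<open>Kq\<close> is small. The Lipschitz bound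
  at the scale exp (-s) then reaches every point of the slice.\<close>

lemma cone_smallness:
  obtains M where "M \<ge> 0"
    "\<And>\<epsilon>. \<epsilon> > 0 \<Longrightarrow> \<exists>T\<ge>0. \<forall>\<tau>\<ge>T. \<forall>\<theta>\<in>pcone \<tau>. Kq \<tau> \<theta> \<le> \<epsilon> \<and> (\<forall>\<sigma>\<in>{1,-1}. \<bar>A \<sigma> \<tau> \<theta> - M\<bar> \<le> \<epsilon>)"
    "\<And>\<delta> \<tau>. \<delta> > 0 \<Longrightarrow> \<tau> \<ge> 0 \<Longrightarrow> \<exists>\<theta>\<in>pcone \<tau>. \<exists>\<sigma>\<in>{1,-1}. A \<sigma> \<tau> \<theta> > M - \<delta>"
proof -
  obtain m \<Lambda> where m: "m \<ge> 1" "\<Lambda> \<ge> 1"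
    "\<And>\<sigma> \<tau> \<theta>. \<sigma> \<in> {1, -1} \<Longrightarrow> 0 \<le> \<tau> \<Longrightarrow> \<theta> \<in> pcone \<tau> \<Longrightarrow> A \<sigma> \<tau> \<theta> \<le> m"
    "\<And>\<sigma> \<tau> \<theta>. \<sigma> \<in> {1, -1} \<Longrightarrow> 0 \<le> \<tau> \<Longrightarrow> \<theta> \<in> pcone \<tau> \<Longrightarrow> \<bar>a \<sigma> \<tau> \<theta>\<bar> \<le> m \<and> \<bar>b \<sigma> \<tau> \<theta>\<bar> \<le> m"
    "\<And>s \<sigma> \<tau> \<theta>. s \<in> {1, -1} \<Longrightarrow> \<sigma> \<in> {1, -1} \<Longrightarrow> 0 \<le> \<tau> \<Longrightarrow> \<theta> \<in> pcone \<tau> \<Longrightarrow>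
       \<bar>Dchar s (A \<sigma>) \<tau> \<theta>\<bar> \<le> \<Lambda> \<and> \<bar>Dchar s Kq \<tau> \<theta>\<bar> \<le> \<Lambda> \<and>
       \<bar>ptheta (A \<sigma>) \<tau> \<theta>\<bar> \<le> \<Lambda> * exp \<tau> \<and> \<bar>ptheta Kq \<tau> \<theta>\<bar> \<le> \<Lambda> * exp \<tau>"
    using cone_bounds by blast
  obtain M where M: "M \<ge> 0"
    "\<And>\<delta>. \<delta> > 0 \<Longrightarrow> \<exists>T\<ge>0. \<forall>\<tau>\<ge>T. \<forall>\<theta>\<in>pcone \<tau>. \<forall>\<sigma>\<in>{1,-1}. A \<sigma> \<tau> \<theta> \<le> M + \<delta>"
    "\<And>\<delta> \<tau>. \<delta> > 0 \<Longrightarrow> \<tau> \<ge> 0 \<Longrightarrow> \<exists>\<theta>\<in>pcone \<tau>. \<exists>\<sigma>\<in>{1,-1}. A \<sigma> \<tau> \<theta> > M - \<delta>"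
    using sup_limit by blast
  have Kqm: "Kq \<tau> \<theta> \<le> 4 * m" if "0 \<le> \<tau>" "\<theta> \<in> pcone \<tau>" for \<tau> \<theta>
  proof -
    have "(u - w)\<^sup>2 \<le> 2 * u\<^sup>2 + 2 * w\<^sup>2" for u w :: real
    proof -
      have "2 * u\<^sup>2 + 2 * w\<^sup>2 - (u - w)\<^sup>2 = (u + w)\<^sup>2" by (simp add: power2_eq_square algebra_simps)
      then show ?thesis by (metis diff_ge_0_iff_ge zero_le_power2)
    qed
    from this[of "a 1 \<tau> \<theta>" "a (-1) \<tau> \<theta>"] this[of "b 1 \<tau> \<theta>" "b (-1) \<tau> \<theta>"]
    have "Kq \<tau> \<theta> \<le> 2 * A 1 \<tau> \<theta> + 2 * A (-1) \<tau> \<theta>" unfolding Kq_def A_def by (simp add: algebra_simps)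
    then show ?thesis using m(3)[of 1 \<tau> \<theta>] m(3)[of "-1" \<tau> \<theta>] that by simp
  qed
  have lip: "\<bar>F s x - F s x'\<bar> \<le> \<Lambda> * exp s * \<bar>x - x'\<bar>"
    if F: "smooth_strip UNIV F" and D: "\<And>y. y \<in> pcone s \<Longrightarrow> \<bar>ptheta F s y\<bar> \<le> \<Lambda> * exp s"
      and x: "x \<in> pcone s" "x' \<in> pcone s" for F s x x'
  proof -
    have c: "pcone s = {\<theta>\<^sub>0 - exp (-s)..\<theta>\<^sub>0 + exp (-s)}" by (auto simp: pcone_def)
    have "norm (F s x - F s x') \<le> (\<Lambda> * exp s) * norm (x - x')"
      by (rule field_differentiable_bound[of "pcone s" "F s" "ptheta F s"])
        (use x D has_ptheta[OF F UNIV_I] in \<open>auto simp: c intro: has_field_derivative_at_within\<close>)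
    then show ?thesis by simp
  qed
  have main: "\<exists>T\<ge>0. \<forall>\<tau>\<ge>T. \<forall>\<theta>\<in>pcone \<tau>. Kq \<tau> \<theta> \<le> \<epsilon> \<and> (\<forall>\<sigma>\<in>{1,-1}. \<bar>A \<sigma> \<tau> \<theta> - M\<bar> \<le> \<epsilon>)" if \<epsilon>: "\<epsilon> > 0" for \<epsilon>
  proof -
    \<comment> \<open>l and Lw make the two error terms of \<open>cone_reach\<close>, multiplied by
      \<Lambda>, at most \<epsilon>/8 each.\<close>
    define l where "l = min 1 (\<epsilon> / (16 * \<Lambda>))"
    have l: "0 < l" "l \<le> 1" "l \<le> \<epsilon> / (16 * \<Lambda>)" using \<epsilon> m by (auto simp: l_def)
    define Lw where "Lw = 2 + 48 * \<Lambda> / \<epsilon>"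
    have q48: "48 * \<Lambda> / \<epsilon> > 0" using m \<epsilon> by simp
    have Lw: "2 \<le> Lw" using q48 by (simp add: Lw_def)
    have eLw: "6 * exp (- Lw) \<le> \<epsilon> / (8 * \<Lambda>)"
    proof -
      have "48 * \<Lambda> / \<epsilon> \<le> exp Lw" using exp_ge_add_one_self[of Lw] by (simp add: Lw_def)
      then have "exp (- Lw) * (48 * \<Lambda> / \<epsilon>) \<le> exp (- Lw) * exp Lw" by (intro mult_left_mono) auto
      then have "exp (- Lw) * (48 * \<Lambda> / \<epsilon>) \<le> 1" by (simp flip: exp_add)
      then show ?thesis using m \<epsilon> by (simp add: field_simps)
    qed
    \<comment> \<open>Beyond the Lipschitz constant 2 \<Lambda>, L is enlarged until N + Kq \<le> 2
      L l, so that the short time used in \<open>deficit_propagation\<close> fits into a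
      leg.\<close>
    define L where "L = 2 * \<Lambda> + (M + 1 + 4 * m) / (2 * l)"
    have Lq: "(M + 1 + 4 * m) / (2 * l) > 0" using M(1) m l by simp
    have L: "L > 0" "2 * \<Lambda> \<le> L" "M + 1 + 4 * m \<le> 2 * L * l"
    proof -
      show "2 * \<Lambda> \<le> L" using Lq by (simp add: L_def)
      then show "L > 0" using m by linarith
      have "2 * L * l = 4 * \<Lambda> * l + (M + 1 + 4 * m)" using l by (simp add: L_def field_simps)
      then show "M + 1 + 4 * m \<le> 2 * L * l" using m l by simp
    qed
    define G where "G = exp (Lw / 2)"
    have G: "G \<ge> 1" using Lw by (simp add: G_def)
    \<comment> \<open>The constants are chosen backwards. e2 is the deficit allowed at the corner:
      growth by G over the second leg, and the square root loss for the other family, must both end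
      below \<epsilon>/2. The deficit 2 \<delta> at the starting point must in turn yield e2 at the
      corner.\<close>
    define e2 where "e2 = min (\<epsilon> / 2) (\<epsilon>\<^sup>2 / (32 * L)) / G"
    have e2: "e2 > 0" using \<epsilon> L G by (auto simp: e2_def)
    have e2G: "G * e2 \<le> \<epsilon> / 2" "8 * L * G * e2 \<le> (\<epsilon> / 2)\<^sup>2"
    proof -
      have g: "G * e2 = min (\<epsilon> / 2) (\<epsilon>\<^sup>2 / (32 * L))" using G by (simp add: e2_def)
      show "G * e2 \<le> \<epsilon> / 2" unfolding g by simp
      have "8 * L * (G * e2) \<le> 8 * L * (\<epsilon>\<^sup>2 / (32 * L))" unfolding g using L by (intro mult_left_mono) auto
      also have "\<dots> = (\<epsilon> / 2)\<^sup>2" using L by (simp add: field_simps power2_eq_square)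
      finally show "8 * L * G * e2 \<le> (\<epsilon> / 2)\<^sup>2" by (simp add: mult_ac)
    qed
    define \<delta> where "\<delta> = min (min 1 (\<epsilon> / 4)) (e2\<^sup>2 / (16 * L * G))"
    have "e2\<^sup>2 / (16 * L * G) > 0" using e2 L G by simp
    then have \<delta>: "\<delta> > 0" "\<delta> \<le> 1" "\<delta> \<le> \<epsilon> / 4" "\<delta> \<le> e2\<^sup>2 / (16 * L * G)" using \<epsilon> by (auto simp: \<delta>_def)
    have \<delta>e: "8 * L * G * (2 * \<delta>) \<le> e2\<^sup>2"
    proof -
      have "(16 * L * G) * \<delta> \<le> (16 * L * G) * (e2\<^sup>2 / (16 * L * G))" using \<delta>(4) L G by (intro mult_left_mono) auto
      also have "\<dots> = e2\<^sup>2" using L G by simp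
      finally show ?thesis by (simp add: mult_ac)
    qed
    obtain T where T: "T \<ge> 0" "\<And>\<tau> \<theta> \<sigma>. \<tau>\<ge>T \<Longrightarrow> \<theta>\<in>pcone \<tau> \<Longrightarrow> \<sigma>\<in>{1,-1} \<Longrightarrow> A \<sigma> \<tau> \<theta> \<le> M + \<delta>"
      using M(2)[OF \<delta>(1)] by blast
    define N where "N = M + \<delta>"
    have "Kq s \<theta> \<le> \<epsilon> \<and> (\<forall>\<sigma>\<in>{1,-1}. \<bar>A \<sigma> s \<theta> - M\<bar> \<le> \<epsilon>)" if s: "s \<ge> T" and \<theta>: "\<theta> \<in> pcone s" for s \<theta>
    proof -
      have s0: "s \<ge> 0" using s T by simp
      define \<tau> where "\<tau> = s + Lw"
      have \<tau>: "\<tau> \<ge> T" "\<tau> \<ge> 0" using s s0 Lw by (auto simp: \<tau>_def)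
      obtain \<theta>s \<sigma> where \<theta>s: "\<theta>s \<in> pcone \<tau>" "\<sigma> \<in> {1, -1}" "A \<sigma> \<tau> \<theta>s > M - \<delta>"
        using M(3)[OF \<delta>(1) \<tau>(2)] by blast
      have m\<sigma>: "- \<sigma> \<in> {1, -1}" using \<theta>s by auto
      have NA: "A \<sigma> t x \<le> N" if "\<sigma> \<in> {1, -1}" "T \<le> t" "x \<in> pcone t" for \<sigma> t x
        using T(2)[OF that(2,3,1)] by (simp add: N_def)
      have DL: "\<bar>Dchar p (A \<sigma>) t x\<bar> + \<bar>Dchar p Kq t x\<bar> \<le> L" if "p \<in> {1, -1}" "\<sigma> \<in> {1, -1}" "T \<le> t" "x \<in> pcone t" for p \<sigma> t x
        using m(5)[OF that(1,2) _ that(4)] that T(1) L(2) by fastforce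
      have NK: "N + Kq t x \<le> 2 * L * l" if "T \<le> t" "x \<in> pcone t" for t x
        using Kqm[OF _ that(2)] that T(1) L(3) \<delta>(2) unfolding N_def by fastforce
      obtain r where r: "s + l \<le> r" "r + l \<le> \<tau>"
        "\<bar>\<theta> - (\<theta>s + (-\<sigma>) * (exp (-\<tau>) - exp (-r)) + \<sigma> * (exp (-r) - exp (-s)))\<bar> \<le> exp (-s) * (2 * l + 6 * exp (-(\<tau> - s)))"
        using cone_reach[OF \<theta>s(2) l(1,2) _ \<theta> \<theta>s(1)] l Lw by (force simp: \<tau>_def)
      define x1 where "x1 = \<theta>s + (-\<sigma>) * (exp (-\<tau>) - exp (-r))"
      define x2 where "x2 = x1 + \<sigma> * (exp (-r) - exp (-s))"
      have Tr: "T \<le> r" "r \<le> \<tau>" "s \<le> r" using r s l by auto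
      have x1: "x1 \<in> pcone r" unfolding x1_def by (rule pcone_path[OF \<theta>s(1) Tr(2) m\<sigma>])
      have x2: "x2 \<in> pcone s" unfolding x2_def by (rule pcone_path[OF x1 Tr(3) \<theta>s(2)])
      have exp_le: "exp ((\<tau> - r) / 2) \<le> G" "exp ((r - s) / 2) \<le> G" using Tr by (auto simp: G_def \<tau>_def)
      have "((N - A (-\<sigma>) r x1) + Kq r x1)\<^sup>2 \<le> 8 * L * exp ((\<tau> - r) / 2) * (2 * \<delta>)"
        unfolding x1_def
        by (rule deficit_propagation(2)[where T = T and l = l]) (use NA DL NK L l Tr r \<theta>s in \<open>auto simp: N_def\<close>)
      also have "\<dots> \<le> 8 * L * G * (2 * \<delta>)"
        using exp_le L \<delta> by (intro mult_right_mono mult_left_mono) auto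
      also note \<delta>e
      finally have "(N - A (-\<sigma>) r x1) + Kq r x1 \<le> e2" by (rule power2_le_imp_le) (use e2 in simp)
      then have d1: "N - A (-\<sigma>) r x1 \<le> e2" using Kq_nonneg[of r x1] by linarith
      have x2': "x2 = x1 + (-(-\<sigma>)) * (exp (-r) - exp (-s))" by (simp add: x2_def)
      have "N - A (-\<sigma>) s x2 \<le> exp ((r - s) / 2) * e2"
        unfolding x2'
        by (rule deficit_propagation(1)[where T = T and l = l, OF NA L(1) DL NK m\<sigma> l(1) s r(1) x1 d1])
      also have "\<dots> \<le> G * e2" using exp_le e2 by (intro mult_right_mono) auto
      also note e2G(1)
      finally have D1: "N - A (-\<sigma>) s x2 \<le> \<epsilon> / 2" .
      have "((N - A (-(-\<sigma>)) s x2) + Kq s x2)\<^sup>2 \<le> 8 * L * exp ((r - s) / 2) * e2"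
        unfolding x2'
        by (rule deficit_propagation(2)[where T = T and l = l, OF NA L(1) DL NK m\<sigma> l(1) s r(1) x1 d1])
      also have "\<dots> \<le> 8 * L * G * e2" using exp_le e2 L by (intro mult_right_mono mult_left_mono) auto
      also note e2G(2)
      finally have "(N - A (-(-\<sigma>)) s x2) + Kq s x2 \<le> \<epsilon> / 2" by (rule power2_le_imp_le) (use \<epsilon> in simp)
      then have "(N - A \<sigma> s x2) + Kq s x2 \<le> \<epsilon> / 2" by simp
      then have D2: "N - A \<sigma> s x2 \<le> \<epsilon> / 2" "Kq s x2 \<le> \<epsilon> / 2"
        using Kq_nonneg[of s x2] NA[OF \<theta>s(2) s x2] by linarith+
      have "\<Lambda> * exp s * \<bar>\<theta> - x2\<bar> \<le> \<Lambda> * exp s * (exp (-s) * (2 * l + 6 * exp (-(\<tau> - s))))"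
        using r(3) m unfolding x2_def x1_def by (intro mult_left_mono) auto
      also have "\<dots> = \<Lambda> * (2 * l + 6 * exp (- Lw))" by (simp add: \<tau>_def exp_minus)
      also have "\<dots> \<le> \<Lambda> * (2 * (\<epsilon> / (16 * \<Lambda>)) + \<epsilon> / (8 * \<Lambda>))"
        using l eLw m by (intro mult_left_mono add_mono) auto
      also have "\<dots> = \<epsilon> / 4" using m by (simp add: field_simps)
      finally have d: "\<Lambda> * exp s * \<bar>\<theta> - x2\<bar> \<le> \<epsilon> / 4" .
      have "\<bar>Kq s \<theta> - Kq s x2\<bar> \<le> \<Lambda> * exp s * \<bar>\<theta> - x2\<bar>"
        by (rule lip[OF smooth_Kq _ \<theta> x2]) (use m(5)[of 1 1 s] s0 in auto)
      then have K: "Kq s \<theta> \<le> \<epsilon>" using d D2(2) \<epsilon> by linarith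
      have "\<bar>A p s \<theta> - M\<bar> \<le> \<epsilon>" if p: "p \<in> {1, -1}" for p
      proof -
        have "\<bar>A p s \<theta> - A p s x2\<bar> \<le> \<Lambda> * exp s * \<bar>\<theta> - x2\<bar>"
          by (rule lip[OF smooth_A _ \<theta> x2]) (use m(5)[OF p p s0] in auto)
        moreover have "p = \<sigma> \<or> p = - \<sigma>" using p \<theta>s(2) by auto
        then have "N - A p s x2 \<le> \<epsilon> / 2" using D1 D2(1) by auto
        moreover have "A p s \<theta> \<le> N" by (rule NA[OF p s \<theta>])
        ultimately show ?thesis using d \<delta> \<epsilon> unfolding N_def by linarith
      qed
      with K show ?thesis by blast
    qed
    then show ?thesis using T(1) by blast
  qed
  show thesis by (rule that[OF M(1) main M(3)])
qed

end

section \<open>The alternative for the limiting direction\<close>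

text \<open>Read backwards from \<tau>: f is below w, cannot have been above w before, and within
  |f| \<le> w decreases at speed at least c, so it reaches -w within time 2 w / c; once below -w at
  an earlier time it need not be followed, as each r is treated separately.\<close>

lemma ode_drop:
  fixes f f' :: "real \<Rightarrow> real"
  assumes d: "\<And>x. r \<le> x \<Longrightarrow> x \<le> \<tau> \<Longrightarrow> (f has_real_derivative f' x) (at x)"
    and up: "\<And>x. r \<le> x \<Longrightarrow> x \<le> \<tau> \<Longrightarrow> \<bar>f x\<bar> \<le> w \<Longrightarrow> f' x \<ge> c" and c: "c > 0"
    and w: "w \<ge> 0" and fin: "f \<tau> < w" and r: "r + 2 * w / c \<le> \<tau>"
  shows "f r \<le> - w"
proof (rule ccontr)
  assume "\<not> f r \<le> - w"
  then have fr: "f r > - w" by simp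
  have "0 \<le> 2 * w / c" using w c by simp
  then have r\<tau>: "r \<le> \<tau>" using r by linarith
  have lo: "f x \<ge> - w" if "r \<le> x" "x \<le> \<tau>" for x
  proof (rule barrier[of r x f f' "- w" x])
    show "f' y > 0" if "r \<le> y" "y \<le> x" "f y = - w" for y
      using up[of y] that w c \<open>x \<le> \<tau>\<close> by auto
  qed (use d fr that in auto)
  have hi: "f x \<le> w" if x: "r \<le> x" "x \<le> \<tau>" for x
  proof (rule ccontr)
    assume "\<not> f x \<le> w"
    have "f \<tau> \<ge> w"
    proof (rule barrier[of x \<tau> f f' w \<tau>])
      show "f' y > 0" if "x \<le> y" "y \<le> \<tau>" "f y = w" for y
        using up[of y] that w c x by auto
    qed (use d x \<open>\<not> f x \<le> w\<close> in auto)
    then show False using fin by simp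
  qed
  have "f r - c * r \<le> f \<tau> - c * \<tau>"
  proof (rule DERIV_nonneg_imp_nondecreasing[OF r\<tau>])
    fix x assume x: "r \<le> x" "x \<le> \<tau>"
    have "((\<lambda>x. f x - c * x) has_real_derivative f' x - c) (at x)"
      by (rule DERIV_diff[OF d[OF x]]) (auto intro!: derivative_eq_intros)
    moreover have "f' x - c \<ge> 0" using up[OF x] lo[OF x] hi[OF x] by (simp add: abs_le_iff)
    ultimately show "\<exists>y. ((\<lambda>x. f x - c * x) has_real_derivative y) (at x) \<and> 0 \<le> y" by blast
  qed
  moreover have "2 * w \<le> c * (\<tau> - r)" using r c by (simp add: field_simps)
  ultimately show False using fr fin by (simp add: algebra_simps)
qed

lemma derivative_upper_bound:
  fixes f f' :: "real \<Rightarrow> real"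
  assumes "p \<le> q" and d: "\<And>x. p \<le> x \<Longrightarrow> x \<le> q \<Longrightarrow> (f has_real_derivative f' x) (at x)"
    and "\<And>x. p \<le> x \<Longrightarrow> x \<le> q \<Longrightarrow> f' x \<le> c"
  shows "f q \<le> f p + c * (q - p)"
proof -
  have "c * p - f p \<le> c * q - f q"
  proof (rule DERIV_nonneg_imp_nondecreasing[OF assms(1)])
    fix x assume x: "p \<le> x" "x \<le> q"
    have "((\<lambda>x. c * x - f x) has_real_derivative c - f' x) (at x)"
      by (rule DERIV_diff[OF _ d[OF x]]) (auto intro!: derivative_eq_intros)
    then show "\<exists>y. ((\<lambda>x. c * x - f x) has_real_derivative y) (at x) \<and> 0 \<le> y" using assms(3)[OF x] by auto
  qed
  then show ?thesis by (simp add: algebra_simps)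
qed

locale gowdy_cone_PQ = gowdy_cone a b \<theta>\<^sub>0 + gowdy_PQ a b P Q for a b \<theta>\<^sub>0 P Q
begin

text \<open>The square root of the limit of A, to be compared with the growth of \<rho> per unit
  time.\<close>

definition "asymp_speed v \<longleftrightarrow> (\<forall>\<epsilon>>0. \<exists>T\<ge>0. \<forall>\<tau>\<ge>T. \<forall>\<theta>\<in>pcone \<tau>. Kq \<tau> \<theta> \<le> \<epsilon> \<and> (\<forall>\<sigma>\<in>{1,-1}. \<bar>A \<sigma> \<tau> \<theta> - v\<^sup>2\<bar> \<le> \<epsilon>))"

text \<open>As A is near \<open>v\<^sup>2\<close> and the two families nearly agree,
  \<open>a \<sigma>\<close> has derivative about \<open>v\<^sup>2 - a\<^sup>2\<close>, at least
  \<zeta> v while |a| \<le> v - \<zeta>. Backwards in time, a value below v - \<zeta> is therefore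
  below -(v - \<zeta>) after a bounded time, and integrating along the characteristic makes P
  decrease linearly. Passing from \<theta> to \<open>\<theta>\<^sub>0\<close> costs a bounded
  amount.\<close>

lemma dichotomy:
  assumes v: "asymp_speed v" and \<zeta>: "0 < \<zeta>" "\<zeta> \<le> v / 2"
  shows "\<exists>T\<ge>0. \<exists>C. \<forall>\<tau>\<ge>T. (\<forall>\<theta>\<in>pcone \<tau>. \<forall>\<sigma>\<in>{1,-1}. v - \<zeta> \<le> a \<sigma> \<tau> \<theta>) \<or> P \<tau> \<theta>\<^sub>0 \<le> - (v - 2 * \<zeta>) * (\<tau> - T) + C"
proof -
  obtain m where m: "m \<ge> 1"
    "\<And>\<sigma> \<tau> \<theta>. \<sigma> \<in> {1, -1} \<Longrightarrow> 0 \<le> \<tau> \<Longrightarrow> \<theta> \<in> pcone \<tau> \<Longrightarrow> \<bar>a \<sigma> \<tau> \<theta>\<bar> \<le> m \<and> \<bar>b \<sigma> \<tau> \<theta>\<bar> \<le> m"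
    using cone_bounds by metis
  have v0: "v > 0" using \<zeta> by simp
  \<comment> \<open>The divisor m + 2 keeps the errors e + m e + e/2 in the derivative of a below
    \<zeta> v / 2, against a main term of at least 3/2 \<zeta> v.\<close>
  define e where "e = min (min 1 \<zeta>) (\<zeta> * v / (2 * (m + 2)))"
  have "\<zeta> * v / (2 * (m + 2)) > 0" using \<zeta> v0 m by simp
  then have e: "e > 0" "e \<le> 1" "e \<le> \<zeta>" "e \<le> \<zeta> * v / (2 * (m + 2))" using \<zeta> by (auto simp: e_def)
  have em: "(m + 2) * e \<le> \<zeta> * v / 2"
  proof -
    have "(m + 2) * e \<le> (m + 2) * (\<zeta> * v / (2 * (m + 2)))" using e(4) m by (intro mult_left_mono) auto
    also have "\<dots> = \<zeta> * v / 2" using m by (simp add: field_simps)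
    finally show ?thesis .
  qed
  have "e\<^sup>2 > 0" using e by simp
  then obtain T where T: "T \<ge> 0" "\<And>\<tau> \<theta>. \<tau>\<ge>T \<Longrightarrow> \<theta>\<in>pcone \<tau> \<Longrightarrow> Kq \<tau> \<theta> \<le> e\<^sup>2"
    "\<And>\<tau> \<theta> \<sigma>. \<tau>\<ge>T \<Longrightarrow> \<theta>\<in>pcone \<tau> \<Longrightarrow> \<sigma> \<in> {1,-1} \<Longrightarrow> \<bar>A \<sigma> \<tau> \<theta> - v\<^sup>2\<bar> \<le> e\<^sup>2"
    using v unfolding asymp_speed_def by metis
  have diffs: "\<bar>a \<sigma> \<tau> \<theta> - a (-\<sigma>) \<tau> \<theta>\<bar> \<le> e" "\<bar>b \<sigma> \<tau> \<theta> - b (-\<sigma>) \<tau> \<theta>\<bar> \<le> e"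
    if "\<tau>\<ge>T" "\<theta>\<in>pcone \<tau>" "\<sigma> \<in> {1,-1}" for \<sigma> \<tau> \<theta>
  proof -
    have "(a \<sigma> \<tau> \<theta> - a (-\<sigma>) \<tau> \<theta>)\<^sup>2 \<le> e\<^sup>2" "(b \<sigma> \<tau> \<theta> - b (-\<sigma>) \<tau> \<theta>)\<^sup>2 \<le> e\<^sup>2"
      using T(2)[OF that(1,2)] unfolding Kq_eq[OF that(3)]
      using zero_le_power2[of "a \<sigma> \<tau> \<theta> - a (-\<sigma>) \<tau> \<theta>"] zero_le_power2[of "b \<sigma> \<tau> \<theta> - b (-\<sigma>) \<tau> \<theta>"] by linarith+
    then show "\<bar>a \<sigma> \<tau> \<theta> - a (-\<sigma>) \<tau> \<theta>\<bar> \<le> e" "\<bar>b \<sigma> \<tau> \<theta> - b (-\<sigma>) \<tau> \<theta>\<bar> \<le> e"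
      using e by (auto simp: abs_le_square_iff[symmetric])
  qed
  define w where "w = v - \<zeta>"
  have w: "w > 0" using \<zeta> v0 by (simp add: w_def)
  have growth: "Dchar (-\<sigma>) (a \<sigma>) \<tau> \<theta> \<ge> \<zeta> * v"
    if "\<tau>\<ge>T" "\<theta>\<in>pcone \<tau>" "\<sigma> \<in> {1,-1}" "\<bar>a \<sigma> \<tau> \<theta>\<bar> \<le> w" for \<sigma> \<tau> \<theta>
  proof -
    have "\<bar>b \<sigma> \<tau> \<theta> * (b \<sigma> \<tau> \<theta> - b (-\<sigma>) \<tau> \<theta>)\<bar> \<le> m * e"
      unfolding abs_mult using m(2)[of \<sigma> \<tau> \<theta>] diffs(2)[OF that(1-3)] that T(1) m(1) by (intro mult_mono) auto
    moreover have "b \<sigma> \<tau> \<theta> * b (-\<sigma>) \<tau> \<theta> = A \<sigma> \<tau> \<theta> - (a \<sigma> \<tau> \<theta>)\<^sup>2 - b \<sigma> \<tau> \<theta> * (b \<sigma> \<tau> \<theta> - b (-\<sigma>) \<tau> \<theta>)"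
      by (simp add: A_def power2_eq_square algebra_simps)
    moreover have "(a \<sigma> \<tau> \<theta>)\<^sup>2 \<le> w\<^sup>2" using that(4) w by (simp add: abs_le_square_iff[symmetric])
    moreover have "e\<^sup>2 \<le> e" using e mult_left_le[of e e] by (simp add: power2_eq_square)
    moreover note T(3)[OF that(1-3)] diffs(1)[OF that(1-3)]
    moreover have "V - W - (e + M + e / 2) \<le> x - d / 2"
      if "\<bar>D\<bar> \<le> M" "x = AA - aa - D" "aa \<le> W" "e2 \<le> e" "\<bar>AA - V\<bar> \<le> e2" "\<bar>d\<bar> \<le> e" for V W M x d D AA aa e2 :: real
      using that by (simp add: abs_le_iff field_simps)
    ultimately have "Dchar (-\<sigma>) (a \<sigma>) \<tau> \<theta> \<ge> v\<^sup>2 - w\<^sup>2 - (e + m * e + e / 2)"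
      unfolding a_eq[OF that(3)] by blast
    moreover have "v\<^sup>2 - w\<^sup>2 = \<zeta> * (2 * v - \<zeta>)" by (simp add: w_def power2_eq_square algebra_simps)
    moreover have "\<zeta> * (2 * v - \<zeta>) \<ge> \<zeta> * (3 / 2 * v)" using \<zeta> by (intro mult_left_mono) auto
    ultimately show ?thesis using em e by (simp add: algebra_simps)
  qed
  define l where "l = 2 * w / (\<zeta> * v)"
  have l: "l \<ge> 0" using w \<zeta> v0 by (simp add: l_def)
  obtain CP where CP: "\<And>x. x \<in> pcone T \<Longrightarrow> \<bar>P T x\<bar> \<le> CP" using pcone_bounded[OF smooth_P] by blast
  \<comment> \<open>The bounded contributions: the data at T, the linear decrease missed during the
    last time l, the possible increase during it, and the passage from \<theta> to
    \<open>\<theta>\<^sub>0\<close>.\<close>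
  define C where "C = CP + (v - 2 * \<zeta>) * l + m * l + m"
  have "P \<tau> \<theta>\<^sub>0 \<le> - (v - 2 * \<zeta>) * (\<tau> - T) + C"
    if \<tau>: "\<tau> \<ge> T" and \<theta>: "\<theta> \<in> pcone \<tau>" and \<sigma>: "\<sigma> \<in> {1, -1}" and less: "a \<sigma> \<tau> \<theta> < w" for \<tau> \<theta> \<sigma>
  proof -
    have m\<sigma>: "- \<sigma> \<in> {1, -1}" using \<sigma> by auto
    define q where "q r = \<theta> + (-\<sigma>) * (exp (-\<tau>) - exp (-r))" for r
    have q: "q r \<in> pcone r" if "r \<le> \<tau>" for r unfolding q_def by (rule pcone_path[OF \<theta> that m\<sigma>])
    have da: "((\<lambda>r. a \<sigma> r (q r)) has_real_derivative Dchar (-\<sigma>) (a \<sigma>) r (q r)) (at r)" for r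
      unfolding q_def by (rule char_deriv_path, rule char_deriv_Dchar[OF smooth_a])
    \<comment> \<open>The family -\<sigma> transports \<open>a \<sigma>\<close>, but along it P has
      derivative \<open>a (-\<sigma>)\<close>; by \<open>diffs\<close> the two differ by at most
      e.\<close>
    have dP: "((\<lambda>r. P r (q r)) has_real_derivative a (-\<sigma>) r (q r)) (at r)" for r
      unfolding q_def a_P[OF m\<sigma>] by (rule char_deriv_path, rule char_deriv_Dchar[OF smooth_P])
    have drop: "a \<sigma> r (q r) \<le> - w" if "T \<le> r" "r + l \<le> \<tau>" for r
    proof (rule ode_drop[where f = "\<lambda>r. a \<sigma> r (q r)" and f' = "\<lambda>r. Dchar (-\<sigma>) (a \<sigma>) r (q r)" and \<tau> = \<tau> and c = "\<zeta> * v"])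
      show "\<zeta> * v > 0" using \<zeta> v0 by simp
      show "Dchar (-\<sigma>) (a \<sigma>) x (q x) \<ge> \<zeta> * v" if "r \<le> x" "x \<le> \<tau>" "\<bar>a \<sigma> x (q x)\<bar> \<le> w" for x
        using growth[OF _ q \<sigma>] that \<open>T \<le> r\<close> by auto
    qed (use da w less that in \<open>auto simp: q_def l_def\<close>)
    \<comment> \<open>The drop is available up to time \<tau> - l; if that precedes T, the phase of
      linear decrease is empty.\<close>
    define r1 where "r1 = max T (\<tau> - l)"
    have r1: "T \<le> r1" "r1 \<le> \<tau>" "\<tau> - l \<le> r1" using \<tau> l by (auto simp: r1_def)
    have "P r1 (q r1) \<le> P T (q T) + - (v - 2 * \<zeta>) * (r1 - T)"
    proof (cases "r1 = T")
      case False
      then have r1': "r1 + l \<le> \<tau>" by (auto simp: r1_def max_def split: if_splits)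
      show ?thesis
      proof (rule derivative_upper_bound[OF r1(1) dP])
        fix r assume r: "T \<le> r" "r \<le> r1"
        have "a \<sigma> r (q r) \<le> - w" using drop[OF r(1)] r r1' by simp
        moreover have "\<bar>a \<sigma> r (q r) - a (-\<sigma>) r (q r)\<bar> \<le> e" using diffs(1)[OF r(1) q \<sigma>] r r1 by simp
        ultimately show "a (-\<sigma>) r (q r) \<le> - (v - 2 * \<zeta>)" using e(3) unfolding w_def by linarith
      qed
    qed simp
    moreover have "P \<tau> (q \<tau>) \<le> P r1 (q r1) + m * (\<tau> - r1)"
    proof (rule derivative_upper_bound[OF r1(2) dP])
      fix r assume r: "r1 \<le> r" "r \<le> \<tau>"
      then show "a (-\<sigma>) r (q r) \<le> m" using m(2)[OF m\<sigma> _ q, of r] r1 T(1) by (simp add: abs_le_iff)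
    qed
    moreover have "m * (\<tau> - r1) \<le> m * l" using r1 m by (intro mult_left_mono) auto
    moreover have "(v - 2 * \<zeta>) * (\<tau> - l - T) \<le> (v - 2 * \<zeta>) * (r1 - T)" using r1 \<zeta> by (intro mult_left_mono) auto
    moreover have "P T (q T) \<le> CP" using CP[OF q[OF \<tau>]] by (simp add: abs_le_iff)
    moreover have "P \<tau> \<theta>\<^sub>0 \<le> P \<tau> \<theta> + m"
    proof -
      have c: "pcone \<tau> = {\<theta>\<^sub>0 - exp (-\<tau>)..\<theta>\<^sub>0 + exp (-\<tau>)}" by (auto simp: pcone_def)
      have "norm (P \<tau> \<theta>\<^sub>0 - P \<tau> \<theta>) \<le> (m * exp \<tau>) * norm (\<theta>\<^sub>0 - \<theta>)"
      proof (rule field_differentiable_bound[of "pcone \<tau>" "P \<tau>" "ptheta P \<tau>"])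
        fix x assume x: "x \<in> pcone \<tau>"
        show "(P \<tau> has_field_derivative ptheta P \<tau> x) (at x within pcone \<tau>)"
          by (rule has_field_derivative_at_within[OF has_ptheta[OF smooth_P UNIV_I]])
        have "exp (-\<tau>) * ptheta P \<tau> x = (a 1 \<tau> x - a (-1) \<tau> x) / 2" by (simp add: a_split gp_def)
        moreover have "\<bar>(a 1 \<tau> x - a (-1) \<tau> x) / 2\<bar> \<le> m" using m(2)[of 1 \<tau> x] m(2)[of "-1" \<tau> x] x \<tau> T(1) by (simp add: abs_le_iff)
        ultimately have "\<bar>exp (-\<tau>) * ptheta P \<tau> x\<bar> \<le> m" by simp
        then show "norm (ptheta P \<tau> x) \<le> m * exp \<tau>" by (simp add: abs_mult exp_minus field_simps)
      qed (use c \<theta> pcone_center in auto)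
      also have "\<dots> \<le> (m * exp \<tau>) * exp (-\<tau>)"
        using \<theta> m by (intro mult_left_mono) (auto simp: pcone_def abs_minus_commute)
      also have "\<dots> = m" by (simp add: exp_minus)
      finally show ?thesis by (simp add: abs_le_iff)
    qed
    moreover have "q \<tau> = \<theta>" by (simp add: q_def)
    ultimately show ?thesis unfolding C_def by (simp add: algebra_simps)
  qed
  then have "\<forall>\<tau>\<ge>T. (\<forall>\<theta>\<in>pcone \<tau>. \<forall>\<sigma>\<in>{1,-1}. v - \<zeta> \<le> a \<sigma> \<tau> \<theta>) \<or> P \<tau> \<theta>\<^sub>0 \<le> - (v - 2 * \<zeta>) * (\<tau> - T) + C"
    unfolding w_def by (meson not_le)
  then show ?thesis using T(1) by blast
qed

text \<open>The hyperbolic cosine of the distance to (0, 0), the image of the origin of the disc.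
  Unlike the distance it is smooth at that point.\<close>

definition "Wd \<tau> = (exp (P \<tau> \<theta>\<^sub>0) * (1 + (Q \<tau> \<theta>\<^sub>0)\<^sup>2) + exp (- P \<tau> \<theta>\<^sub>0)) / 2"

lemma Wd_pos: "Wd \<tau> > 0"
proof -
  have q: "1 + (Q \<tau> \<theta>\<^sub>0)\<^sup>2 > 0" by (rule add_pos_nonneg) auto
  show ?thesis unfolding Wd_def
    by (rule divide_pos_pos[OF add_pos_pos[OF mult_pos_pos[OF exp_gt_zero q] exp_gt_zero]]) simp
qed

text \<open>In the orthonormal frame the gradient of \<open>Wd\<close> is (S, Q), of squared length
  \<open>Wd\<^sup>2 - 1\<close>. By Cauchy-Schwarz the logarithm of \<open>Wd\<close> grows no
  faster than the speed, whose square is at most the mean of the two A.\<close>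

lemma ln_Wd_bound:
  assumes u: "u > 0" and Au: "\<And>\<tau> \<sigma>. \<tau> \<ge> T \<Longrightarrow> \<sigma> \<in> {1, -1} \<Longrightarrow> A \<sigma> \<tau> \<theta>\<^sub>0 \<le> u\<^sup>2" and \<tau>: "\<tau> \<ge> T"
  shows "ln (Wd \<tau>) \<le> ln (Wd T) + u * (\<tau> - T)"
proof (rule derivative_upper_bound[OF \<tau>])
  fix t assume t: "T \<le> t"
  define S where "S = (exp (P t \<theta>\<^sub>0) * (1 + (Q t \<theta>\<^sub>0)\<^sup>2) - exp (- P t \<theta>\<^sub>0)) / 2"
  define f h where "f = ptau P t \<theta>\<^sub>0" and "h = hq t \<theta>\<^sub>0"
  let ?W' = "S * f + Q t \<theta>\<^sub>0 * h"
  have dW: "(Wd has_real_derivative ?W') (at t)"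
    unfolding Wd_def S_def f_def h_def hq_def
    using has_ptau[OF smooth_P UNIV_I, of \<theta>\<^sub>0 t] has_ptau[OF smooth_Q UNIV_I, of \<theta>\<^sub>0 t]
    by (auto intro!: derivative_eq_intros simp: field_simps)
  show "((\<lambda>t. ln (Wd t)) has_real_derivative ?W' / Wd t) (at t)"
    using DERIV_chain2[OF DERIV_ln[OF Wd_pos] dW] by (simp add: field_simps)
  have "exp (P t \<theta>\<^sub>0) * exp (- P t \<theta>\<^sub>0) = 1" by (simp flip: exp_add)
  then have "(Wd t)\<^sup>2 = S\<^sup>2 + (1 + (Q t \<theta>\<^sub>0)\<^sup>2)"
    unfolding Wd_def S_def by (simp add: power2_eq_square field_simps)
  then have SW: "S\<^sup>2 + (Q t \<theta>\<^sub>0)\<^sup>2 \<le> (Wd t)\<^sup>2" by simp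
  have fh: "f\<^sup>2 + h\<^sup>2 \<le> u\<^sup>2"
  proof -
    have "A 1 t \<theta>\<^sub>0 + A (-1) t \<theta>\<^sub>0 = 2 * f\<^sup>2 + 2 * h\<^sup>2 + 2 * (gp t \<theta>\<^sub>0)\<^sup>2 + 2 * (kq t \<theta>\<^sub>0)\<^sup>2"
      unfolding A_def a_split b_split f_def h_def by (simp add: power2_eq_square algebra_simps)
    moreover have "A 1 t \<theta>\<^sub>0 \<le> u\<^sup>2" "A (-1) t \<theta>\<^sub>0 \<le> u\<^sup>2" using Au[OF t] by auto
    moreover have "0 \<le> (gp t \<theta>\<^sub>0)\<^sup>2" "0 \<le> (kq t \<theta>\<^sub>0)\<^sup>2" by (rule zero_le_power2)+
    ultimately show ?thesis by linarith
  qed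
  have "?W'\<^sup>2 \<le> (S\<^sup>2 + (Q t \<theta>\<^sub>0)\<^sup>2) * (f\<^sup>2 + h\<^sup>2)"
  proof -
    have "(S\<^sup>2 + (Q t \<theta>\<^sub>0)\<^sup>2) * (f\<^sup>2 + h\<^sup>2) - ?W'\<^sup>2 = (S * h - Q t \<theta>\<^sub>0 * f)\<^sup>2"
      by (simp add: power2_eq_square algebra_simps)
    then show ?thesis by (metis diff_ge_0_iff_ge zero_le_power2)
  qed
  also have "\<dots> \<le> (Wd t)\<^sup>2 * u\<^sup>2" using SW fh by (intro mult_mono) auto
  finally have "?W'\<^sup>2 \<le> (Wd t * u)\<^sup>2" by (simp add: power_mult_distrib)
  then have "?W' \<le> Wd t * u" by (rule power2_le_imp_le) (use Wd_pos[of t] u in simp)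
  then show "?W' / Wd t \<le> u" using Wd_pos[of t] by (simp add: divide_le_eq mult.commute)
qed

text \<open>On the slice, a \<ge> v - \<zeta> and A near \<open>v\<^sup>2\<close> confine a to
  within \<zeta> of v and leave \<open>b\<^sup>2 \<le> 2 * v * \<zeta>\<close>. These bounds are
  strictly better than claimed, so by compactness the claim holds in an \<eta>-neighbourhood of the
  slice: here information over one angle becomes information over an interval.\<close>

lemma good_start:
  assumes v: "v \<le> 1" "v > 0" and \<zeta>: "\<zeta> > 0" "\<zeta> < \<delta> / 2" "\<zeta> \<le> v" "3 * \<zeta> < \<epsilon>\<^sup>2" and \<epsilon>: "\<epsilon> > 0" and \<zeta>1: "\<zeta> \<le> 1"
    and ge: "\<And>\<theta> \<sigma>. \<theta>\<in>pcone T \<Longrightarrow> \<sigma>\<in>{1,-1} \<Longrightarrow> v - \<zeta> \<le> a \<sigma> T \<theta>"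
    and Av: "\<And>\<theta> \<sigma>. \<theta>\<in>pcone T \<Longrightarrow> \<sigma>\<in>{1,-1} \<Longrightarrow> \<bar>A \<sigma> T \<theta> - v\<^sup>2\<bar> \<le> \<zeta>\<^sup>2"
  shows "\<exists>\<eta>>0. \<forall>\<sigma>\<in>{1,-1}. \<forall>\<theta>. \<bar>\<theta> - \<theta>\<^sub>0\<bar> \<le> \<eta> + exp (-T) \<longrightarrow> \<bar>a \<sigma> T \<theta> - v\<bar> \<le> \<delta> / 2 \<and> \<bar>b \<sigma> T \<theta>\<bar> \<le> \<epsilon>"
proof -
  have ab: "\<bar>a \<sigma> T \<theta> - v\<bar> < \<delta> / 2" "\<bar>b \<sigma> T \<theta>\<bar> < \<epsilon>" if "\<theta>\<in>pcone T" "\<sigma>\<in>{1,-1}" for \<theta> \<sigma>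
  proof -
    have sq: "(a \<sigma> T \<theta>)\<^sup>2 + (b \<sigma> T \<theta>)\<^sup>2 \<le> v\<^sup>2 + \<zeta>\<^sup>2" using Av[OF that] unfolding A_def by linarith
    have "v\<^sup>2 + \<zeta>\<^sup>2 \<le> (v + \<zeta>)\<^sup>2" using v \<zeta> by (simp add: power2_eq_square algebra_simps)
    then have "(a \<sigma> T \<theta>)\<^sup>2 \<le> (v + \<zeta>)\<^sup>2" using sq zero_le_power2[of "b \<sigma> T \<theta>"] by linarith
    then have "a \<sigma> T \<theta> \<le> v + \<zeta>" by (rule power2_le_imp_le) (use v \<zeta> in simp)
    then show "\<bar>a \<sigma> T \<theta> - v\<bar> < \<delta> / 2" using ge[OF that] \<zeta> by linarith
    have "(v - \<zeta>)\<^sup>2 \<le> (a \<sigma> T \<theta>)\<^sup>2" using ge[OF that] \<zeta> by (intro power_mono) auto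
    then have "(b \<sigma> T \<theta>)\<^sup>2 \<le> v\<^sup>2 + \<zeta>\<^sup>2 - (v - \<zeta>)\<^sup>2" using sq by linarith
    also have "\<dots> = 2 * (v * \<zeta>)" by (simp add: power2_eq_square algebra_simps)
    also have "\<dots> \<le> 2 * (1 * \<zeta>)" using v \<zeta> by (intro mult_left_mono mult_right_mono) auto
    also have "\<dots> < \<epsilon>\<^sup>2" using \<zeta> by simp
    finally have "\<bar>b \<sigma> T \<theta>\<bar>\<^sup>2 < \<epsilon>\<^sup>2" by simp
    then show "\<bar>b \<sigma> T \<theta>\<bar> < \<epsilon>" by (rule power2_less_imp_less) (use \<epsilon> in simp)
  qed
  define U where "U = {\<theta>. \<bar>a 1 T \<theta> - v\<bar> < \<delta> / 2} \<inter> {\<theta>. \<bar>a (-1) T \<theta> - v\<bar> < \<delta> / 2} \<inter> {\<theta>. \<bar>b 1 T \<theta>\<bar> < \<epsilon>} \<inter> {\<theta>. \<bar>b (-1) T \<theta>\<bar> < \<epsilon>}"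
  have ca: "continuous_on UNIV (a \<sigma> T)" "continuous_on UNIV (b \<sigma> T)" for \<sigma>
    using smooth_strip_cont_section(1)[OF smooth_a] smooth_strip_cont_section(1)[OF smooth_b] by blast+
  have "open U" unfolding U_def
    by (intro open_Int open_Collect_less continuous_on_rabs continuous_on_diff continuous_on_const ca)
  moreover have c: "pcone T = {\<theta>\<^sub>0 - exp (-T)..\<theta>\<^sub>0 + exp (-T)}" by (auto simp: pcone_def)
  then have "compact (pcone T)" by simp
  moreover have "pcone T \<subseteq> U" using ab by (auto simp: U_def)
  ultimately obtain \<eta> where \<eta>: "\<eta> > 0" "(\<Union>x\<in>pcone T. cball x \<eta>) \<subseteq> U"
    using compact_subset_open_imp_cball_epsilon_subset by metis
  have "\<theta> \<in> U" if "\<bar>\<theta> - \<theta>\<^sub>0\<bar> \<le> \<eta> + exp (-T)" for \<theta>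
  proof -
    \<comment> \<open>The point of the slice nearest to \<theta>.\<close>
    define x where "x = max (\<theta>\<^sub>0 - exp (-T)) (min (\<theta>\<^sub>0 + exp (-T)) \<theta>)"
    have p: "0 < exp (-T)" by simp
    have "x \<in> pcone T" using p unfolding c x_def by (auto simp: max_def min_def simp del: exp_gt_zero)
    moreover have "\<theta> \<in> cball x \<eta>"
      using that p \<eta>(1) unfolding x_def by (auto simp: dist_real_def max_def min_def abs_le_iff simp del: exp_gt_zero)
    ultimately show ?thesis using \<eta>(2) by blast
  qed
  then show ?thesis using \<eta>(1) by (intro exI[of _ \<eta>]) (auto simp: U_def intro: less_imp_le)
qed

end

subsection \<open>The Poincare disc\<close>

text \<open>The half-plane model: \<open>(1 + z) / (1 - z) = exp (- P) - \<i> Q\<close>.\<close>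

definition disc_E :: "complex \<Rightarrow> real" where "disc_E z = 1 - (Re z)\<^sup>2 - (Im z)\<^sup>2"
definition disc_N :: "complex \<Rightarrow> real" where "disc_N z = (1 - Re z)\<^sup>2 + (Im z)\<^sup>2"
definition disc_P :: "complex \<Rightarrow> real" where "disc_P z = ln (disc_N z) - ln (disc_E z)"
definition disc_Q :: "complex \<Rightarrow> real" where "disc_Q z = - 2 * Im z / disc_N z"

text \<open>The derivative of the coordinates in the orthonormal frame dP, exp P dQ, written as a complex
  number.\<close>

definition disc_c :: "complex \<Rightarrow> complex \<Rightarrow> complex" where
  "disc_c z w = - 2 * (1 - cnj z) * w / ((1 - z) * (1 - z * cnj z))"

lemma disc_E_eq: "disc_E z = 1 - (cmod z)\<^sup>2"
  by (simp add: disc_E_def cmod_power2)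

lemma disc_pos:
  assumes "cmod z < 1"
  shows "disc_E z > 0" "disc_N z > 0"
proof -
  have "(cmod z)\<^sup>2 < 1" using assms by (simp add: power_less_one_iff)
  then show E: "disc_E z > 0" by (simp add: disc_E_eq)
  have "Re z < 1" using assms complex_Re_le_cmod[of z] by linarith
  then have "(1 - Re z)\<^sup>2 > 0" by simp
  then show "disc_N z > 0" unfolding disc_N_def by (intro add_pos_nonneg) auto
qed

lemma disc_c_alt:
  assumes "cmod z < 1"
  shows "disc_c z w = - 2 * ((1 - cnj z)\<^sup>2 * w) / complex_of_real (disc_N z * disc_E z)"
proof -
  have N: "(1 - z) * (1 - cnj z) = complex_of_real (disc_N z)"
    by (simp add: complex_eq_iff disc_N_def power2_eq_square algebra_simps)
  have E: "1 - z * cnj z = complex_of_real (disc_E z)"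
    by (simp add: complex_eq_iff disc_E_def power2_eq_square algebra_simps)
  have nz: "complex_of_real (disc_N z) \<noteq> 0" "complex_of_real (disc_E z) \<noteq> 0"
    using disc_pos[OF assms] by auto
  have "1 - z \<noteq> 0" "1 - cnj z \<noteq> 0" using nz N by auto
  then show ?thesis unfolding disc_c_def E of_real_mult N[symmetric]
    using nz by (simp add: divide_simps power2_eq_square) (simp add: algebra_simps)
qed

lemma disc_c_Re_Im:
  assumes "cmod z < 1"
  shows "Re (disc_c z w) = - 2 * (((1 - Re z)\<^sup>2 - (Im z)\<^sup>2) * Re w - 2 * (1 - Re z) * Im z * Im w) / (disc_N z * disc_E z)"
    and "Im (disc_c z w) = - 2 * (((1 - Re z)\<^sup>2 - (Im z)\<^sup>2) * Im w + 2 * (1 - Re z) * Im z * Re w) / (disc_N z * disc_E z)"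
  unfolding disc_c_alt[OF assms] Re_divide_of_real Im_divide_of_real
  by (simp_all add: power2_eq_square algebra_simps)

text \<open>|1 - cnj z| = |1 - z|, so the frame components have length 2 |w| / (1 - |z|^2). This is
  the isometry property of the chart, and also the reason why A does not depend on the
  chart.\<close>

lemma disc_c_norm:
  assumes "cmod z < 1"
  shows "(Re (disc_c z w))\<^sup>2 + (Im (disc_c z w))\<^sup>2 = 4 * (cmod w)\<^sup>2 / (1 - (cmod z)\<^sup>2)\<^sup>2"
proof -
  have nz: "disc_N z \<noteq> 0" "disc_E z \<noteq> 0" using disc_pos[OF assms] by auto
  have "(Re (disc_c z w))\<^sup>2 + (Im (disc_c z w))\<^sup>2 =
    (4 * ((((1 - Re z)\<^sup>2 - (Im z)\<^sup>2) * Re w - 2 * (1 - Re z) * Im z * Im w)\<^sup>2 +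
      (((1 - Re z)\<^sup>2 - (Im z)\<^sup>2) * Im w + 2 * (1 - Re z) * Im z * Re w)\<^sup>2)) / (disc_N z * disc_E z)\<^sup>2"
  proof -
    have "(- 2 * p / n)\<^sup>2 + (- 2 * q / n)\<^sup>2 = (4 * (p\<^sup>2 + q\<^sup>2)) / n\<^sup>2" for p q n :: real
      by (simp add: power_divide power_mult_distrib add_divide_distrib)
    then show ?thesis unfolding disc_c_Re_Im[OF assms] .
  qed
  also have "(((1 - Re z)\<^sup>2 - (Im z)\<^sup>2) * Re w - 2 * (1 - Re z) * Im z * Im w)\<^sup>2 +
      (((1 - Re z)\<^sup>2 - (Im z)\<^sup>2) * Im w + 2 * (1 - Re z) * Im z * Re w)\<^sup>2 = (disc_N z)\<^sup>2 * (cmod w)\<^sup>2"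
    unfolding cmod_power2 disc_N_def by (simp add: power2_eq_square algebra_simps)
  finally show ?thesis using nz by (simp add: disc_E_eq power_mult_distrib)
qed

lemma exp_disc_P: "cmod z < 1 \<Longrightarrow> exp (disc_P z) = disc_N z / disc_E z"
  using disc_pos[of z] by (simp add: disc_P_def exp_diff)

lemma disc_derivative:
  assumes z: "(z has_vector_derivative w) (at t)" and inD: "cmod (z t) < 1"
  shows "((\<lambda>t. disc_P (z t)) has_real_derivative Re (disc_c (z t) w)) (at t)"
    and "((\<lambda>t. disc_Q (z t)) has_real_derivative exp (- disc_P (z t)) * Im (disc_c (z t) w)) (at t)"
proof -
  have x: "((\<lambda>t. Re (z t)) has_real_derivative Re w) (at t)" and y: "((\<lambda>t. Im (z t)) has_real_derivative Im w) (at t)"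
    using z by (auto simp: has_vector_derivative_complex_iff)
  define X Y N E where "X = Re (z t)" and "Y = Im (z t)" and "N = disc_N (z t)" and "E = disc_E (z t)"
  have N: "N = (1 - X)\<^sup>2 + Y\<^sup>2" and E: "E = 1 - X\<^sup>2 - Y\<^sup>2" by (simp_all add: N_def E_def X_def Y_def disc_N_def disc_E_def)
  have NE: "N > 0" "E > 0" unfolding N_def E_def using disc_pos[OF inD] by auto
  have dN: "((\<lambda>t. disc_N (z t)) has_real_derivative (2 * Y * Im w - 2 * (1 - X) * Re w)) (at t)"
  proof -
    have "((\<lambda>t. (1 - x t)\<^sup>2 + (y t)\<^sup>2) has_real_derivative (2 * y t * y' - 2 * (1 - x t) * x')) (at t)"
      if "(x has_real_derivative x') (at t)" "(y has_real_derivative y') (at t)" for x y x' y'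
      using that by (auto intro!: derivative_eq_intros)
    from this[OF x y] show ?thesis unfolding disc_N_def X_def Y_def .
  qed
  have dE: "((\<lambda>t. disc_E (z t)) has_real_derivative - (2 * X * Re w + 2 * Y * Im w)) (at t)"
  proof -
    have "((\<lambda>t. 1 - (x t)\<^sup>2 - (y t)\<^sup>2) has_real_derivative - (2 * x t * x' + 2 * y t * y')) (at t)"
      if "(x has_real_derivative x') (at t)" "(y has_real_derivative y') (at t)" for x y x' y'
      using that by (auto intro!: derivative_eq_intros)
    from this[OF x y] show ?thesis unfolding disc_E_def X_def Y_def .
  qed
  have "((\<lambda>t. disc_P (z t)) has_real_derivative (2 * Y * Im w - 2 * (1 - X) * Re w) / N + (2 * X * Re w + 2 * Y * Im w) / E) (at t)"
    unfolding disc_P_def using dN dE NE unfolding N_def E_def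
    by (auto intro!: derivative_eq_intros simp: divide_inverse algebra_simps)
  also have "(2 * Y * Im w - 2 * (1 - X) * Re w) / N + (2 * X * Re w + 2 * Y * Im w) / E
      = (E * (2 * Y * Im w - 2 * (1 - X) * Re w) + N * (2 * X * Re w + 2 * Y * Im w)) / (N * E)"
    using NE by (simp add: field_simps)
  also have "E * (2 * Y * Im w - 2 * (1 - X) * Re w) + N * (2 * X * Re w + 2 * Y * Im w)
      = - 2 * (((1 - X)\<^sup>2 - Y\<^sup>2) * Re w - 2 * (1 - X) * Y * Im w)"
    unfolding N E by (simp add: power2_eq_square algebra_simps)
  finally show "((\<lambda>t. disc_P (z t)) has_real_derivative Re (disc_c (z t) w)) (at t)"
    unfolding disc_c_Re_Im[OF inD] X_def Y_def N_def E_def .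
  have ex: "exp (- disc_P (z t)) = E / N" using exp_disc_P[OF inD] by (simp add: exp_minus N_def E_def)
  have "((\<lambda>t. disc_Q (z t)) has_real_derivative (- 2 * Im w * N - (- 2 * Y) * (2 * Y * Im w - 2 * (1 - X) * Re w)) / (N * N)) (at t)"
    unfolding disc_Q_def using DERIV_divide[OF DERIV_cmult[OF y, of "-2"] dN] NE unfolding N_def Y_def by simp
  also have "- 2 * Im w * N - (- 2 * Y) * (2 * Y * Im w - 2 * (1 - X) * Re w) = - 2 * (((1 - X)\<^sup>2 - Y\<^sup>2) * Im w + 2 * (1 - X) * Y * Re w)"
    unfolding N by (simp add: power2_eq_square algebra_simps)
  also have "\<dots> / (N * N) = E / N * (\<dots> / (N * E))" using NE by simp
  finally show "((\<lambda>t. disc_Q (z t)) has_real_derivative exp (- disc_P (z t)) * Im (disc_c (z t) w)) (at t)"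
    unfolding disc_c_Re_Im[OF inD] ex X_def Y_def N_def E_def .
qed

text \<open>s = -1 precomposes with the rotation z \<mapsto> - z and so moves the distinguished
  boundary point from 1 to -1.\<close>

definition disc_chart :: "real \<Rightarrow> complex \<Rightarrow> real \<times> real" where
  "disc_chart s z = (disc_Q (s *\<^sub>R z), disc_P (s *\<^sub>R z))"

text \<open>The inverse Cayley transform (h - 1) / (h + 1) with h = y - i Q, in real and imaginary
  parts.\<close>

definition disc_chart_inv :: "real \<Rightarrow> real \<times> real \<Rightarrow> complex" where
  "disc_chart_inv s p = (let y = exp (- snd p); D = (fst p)\<^sup>2 + (y + 1)\<^sup>2 in
     s *\<^sub>R Complex (((fst p)\<^sup>2 + y\<^sup>2 - 1) / D) (- 2 * fst p / D))"

lemma disc_chart_inverse: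
  assumes z: "cmod z < 1" and s: "s \<in> {1, -1}"
  shows "disc_chart_inv s (disc_chart s z) = z"
proof -
  define z' where "z' = s *\<^sub>R z"
  have z': "cmod z' < 1" using z s by (auto simp: z'_def)
  define X Y N E where "X = Re z'" and "Y = Im z'" and "N = disc_N z'" and "E = disc_E z'"
  have N: "N = (1 - X)\<^sup>2 + Y\<^sup>2" and E: "E = 1 - X\<^sup>2 - Y\<^sup>2" by (simp_all add: N_def E_def X_def Y_def disc_N_def disc_E_def)
  have NE: "N > 0" "E > 0" unfolding N_def E_def using disc_pos[OF z'] by auto
  have ex: "exp (- disc_P z') = E / N" using exp_disc_P[OF z'] by (simp add: exp_minus N_def E_def)
  have Q: "disc_Q z' = - 2 * Y / N" by (simp add: disc_Q_def Y_def N_def)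
  have D: "(- 2 * Y / N)\<^sup>2 + (E / N + 1)\<^sup>2 = 4 / N"
  proof -
    have "(- 2 * Y / N)\<^sup>2 + (E / N + 1)\<^sup>2 = ((2 * Y)\<^sup>2 + (E + N)\<^sup>2) / N\<^sup>2" using NE by (simp add: field_simps power2_eq_square)
    also have "(2 * Y)\<^sup>2 + (E + N)\<^sup>2 = 4 * N" unfolding E N by (simp add: power2_eq_square algebra_simps)
    finally show ?thesis using NE by (simp add: power2_eq_square)
  qed
  have R: "(- 2 * Y / N)\<^sup>2 + (E / N)\<^sup>2 - 1 = 4 * X / N"
  proof -
    have "(- 2 * Y / N)\<^sup>2 + (E / N)\<^sup>2 - 1 = ((2 * Y)\<^sup>2 + E\<^sup>2 - N\<^sup>2) / N\<^sup>2" using NE by (simp add: field_simps power2_eq_square)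
    also have "(2 * Y)\<^sup>2 + E\<^sup>2 - N\<^sup>2 = 4 * X * N" unfolding E N by (simp add: power2_eq_square algebra_simps)
    finally show ?thesis using NE by (simp add: power2_eq_square)
  qed
  have "disc_chart_inv s (disc_Q z', disc_P z') = s *\<^sub>R Complex X Y"
    unfolding disc_chart_inv_def Let_def fst_conv snd_conv ex Q D R using NE by simp
  also have "\<dots> = z" using s by (auto simp: X_def Y_def z'_def complex_eq_iff)
  finally show ?thesis by (simp add: disc_chart_def z'_def)
qed

lemma disc_chart_inv_props:
  assumes s: "s \<in> {1, -1}"
  shows "cmod (disc_chart_inv s p) < 1" and "disc_chart s (disc_chart_inv s p) = p"
proof -
  define Q y D where "Q = fst p" and "y = exp (- snd p)" and "D = Q\<^sup>2 + (y + 1)\<^sup>2"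
  have y: "y > 0" by (simp add: y_def)
  have "(y + 1)\<^sup>2 > 0" using y by simp
  then have D: "D > 0" unfolding D_def by (intro add_nonneg_pos) auto
  define z where "z = Complex ((Q\<^sup>2 + y\<^sup>2 - 1) / D) (- 2 * Q / D)"
  have inv: "disc_chart_inv s p = s *\<^sub>R z"
    by (simp add: disc_chart_inv_def Let_def z_def D_def Q_def y_def)
  have E: "disc_E z = 4 * y / D"
  proof -
    have "disc_E z = (D\<^sup>2 - (Q\<^sup>2 + y\<^sup>2 - 1)\<^sup>2 - (2 * Q)\<^sup>2) / D\<^sup>2" using D by (simp add: disc_E_def z_def field_simps power2_eq_square)
    also have "D\<^sup>2 - (Q\<^sup>2 + y\<^sup>2 - 1)\<^sup>2 - (2 * Q)\<^sup>2 = 4 * y * D" unfolding D_def by (simp add: power2_eq_square algebra_simps)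
    finally show ?thesis using D by (simp add: power2_eq_square)
  qed
  have N: "disc_N z = 4 / D"
  proof -
    have "disc_N z = ((D - (Q\<^sup>2 + y\<^sup>2 - 1))\<^sup>2 + (2 * Q)\<^sup>2) / D\<^sup>2" using D by (simp add: disc_N_def z_def field_simps power2_eq_square)
    also have "(D - (Q\<^sup>2 + y\<^sup>2 - 1))\<^sup>2 + (2 * Q)\<^sup>2 = 4 * D" unfolding D_def by (simp add: power2_eq_square algebra_simps)
    finally show ?thesis using D by (simp add: power2_eq_square)
  qed
  have "1 - (cmod z)\<^sup>2 > 0" using E D y by (simp flip: disc_E_eq)
  then have z1: "cmod z < 1" by (simp add: abs_square_less_1)
  then show "cmod (disc_chart_inv s p) < 1" unfolding inv using s by auto
  have "disc_P z = snd p"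
  proof -
    have "exp (disc_P z) = 1 / y" using exp_disc_P[OF z1] E N D y by simp
    also have "\<dots> = exp (snd p)" by (simp add: y_def exp_minus inverse_eq_divide)
    finally show ?thesis by simp
  qed
  moreover have "disc_Q z = fst p" unfolding disc_Q_def N using D by (simp add: z_def Q_def)
  moreover have "s *\<^sub>R (s *\<^sub>R z) = z" using s by auto
  ultimately show "disc_chart s (disc_chart_inv s p) = p" by (simp add: disc_chart_def inv)
qed

lemma Cinf_on_Complex:
  assumes S: "open S" and f: "Cinf_on S f" and g: "Cinf_on S g"
  shows "Cinf_on S (\<lambda>x. Complex (f x) (g x))"
proof -
  have "bounded_linear (\<lambda>p. complex_of_real (fst p) + \<i> * complex_of_real (snd p))"
    by (intro bounded_linear_add bounded_linear_compose[OF bounded_linear_of_real] bounded_linear_fst bounded_linear_snd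
        bounded_linear_compose[OF bounded_linear_mult_right])
  from Cinf_on_bounded_linear_compose[OF S this Cinf_on_Pair[OF S f g]] show ?thesis
    by (simp add: Complex_eq)
qed

lemma hyp_isometry_disc_chart:
  assumes s: "s \<in> {1, -1}"
  shows "hyp_isometry (disc_chart s)"
  unfolding hyp_isometry_def
proof (intro conjI ballI allI)
  show bij: "bij_betw (disc_chart s) (ball 0 1) UNIV"
    by (rule bij_betw_byWitness[where f' = "disc_chart_inv s"])
      (use disc_chart_inverse[OF _ s] disc_chart_inv_props[OF s] in auto)
  have sz: "cmod (s *\<^sub>R z) < 1" if "z \<in> ball 0 1" for z using that s by auto
  have ob: "open (ball 0 1 :: complex set)" by simp
  have R: "Cinf_on (ball 0 1) (\<lambda>z. Re (s *\<^sub>R z))" and I: "Cinf_on (ball 0 1) (\<lambda>z. Im (s *\<^sub>R z))"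
    by (intro Cinf_on_bounded_linear ob bounded_linear_compose[OF bounded_linear_Re] bounded_linear_compose[OF bounded_linear_Im] bounded_linear_scaleR_right)+
  have N: "Cinf_on (ball 0 1) (\<lambda>z. disc_N (s *\<^sub>R z))" and E: "Cinf_on (ball 0 1) (\<lambda>z. disc_E (s *\<^sub>R z))"
    unfolding disc_N_def disc_E_def
    by (intro Cinf_on_add Cinf_on_diff Cinf_on_power Cinf_on_const ob R I)+
  have NE: "disc_N (s *\<^sub>R z) > 0" "disc_E (s *\<^sub>R z) > 0" "disc_N (s *\<^sub>R z) \<noteq> 0" if "z \<in> ball 0 1" for z
    using disc_pos[OF sz[OF that]] by auto
  show "Cinf_on (ball 0 1) (disc_chart s)" unfolding disc_chart_def[abs_def] disc_Q_def disc_P_def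
    by (intro Cinf_on_Pair Cinf_on_divide Cinf_on_mult Cinf_on_diff Cinf_on_ln Cinf_on_const ob N E I NE)
  have "inv_into (ball 0 1) (disc_chart s) = disc_chart_inv s"
  proof
    fix p
    have "inv_into (ball 0 1) (disc_chart s) (disc_chart s (disc_chart_inv s p)) = disc_chart_inv s p"
      by (rule inv_into_f_f[OF bij_betw_imp_inj_on[OF bij]]) (use disc_chart_inv_props(1)[OF s] in simp)
    then show "inv_into (ball 0 1) (disc_chart s) p = disc_chart_inv s p"
      by (simp add: disc_chart_inv_props(2)[OF s])
  qed
  moreover have "Cinf_on UNIV (disc_chart_inv s)"
  proof -
    have f: "Cinf_on UNIV (fst :: real \<times> real \<Rightarrow> real)" and g: "Cinf_on UNIV (snd :: real \<times> real \<Rightarrow> real)"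
      by (intro Cinf_on_bounded_linear bounded_linear_fst bounded_linear_snd open_UNIV)+
    have pos: "(fst p)\<^sup>2 + (exp (- snd p) + 1)\<^sup>2 \<noteq> 0" for p :: "real \<times> real"
    proof -
      have "exp (- snd p) + 1 > 0" by (rule add_pos_pos) auto
      then have "(exp (- snd p) + 1)\<^sup>2 > 0" by simp
      then have "(fst p)\<^sup>2 + (exp (- snd p) + 1)\<^sup>2 > 0" by (intro add_nonneg_pos) auto
      then show ?thesis by (rule less_imp_neq[THEN not_sym])
    qed
    have "Cinf_on UNIV (\<lambda>p::real \<times> real. Complex (((fst p)\<^sup>2 + (exp (- snd p))\<^sup>2 - 1) / ((fst p)\<^sup>2 + (exp (- snd p) + 1)\<^sup>2))
        (- 2 * fst p / ((fst p)\<^sup>2 + (exp (- snd p) + 1)\<^sup>2)))"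
      by (intro Cinf_on_Complex Cinf_on_divide Cinf_on_diff Cinf_on_add Cinf_on_mult Cinf_on_power Cinf_on_exp Cinf_on_minus Cinf_on_const
          f g open_UNIV pos)
    from Cinf_on_bounded_linear_compose[OF open_UNIV bounded_linear_scaleR_right this, of s]
    show ?thesis unfolding disc_chart_inv_def[abs_def] Let_def .
  qed
  ultimately show "Cinf_on UNIV (inv_into (ball 0 1) (disc_chart s))" by simp
  fix x v :: complex assume x: "x \<in> ball 0 1"
  have "((\<lambda>t. s *\<^sub>R (x + t *\<^sub>R v)) has_vector_derivative s *\<^sub>R v) (at 0)"
    by (auto intro!: derivative_eq_intros)
  from disc_derivative[OF this] sz[OF x]
  have "((\<lambda>t. disc_chart s (x + t *\<^sub>R v)) has_vector_derivative
      (exp (- disc_P (s *\<^sub>R x)) * Im (disc_c (s *\<^sub>R x) (s *\<^sub>R v)), Re (disc_c (s *\<^sub>R x) (s *\<^sub>R v)))) (at 0)"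
    unfolding disc_chart_def has_real_derivative_iff_has_vector_derivative
    by (intro has_vector_derivative_Pair) auto
  then have d: "dirD [v] (disc_chart s) x = (exp (- disc_P (s *\<^sub>R x)) * Im (disc_c (s *\<^sub>R x) (s *\<^sub>R v)), Re (disc_c (s *\<^sub>R x) (s *\<^sub>R v)))"
    by (simp add: vector_derivative_at)
  have "exp (2 * P) * (exp (- P) * i)\<^sup>2 = i\<^sup>2" for P i :: real
  proof -
    have "exp (2 * P) * (exp (- P))\<^sup>2 = 1" by (simp add: power2_eq_square flip: exp_add)
    then show ?thesis by (simp add: power_mult_distrib flip: mult.assoc)
  qed
  then have "gR (disc_chart s x) (dirD [v] (disc_chart s) x) = (Re (disc_c (s *\<^sub>R x) (s *\<^sub>R v)))\<^sup>2 + (Im (disc_c (s *\<^sub>R x) (s *\<^sub>R v)))\<^sup>2"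
    unfolding gR_def d by (simp add: disc_chart_def)
  also have "\<dots> = gD x v" unfolding disc_c_norm[OF sz[OF x]] gD_def using s by auto
  finally show "gR (disc_chart s x) (dirD [v] (disc_chart s) x) = gD x v" .
qed

text \<open>The first bound turns growth of \<rho> into growth of P. The second follows from
  \<open>(1 - |z|\<^sup>2)\<^sup>2 \<le> |1 - z\<^sup>2|\<^sup>2\<close> and prevents P from being
  very negative in both charts. The third is
  \<open>exp \<rho> \<le> 2 * cosh \<rho>\<close>.\<close>

lemma disc_P_bounds:
  assumes "cmod z < 1"
  shows "\<bar>disc_P z\<bar> \<le> hrho z" and "disc_P z + disc_P (- z) \<ge> 0"
    and "hrho z \<le> ln 2 + ln ((exp (disc_P z) * (1 + (disc_Q z)\<^sup>2) + exp (- disc_P z)) / 2)"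
proof -
  define r where "r = cmod z"
  have r: "0 \<le> r" "r < 1" using assms by (auto simp: r_def)
  define N E where "N = disc_N z" and "E = disc_E z"
  have NE: "N > 0" "E > 0" unfolding N_def E_def using disc_pos[OF assms] by auto
  have E: "E = (1 - r) * (1 + r)" by (simp add: E_def disc_E_eq r_def power2_eq_square algebra_simps)
  have N: "N = (cmod (1 - z))\<^sup>2" by (simp add: N_def disc_N_def cmod_power2)
  have tri: "1 - r \<le> cmod (1 - z)" "cmod (1 - z) \<le> 1 + r"
    using norm_triangle_ineq2[of 1 z] norm_triangle_ineq4[of 1 z] by (auto simp: r_def)
  have N1: "(1 - r)\<^sup>2 \<le> N" "N \<le> (1 + r)\<^sup>2" unfolding N using tri r by (auto intro!: power_mono)
  have hr: "hrho z = ln ((1 + r) / (1 - r))" by (simp add: hrho_def r_def)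
  have P: "disc_P z = ln (N / E)" using NE by (simp add: disc_P_def N_def E_def ln_div)
  have "N / E \<le> (1 + r) / (1 - r)"
  proof -
    have "N / E \<le> (1 + r)\<^sup>2 / E" using N1 NE by (intro divide_right_mono) auto
    also have "\<dots> = (1 + r) / (1 - r)" unfolding E using r by (simp add: power2_eq_square)
    finally show ?thesis .
  qed
  then have 1: "disc_P z \<le> hrho z" unfolding P hr using NE r by simp
  have "(1 - r) / (1 + r) \<le> N / E"
  proof -
    have "(1 - r) / (1 + r) = (1 - r)\<^sup>2 / E" unfolding E using r by (simp add: power2_eq_square)
    also have "\<dots> \<le> N / E" using N1 NE by (intro divide_right_mono) auto
    finally show ?thesis .
  qed
  then have "ln ((1 - r) / (1 + r)) \<le> disc_P z" unfolding P using NE r by simp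
  moreover have "ln ((1 - r) / (1 + r)) = - hrho z" unfolding hr using r by (simp add: ln_div)
  ultimately show "\<bar>disc_P z\<bar> \<le> hrho z" using 1 by simp
  have z': "cmod (- z) < 1" using assms by simp
  define N' where "N' = disc_N (- z)"
  have N': "N' > 0" "N' = (cmod (1 + z))\<^sup>2" using disc_pos[OF z'] by (auto simp: N'_def disc_N_def cmod_power2)
  have E': "disc_E (- z) = E" by (simp add: E_def disc_E_def)
  have "E\<^sup>2 \<le> N * N'"
  proof -
    have "E = 1 - cmod (z * z)" by (simp add: E_def disc_E_eq norm_mult power2_eq_square)
    also have "\<dots> \<le> cmod (1 - z * z)" using norm_triangle_ineq2[of 1 "z * z"] by simp
    also have "1 - z * z = (1 - z) * (1 + z)" by (simp add: algebra_simps)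
    finally have "E \<le> cmod (1 - z) * cmod (1 + z)" by (simp add: norm_mult)
    then have "E\<^sup>2 \<le> (cmod (1 - z) * cmod (1 + z))\<^sup>2" using NE by (intro power_mono) auto
    then show ?thesis by (simp add: N N' power_mult_distrib)
  qed
  then have "ln (E\<^sup>2) \<le> ln (N * N')" using NE N' by (subst ln_le_cancel_iff) auto
  then show "disc_P z + disc_P (- z) \<ge> 0" unfolding disc_P_def E' using NE N'
    by (simp add: ln_mult ln_realpow N_def[symmetric] E_def[symmetric] N'_def[symmetric])
  have W: "(exp (disc_P z) * (1 + (disc_Q z)\<^sup>2) + exp (- disc_P z)) / 2 = (1 + r\<^sup>2) / E"
  proof -
    have "exp (disc_P z) * (1 + (disc_Q z)\<^sup>2) + exp (- disc_P z) = (N\<^sup>2 + (2 * Im z)\<^sup>2 + E\<^sup>2) / (N * E)"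
      unfolding exp_minus exp_disc_P[OF assms] disc_Q_def N_def[symmetric] E_def[symmetric]
      using NE by (simp add: field_simps power2_eq_square)
    also have "N\<^sup>2 + (2 * Im z)\<^sup>2 + E\<^sup>2 = 2 * (1 + r\<^sup>2) * N"
      unfolding N_def E_def disc_N_def disc_E_def r_def cmod_power2 by (simp add: power2_eq_square algebra_simps)
    also have "2 * (1 + r\<^sup>2) * N / (N * E) = 2 * ((1 + r\<^sup>2) / E)" using NE by simp
    finally have f: "exp (disc_P z) * (1 + (disc_Q z)\<^sup>2) + exp (- disc_P z) = 2 * ((1 + r\<^sup>2) / E)" .
    show ?thesis unfolding f by (rule nonzero_mult_div_cancel_left) simp
  qed
  have "(1 + r) / (1 - r) \<le> 2 * ((1 + r\<^sup>2) / E)"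
  proof -
    have "(1 + r) / (1 - r) = (1 + r)\<^sup>2 / E" unfolding E using r by (simp add: power2_eq_square)
    also have "(1 + r)\<^sup>2 \<le> 2 * (1 + r\<^sup>2)" using zero_le_power2[of "1 - r"] by (simp add: power2_eq_square algebra_simps)
    finally show ?thesis using NE by (simp add: divide_right_mono)
  qed
  moreover have "(1 + r\<^sup>2) / E > 0" using NE by (intro divide_pos_pos add_pos_nonneg) auto
  ultimately have "ln ((1 + r) / (1 - r)) \<le> ln (2 * ((1 + r\<^sup>2) / E))" using r by (intro ln_mono) auto
  also have "\<dots> = ln 2 + ln ((1 + r\<^sup>2) / E)" using \<open>(1 + r\<^sup>2) / E > 0\<close> by (intro ln_mult_pos) auto
  finally show "hrho z \<le> ln 2 + ln ((exp (disc_P z) * (1 + (disc_Q z)\<^sup>2) + exp (- disc_P z)) / 2)"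
    unfolding W hr .
qed

text \<open>\<open>eq\<close> is the derivative along a characteristic of
  \<open>c * ((1 - z) * (1 - z * cnj z)) = - 2 * ((1 - cnj z) * w)\<close>, where z has derivative
  w1, w has derivative R, and c has derivative c'. The conclusion solves it for c';
  \<open>(c1 - cnj c1) / 2\<close> is i times the imaginary part of c1.\<close>

lemma disc_c_derivative_algebra:
  fixes z w w1 c' :: complex
  assumes z: "cmod z < 1"
  defines "c \<equiv> disc_c z w" and "c1 \<equiv> disc_c z w1" and "R \<equiv> - 2 * cnj z * w * w1 / (1 - z * cnj z) - (w - w1) / 2"
  assumes eq: "c * ((1 - z) * - (w1 * cnj z + z * cnj w1) + - w1 * (1 - z * cnj z)) + c' * ((1 - z) * (1 - z * cnj z))
      = - 2 * ((1 - cnj z) * R + - cnj w1 * w)"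
  shows "c' = - ((c1 - cnj c1) / 2) * c - (c - c1) / 2"
proof -
  have nE: "1 - z * cnj z \<noteq> 0"
  proof -
    have "1 - z * cnj z = complex_of_real (disc_E z)"
      by (simp add: complex_eq_iff disc_E_def power2_eq_square algebra_simps)
    then show ?thesis using disc_pos[OF z] by simp
  qed
  have nu: "1 - z \<noteq> 0" using z by auto
  then have nub: "1 - cnj z \<noteq> 0" by (metis complex_cnj_diff complex_cnj_one complex_cnj_zero_iff)
  \<comment> \<open>Named inverses with three relations turn the claim into a polynomial identity;
    besides these, only \<open>E = u + ub - u * ub\<close> is used.\<close>
  define u ub E iu iub iE wb where "u = 1 - z" and "ub = 1 - cnj z" and "E = 1 - z * cnj z"
    and "iu = inverse u" and "iub = inverse ub" and "iE = inverse E" and "wb = cnj w1"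
  have rel: "u * iu = 1" "ub * iub = 1" "E * iE = 1"
    using nu nub nE by (simp_all add: u_def ub_def E_def iu_def iub_def iE_def)
  have zz: "z = 1 - u" "cnj z = 1 - ub" "E = u + ub - u * ub" by (simp_all add: u_def ub_def E_def algebra_simps)
  have c: "c = - 2 * ub * w * iu * iE" "c1 = - 2 * ub * w1 * iu * iE" "cnj c1 = - 2 * u * wb * iub * iE"
    by (simp_all add: c_def c1_def disc_c_def u_def ub_def E_def iu_def iub_def iE_def wb_def divide_inverse mult_ac)
  have R: "R = - 2 * (1 - ub) * w * w1 * iE - (w - w1) / 2"
  proof -
    have "x / E = x * iE" for x by (simp add: iE_def divide_inverse)
    then show ?thesis unfolding R_def E_def[symmetric] by (simp add: ub_def)
  qed
  define T where "T = - ((c1 - cnj c1) / 2) * c - (c - c1) / 2"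
  have eq': "c * (u * - (w1 * (1 - ub) + (1 - u) * wb) + - w1 * E) + c' * (u * E) = - 2 * (ub * R + - wb * w)"
    using eq unfolding u_def ub_def E_def wb_def by simp
  have T: "T = - ((- 2 * ub * w1 * iu * iE + 2 * u * wb * iub * iE) / 2) * (- 2 * ub * w * iu * iE)
      - (- 2 * ub * w * iu * iE + 2 * ub * w1 * iu * iE) / 2"
    unfolding T_def c(3) unfolding c(1,2) by simp
  have T': "T = - 2 * ub * ub * w * w1 * iu * iu * iE * iE + 2 * (u * iu) * (ub * iub) * w * wb * iE * iE + ub * (w - w1) * iu * iE"
    unfolding T by (simp add: field_simps)
  have "T * (u * E) = - 2 * ub * ub * w * w1 * iu * iE + 2 * w * wb * u * iE + ub * (w - w1)"
  proof -
    have "T * (u * E) = - 2 * ub * ub * w * w1 * iu * iE * (u * iu) * (E * iE) +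
        2 * w * wb * u * iE * (u * iu) * (ub * iub) * (E * iE) + ub * (w - w1) * (u * iu) * (E * iE)"
      unfolding T' by (simp add: algebra_simps)
    then show ?thesis unfolding rel by simp
  qed
  moreover have "c' * (u * E) = - 2 * (ub * R - wb * w) - c * (- (u * (w1 * (1 - ub) + (1 - u) * wb)) - w1 * E)"
    using eq' by (simp add: algebra_simps)
  moreover have "\<dots> = - 2 * ub * ub * w * w1 * iu * iE + 2 * w * wb * u * iE + ub * (w - w1)"
  proof -
    have "- 2 * (ub * R - wb * w) = 4 * ub * (1 - ub) * w * w1 * iE + ub * (w - w1) + 2 * wb * w"
      unfolding R by (simp add: field_simps)
    moreover have "c * (- (u * (w1 * (1 - ub) + (1 - u) * wb)) - w1 * E) =
       2 * ub * w * (w1 * (1 - ub) + (1 - u) * wb) * iE + 2 * ub * w * w1 * iu"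
    proof -
      have "c * (- (u * (w1 * (1 - ub) + (1 - u) * wb)) - w1 * E) =
         2 * ub * w * (w1 * (1 - ub) + (1 - u) * wb) * iE * (u * iu) + 2 * ub * w * w1 * iu * (E * iE)"
        unfolding c by (simp add: algebra_simps)
      then show ?thesis unfolding rel by simp
    qed
    moreover have "4 * ub * (1 - ub) * w * w1 * iE + 2 * wb * w - (2 * ub * w * (w1 * (1 - ub) + (1 - u) * wb) * iE + 2 * ub * w * w1 * iu)
      = - 2 * ub * ub * w * w1 * iu * iE + 2 * w * wb * u * iE"
    proof -
      have h1: "iu = (1 + ub * iu - ub) * iE"
      proof -
        have "iu * (E * iE) = (u * iu + ub * iu - (u * iu) * ub) * iE" unfolding zz(3) by (simp add: algebra_simps)
        then show ?thesis unfolding rel by simp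
      qed
      have h2: "2 * wb * w = 2 * wb * w * (u + ub - u * ub) * iE"
      proof -
        have "2 * wb * w * (E * iE) = 2 * wb * w * (u + ub - u * ub) * iE" unfolding zz(3) by (simp add: mult.assoc)
        then show ?thesis unfolding rel by simp
      qed
      have "4 * ub * (1 - ub) * w * w1 * iE + 2 * wb * w - (2 * ub * w * (w1 * (1 - ub) + (1 - u) * wb) * iE + 2 * ub * w * w1 * iu)
        = 4 * ub * (1 - ub) * w * w1 * iE + 2 * wb * w * (u + ub - u * ub) * iE
          - (2 * ub * w * (w1 * (1 - ub) + (1 - u) * wb) * iE + 2 * ub * w * w1 * ((1 + ub * iu - ub) * iE))"
        unfolding h2[symmetric] h1[symmetric] ..
      also have "\<dots> = - 2 * ub * ub * w * w1 * iu * iE + 2 * w * wb * u * iE" by (simp add: algebra_simps)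
      finally show ?thesis .
    qed
    moreover have "x1 + y + x2 - z = r + y" if "x1 + x2 - z = r" for x1 x2 y z r :: complex
      using that by (simp add: algebra_simps)
    ultimately show ?thesis by metis
  qed
  ultimately have "c' * (u * E) = T * (u * E)" by simp
  moreover have "u * E \<noteq> 0" using nu nE by (simp add: u_def E_def)
  ultimately show ?thesis unfolding T_def by simp
qed

section \<open>From the equation in the disc to the frame system\<close>

lemma smooth_strip_UNIV: "smooth_strip UNIV F \<longleftrightarrow> Cinf_on UNIV (\<lambda>x. F (fst x) (snd x))"
  by (simp add: smooth_strip_def)

lemma ptau_Complex:
  assumes "smooth_strip UNIV F" "smooth_strip UNIV G"
  shows "ptau (\<lambda>t s. Complex (F t s) (G t s)) \<tau> \<theta> = Complex (ptau F \<tau> \<theta>) (ptau G \<tau> \<theta>)"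
    and "ptheta (\<lambda>t s. Complex (F t s) (G t s)) \<tau> \<theta> = Complex (ptheta F \<tau> \<theta>) (ptheta G \<tau> \<theta>)"
proof -
  have "((\<lambda>t. Complex (F t \<theta>) (G t \<theta>)) has_vector_derivative Complex (ptau F \<tau> \<theta>) (ptau G \<tau> \<theta>)) (at \<tau>)"
    using has_ptau[OF assms(1) UNIV_I] has_ptau[OF assms(2) UNIV_I] by (simp add: has_vector_derivative_complex_iff)
  then show "ptau (\<lambda>t s. Complex (F t s) (G t s)) \<tau> \<theta> = Complex (ptau F \<tau> \<theta>) (ptau G \<tau> \<theta>)"
    unfolding ptau_def by (rule vector_derivative_at)
  have "((\<lambda>s. Complex (F \<tau> s) (G \<tau> s)) has_vector_derivative Complex (ptheta F \<tau> \<theta>) (ptheta G \<tau> \<theta>)) (at \<theta>)"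
    using has_ptheta[OF assms(1) UNIV_I] has_ptheta[OF assms(2) UNIV_I] by (simp add: has_vector_derivative_complex_iff)
  then show "ptheta (\<lambda>t s. Complex (F t s) (G t s)) \<tau> \<theta> = Complex (ptheta F \<tau> \<theta>) (ptheta G \<tau> \<theta>)"
    unfolding ptheta_def by (rule vector_derivative_at)
qed

locale disc_solution =
  fixes z :: "real \<Rightarrow> real \<Rightarrow> complex"
  assumes smooth: "Cinf_on UNIV (\<lambda>x::real \<times> real. z (fst x) (snd x))"
    and inD: "\<And>\<tau> \<theta>. cmod (z \<tau> \<theta>) < 1"
    and eq: "gowdy_eq z"
begin

definition "X \<tau> \<theta> = Re (z \<tau> \<theta>)"
definition "Y \<tau> \<theta> = Im (z \<tau> \<theta>)"
definition "E \<tau> \<theta> = 1 - (X \<tau> \<theta>)\<^sup>2 - (Y \<tau> \<theta>)\<^sup>2"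

lemma z_eq: "z = (\<lambda>\<tau> \<theta>. Complex (X \<tau> \<theta>) (Y \<tau> \<theta>))"
  by (simp add: X_def Y_def)

lemma smooth_X: "smooth_strip UNIV X" and smooth_Y: "smooth_strip UNIV Y"
  unfolding smooth_strip_UNIV X_def Y_def
  by (rule Cinf_on_bounded_linear_compose[OF open_UNIV bounded_linear_Re smooth]
      Cinf_on_bounded_linear_compose[OF open_UNIV bounded_linear_Im smooth])+

lemma E_eq: "E \<tau> \<theta> = disc_E (z \<tau> \<theta>)" "E \<tau> \<theta> = 1 - (cmod (z \<tau> \<theta>))\<^sup>2"
  by (simp_all add: E_def X_def Y_def disc_E_def cmod_power2)

lemma E_pos: "E \<tau> \<theta> > 0"
  unfolding E_eq(1) by (rule disc_pos(1)[OF inD])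

lemma smooth_E: "smooth_strip UNIV E"
  unfolding E_def[abs_def] by (intro smooth_strip_diff smooth_strip_power smooth_strip_const smooth_X smooth_Y open_UNIV)

lemma quotient_derivatives:
  assumes F: "smooth_strip UNIV F"
  shows "ptau (\<lambda>t s. F t s / (E t s)\<^sup>2) \<tau> \<theta> = ptau F \<tau> \<theta> / (E \<tau> \<theta>)\<^sup>2
      + 4 * F \<tau> \<theta> * (X \<tau> \<theta> * ptau X \<tau> \<theta> + Y \<tau> \<theta> * ptau Y \<tau> \<theta>) / (E \<tau> \<theta>) ^ 3"
    and "ptheta (\<lambda>t s. F t s / (E t s)\<^sup>2) \<tau> \<theta> = ptheta F \<tau> \<theta> / (E \<tau> \<theta>)\<^sup>2
      + 4 * F \<tau> \<theta> * (X \<tau> \<theta> * ptheta X \<tau> \<theta> + Y \<tau> \<theta> * ptheta Y \<tau> \<theta>) / (E \<tau> \<theta>) ^ 3"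
proof -
  have gen: "((\<lambda>t. f t / (1 - (x t)\<^sup>2 - (y t)\<^sup>2)\<^sup>2) has_real_derivative
      f' / (1 - (x r)\<^sup>2 - (y r)\<^sup>2)\<^sup>2 + 4 * f r * (x r * x' + y r * y') / (1 - (x r)\<^sup>2 - (y r)\<^sup>2) ^ 3) (at r)"
    if f: "(f has_real_derivative f') (at r)" "(x has_real_derivative x') (at r)" "(y has_real_derivative y') (at r)"
      and pos: "1 - (x r)\<^sup>2 - (y r)\<^sup>2 > 0" for f x y :: "real \<Rightarrow> real" and f' x' y' r
  proof -
    define e where "e = 1 - (x r)\<^sup>2 - (y r)\<^sup>2"
    have e: "e \<noteq> 0" using pos by (simp add: e_def)
    have de: "((\<lambda>t. (1 - (x t)\<^sup>2 - (y t)\<^sup>2)\<^sup>2) has_real_derivative 2 * e * - (2 * (x r * x' + y r * y'))) (at r)"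
      using f unfolding e_def by (auto intro!: derivative_eq_intros simp: algebra_simps)
    have "((\<lambda>t. f t / (1 - (x t)\<^sup>2 - (y t)\<^sup>2)\<^sup>2) has_real_derivative
        (f' * e\<^sup>2 - f r * (2 * e * - (2 * (x r * x' + y r * y')))) / (e\<^sup>2 * e\<^sup>2)) (at r)"
      using DERIV_divide[OF f(1) de] e unfolding e_def by simp
    also have "(f' * e\<^sup>2 - f r * (2 * e * - (2 * (x r * x' + y r * y')))) / (e\<^sup>2 * e\<^sup>2)
        = f' / e\<^sup>2 + 4 * f r * (x r * x' + y r * y') / e ^ 3"
      using e by (simp add: field_simps power2_eq_square power3_eq_cube)
    finally show ?thesis unfolding e_def .
  qed
  note pos = E_pos[unfolded E_def]
  show "ptau (\<lambda>t s. F t s / (E t s)\<^sup>2) \<tau> \<theta> = ptau F \<tau> \<theta> / (E \<tau> \<theta>)\<^sup>2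
      + 4 * F \<tau> \<theta> * (X \<tau> \<theta> * ptau X \<tau> \<theta> + Y \<tau> \<theta> * ptau Y \<tau> \<theta>) / (E \<tau> \<theta>) ^ 3"
    unfolding E_def by (rule ptauI, rule gen[OF has_ptau[OF F UNIV_I] has_ptau[OF smooth_X UNIV_I] has_ptau[OF smooth_Y UNIV_I] pos])
  show "ptheta (\<lambda>t s. F t s / (E t s)\<^sup>2) \<tau> \<theta> = ptheta F \<tau> \<theta> / (E \<tau> \<theta>)\<^sup>2
      + 4 * F \<tau> \<theta> * (X \<tau> \<theta> * ptheta X \<tau> \<theta> + Y \<tau> \<theta> * ptheta Y \<tau> \<theta>) / (E \<tau> \<theta>) ^ 3"
    unfolding E_def by (rule pthetaI, rule gen[OF has_ptheta[OF F UNIV_I] has_ptheta[OF smooth_X UNIV_I] has_ptheta[OF smooth_Y UNIV_I] pos])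
qed

lemma component_equations:
  defines "K \<equiv> \<lambda>\<tau> \<theta>. ((ptau X \<tau> \<theta>)\<^sup>2 + (ptau Y \<tau> \<theta>)\<^sup>2) - exp (-2 * \<tau>) * ((ptheta X \<tau> \<theta>)\<^sup>2 + (ptheta Y \<tau> \<theta>)\<^sup>2)"
  shows "ptau (\<lambda>t s. ptau X t s / (E t s)\<^sup>2) \<tau> \<theta> - exp (-2 * \<tau>) * ptheta (\<lambda>t s. ptheta X t s / (E t s)\<^sup>2) \<tau> \<theta> = 2 * X \<tau> \<theta> / (E \<tau> \<theta>) ^ 3 * K \<tau> \<theta>"
    and "ptau (\<lambda>t s. ptau Y t s / (E t s)\<^sup>2) \<tau> \<theta> - exp (-2 * \<tau>) * ptheta (\<lambda>t s. ptheta Y t s / (E t s)\<^sup>2) \<tau> \<theta> = 2 * Y \<tau> \<theta> / (E \<tau> \<theta>) ^ 3 * K \<tau> \<theta>"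
proof -
  have pz: "ptau z t s = Complex (ptau X t s) (ptau Y t s)" "ptheta z t s = Complex (ptheta X t s) (ptheta Y t s)" for t s
    using ptau_Complex[OF smooth_X smooth_Y] z_eq by simp_all
  have dv: "Complex p q / complex_of_real r = Complex (p / r) (q / r)" for p q r by (simp add: complex_eq_iff)
  have E2: "E t s \<noteq> 0" for t s using E_pos[of t s] by simp
  have sm: "smooth_strip UNIV (\<lambda>t s. F t s / (E t s)\<^sup>2)" if "smooth_strip UNIV F" for F
    by (intro smooth_strip_divide smooth_strip_power smooth_E that open_UNIV) (simp add: E2)
  have 1: "ptau (\<lambda>t s. ptau z t s / complex_of_real ((1 - (cmod (z t s))\<^sup>2)\<^sup>2)) \<tau> \<theta>
      = Complex (ptau (\<lambda>t s. ptau X t s / (E t s)\<^sup>2) \<tau> \<theta>) (ptau (\<lambda>t s. ptau Y t s / (E t s)\<^sup>2) \<tau> \<theta>)"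
    unfolding pz dv E_eq(2)[symmetric] by (rule ptau_Complex(1)) (intro sm smooth_strip_ptau smooth_X smooth_Y)+
  have 2: "ptheta (\<lambda>t s. ptheta z t s / complex_of_real ((1 - (cmod (z t s))\<^sup>2)\<^sup>2)) \<tau> \<theta>
      = Complex (ptheta (\<lambda>t s. ptheta X t s / (E t s)\<^sup>2) \<tau> \<theta>) (ptheta (\<lambda>t s. ptheta Y t s / (E t s)\<^sup>2) \<tau> \<theta>)"
    unfolding pz dv E_eq(2)[symmetric] by (rule ptau_Complex(2)) (intro sm smooth_strip_ptheta smooth_X smooth_Y)+
  have K: "(cmod (ptau z \<tau> \<theta>))\<^sup>2 - exp (-2 * \<tau>) * (cmod (ptheta z \<tau> \<theta>))\<^sup>2 = K \<tau> \<theta>"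
    unfolding pz K_def by (simp add: cmod_power2)
  have "2 * z \<tau> \<theta> / complex_of_real ((E \<tau> \<theta>) ^ 3) * complex_of_real (K \<tau> \<theta>)
    = Complex (2 * X \<tau> \<theta> / (E \<tau> \<theta>) ^ 3 * K \<tau> \<theta>) (2 * Y \<tau> \<theta> / (E \<tau> \<theta>) ^ 3 * K \<tau> \<theta>)"
    unfolding complex_eq_iff by (simp add: X_def Y_def Re_divide_of_real Im_divide_of_real del: of_real_power)
  then have eqn: "Complex (ptau (\<lambda>t s. ptau X t s / (E t s)\<^sup>2) \<tau> \<theta>) (ptau (\<lambda>t s. ptau Y t s / (E t s)\<^sup>2) \<tau> \<theta>)
      - complex_of_real (exp (-2 * \<tau>)) * Complex (ptheta (\<lambda>t s. ptheta X t s / (E t s)\<^sup>2) \<tau> \<theta>) (ptheta (\<lambda>t s. ptheta Y t s / (E t s)\<^sup>2) \<tau> \<theta>)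
      = Complex (2 * X \<tau> \<theta> / (E \<tau> \<theta>) ^ 3 * K \<tau> \<theta>) (2 * Y \<tau> \<theta> / (E \<tau> \<theta>) ^ 3 * K \<tau> \<theta>)"
    using eq[unfolded gowdy_eq_def, rule_format, of \<tau> \<theta>] unfolding 1 2 K unfolding E_eq(2)[symmetric] by simp
  from arg_cong[OF this, of Re] arg_cong[OF this, of Im]
  show "ptau (\<lambda>t s. ptau X t s / (E t s)\<^sup>2) \<tau> \<theta> - exp (-2 * \<tau>) * ptheta (\<lambda>t s. ptheta X t s / (E t s)\<^sup>2) \<tau> \<theta> = 2 * X \<tau> \<theta> / (E \<tau> \<theta>) ^ 3 * K \<tau> \<theta>"
    "ptau (\<lambda>t s. ptau Y t s / (E t s)\<^sup>2) \<tau> \<theta> - exp (-2 * \<tau>) * ptheta (\<lambda>t s. ptheta Y t s / (E t s)\<^sup>2) \<tau> \<theta> = 2 * Y \<tau> \<theta> / (E \<tau> \<theta>) ^ 3 * K \<tau> \<theta>"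
    by simp_all
qed

definition "zc \<sigma> \<tau> \<theta> = Complex (Dchar \<sigma> X \<tau> \<theta>) (Dchar \<sigma> Y \<tau> \<theta>)"

text \<open>Expanding the divergence form, the derivatives of the conformal factor combine with the
  right-hand side into a single product of the two characteristic derivatives; the last term is the
  first-order term of \<open>Dchar_Dchar\<close>.\<close>

lemma wave_equation:
  assumes \<sigma>: "\<sigma> \<in> {1, -1}"
  shows "Complex (Dchar (-\<sigma>) (Dchar \<sigma> X) \<tau> \<theta>) (Dchar (-\<sigma>) (Dchar \<sigma> Y) \<tau> \<theta>) =
    - 2 * cnj (z \<tau> \<theta>) * zc \<sigma> \<tau> \<theta> * zc (-\<sigma>) \<tau> \<theta> / (1 - z \<tau> \<theta> * cnj (z \<tau> \<theta>)) - (zc \<sigma> \<tau> \<theta> - zc (-\<sigma>) \<tau> \<theta>) / 2"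
proof -
  define x y e u where "x = X \<tau> \<theta>" and "y = Y \<tau> \<theta>" and "e = E \<tau> \<theta>" and "u = exp (-\<tau>)"
  define xt xs yt ys xtt xss ytt yss where "xt = ptau X \<tau> \<theta>" and "xs = ptheta X \<tau> \<theta>" and "yt = ptau Y \<tau> \<theta>" and "ys = ptheta Y \<tau> \<theta>"
    and "xtt = ptau (ptau X) \<tau> \<theta>" and "xss = ptheta (ptheta X) \<tau> \<theta>" and "ytt = ptau (ptau Y) \<tau> \<theta>" and "yss = ptheta (ptheta Y) \<tau> \<theta>"
  note defs = x_def y_def e_def xt_def xs_def yt_def ys_def xtt_def xss_def ytt_def yss_def
  have e: "e > 0" unfolding e_def by (rule E_pos)
  have u2: "exp (-2 * \<tau>) = u * u" by (simp add: u_def flip: exp_add)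
  have s2: "\<sigma>\<^sup>2 = 1" "\<sigma> * \<sigma> = 1" using \<sigma> by auto
  define k where "k = (xt\<^sup>2 + yt\<^sup>2) - u * u * (xs\<^sup>2 + ys\<^sup>2)"
  \<comment> \<open>Multiplication by the cube of e clears all denominators; f is kept general so
    that both components are covered.\<close>
  have clear: "e * (ftt - u * u * fss) = 2 * f * k - 4 * ft * (x * xt + y * yt) + 4 * (u * u) * fs * (x * xs + y * ys)"
    if "ftt / e\<^sup>2 + 4 * ft * (x * xt + y * yt) / e ^ 3 - u * u * (fss / e\<^sup>2 + 4 * fs * (x * xs + y * ys) / e ^ 3) = 2 * f / e ^ 3 * k"
    for f ft fs ftt fss
  proof -
    have "(ftt / e\<^sup>2 + 4 * ft * (x * xt + y * yt) / e ^ 3 - u * u * (fss / e\<^sup>2 + 4 * fs * (x * xs + y * ys) / e ^ 3)) * e ^ 3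
       = e * (ftt - u * u * fss) + 4 * ft * (x * xt + y * yt) - 4 * (u * u) * fs * (x * xs + y * ys)"
      using e by (simp add: field_simps power2_eq_square power3_eq_cube)
    moreover have "(2 * f / e ^ 3 * k) * e ^ 3 = 2 * f * k" using e by simp
    ultimately show ?thesis using that by simp
  qed
  have cx: "e * (xtt - u * u * xss) = 2 * x * k - 4 * xt * (x * xt + y * yt) + 4 * (u * u) * xs * (x * xs + y * ys)"
    using component_equations(1)[of \<tau> \<theta>]
    unfolding quotient_derivatives[OF smooth_strip_ptau[OF smooth_X]] quotient_derivatives[OF smooth_strip_ptheta[OF smooth_X]] u2
    by (intro clear) (simp add: defs k_def)
  have cy: "e * (ytt - u * u * yss) = 2 * y * k - 4 * yt * (x * xt + y * yt) + 4 * (u * u) * ys * (x * xs + y * ys)"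
    using component_equations(2)[of \<tau> \<theta>]
    unfolding quotient_derivatives[OF smooth_strip_ptau[OF smooth_Y]] quotient_derivatives[OF smooth_strip_ptheta[OF smooth_Y]] u2
    by (intro clear) (simp add: defs k_def)
  define p q p' q' where "p = xt + \<sigma> * u * xs" and "q = yt + \<sigma> * u * ys" and "p' = xt - \<sigma> * u * xs" and "q' = yt - \<sigma> * u * ys"
  have zc: "zc \<sigma> \<tau> \<theta> = Complex p q" "zc (-\<sigma>) \<tau> \<theta> = Complex p' q'"
    by (simp_all add: zc_def Dchar_def p_def q_def p'_def q'_def defs u_def)
  have DX: "Dchar (-\<sigma>) (Dchar \<sigma> X) \<tau> \<theta> = xtt - u * u * xss - (p - p') / 2"
    unfolding Dchar_Dchar[OF smooth_X] s2 u2 by (simp add: defs p_def p'_def u_def)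
  have DY: "Dchar (-\<sigma>) (Dchar \<sigma> Y) \<tau> \<theta> = ytt - u * u * yss - (q - q') / 2"
    unfolding Dchar_Dchar[OF smooth_Y] s2 u2 by (simp add: defs q_def q'_def u_def)
  \<comment> \<open>The complex product of the two characteristic derivatives is built from these
    combinations, in which \<sigma> enters only through its square.\<close>
  have pp: "p * p' = xt\<^sup>2 - u * u * xs\<^sup>2" "q * q' = yt\<^sup>2 - u * u * ys\<^sup>2" "p * q' + p' * q = 2 * (xt * yt - u * u * xs * ys)"
  proof -
    have "p * p' = xt\<^sup>2 - (\<sigma> * \<sigma>) * (u * u) * xs\<^sup>2" by (simp add: p_def p'_def power2_eq_square algebra_simps)
    then show "p * p' = xt\<^sup>2 - u * u * xs\<^sup>2" by (simp add: s2)
    have "q * q' = yt\<^sup>2 - (\<sigma> * \<sigma>) * (u * u) * ys\<^sup>2" by (simp add: q_def q'_def power2_eq_square algebra_simps)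
    then show "q * q' = yt\<^sup>2 - u * u * ys\<^sup>2" by (simp add: s2)
    have "p * q' + p' * q = 2 * (xt * yt - (\<sigma> * \<sigma>) * (u * u) * xs * ys)" by (simp add: p_def p'_def q_def q'_def algebra_simps)
    then show "p * q' + p' * q = 2 * (xt * yt - u * u * xs * ys)" by (simp add: s2)
  qed
  have rx: "xtt - u * u * xss = (2 * x * (q * q' - p * p') - 2 * y * (p * q' + p' * q)) / e"
  proof -
    have "e * (xtt - u * u * xss) = 2 * x * (q * q' - p * p') - 2 * y * (p * q' + p' * q)"
      unfolding cx pp k_def by (simp add: power2_eq_square algebra_simps)
    then show ?thesis using e by (simp add: field_simps)
  qed
  have ry: "ytt - u * u * yss = (2 * y * (p * p' - q * q') - 2 * x * (p * q' + p' * q)) / e"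
  proof -
    have "e * (ytt - u * u * yss) = 2 * y * (p * p' - q * q') - 2 * x * (p * q' + p' * q)"
      unfolding cy pp k_def by (simp add: power2_eq_square algebra_simps)
    then show ?thesis using e by (simp add: field_simps)
  qed
  have z: "z \<tau> \<theta> = Complex x y" by (simp add: x_def y_def X_def Y_def)
  have ec: "1 - Complex x y * cnj (Complex x y) = complex_of_real e"
    by (simp add: complex_eq_iff e_def E_def x_def y_def power2_eq_square)
  have "Complex (xtt - u * u * xss) (ytt - u * u * yss) = - 2 * cnj (Complex x y) * Complex p q * Complex p' q' / complex_of_real e"
    unfolding rx ry complex_eq_iff Re_divide_of_real Im_divide_of_real by (simp add: algebra_simps)
  then show ?thesis unfolding DX DY zc z ec by (simp add: complex_eq_iff)
qed

definition "P \<tau> \<theta> = disc_P (z \<tau> \<theta>)"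
definition "Q \<tau> \<theta> = disc_Q (z \<tau> \<theta>)"
definition "a \<sigma> = Dchar \<sigma> P"
definition "b \<sigma> \<tau> \<theta> = exp (P \<tau> \<theta>) * Dchar \<sigma> Q \<tau> \<theta>"

lemma smooth_N: "smooth_strip UNIV (\<lambda>\<tau> \<theta>. disc_N (z \<tau> \<theta>))"
proof -
  have "smooth_strip UNIV (\<lambda>\<tau> \<theta>. (1 - X \<tau> \<theta>)\<^sup>2 + (Y \<tau> \<theta>)\<^sup>2)"
    by (intro smooth_strip_add smooth_strip_power smooth_strip_diff smooth_strip_const smooth_X smooth_Y open_UNIV)
  then show ?thesis by (simp add: disc_N_def X_def Y_def)
qed

lemma N_pos: "disc_N (z \<tau> \<theta>) > 0" "disc_N (z \<tau> \<theta>) \<noteq> 0"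
  using disc_pos(2)[OF inD, of \<tau> \<theta>] by auto

lemma smooth_P: "smooth_strip UNIV P"
proof -
  have "smooth_strip UNIV (\<lambda>\<tau> \<theta>. ln (disc_N (z \<tau> \<theta>)) - ln (E \<tau> \<theta>))"
    by (intro smooth_strip_diff smooth_strip_ln smooth_N smooth_E open_UNIV N_pos E_pos)
  then show ?thesis by (simp add: P_def[abs_def] disc_P_def E_eq)
qed

lemma smooth_Q: "smooth_strip UNIV Q"
proof -
  have "smooth_strip UNIV (\<lambda>\<tau> \<theta>. (- 2) * Y \<tau> \<theta> / disc_N (z \<tau> \<theta>))"
    by (intro smooth_strip_divide smooth_strip_mult smooth_strip_const smooth_N smooth_Y open_UNIV N_pos)
  then show ?thesis by (simp add: Q_def[abs_def] disc_Q_def Y_def)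
qed

lemma smooth_a: "smooth_strip UNIV (a \<sigma>)" and smooth_b: "smooth_strip UNIV (b \<sigma>)"
  unfolding a_def b_def[abs_def]
  by (intro smooth_strip_mult smooth_strip_exp smooth_strip_Dchar smooth_P smooth_Q open_UNIV)+

lemma z_path:
  "((\<lambda>s. z s (\<theta> + \<sigma> * (exp (-\<tau>) - exp (-s)))) has_vector_derivative zc \<sigma> \<tau> \<theta>) (at \<tau>)"
  using char_deriv_Dchar[OF smooth_X, of \<sigma> \<tau> \<theta>] char_deriv_Dchar[OF smooth_Y, of \<sigma> \<tau> \<theta>]
  unfolding char_deriv_def zc_def has_vector_derivative_complex_iff by (simp add: X_def Y_def)

lemma ab_disc_c: "Complex (a \<sigma> \<tau> \<theta>) (b \<sigma> \<tau> \<theta>) = disc_c (z \<tau> \<theta>) (zc \<sigma> \<tau> \<theta>)"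
proof -
  have i: "cmod (z \<tau> (\<theta> + \<sigma> * (exp (-\<tau>) - exp (-\<tau>)))) < 1" by (rule inD)
  from disc_derivative[OF z_path i]
  have "char_deriv \<sigma> P \<tau> \<theta> (Re (disc_c (z \<tau> \<theta>) (zc \<sigma> \<tau> \<theta>)))"
    "char_deriv \<sigma> Q \<tau> \<theta> (exp (- P \<tau> \<theta>) * Im (disc_c (z \<tau> \<theta>) (zc \<sigma> \<tau> \<theta>)))"
    unfolding char_deriv_def P_def Q_def by simp_all
  then have "Dchar \<sigma> P \<tau> \<theta> = Re (disc_c (z \<tau> \<theta>) (zc \<sigma> \<tau> \<theta>))"
    "Dchar \<sigma> Q \<tau> \<theta> = exp (- P \<tau> \<theta>) * Im (disc_c (z \<tau> \<theta>) (zc \<sigma> \<tau> \<theta>))"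
    using Dchar_eqI[OF smooth_P] Dchar_eqI[OF smooth_Q] by blast+
  moreover have "exp (P \<tau> \<theta>) * (exp (- P \<tau> \<theta>) * x) = x" for x by (simp flip: mult.assoc exp_add)
  ultimately show ?thesis by (simp add: a_def b_def complex_eq_iff)
qed

text \<open>The identity \<open>c * ((1 - z) * (1 - z * cnj z)) = - 2 * ((1 - cnj z) * w)\<close>
  holds along a whole characteristic of the family -\<sigma>. Equating the derivatives of both
  sides, with the wave equation for that of w, determines the derivative of c; this is
  \<open>gowdy_frame\<close> in complex form.\<close>

lemma frame_equation:
  assumes \<sigma>: "\<sigma> \<in> {1, -1}"
  shows "Complex (Dchar (-\<sigma>) (a \<sigma>) \<tau> \<theta>) (Dchar (-\<sigma>) (b \<sigma>) \<tau> \<theta>) =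
    - (\<i> * complex_of_real (b (-\<sigma>) \<tau> \<theta>)) * Complex (a \<sigma> \<tau> \<theta>) (b \<sigma> \<tau> \<theta>)
     - (Complex (a \<sigma> \<tau> \<theta>) (b \<sigma> \<tau> \<theta>) - Complex (a (-\<sigma>) \<tau> \<theta>) (b (-\<sigma>) \<tau> \<theta>)) / 2"
proof -
  define h where "h s = \<theta> + (-\<sigma>) * (exp (-\<tau>) - exp (-s))" for s
  have h0: "h \<tau> = \<theta>" by (simp add: h_def)
  define c where "c s = Complex (a \<sigma> s (h s)) (b \<sigma> s (h s))" for s
  define \<zeta> where "\<zeta> s = z s (h s)" for s
  define w where "w s = zc \<sigma> s (h s)" for s
  define w1 where "w1 = zc (-\<sigma>) \<tau> \<theta>"
  define c' where "c' = Complex (Dchar (-\<sigma>) (a \<sigma>) \<tau> \<theta>) (Dchar (-\<sigma>) (b \<sigma>) \<tau> \<theta>)"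
  define R where "R = - 2 * cnj (z \<tau> \<theta>) * zc \<sigma> \<tau> \<theta> * w1 / (1 - z \<tau> \<theta> * cnj (z \<tau> \<theta>)) - (zc \<sigma> \<tau> \<theta> - w1) / 2"
  have dc: "(c has_vector_derivative c') (at \<tau>)"
    using char_deriv_Dchar[OF smooth_a, of "-\<sigma>" \<sigma> \<tau> \<theta>] char_deriv_Dchar[OF smooth_b, of "-\<sigma>" \<sigma> \<tau> \<theta>]
    unfolding char_deriv_def c_def h_def c'_def has_vector_derivative_complex_iff by simp
  have d\<zeta>: "(\<zeta> has_vector_derivative w1) (at \<tau>)" unfolding \<zeta>_def h_def w1_def by (rule z_path)
  have dw: "(w has_vector_derivative R) (at \<tau>)"
  proof -
    have "smooth_strip UNIV (Dchar \<sigma> X)" "smooth_strip UNIV (Dchar \<sigma> Y)"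
      by (intro smooth_strip_Dchar smooth_X smooth_Y open_UNIV)+
    from char_deriv_Dchar[OF this(1), of "-\<sigma>" \<tau> \<theta>] char_deriv_Dchar[OF this(2), of "-\<sigma>" \<tau> \<theta>]
    have "(w has_vector_derivative Complex (Dchar (-\<sigma>) (Dchar \<sigma> X) \<tau> \<theta>) (Dchar (-\<sigma>) (Dchar \<sigma> Y) \<tau> \<theta>)) (at \<tau>)"
      unfolding char_deriv_def w_def h_def zc_def has_vector_derivative_complex_iff by simp
    then show ?thesis unfolding wave_equation[OF \<sigma>] R_def w1_def .
  qed
  have cs: "c s * ((1 - \<zeta> s) * (1 - \<zeta> s * cnj (\<zeta> s))) = - 2 * ((1 - cnj (\<zeta> s)) * w s)" for s
  proof -
    have i: "cmod (\<zeta> s) < 1" unfolding \<zeta>_def by (rule inD)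
    have "1 - \<zeta> s * cnj (\<zeta> s) = complex_of_real (disc_E (\<zeta> s))"
      by (simp add: complex_eq_iff disc_E_def power2_eq_square algebra_simps)
    then have "1 - \<zeta> s * cnj (\<zeta> s) \<noteq> 0" using disc_pos[OF i] by simp
    moreover have "1 - \<zeta> s \<noteq> 0" using i by auto
    ultimately have D: "(1 - \<zeta> s) * (1 - \<zeta> s * cnj (\<zeta> s)) \<noteq> 0" by simp
    have h: "- 2 * p * q / D * D = - 2 * (p * q)" if "D \<noteq> 0" for p q D :: complex using that by simp
    show ?thesis unfolding c_def ab_disc_c disc_c_def \<zeta>_def[symmetric] w_def[symmetric] by (rule h[OF D])
  qed
  have dcn: "((\<lambda>s. cnj (\<zeta> s)) has_vector_derivative cnj w1) (at \<tau>)" by (rule has_vector_derivative_cnj[OF d\<zeta>])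
  have d1: "((\<lambda>s. 1 - \<zeta> s) has_vector_derivative 0 - w1) (at \<tau>)"
    by (rule has_vector_derivative_diff[OF has_vector_derivative_const d\<zeta>])
  have d2: "((\<lambda>s. 1 - \<zeta> s * cnj (\<zeta> s)) has_vector_derivative 0 - (\<zeta> \<tau> * cnj w1 + w1 * cnj (\<zeta> \<tau>))) (at \<tau>)"
    by (rule has_vector_derivative_diff[OF has_vector_derivative_const has_vector_derivative_mult[OF d\<zeta> dcn]])
  have d3: "((\<lambda>s. 1 - cnj (\<zeta> s)) has_vector_derivative 0 - cnj w1) (at \<tau>)"
    by (rule has_vector_derivative_diff[OF has_vector_derivative_const dcn])
  note L = has_vector_derivative_mult[OF dc has_vector_derivative_mult[OF d1 d2]]
  note Rr = has_vector_derivative_mult_right[OF has_vector_derivative_mult[OF d3 dw], of "-2"]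
  have "c \<tau> * ((1 - \<zeta> \<tau>) * (0 - (\<zeta> \<tau> * cnj w1 + w1 * cnj (\<zeta> \<tau>))) + (0 - w1) * (1 - \<zeta> \<tau> * cnj (\<zeta> \<tau>))) +
      c' * ((1 - \<zeta> \<tau>) * (1 - \<zeta> \<tau> * cnj (\<zeta> \<tau>))) = - 2 * ((1 - cnj (\<zeta> \<tau>)) * R + (0 - cnj w1) * w \<tau>)"
    using vector_derivative_unique_at[OF L] Rr unfolding cs by blast
  moreover have "\<zeta> \<tau> = z \<tau> \<theta>" "w \<tau> = zc \<sigma> \<tau> \<theta>" "c \<tau> = disc_c (z \<tau> \<theta>) (zc \<sigma> \<tau> \<theta>)"
    by (simp_all add: \<zeta>_def w_def c_def h0 ab_disc_c)
  ultimately have "c' = - ((disc_c (z \<tau> \<theta>) w1 - cnj (disc_c (z \<tau> \<theta>) w1)) / 2) * disc_c (z \<tau> \<theta>) (zc \<sigma> \<tau> \<theta>)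
      - (disc_c (z \<tau> \<theta>) (zc \<sigma> \<tau> \<theta>) - disc_c (z \<tau> \<theta>) w1) / 2"
    by (intro disc_c_derivative_algebra[OF inD]) (simp add: R_def algebra_simps)
  moreover have "disc_c (z \<tau> \<theta>) w1 = Complex (a (-\<sigma>) \<tau> \<theta>) (b (-\<sigma>) \<tau> \<theta>)" by (simp add: w1_def ab_disc_c)
  moreover have "(Complex p q - cnj (Complex p q)) / 2 = \<i> * complex_of_real q" for p q by (simp add: complex_eq_iff)
  ultimately show ?thesis unfolding c'_def ab_disc_c[symmetric] by simp
qed

lemma gowdy_frame_ab: "gowdy_frame a b"
proof
  fix \<sigma> \<tau> \<theta> assume \<sigma>: "\<sigma> \<in> {1, - 1::real}"
  from frame_equation[OF this, of \<tau> \<theta>]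
  show "Dchar (- \<sigma>) (a \<sigma>) \<tau> \<theta> = b \<sigma> \<tau> \<theta> * b (- \<sigma>) \<tau> \<theta> - (a \<sigma> \<tau> \<theta> - a (- \<sigma>) \<tau> \<theta>) / 2"
    "Dchar (- \<sigma>) (b \<sigma>) \<tau> \<theta> = - a \<sigma> \<tau> \<theta> * b (- \<sigma>) \<tau> \<theta> - (b \<sigma> \<tau> \<theta> - b (- \<sigma>) \<tau> \<theta>) / 2"
    by (simp_all add: complex_eq_iff mult.commute)
qed (rule smooth_a smooth_b)+

lemma gowdy_cone_PQ_z: "gowdy_cone_PQ a b P Q"
  unfolding gowdy_cone_PQ_def gowdy_cone_def gowdy_PQ_def gowdy_PQ_axioms_def
  using gowdy_frame_ab smooth_P smooth_Q by (auto simp: a_def b_def)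

lemma gowdy_PQ_z: "gowdy_PQ a b P Q"
  unfolding gowdy_PQ_def gowdy_PQ_axioms_def
  using gowdy_frame_ab smooth_P smooth_Q by (auto simp: a_def b_def)

text \<open>The right-hand side does not change when z is replaced by - z, so the two charts share
  the same A.\<close>

lemma ab_norm: "(a \<sigma> \<tau> \<theta>)\<^sup>2 + (b \<sigma> \<tau> \<theta>)\<^sup>2 = 4 * (cmod (zc \<sigma> \<tau> \<theta>))\<^sup>2 / (1 - (cmod (z \<tau> \<theta>))\<^sup>2)\<^sup>2"
  using disc_c_norm[OF inD, of \<tau> \<theta> "zc \<sigma> \<tau> \<theta>"] by (simp flip: ab_disc_c)

end

text \<open>\<open>ptau\<close> and \<open>ptheta\<close> are chosen derivatives, so the sign is
  pulled out by exhibiting the derivatives of the components.\<close>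

lemma ptau_uminus_Complex:
  assumes U: "smooth_strip UNIV U" and V: "smooth_strip UNIV V"
  shows "ptau (\<lambda>t s. - Complex (U t s) (V t s)) \<tau> \<theta> = - ptau (\<lambda>t s. Complex (U t s) (V t s)) \<tau> \<theta>"
    and "ptheta (\<lambda>t s. - Complex (U t s) (V t s)) \<tau> \<theta> = - ptheta (\<lambda>t s. Complex (U t s) (V t s)) \<tau> \<theta>"
proof -
  have m: "smooth_strip UNIV (\<lambda>t s. - F t s)" if "smooth_strip UNIV F" for F
    using smooth_strip_mult[OF open_UNIV smooth_strip_const[OF open_UNIV, of "-1"] that] by simp
  have n: "ptau (\<lambda>t s. - F t s) \<tau> \<theta> = - ptau F \<tau> \<theta>" "ptheta (\<lambda>t s. - F t s) \<tau> \<theta> = - ptheta F \<tau> \<theta>"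
    if "smooth_strip UNIV F" for F
    by (rule ptauI, rule DERIV_minus[OF has_ptau[OF that UNIV_I]])
      (rule pthetaI, rule DERIV_minus[OF has_ptheta[OF that UNIV_I]])
  have e: "- Complex p q = Complex (- p) (- q)" for p q by (simp add: complex_eq_iff)
  show "ptau (\<lambda>t s. - Complex (U t s) (V t s)) \<tau> \<theta> = - ptau (\<lambda>t s. Complex (U t s) (V t s)) \<tau> \<theta>"
    "ptheta (\<lambda>t s. - Complex (U t s) (V t s)) \<tau> \<theta> = - ptheta (\<lambda>t s. Complex (U t s) (V t s)) \<tau> \<theta>"
    unfolding e ptau_Complex[OF U V] ptau_Complex[OF m[OF U] m[OF V]] n[OF U] n[OF V] by simp_all
qed

context disc_solution
begin

text \<open>Both sides of the equation are odd in z.\<close>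

lemma disc_solution_uminus: "disc_solution (\<lambda>\<tau> \<theta>. - z \<tau> \<theta>)"
proof
  show "Cinf_on UNIV (\<lambda>x::real \<times> real. - z (fst x) (snd x))"
    by (rule Cinf_on_bounded_linear_compose[OF open_UNIV bounded_linear_minus[OF bounded_linear_ident] smooth])
  show "cmod (- z \<tau> \<theta>) < 1" for \<tau> \<theta> using inD by simp
  have zXY: "Complex (X t s) (Y t s) = z t s" for t s by (simp add: X_def Y_def)
  have mz: "ptau (\<lambda>\<tau> \<theta>. - z \<tau> \<theta>) t s = - ptau z t s" "ptheta (\<lambda>\<tau> \<theta>. - z \<tau> \<theta>) t s = - ptheta z t s" for t s
    using ptau_uminus_Complex[OF smooth_X smooth_Y] unfolding zXY .
  have E2: "E t s \<noteq> 0" for t s using E_pos[of t s] by simp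
  have sm: "smooth_strip UNIV (\<lambda>t s. F t s / (E t s)\<^sup>2)" if "smooth_strip UNIV F" for F
    by (intro smooth_strip_divide smooth_strip_power smooth_E that open_UNIV) (simp add: E2)
  have pz: "ptau z t s = Complex (ptau X t s) (ptau Y t s)" "ptheta z t s = Complex (ptheta X t s) (ptheta Y t s)" for t s
    using ptau_Complex[OF smooth_X smooth_Y] z_eq by simp_all
  have dv: "Complex p q / complex_of_real r = Complex (p / r) (q / r)" for p q r by (simp add: complex_eq_iff)
  have 1: "ptau (\<lambda>t s. - (ptau z t s / complex_of_real ((1 - (cmod (z t s))\<^sup>2)\<^sup>2))) \<tau> \<theta>
      = - ptau (\<lambda>t s. ptau z t s / complex_of_real ((1 - (cmod (z t s))\<^sup>2)\<^sup>2)) \<tau> \<theta>" for \<tau> \<theta>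
    unfolding pz dv E_eq(2)[symmetric] by (rule ptau_uminus_Complex(1)) (intro sm smooth_strip_ptau smooth_X smooth_Y)+
  have 2: "ptheta (\<lambda>t s. - (ptheta z t s / complex_of_real ((1 - (cmod (z t s))\<^sup>2)\<^sup>2))) \<tau> \<theta>
      = - ptheta (\<lambda>t s. ptheta z t s / complex_of_real ((1 - (cmod (z t s))\<^sup>2)\<^sup>2)) \<tau> \<theta>" for \<tau> \<theta>
    unfolding pz dv E_eq(2)[symmetric] by (rule ptau_uminus_Complex(2)) (intro sm smooth_strip_ptheta smooth_X smooth_Y)+
  have neg: "- x - c * (- y) = 2 * (- w) / d * e" if "x - c * y = 2 * w / d * e" for x y c w d e :: complex
    using arg_cong[OF that, of uminus] by simp
  show "gowdy_eq (\<lambda>\<tau> \<theta>. - z \<tau> \<theta>)"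
    unfolding gowdy_eq_def mz norm_minus_cancel minus_divide_left[symmetric] 1 2
    unfolding minus_divide_left
    by (intro allI neg eq[unfolded gowdy_eq_def, rule_format])
qed

end

section \<open>The speed at the given angle and the choice of the chart\<close>

locale disc_solution_at = disc_solution +
  fixes \<theta>\<^sub>0 :: real

sublocale disc_solution_at \<subseteq> gw: gowdy_cone_PQ a b \<theta>\<^sub>0 P Q
  by (rule gowdy_cone_PQ_z)

context disc_solution_at
begin

lemma asymp_speed_exists: "\<exists>v\<ge>0. gw.asymp_speed v"
proof -
  obtain M where M: "M \<ge> 0"
    "\<And>\<epsilon>. \<epsilon> > 0 \<Longrightarrow> \<exists>T\<ge>0. \<forall>\<tau>\<ge>T. \<forall>\<theta>\<in>gw.pcone \<tau>. gw.Kq \<tau> \<theta> \<le> \<epsilon> \<and> (\<forall>\<sigma>\<in>{1,-1}. \<bar>gw.A \<sigma> \<tau> \<theta> - M\<bar> \<le> \<epsilon>)"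
    by (rule gw.cone_smallness) blast
  have "gw.asymp_speed (sqrt M)" unfolding gw.asymp_speed_def using M by simp
  then show ?thesis using M(1) by (intro exI[of _ "sqrt M"]) simp
qed

lemma Wd_hrho: "hrho (z \<tau> \<theta>\<^sub>0) \<le> ln 2 + ln (gw.Wd \<tau>)"
  unfolding gw.Wd_def P_def Q_def by (rule disc_P_bounds(3)[OF inD])

lemma P_hrho: "\<bar>P \<tau> \<theta>\<bar> \<le> hrho (z \<tau> \<theta>)"
  unfolding P_def by (rule disc_P_bounds(1)[OF inD])

text \<open>If v < \<gamma>, the speed at \<open>\<theta>\<^sub>0\<close> is eventually at most some
  u < \<gamma>. Then \<open>ln (Wd \<tau>)\<close>, and with it \<rho>, is at most u \<tau> plus a
  constant, which contradicts the lower bound along the sequence.\<close>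

lemma speed_ge:
  assumes v: "gw.asymp_speed v" "v \<ge> 0" and seq: "filterlim \<tau>s at_top sequentially"
    and lower: "\<And>k. hrho (z (\<tau>s k) \<theta>\<^sub>0) / \<tau>s k \<ge> \<gamma>"
  shows "\<gamma> \<le> v"
proof (rule ccontr)
  assume "\<not> \<gamma> \<le> v"
  then have vg: "v < \<gamma>" by simp
  define u where "u = (v + \<gamma>) / 2"
  have u: "u > 0" "v < u" "u < \<gamma>" using v(2) vg by (auto simp: u_def)
  then have "u\<^sup>2 - v\<^sup>2 > 0" using v(2) by (simp add: power_strict_mono)
  then obtain T where T: "\<And>\<tau> \<sigma>. \<tau> \<ge> T \<Longrightarrow> \<sigma> \<in> {1, -1} \<Longrightarrow> \<bar>gw.A \<sigma> \<tau> \<theta>\<^sub>0 - v\<^sup>2\<bar> \<le> u\<^sup>2 - v\<^sup>2"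
    using v(1) gw.pcone_center unfolding gw.asymp_speed_def by metis
  have Au: "gw.A \<sigma> \<tau> \<theta>\<^sub>0 \<le> u\<^sup>2" if "\<tau> \<ge> T" "\<sigma> \<in> {1, -1}" for \<sigma> \<tau> using T[OF that] by linarith
  define K where "K = ln 2 + ln (gw.Wd T) - u * T"
  have "\<forall>\<^sub>F k in sequentially. \<tau>s k > max (max 1 T) (K / (\<gamma> - u))"
    using seq unfolding filterlim_at_top_dense by blast
  then obtain k where k: "\<tau>s k > 1" "\<tau>s k \<ge> T" "\<tau>s k > K / (\<gamma> - u)"
    by (auto dest!: eventually_happens)
  have "\<gamma> * \<tau>s k \<le> hrho (z (\<tau>s k) \<theta>\<^sub>0)" using lower[of k] k(1) by (simp add: field_simps)
  also have "\<dots> \<le> ln 2 + (ln (gw.Wd T) + u * (\<tau>s k - T))"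
    using Wd_hrho[of "\<tau>s k"] gw.ln_Wd_bound[OF u(1) Au k(2)] by linarith
  also have "\<dots> = K + u * \<tau>s k" by (simp add: K_def algebra_simps)
  finally have "(\<gamma> - u) * \<tau>s k \<le> K" by (simp add: algebra_simps)
  then have "\<tau>s k \<le> K / (\<gamma> - u)" using u by (simp add: field_simps)
  then show False using k by simp
qed

text \<open>If v > c, both alternatives contradict |P| \<le> c \<tau>. The decreasing one has slope
  -(v - 2 \<zeta>) = -(c + \<zeta>) and is excluded at late times; then \<open>ptau P\<close> is at
  least v - \<zeta> = c + 2 \<zeta> from some time on.\<close>

lemma speed_le:
  assumes v: "gw.asymp_speed v" and c: "c > 0" and upper: "\<And>\<tau>. \<tau> \<ge> T \<Longrightarrow> hrho (z \<tau> \<theta>\<^sub>0) / \<tau> \<le> c"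
  shows "v \<le> c"
proof (rule ccontr)
  assume "\<not> v \<le> c"
  define \<zeta> where "\<zeta> = (v - c) / 3"
  have \<zeta>: "0 < \<zeta>" "\<zeta> \<le> v / 2" "v - c = 3 * \<zeta>" using \<open>\<not> v \<le> c\<close> c by (auto simp: \<zeta>_def)
  obtain T1 C where T1: "T1 \<ge> 0" and
    di: "\<And>\<tau>. \<tau> \<ge> T1 \<Longrightarrow> (\<forall>\<theta>\<in>gw.pcone \<tau>. \<forall>\<sigma>\<in>{1,-1}. v - \<zeta> \<le> a \<sigma> \<tau> \<theta>) \<or> P \<tau> \<theta>\<^sub>0 \<le> - (v - 2 * \<zeta>) * (\<tau> - T1) + C"
    using gw.dichotomy[OF v \<zeta>(1,2)] by blast
  have Pc: "\<bar>P \<tau> \<theta>\<^sub>0\<bar> \<le> c * \<tau>" if "\<tau> \<ge> T" "\<tau> > 0" for \<tau>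
    using P_hrho[of \<tau> \<theta>\<^sub>0] upper[OF that(1)] that(2) by (simp add: field_simps)
  define N where "N = max (max T T1) (max 1 ((C + (v - 2 * \<zeta>) * T1) / \<zeta> + 1))"
  have N: "N \<ge> T" "N \<ge> T1" "N \<ge> 1" "N > (C + (v - 2 * \<zeta>) * T1) / \<zeta>" by (auto simp: N_def)
  have good: "v - \<zeta> \<le> a \<sigma> \<tau> \<theta>\<^sub>0" if \<tau>: "\<tau> \<ge> N" "\<sigma> \<in> {1, -1}" for \<sigma> \<tau>
  proof (rule ccontr)
    assume "\<not> v - \<zeta> \<le> a \<sigma> \<tau> \<theta>\<^sub>0"
    then have "P \<tau> \<theta>\<^sub>0 \<le> - (v - 2 * \<zeta>) * (\<tau> - T1) + C"
      using di[of \<tau>] gw.pcone_center \<tau> N by fastforce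
    moreover have "- (c * \<tau>) \<le> P \<tau> \<theta>\<^sub>0" using Pc[of \<tau>] \<tau> N by auto
    ultimately have "(v - c - 2 * \<zeta>) * \<tau> \<le> C + (v - 2 * \<zeta>) * T1" by (simp add: algebra_simps)
    then have "\<tau> \<le> (C + (v - 2 * \<zeta>) * T1) / \<zeta>" using \<zeta> by (simp add: field_simps)
    then show False using \<tau> N by linarith
  qed
  define S where "S = max N ((- P N \<theta>\<^sub>0 + (v - \<zeta>) * N) / (2 * \<zeta>) + 1)"
  have S: "S \<ge> N" "S > (- P N \<theta>\<^sub>0 + (v - \<zeta>) * N) / (2 * \<zeta>)" by (auto simp: S_def)
  have "(\<lambda>\<tau>. - P \<tau> \<theta>\<^sub>0) S \<le> (\<lambda>\<tau>. - P \<tau> \<theta>\<^sub>0) N + - (v - \<zeta>) * (S - N)"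
  proof (rule derivative_upper_bound[OF S(1)])
    show "((\<lambda>\<tau>. - P \<tau> \<theta>\<^sub>0) has_real_derivative - ptau P x \<theta>\<^sub>0) (at x)" for x
      by (rule DERIV_minus[OF has_ptau[OF smooth_P UNIV_I]])
    show "- ptau P x \<theta>\<^sub>0 \<le> - (v - \<zeta>)" if "N \<le> x" for x
      using good[OF that, of 1] good[OF that, of "-1"] gw.a_split[of x \<theta>\<^sub>0] by simp
  qed
  moreover have "P S \<theta>\<^sub>0 \<le> c * S" using Pc[of S] S(1) N by auto
  ultimately have "(v - c - \<zeta>) * S \<le> - P N \<theta>\<^sub>0 + (v - \<zeta>) * N" by (simp add: algebra_simps)
  then have "S \<le> (- P N \<theta>\<^sub>0 + (v - \<zeta>) * N) / (2 * \<zeta>)" using \<zeta> by (simp add: field_simps)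
  then show False using S by linarith
qed

end

context disc_solution_at
begin

lemma speed_unique:
  assumes "gw.asymp_speed v" "v \<ge> 0" "w \<ge> 0"
    and w: "\<And>\<epsilon>. \<epsilon> > 0 \<Longrightarrow> \<exists>T. \<forall>\<tau>\<ge>T. \<bar>gw.A 1 \<tau> \<theta>\<^sub>0 - w\<^sup>2\<bar> \<le> \<epsilon>"
  shows "v = w"
proof -
  have "\<bar>v\<^sup>2 - w\<^sup>2\<bar> \<le> 0 + \<epsilon>" if "\<epsilon> > 0" for \<epsilon>
  proof -
    have e2: "\<epsilon> / 2 > 0" using that by simp
    obtain T1 where T1: "\<And>\<tau>. \<tau> \<ge> T1 \<Longrightarrow> \<bar>gw.A 1 \<tau> \<theta>\<^sub>0 - v\<^sup>2\<bar> \<le> \<epsilon> / 2"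
      using assms(1) e2 gw.pcone_center unfolding gw.asymp_speed_def by blast
    obtain T2 where T2: "\<And>\<tau>. \<tau> \<ge> T2 \<Longrightarrow> \<bar>gw.A 1 \<tau> \<theta>\<^sub>0 - w\<^sup>2\<bar> \<le> \<epsilon> / 2" using w[OF e2] by blast
    have x: "\<bar>x - y\<bar> \<le> 0 + \<epsilon>" if "\<bar>q - x\<bar> \<le> \<epsilon> / 2" "\<bar>q - y\<bar> \<le> \<epsilon> / 2" for q x y :: real using that by linarith
    show ?thesis by (rule x[OF T1[of "max T1 T2"] T2[of "max T1 T2"]]) simp_all
  qed
  then have "\<bar>v\<^sup>2 - w\<^sup>2\<bar> \<le> 0" by (rule field_le_epsilon)
  then have "v\<^sup>2 = w\<^sup>2" by simp
  then show ?thesis using assms(2,3) by simp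
qed

text \<open>With g = \<gamma>/2, the values \<delta> = g/32 and \<epsilon> = g/8 are the largest
  that two of the conditions admit, and the square of \<epsilon> is half of \<delta> g. The
  tolerance \<gamma>^2 / 1024 is small enough for \<open>good_start\<close>, where three times it
  must be below \<open>\<epsilon>\<^sup>2 = \<gamma>\<^sup>2 / 256\<close>.\<close>

lemma small_data:
  assumes \<gamma>: "\<gamma> > 0" and v: "\<gamma> \<le> v" "v \<le> 1 - \<gamma>" and T: "T \<ge> 0"
    and ge: "\<And>\<theta> \<sigma>. \<theta>\<in>gw.pcone T \<Longrightarrow> \<sigma>\<in>{1,-1} \<Longrightarrow> v - \<gamma>\<^sup>2 / 1024 \<le> a \<sigma> T \<theta>"
    and Av: "\<And>\<theta> \<sigma>. \<theta>\<in>gw.pcone T \<Longrightarrow> \<sigma>\<in>{1,-1} \<Longrightarrow> \<bar>gw.A \<sigma> T \<theta> - v\<^sup>2\<bar> \<le> (\<gamma>\<^sup>2 / 1024)\<^sup>2"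
  shows "\<exists>\<eta>>0. gowdy_small_PQ a b T \<eta> \<theta>\<^sub>0 v (\<gamma> / 64) (\<gamma> / 2) (\<gamma> / 16) P Q"
proof -
  have g1: "\<gamma> < 1" using v \<gamma> by linarith
  have "\<gamma> * \<gamma> \<le> \<gamma> * 1" using g1 \<gamma> by (intro mult_left_mono) auto
  then have g2: "\<gamma>\<^sup>2 \<le> \<gamma>" by (simp add: power2_eq_square)
  have e2: "(\<gamma> / 16)\<^sup>2 = \<gamma>\<^sup>2 / 256" by (simp add: power2_eq_square)
  have p2: "\<gamma>\<^sup>2 > 0" using \<gamma> by simp
  obtain \<eta> where \<eta>: "\<eta> > 0"
    "\<forall>\<sigma>\<in>{1,-1}. \<forall>\<theta>. \<bar>\<theta> - \<theta>\<^sub>0\<bar> \<le> \<eta> + exp (-T) \<longrightarrow> \<bar>a \<sigma> T \<theta> - v\<bar> \<le> (\<gamma> / 64) / 2 \<and> \<bar>b \<sigma> T \<theta>\<bar> \<le> \<gamma> / 16"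
    using gw.good_start[of v "\<gamma>\<^sup>2 / 1024" "\<gamma> / 64" "\<gamma> / 16" T] v \<gamma> g1 g2 e2 p2 ge Av by auto
  have "gowdy_small_PQ a b T \<eta> \<theta>\<^sub>0 v (\<gamma> / 64) (\<gamma> / 2) (\<gamma> / 16) P Q"
    unfolding gowdy_small_PQ_def gowdy_small_PQ_axioms_def gowdy_small_def gowdy_small_axioms_def
  proof (intro conjI gowdy_PQ_z gowdy_frame_ab allI impI)
    show "\<gamma> / 64 > 0" "\<gamma> / 2 > 0" "\<gamma> / 16 > 0" "\<eta> > 0" "\<gamma> / 2 + \<gamma> / 64 \<le> v" "v \<le> 1 - \<gamma> / 2 - \<gamma> / 64"
      "\<gamma> / 16 \<le> \<gamma> / 2 / 8" "T \<ge> 0" "\<gamma> / 64 \<le> \<gamma> / 2 / 32" using \<gamma> \<eta>(1) v T by auto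
    show "(\<gamma> / 16)\<^sup>2 < \<gamma> / 64 * (\<gamma> / 2)" using p2 by (simp add: power2_eq_square)
  qed (use \<eta>(2) in auto)
  then show ?thesis using \<eta>(1) by blast
qed

end

text \<open>The rate g/8 already includes losses that absorb polynomial growth, so constant
  polynomials serve for every k.\<close>

lemma (in gowdy_small_PQ) expansion_Ck_norm:
  "\<exists>\<alpha>>0. \<exists>\<tau>\<^sub>0. \<exists>v \<phi>\<^sub>0 q r :: real \<Rightarrow> real.
        Cinf_on I v \<and> Cinf_on I \<phi>\<^sub>0 \<and> Cinf_on I q \<and> Cinf_on I r \<and>
        (\<forall>\<theta>\<in>I. \<alpha> \<le> v \<theta> \<and> v \<theta> \<le> 1 - \<alpha>) \<and> 1 - \<alpha> < 1 \<and>
        (\<exists>\<Xi> :: nat \<Rightarrow> nat \<Rightarrow> real poly. \<forall>k. \<forall>\<tau>\<ge>\<tau>\<^sub>0.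
          (let p = (\<lambda>t \<theta>. v \<theta> * t + \<phi>\<^sub>0 \<theta>) in
           Ck_norm k I (\<lambda>t \<theta>. deriv (\<lambda>s. P s \<theta>) t - v \<theta>) \<tau>
             \<le> ereal (poly (\<Xi> 1 k) \<tau> * exp (-\<alpha>*\<tau>)) \<and>
           Ck_norm k I (\<lambda>t \<theta>. P t \<theta> - p t \<theta>) \<tau>
             \<le> ereal (poly (\<Xi> 2 k) \<tau> * exp (-\<alpha>*\<tau>)) \<and>
           Ck_norm k I (\<lambda>t \<theta>. exp (2 * p t \<theta>) * deriv (\<lambda>s. Q s \<theta>) t - r \<theta>) \<tau>
             \<le> ereal (poly (\<Xi> 3 k) \<tau> * exp (-\<alpha>*\<tau>)) \<and>
           Ck_norm k I (\<lambda>t \<theta>. exp (2 * p t \<theta>) * (Q t \<theta> - q \<theta>) + r \<theta> / (2 * v \<theta>)) \<tau>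
             \<le> ereal (poly (\<Xi> 4 k) \<tau> * exp (-\<alpha>*\<tau>))))"
proof -
  obtain v \<phi>\<^sub>0 q r where sm: "Cinf_on I v" "Cinf_on I \<phi>\<^sub>0" "Cinf_on I q" "Cinf_on I r"
    and v: "\<And>\<theta>. \<theta> \<in> I \<Longrightarrow> g \<le> v \<theta> \<and> v \<theta> \<le> 1 - g"
    and ord: "exp_order I T (- (g / 8)) (\<lambda>t \<theta>. ptau P t \<theta> - v \<theta>)"
      "exp_order I T (- (g / 8)) (\<lambda>t \<theta>. P t \<theta> - (v \<theta> * t + \<phi>\<^sub>0 \<theta>))"
      "exp_order I T (- (g / 8)) (\<lambda>t \<theta>. exp (2 * (v \<theta> * t + \<phi>\<^sub>0 \<theta>)) * ptau Q t \<theta> - r \<theta>)"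
      "exp_order I T (- (g / 8)) (\<lambda>t \<theta>. exp (2 * (v \<theta> * t + \<phi>\<^sub>0 \<theta>)) * (Q t \<theta> - q \<theta>) + r \<theta> / (2 * v \<theta>))"
    using asymptotic_expansion by blast
  have d: "deriv (\<lambda>s. F s \<theta>) t = ptau F t \<theta>" if "smooth_strip UNIV F" for F t \<theta>
    by (rule DERIV_imp_deriv[OF has_ptau[OF that UNIV_I]])
  have Ck: "\<exists>C. \<forall>k. \<forall>\<tau>\<ge>T. Ck_norm k I F \<tau> \<le> ereal (poly [:C k:] \<tau> * exp (- (g / 8) * \<tau>))"
    if F: "exp_order I T (- (g / 8)) F" for F
  proof -
    have "\<forall>k. \<exists>C. \<forall>\<tau>\<ge>T. Ck_norm k I F \<tau> \<le> ereal (poly [:C:] \<tau> * exp (- (g / 8) * \<tau>))"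
      using Ck_norm_exp_order[OF F] by simp
    then show ?thesis by (rule choice)
  qed
  obtain C1 where C1: "\<forall>k. \<forall>\<tau>\<ge>T. Ck_norm k I (\<lambda>t \<theta>. ptau P t \<theta> - v \<theta>) \<tau> \<le> ereal (poly [:C1 k:] \<tau> * exp (- (g / 8) * \<tau>))"
    using Ck[OF ord(1)] by blast
  obtain C2 where C2: "\<forall>k. \<forall>\<tau>\<ge>T. Ck_norm k I (\<lambda>t \<theta>. P t \<theta> - (v \<theta> * t + \<phi>\<^sub>0 \<theta>)) \<tau> \<le> ereal (poly [:C2 k:] \<tau> * exp (- (g / 8) * \<tau>))"
    using Ck[OF ord(2)] by blast
  obtain C3 where C3: "\<forall>k. \<forall>\<tau>\<ge>T. Ck_norm k I (\<lambda>t \<theta>. exp (2 * (v \<theta> * t + \<phi>\<^sub>0 \<theta>)) * ptau Q t \<theta> - r \<theta>) \<tau> \<le> ereal (poly [:C3 k:] \<tau> * exp (- (g / 8) * \<tau>))"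
    using Ck[OF ord(3)] by blast
  obtain C4 where C4: "\<forall>k. \<forall>\<tau>\<ge>T. Ck_norm k I (\<lambda>t \<theta>. exp (2 * (v \<theta> * t + \<phi>\<^sub>0 \<theta>)) * (Q t \<theta> - q \<theta>) + r \<theta> / (2 * v \<theta>)) \<tau> \<le> ereal (poly [:C4 k:] \<tau> * exp (- (g / 8) * \<tau>))"
    using Ck[OF ord(4)] by blast
  define \<Xi> where "\<Xi> i k = [:(if i = 1 then C1 k else if i = 2 then C2 k else if i = 3 then C3 k else C4 k):]" for i k :: nat
  have \<Xi>: "\<Xi> 1 k = [:C1 k:]" "\<Xi> 2 k = [:C2 k:]" "\<Xi> 3 k = [:C3 k:]" "\<Xi> 4 k = [:C4 k:]" for k
    by (simp_all add: \<Xi>_def)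
  have g8: "g / 8 > 0" "1 - g / 8 < 1" "\<forall>\<theta>\<in>I. g / 8 \<le> v \<theta> \<and> v \<theta> \<le> 1 - g / 8" using pos v by fastforce+
  show ?thesis
    unfolding Let_def d[OF smooth_P] d[OF smooth_Q]
    by (rule exI[of _ "g / 8"], intro conjI g8, rule exI[of _ T], rule exI[of _ v], rule exI[of _ \<phi>\<^sub>0],
        rule exI[of _ q], rule exI[of _ r], intro conjI sm g8, rule exI[of _ \<Xi>])
      (use C1 C2 C3 C4 in \<open>unfold \<Xi>, blast\<close>)
qed

theorem theorem3:
  fixes z :: "real \<Rightarrow> real \<Rightarrow> complex" and \<theta>\<^sub>0 T \<gamma> :: real
    and \<tau>s :: "nat \<Rightarrow> real"
  assumes smooth: "Cinf_on UNIV (\<lambda>x::real \<times> real. z (fst x) (snd x))"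
    and inD: "\<And>\<tau> \<theta>. cmod (z \<tau> \<theta>) < 1"
    and periodic: "\<And>\<tau> \<theta>. z \<tau> (\<theta> + 2 * pi) = z \<tau> \<theta>"
    and eq: "gowdy_eq z"
    and \<gamma>: "0 < \<gamma>" "\<gamma> < 1"
    and upper: "\<And>\<tau>. \<tau> \<ge> T \<Longrightarrow> hrho (z \<tau> \<theta>\<^sub>0) / \<tau> \<le> 1 - \<gamma>"
    and seq: "filterlim \<tau>s at_top sequentially"
    and lower: "\<And>k. hrho (z (\<tau>s k) \<theta>\<^sub>0) / \<tau>s k \<ge> \<gamma>"
  shows "\<exists>\<eta>>0. \<exists>\<phi>. hyp_isometry \<phi> \<and>
     (let Q = (\<lambda>\<tau> \<theta>. fst (\<phi> (z \<tau> \<theta>))); P = (\<lambda>\<tau> \<theta>. snd (\<phi> (z \<tau> \<theta>)));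
          I = {\<theta>\<^sub>0 - \<eta> <..< \<theta>\<^sub>0 + \<eta>} in
      \<exists>\<alpha>>0. \<exists>\<tau>\<^sub>0. \<exists>v \<phi>\<^sub>0 q r :: real \<Rightarrow> real.
        Cinf_on I v \<and> Cinf_on I \<phi>\<^sub>0 \<and> Cinf_on I q \<and> Cinf_on I r \<and>
        (\<forall>\<theta>\<in>I. \<alpha> \<le> v \<theta> \<and> v \<theta> \<le> 1 - \<alpha>) \<and> 1 - \<alpha> < 1 \<and>
        (\<exists>\<Xi> :: nat \<Rightarrow> nat \<Rightarrow> real poly. \<forall>k. \<forall>\<tau>\<ge>\<tau>\<^sub>0.
          (let p = (\<lambda>t \<theta>. v \<theta> * t + \<phi>\<^sub>0 \<theta>) in
           Ck_norm k I (\<lambda>t \<theta>. deriv (\<lambda>s. P s \<theta>) t - v \<theta>) \<tau>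
             \<le> ereal (poly (\<Xi> 1 k) \<tau> * exp (-\<alpha>*\<tau>)) \<and>
           Ck_norm k I (\<lambda>t \<theta>. P t \<theta> - p t \<theta>) \<tau>
             \<le> ereal (poly (\<Xi> 2 k) \<tau> * exp (-\<alpha>*\<tau>)) \<and>
           Ck_norm k I (\<lambda>t \<theta>. exp (2 * p t \<theta>) * deriv (\<lambda>s. Q s \<theta>) t - r \<theta>) \<tau>
             \<le> ereal (poly (\<Xi> 3 k) \<tau> * exp (-\<alpha>*\<tau>)) \<and>
           Ck_norm k I (\<lambda>t \<theta>. exp (2 * p t \<theta>) * (Q t \<theta> - q \<theta>) + r \<theta> / (2 * v \<theta>)) \<tau>
             \<le> ereal (poly (\<Xi> 4 k) \<tau> * exp (-\<alpha>*\<tau>)))))"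
proof -
  \<comment> \<open>\<open>p\<close> is the solution itself and \<open>n\<close> its negative, that
    is z seen in the charts with boundary point 1 and -1.\<close>
  interpret p: disc_solution_at z \<theta>\<^sub>0
    by unfold_locales (use smooth inD eq in auto)
  interpret n: disc_solution_at "\<lambda>\<tau> \<theta>. - z \<tau> \<theta>" \<theta>\<^sub>0
    unfolding disc_solution_at_def by (rule p.disc_solution_uminus)
  obtain v where v: "p.gw.asymp_speed v" "v \<ge> 0" using p.asymp_speed_exists by blast
  obtain w where w: "n.gw.asymp_speed w" "w \<ge> 0" using n.asymp_speed_exists by blast
  have zc: "n.zc \<sigma> \<tau> \<theta> = - p.zc \<sigma> \<tau> \<theta>" for \<sigma> \<tau> \<theta>
    by (rule vector_derivative_unique_at[OF n.z_path has_vector_derivative_minus[OF p.z_path]])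
  have A: "n.gw.A \<sigma> \<tau> \<theta> = p.gw.A \<sigma> \<tau> \<theta>" for \<sigma> \<tau> \<theta>
    unfolding n.gw.A_def p.gw.A_def n.ab_norm p.ab_norm zc norm_minus_cancel ..
  \<comment> \<open>Since A agrees for z and - z, so do the speeds, and the two alternatives below
    have the same slope.\<close>
  have vw: "w = v"
  proof (rule n.speed_unique[OF w v(2)])
    show "\<exists>T. \<forall>\<tau>\<ge>T. \<bar>n.gw.A 1 \<tau> \<theta>\<^sub>0 - v\<^sup>2\<bar> \<le> \<epsilon>" if "\<epsilon> > 0" for \<epsilon>
      using v(1) that p.gw.pcone_center unfolding p.gw.asymp_speed_def A by blast
  qed
  have v\<gamma>: "\<gamma> \<le> v" "v \<le> 1 - \<gamma>"
    using p.speed_ge[OF v seq lower] p.speed_le[OF v(1) _ upper] \<gamma> by auto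
  define \<zeta> where "\<zeta> = \<gamma>\<^sup>2 / 1024"
  have "\<gamma> * \<gamma> \<le> \<gamma> * 1" using \<gamma> by (intro mult_left_mono) auto
  then have "\<gamma>\<^sup>2 \<le> \<gamma>" by (simp only: power2_eq_square mult_1_right)
  moreover have "\<gamma>\<^sup>2 > 0" using \<gamma> by simp
  ultimately have \<zeta>: "\<zeta> > 0" "\<zeta> \<le> v / 2" "v - 2 * \<zeta> > 0" using \<gamma> v\<gamma> unfolding \<zeta>_def by linarith+
  obtain T1 C1 where T1: "\<And>\<tau>. \<tau> \<ge> T1 \<Longrightarrow> (\<forall>\<theta>\<in>p.gw.pcone \<tau>. \<forall>\<sigma>\<in>{1,-1}. v - \<zeta> \<le> p.a \<sigma> \<tau> \<theta>) \<or> p.P \<tau> \<theta>\<^sub>0 \<le> - (v - 2 * \<zeta>) * (\<tau> - T1) + C1"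
    using p.gw.dichotomy[OF v(1) \<zeta>(1,2)] by blast
  obtain T2 C2 where T2: "\<And>\<tau>. \<tau> \<ge> T2 \<Longrightarrow> (\<forall>\<theta>\<in>n.gw.pcone \<tau>. \<forall>\<sigma>\<in>{1,-1}. v - \<zeta> \<le> n.a \<sigma> \<tau> \<theta>) \<or> n.P \<tau> \<theta>\<^sub>0 \<le> - (v - 2 * \<zeta>) * (\<tau> - T2) + C2"
    using n.gw.dichotomy[OF w(1) \<zeta>(1), unfolded vw, OF \<zeta>(2)] by blast
  have z2: "\<zeta>\<^sup>2 > 0" using \<zeta>(1) by simp
  obtain T3 where T3: "\<And>\<tau> \<theta> \<sigma>. \<tau> \<ge> T3 \<Longrightarrow> \<theta>\<in>p.gw.pcone \<tau> \<Longrightarrow> \<sigma>\<in>{1,-1} \<Longrightarrow> \<bar>p.gw.A \<sigma> \<tau> \<theta> - v\<^sup>2\<bar> \<le> \<zeta>\<^sup>2"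
    using v(1) z2 unfolding p.gw.asymp_speed_def by meson
  \<comment> \<open>Past the last entry of the maximum the two linear upper bounds for P add up to a
    negative number, against \<open>disc_P z + disc_P (- z) \<ge> 0\<close>; so at time S at least
    one chart is in the good alternative.\<close>
  define S where "S = max (max 0 T1) (max (max T2 T3) ((C1 + C2 + (v - 2 * \<zeta>) * (T1 + T2)) / (2 * (v - 2 * \<zeta>)) + 1))"
  have S: "S \<ge> 0" "S \<ge> T1" "S \<ge> T2" "S \<ge> T3" "S > (C1 + C2 + (v - 2 * \<zeta>) * (T1 + T2)) / (2 * (v - 2 * \<zeta>))"
    by (auto simp: S_def)
  have "\<not> (p.P S \<theta>\<^sub>0 \<le> - (v - 2 * \<zeta>) * (S - T1) + C1 \<and> n.P S \<theta>\<^sub>0 \<le> - (v - 2 * \<zeta>) * (S - T2) + C2)"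
  proof
    assume "p.P S \<theta>\<^sub>0 \<le> - (v - 2 * \<zeta>) * (S - T1) + C1 \<and> n.P S \<theta>\<^sub>0 \<le> - (v - 2 * \<zeta>) * (S - T2) + C2"
    moreover have "p.P S \<theta>\<^sub>0 + n.P S \<theta>\<^sub>0 \<ge> 0" unfolding p.P_def n.P_def by (rule disc_P_bounds(2)[OF inD])
    moreover have "x * 2 * S \<le> C1 + C2 + x * (T1 + T2)"
      if "P \<le> - x * (S - T1) + C1 \<and> P' \<le> - x * (S - T2) + C2" "P + P' \<ge> 0" for x P P'
      using that by (simp add: algebra_simps)
    ultimately have "(v - 2 * \<zeta>) * 2 * S \<le> C1 + C2 + (v - 2 * \<zeta>) * (T1 + T2)" by blast
    then have "S \<le> (C1 + C2 + (v - 2 * \<zeta>) * (T1 + T2)) / (2 * (v - 2 * \<zeta>))"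
      using \<zeta>(3) by (subst pos_le_divide_eq) (simp_all add: mult_ac)
    then show False using S(5) by simp
  qed
  then consider
      (p) "\<And>\<theta> \<sigma>. \<theta>\<in>p.gw.pcone S \<Longrightarrow> \<sigma>\<in>{1,-1} \<Longrightarrow> v - \<zeta> \<le> p.a \<sigma> S \<theta>"
    | (n) "\<And>\<theta> \<sigma>. \<theta>\<in>n.gw.pcone S \<Longrightarrow> \<sigma>\<in>{1,-1} \<Longrightarrow> v - \<zeta> \<le> n.a \<sigma> S \<theta>"
    using T1[OF S(2)] T2[OF S(3)] by blast
  then show ?thesis
  proof cases
    case p
    obtain \<eta> where \<eta>: "\<eta> > 0" "gowdy_small_PQ p.a p.b S \<eta> \<theta>\<^sub>0 v (\<gamma> / 64) (\<gamma> / 2) (\<gamma> / 16) p.P p.Q"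
      using p.small_data[OF \<gamma>(1) v\<gamma> S(1) p[unfolded \<zeta>_def] T3[OF S(4), unfolded \<zeta>_def]] by blast
    have F: "snd (disc_chart 1 (z \<tau> \<theta>)) = p.P \<tau> \<theta>" "fst (disc_chart 1 (z \<tau> \<theta>)) = p.Q \<tau> \<theta>" for \<tau> \<theta>
      by (simp_all add: disc_chart_def p.P_def p.Q_def)
    show ?thesis
      by (rule exI[of _ \<eta>], rule conjI[OF \<eta>(1)], rule exI[of _ "disc_chart 1"],
          rule conjI[OF hyp_isometry_disc_chart], simp, unfold Let_def F,
          rule gowdy_small_PQ.expansion_Ck_norm[OF \<eta>(2), unfolded gowdy_small_PQ.I_def[OF \<eta>(2)] Let_def])
  next
    case n
    obtain \<eta> where \<eta>: "\<eta> > 0" "gowdy_small_PQ n.a n.b S \<eta> \<theta>\<^sub>0 v (\<gamma> / 64) (\<gamma> / 2) (\<gamma> / 16) n.P n.Q"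
      using n.small_data[OF \<gamma>(1) v\<gamma> S(1) n[unfolded \<zeta>_def] T3[OF S(4), folded A, unfolded \<zeta>_def]] by blast
    have F: "snd (disc_chart (-1) (z \<tau> \<theta>)) = n.P \<tau> \<theta>" "fst (disc_chart (-1) (z \<tau> \<theta>)) = n.Q \<tau> \<theta>" for \<tau> \<theta>
      by (simp_all add: disc_chart_def n.P_def n.Q_def)
    show ?thesis
      by (rule exI[of _ \<eta>], rule conjI[OF \<eta>(1)], rule exI[of _ "disc_chart (-1)"],
          rule conjI[OF hyp_isometry_disc_chart], simp, unfold Let_def F,
          rule gowdy_small_PQ.expansion_Ck_norm[OF \<eta>(2), unfolded gowdy_small_PQ.I_def[OF \<eta>(2)] Let_def])
  qed
qed

end
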